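(* Assume $1<p<N$, $p+m-3>0$, and that $g\in C([0,+\infty))\cap C^1((0,+\infty))$, $g(0)=0$, $g(s)>0$ for $s>0$, satisfies, for given $0<\alpha_1\le\alpha_2<p$, $$\alpha_1\frac{g(s)}{s}\le g'(s)\le\alpha_2\frac{g(s)}{s},\qquad s>0.$$ Let $f(x)=e^{g(|x|)}$ and let $u$ be a strong solution to the Cauchy problem $$f(x)\,\frac{\partial u}{\partial t}-\operatorname{div}\big(f(x)u^{m-1}|\nabla u|^{p-2}\nabla u\big)=0\ \text{ in } S_\infty=\mathbb R^N\times(0,+\infty),\qquad u(x,0)=u_0(x),\ x\in\mathbb R^N,$$ with compactly supported and bounded initial data $u_0\ge0$ such that $u_0(x)\ge\varepsilon>0$ for $|x|\le\ell$, $\ell>0$. Then there exist constants $t_0>1$ and $C_*,r_0,\varGamma>0$ such that the function $\widetilde u$ (defined in the context) is a subsolution to the equation and $$u(x,t)\ge\widetilde u(x,t),\qquad (x,t)\in S_\infty.$$ Moreover, for a suitable constant $\gamma>0$, $$\operatorname{supp}u(t)\supset B_{R(t)}(0),\qquad R(t)=\gamma\,g^{(-1)}(\log t),\qquad t>t_0.$$ The constants here depend on the parameters appearing in the assumptions (i.e. on $N,p,m,\alpha_1,\alpha_2$ and $g$) and on $\varepsilon$, $\ell$.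
   Context: $g^{(-1)}$ is the inverse function of $g$. $L^1_f(\mathbb R^N)$ is the $L^1$ space with respect to the measure $f(x)\,dx$, and $L^1_{f,\mathrm{loc}}$ its local version. Barrier function. $G(r)=\int_0^r\frac{g(s)}{s}\,ds$ for $r\ge0$; $G^{(-1)}$ is the inverse function of $G$; $J(r)=\frac{r^p}{G(r)}$ for $r>0$; $\tau=\varGamma\log(t+t_0)$ for $t\ge0$; $E(\tau)=J(G^{(-1)}(\tau))=\frac{G^{(-1)}(\tau)^p}{\tau}$ for $\tau>0$; and $$I(r)=\nu_0\Big(\frac{r^p}{G(r_0)}\Big)^{\frac1{p-1}}+(1-\nu_0)J(r_0)^{\frac1{p-1}}.$$ With $r=|x|$ and $[\cdot]_+$ the positive part, $$\widetilde u(x,t)=\frac{C_*}{(t+t_0)^{\frac1{p+m-3}}}\Big[E(\tau)^{\frac1{p-1}}-J(r)^{\frac1{p-1}}\Big]_+^{\frac{p-1}{p+m-3}},\quad r\ge r_0,$$ $$\widetilde u(x,t)=\frac{C_*}{(t+t_0)^{\frac1{p+m-3}}}\Big[E(\tau)^{\frac1{p-1}}-I(r)\Big]_+^{\frac{p-1}{p+m-3}},\quad r<r_0.$$ The constant $\nu_0\in(0,1)$ is selected so that $\widetilde u$ and $\widetilde u_r$ are continuous also at $r=r_0$, namely $\nu_0=1-\frac{r_0G'(r_0)}{p\,G(r_0)}$. Solutions. A function $u\ge0$ is a weak solution to the equation if $u\in C([0,+\infty);L^1_f(\mathbb R^N))\cap L^\infty(\mathbb R^N\times(\bar t,+\infty))$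 for all $\bar t>0$, $\nabla u^{\frac{p+m-2}{p-1}}\in L^p_{\mathrm{loc}}(S_\infty)$, and for all $\eta\in C_0^\infty(S_\infty)$ $$\int_0^{+\infty}\!\!\int_{\mathbb R^N}\{-u\eta_t+u^{m-1}|\nabla u|^{p-2}\nabla u\cdot\nabla\eta\}f(x)\,dx\,dt=0.$$ If moreover $u_t\in L^\infty_{\mathrm{loc}}((0,+\infty);L^1_{f,\mathrm{loc}}(\mathbb R^N))$, then $u$ is a strong solution. Supersolutions [subsolutions] are defined similarly, requiring for all $\eta\ge0$ the inequality sign $\ge$ [$\le$] in place of equality in the integral identity. Solutions to the Cauchy problem are solutions to the equation with $u(0)=u_0$ in the sense of $C([0,+\infty);L^1_f(\mathbb R^N))$. *)

theory Defs
  imports "HOL-Analysis.Analysis"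
begin

text \<open>
  The Euclidean space of dimension N is a type \<open>'a :: euclidean_space\<close> with \<open>N = DIM('a)\<close>.
  Space-time points are pairs \<open>(x, t) :: 'a \<times> real\<close>; a function of space and time is written
  in curried form \<open>u x t\<close>. Functions are representatives of their Lebesgue classes, and no
  notion below depends on the representative: pointwise relations between them hold
  almost everywhere (for each fixed time where a time slice is concerned).
\<close>

definition spacetime :: "('a::euclidean_space \<times> real) set" where
  "spacetime = UNIV \<times> {0<..}"

subsection \<open>Test functions\<close>

fun k_times_cont_diff :: "nat \<Rightarrow> ('b::euclidean_space \<Rightarrow> real) \<Rightarrow> bool" where
  "k_times_cont_diff 0 h \<longleftrightarrow> continuous_on UNIV h"
| "k_times_cont_diff (Suc k) h \<longleftrightarrow>
     (\<forall>z. h differentiable (at z)) \<and>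
     (\<forall>v. k_times_cont_diff k (\<lambda>z. frechet_derivative h (at z) v))"

text \<open>Test functions on an open set \<open>S\<close>, extended by zero to the whole space.\<close>

definition test_function :: "'b::euclidean_space set \<Rightarrow> ('b \<Rightarrow> real) \<Rightarrow> bool" where
  "test_function S \<eta> \<longleftrightarrow>
     (\<forall>k. k_times_cont_diff k \<eta>) \<and> (\<exists>K. compact K \<and> K \<subseteq> S \<and> (\<forall>z. z \<notin> K \<longrightarrow> \<eta> z = 0))"

definition grad_x :: "('a::euclidean_space \<times> real \<Rightarrow> real) \<Rightarrow> 'a \<times> real \<Rightarrow> 'a" where
  "grad_x \<eta> z = (\<Sum>b\<in>Basis. frechet_derivative \<eta> (at z) (b, 0) *\<^sub>R b)"

definition deriv_t :: "('a::euclidean_space \<times> real \<Rightarrow> real) \<Rightarrow> 'a \<times> real \<Rightarrow> real" where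
  "deriv_t \<eta> z = frechet_derivative \<eta> (at z) (0, 1)"

subsection \<open>Weighted and local Lebesgue spaces, weak derivatives\<close>

definition weighted :: "('a::euclidean_space \<Rightarrow> real) \<Rightarrow> 'a measure" where
  "weighted f = density lebesgue (\<lambda>x. ennreal (f x))"

definition continuous_in_L1 :: "('a::euclidean_space \<Rightarrow> real) \<Rightarrow> ('a \<Rightarrow> real \<Rightarrow> real) \<Rightarrow> bool" where
  "continuous_in_L1 f u \<longleftrightarrow>
     (\<forall>t\<ge>0. integrable (weighted f) (\<lambda>x. u x t)) \<and>
     (\<forall>s\<ge>0. ((\<lambda>t. LINT x|weighted f. \<bar>u x t - u x s\<bar>) \<longlongrightarrow> 0) (at s within {0..}))"

definition locally_L1 ::
    "'b::euclidean_space set \<Rightarrow> ('b \<Rightarrow> 'c::{banach, second_countable_topology}) \<Rightarrow> bool" where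
  "locally_L1 S h \<longleftrightarrow> (\<forall>K. compact K \<and> K \<subseteq> S \<longrightarrow> set_integrable lebesgue K h)"

definition locally_Lp ::
    "real \<Rightarrow> 'b::euclidean_space set \<Rightarrow> ('b \<Rightarrow> 'c::{banach, second_countable_topology}) \<Rightarrow> bool" where
  "locally_Lp p S h \<longleftrightarrow>
     h \<in> borel_measurable (lebesgue_on S) \<and>
     (\<forall>K. compact K \<and> K \<subseteq> S \<longrightarrow> set_integrable lebesgue K (\<lambda>z. norm (h z) powr p))"

text \<open>\<open>V\<close> is the distributional spatial gradient of \<open>w\<close>, respectively \<open>v\<close> the distributional
  time derivative of \<open>w\<close>, on space-time.\<close>

definition weak_grad_x ::
    "('a::euclidean_space \<times> real \<Rightarrow> real) \<Rightarrow> ('a \<times> real \<Rightarrow> 'a) \<Rightarrow> bool" where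
  "weak_grad_x w V \<longleftrightarrow>
     locally_L1 spacetime w \<and> locally_L1 spacetime V \<and>
     (\<forall>\<eta>. test_function spacetime \<eta> \<longrightarrow>
        (LINT z:spacetime|lebesgue. w z *\<^sub>R grad_x \<eta> z) =
        - (LINT z:spacetime|lebesgue. \<eta> z *\<^sub>R V z))"

definition weak_deriv_t ::
    "('a::euclidean_space \<times> real \<Rightarrow> real) \<Rightarrow> ('a \<times> real \<Rightarrow> real) \<Rightarrow> bool" where
  "weak_deriv_t w v \<longleftrightarrow>
     locally_L1 spacetime w \<and> locally_L1 spacetime v \<and>
     (\<forall>\<eta>. test_function spacetime \<eta> \<longrightarrow>
        (LINT z:spacetime|lebesgue. w z * deriv_t \<eta> z) =
        - (LINT z:spacetime|lebesgue. \<eta> z * v z))"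

text \<open>The support of a function determined up to null sets.\<close>

definition ess_support :: "('a::euclidean_space \<Rightarrow> real) \<Rightarrow> 'a set" where
  "ess_support v = {x. \<forall>e>0. \<not> (AE y in lebesgue. y \<in> ball x e \<longrightarrow> v y = 0)}"

subsection \<open>Solutions\<close>

text \<open>
  Only the power \<open>u\<^sup>\<sigma>\<close> with \<open>\<sigma> = (p + m - 2) / (p - 1)\<close> is required to have a weak gradient
  \<open>V\<close>; the gradient of \<open>u\<close> itself is then understood through the chain rule, as
  \<open>u\<^sup>1\<^sup>-\<^sup>\<sigma> V / \<sigma>\<close> where \<open>u > 0\<close> and as \<open>0\<close> where \<open>u = 0\<close>. The latter is built in by the convention
  \<open>0 powr a = 0\<close> (for every \<open>a\<close>), which also makes the flux vanish where \<open>u\<close> or its gradient does.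
\<close>

definition sigma :: "real \<Rightarrow> real \<Rightarrow> real" where
  "sigma p m = (p + m - 2) / (p - 1)"

definition grad_of_power ::
    "real \<Rightarrow> real \<Rightarrow> ('a::euclidean_space \<Rightarrow> real \<Rightarrow> real) \<Rightarrow> ('a \<times> real \<Rightarrow> 'a) \<Rightarrow> 'a \<times> real \<Rightarrow> 'a" where
  "grad_of_power p m u V = (\<lambda>(x, t). (u x t powr (1 - sigma p m) / sigma p m) *\<^sub>R V (x, t))"

definition energy_integral ::
    "real \<Rightarrow> real \<Rightarrow> ('a::euclidean_space \<Rightarrow> real) \<Rightarrow> ('a \<Rightarrow> real \<Rightarrow> real) \<Rightarrow> ('a \<times> real \<Rightarrow> 'a)
       \<Rightarrow> ('a \<times> real \<Rightarrow> real) \<Rightarrow> real" where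
  "energy_integral p m f u Du \<eta> =
     (LINT z:spacetime|lebesgue.
        (case z of (x, t) \<Rightarrow>
          (- u x t * deriv_t \<eta> z
           + (u x t powr (m - 1) * norm (Du z) powr (p - 2)) *\<^sub>R Du z \<bullet> grad_x \<eta> z) * f x))"

definition solution_class ::
    "real \<Rightarrow> real \<Rightarrow> ('a::euclidean_space \<Rightarrow> real) \<Rightarrow> ('a \<Rightarrow> real \<Rightarrow> real) \<Rightarrow> ('a \<times> real \<Rightarrow> 'a) \<Rightarrow> bool" where
  "solution_class p m f u V \<longleftrightarrow>
     (\<forall>t\<ge>0. AE x in lebesgue. 0 \<le> u x t) \<and>
     continuous_in_L1 f u \<and>
     (\<lambda>(x, t). u x t) \<in> borel_measurable (lebesgue_on spacetime) \<and>
     (\<forall>s>0. \<exists>M. AE (x, t) in lebesgue. s < t \<longrightarrow> \<bar>u x t\<bar> \<le> M) \<and>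
     weak_grad_x (\<lambda>(x, t). u x t powr sigma p m) V \<and>
     locally_Lp p spacetime V"

definition weak_solution ::
    "real \<Rightarrow> real \<Rightarrow> ('a::euclidean_space \<Rightarrow> real) \<Rightarrow> ('a \<Rightarrow> real \<Rightarrow> real) \<Rightarrow> bool" where
  "weak_solution p m f u \<longleftrightarrow>
     (\<exists>V. solution_class p m f u V \<and>
        (\<forall>\<eta>. test_function spacetime \<eta> \<longrightarrow>
           energy_integral p m f u (grad_of_power p m u V) \<eta> = 0))"

definition weak_subsolution ::
    "real \<Rightarrow> real \<Rightarrow> ('a::euclidean_space \<Rightarrow> real) \<Rightarrow> ('a \<Rightarrow> real \<Rightarrow> real) \<Rightarrow> bool" where
  "weak_subsolution p m f u \<longleftrightarrow>
     (\<exists>V. solution_class p m f u V \<and>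
        (\<forall>\<eta>. test_function spacetime \<eta> \<and> (\<forall>z. 0 \<le> \<eta> z) \<longrightarrow>
           energy_integral p m f u (grad_of_power p m u V) \<eta> \<le> 0))"

definition strong_solution ::
    "real \<Rightarrow> real \<Rightarrow> ('a::euclidean_space \<Rightarrow> real) \<Rightarrow> ('a \<Rightarrow> real \<Rightarrow> real) \<Rightarrow> bool" where
  "strong_solution p m f u \<longleftrightarrow>
     weak_solution p m f u \<and>
     (\<exists>v. weak_deriv_t (\<lambda>(x, t). u x t) v \<and>
        (\<forall>a b K. 0 < a \<and> compact K \<longrightarrow>
           (\<exists>M. AE t in lebesgue. t \<in> {a..b} \<longrightarrow>
              set_integrable (weighted f) K (\<lambda>x. v (x, t)) \<and>
              (LINT x:K|weighted f. \<bar>v (x, t)\<bar>) \<le> M)))"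

definition strong_solution_Cauchy ::
    "real \<Rightarrow> real \<Rightarrow> ('a::euclidean_space \<Rightarrow> real) \<Rightarrow> ('a \<Rightarrow> real) \<Rightarrow> ('a \<Rightarrow> real \<Rightarrow> real) \<Rightarrow> bool" where
  "strong_solution_Cauchy p m f u\<^sub>0 u \<longleftrightarrow>
     strong_solution p m f u \<and> (AE x in lebesgue. u x 0 = u\<^sub>0 x)"

subsection \<open>Barrier function\<close>

text \<open>Inverse of a function on the half-line \<open>[0, \<infinity>)\<close>, meaningful for increasing unbounded
  functions vanishing at the origin.\<close>

definition half_line_inverse :: "(real \<Rightarrow> real) \<Rightarrow> real \<Rightarrow> real" where
  "half_line_inverse h = inv_into {0..} h"

definition G_fun :: "(real \<Rightarrow> real) \<Rightarrow> real \<Rightarrow> real" where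
  "G_fun g r = integral {0..r} (\<lambda>s. g s / s)"

definition J_fun :: "real \<Rightarrow> (real \<Rightarrow> real) \<Rightarrow> real \<Rightarrow> real" where
  "J_fun p g r = r powr p / G_fun g r"

definition E_fun :: "real \<Rightarrow> (real \<Rightarrow> real) \<Rightarrow> real \<Rightarrow> real" where
  "E_fun p g \<tau> = J_fun p g (half_line_inverse (G_fun g) \<tau>)"

definition nu0 :: "real \<Rightarrow> (real \<Rightarrow> real) \<Rightarrow> real \<Rightarrow> real" where
  "nu0 p g r\<^sub>0 = 1 - r\<^sub>0 * deriv (G_fun g) r\<^sub>0 / (p * G_fun g r\<^sub>0)"

definition I_fun :: "real \<Rightarrow> (real \<Rightarrow> real) \<Rightarrow> real \<Rightarrow> real \<Rightarrow> real" where
  "I_fun p g r\<^sub>0 r =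
     nu0 p g r\<^sub>0 * (r powr p / G_fun g r\<^sub>0) powr (1 / (p - 1))
     + (1 - nu0 p g r\<^sub>0) * J_fun p g r\<^sub>0 powr (1 / (p - 1))"

definition barrier ::
    "real \<Rightarrow> real \<Rightarrow> (real \<Rightarrow> real) \<Rightarrow> real \<Rightarrow> real \<Rightarrow> real \<Rightarrow> real
       \<Rightarrow> 'a::euclidean_space \<Rightarrow> real \<Rightarrow> real" where
  "barrier p m g t\<^sub>0 C r\<^sub>0 \<Gamma> x t =
     (let r = norm x; \<tau> = \<Gamma> * ln (t + t\<^sub>0) in
      C / (t + t\<^sub>0) powr (1 / (p + m - 3)) *
      (max 0 (E_fun p g \<tau> powr (1 / (p - 1))
              - (if r\<^sub>0 \<le> r then J_fun p g r powr (1 / (p - 1)) else I_fun p g r\<^sub>0 r)))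
        powr ((p - 1) / (p + m - 3)))"

end

theory Submission
  imports Defs "HOL-Computational_Algebra.Polynomial"
begin

text \<open>
  Write \<open>\<phi> = E\<^bsup>1/(p-1)\<^esup>\<close> and \<open>\<psi> = J\<^bsup>1/(p-1)\<^esup>\<close> (continued by \<open>I\<close> for \<open>r < r\<^sub>0\<close>), so that the barrier is
  \<open>C (t + t\<^sub>0)\<^bsup>-1/k\<^esup> [\<phi>(\<tau>) - \<psi>(r)]\<^sub>+\<^bsup>q\<^esup>\<close> with \<open>k = p + m - 3\<close> and \<open>q = (p - 1)/k\<close>. The condition on \<open>g\<close> makes \<open>\<psi>'\<^bsup>p-1\<^esup>/r\<close> a Lipschitz
  function whose weighted divergence is bounded, and gives \<open>\<phi>' \<le> const \<phi>/\<tau>\<close>. The differential inequality for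
  the barrier then holds pointwise: the divergence is absorbed by the decay in time because \<open>C\<close> is small,
  and the growth of \<open>\<phi>\<close> is absorbed by the decay in time inside (\<open>t\<^sub>0\<close> large) and by the diffusion near
  the free boundary (\<open>\<Gamma>\<close> small). A regularisation of the power \<open>q\<close> turns this into the weak inequality.

  The solution \<open>u\<close> and a compactly supported subsolution with a weak time derivative are compared by testing
  with smooth approximations of the indicator of the set where \<open>w = u\<^bsup>\<sigma>\<^esup>\<close> is the smaller one: the fluxes are
  monotone functions of \<open>\<nabla>w\<close>, which are the only gradients that are known to exist. The choice \<open>\<Gamma> ln t\<^sub>0 = G(\<ell>)\<close>
  makes the initial barrier vanish outside \<open>B\<^sub>\<ell>\<close>, and the support follows from \<open>G \<le> g/\<alpha>\<^sub>1\<close>.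
\<close>

section \<open>Smooth functions\<close>

text \<open>The exponents \<open>1/k\<close> and \<open>q\<close> are forced. With
  \<open>T = t + t0\<close> and \<open>z\<close> the bracket, the time derivative and the divergence
  of the flux of \<open>C T^(-1/k) z^q\<close> both carry \<open>T^(-1/k-1)\<close>, and the flux
  carries exactly \<open>z^q\<close>: it equals \<open>- K C^k / T\<close> times the barrier times
  the radial field \<open>\<Lambda>c x\<close>. The pointwise inequality is therefore linear in the
  pair formed by the power and its derivative, and it survives when one regularised power replaces
  \<open>z^q\<close> in both places. The obstacle is the case \<open>q < 1\<close>, where the time
  derivative blows up at the free boundary; its local integrability, needed for the weak time
  derivative of the barrier, comes from Fatou's lemma along the regularisations. In the comparison
  only the powers have gradients, while the time derivatives belong to the functions themselves. The
  two fit together because \<open>ut^\<sigma> - u^\<sigma>\<close> and \<open>ut - u\<close> have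
  the same sign: the cutoff tends to an indicator, and the time term becomes the derivative of the
  positive part of \<open>ut - u\<close>. Continuity in \<open>L^1\<close> then carries the ordering
  from time 0 to later times.\<close>

abbreviation smooth :: "('b::euclidean_space \<Rightarrow> real) \<Rightarrow> bool" where
  "smooth h \<equiv> \<forall>k. k_times_cont_diff k h"

text \<open>Gradients and time derivatives of test functions are \<open>frechet_derivative\<close>
  evaluated at a direction, so the calculus below is done one direction at a time:
  \<open>(b, 0)\<close> in space and \<open>(0, 1)\<close> in time.\<close>

abbreviation ddir :: "'b::euclidean_space \<Rightarrow> ('b \<Rightarrow> real) \<Rightarrow> 'b \<Rightarrow> real" where
  "ddir v h \<equiv> \<lambda>z. frechet_derivative h (at z) v"

lemma has_derivative_ddir:
  "h differentiable (at z) \<Longrightarrow> (h has_derivative (\<lambda>v. ddir v h z)) (at z)"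
  using frechet_derivative_works by fastforce

lemma ddir_eq: "(h has_derivative h') (at z) \<Longrightarrow> ddir v h z = h' v"
  by (metis frechet_derivative_at)

lemma ddir_scale: "h differentiable (at z) \<Longrightarrow> ddir (c *\<^sub>R v) h z = c * ddir v h z"
  using has_derivative_ddir[of h z] linear_cmul[OF has_derivative_linear]
  by fastforce

lemma ddir_real:
  fixes h :: "real \<Rightarrow> real"
  assumes "(h has_real_derivative d) (at x)"
  shows "ddir v h x = d * v"
  using assms by (intro ddir_eq) (simp add: has_field_derivative_def)

lemma kcd_antimono: "k_times_cont_diff (Suc k) h \<Longrightarrow> k_times_cont_diff k h"
proof (induction k arbitrary: h)
  case 0
  then show ?case
    by (auto simp: continuous_on_eq_continuous_at intro: differentiable_imp_continuous_within)
qed simp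

lemma smooth_differentiable: "smooth h \<Longrightarrow> h differentiable (at z)"
  using k_times_cont_diff.simps(2) by blast

lemma smooth_ddir: "smooth h \<Longrightarrow> smooth (ddir v h)"
  using k_times_cont_diff.simps(2) by blast

lemma smooth_continuous: "smooth h \<Longrightarrow> continuous_on A h"
  by (meson continuous_on_subset k_times_cont_diff.simps(1) subset_UNIV)

text \<open>Coinduction for smoothness: a family of differentiable functions that is stable under
  every directional derivative can be differentiated indefinitely. Convolutions, affine
  substitutions and the flat exponential are handled through such families.\<close>

lemma smooth_coinduct:
  assumes "P h"
    and "\<And>h z. P h \<Longrightarrow> h differentiable (at z)"
    and "\<And>h v. P h \<Longrightarrow> P (ddir v h)"
  shows "smooth h"
proof
  fix k show "k_times_cont_diff k h" using assms(1)
  proof (induction k arbitrary: h)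
    case 0
    then show ?case using assms(2)
      by (auto simp: continuous_on_eq_continuous_at intro!: differentiable_imp_continuous_within)
  qed (use assms in auto)
qed

lemma kcd_const: "k_times_cont_diff k (\<lambda>_. c)"
proof (induction k arbitrary: c)
  case (Suc k)
  have "ddir v (\<lambda>_. c) z = 0" for v z :: 'a
    by (intro ddir_eq) auto
  then show ?case using Suc by simp
qed simp

lemma kcd_linear:
  assumes "bounded_linear h"
  shows "k_times_cont_diff k h"
proof (cases k)
  case 0
  then show ?thesis using assms by (simp add: linear_continuous_on)
next
  case (Suc n)
  have "(h has_derivative h) (at z)" for z
    using assms by (rule bounded_linear_imp_has_derivative)
  then show ?thesis using Suc
    by (auto simp: ddir_eq[of h h] kcd_const intro: differentiableI)
qed

lemma kcd_add:
  "k_times_cont_diff k h \<Longrightarrow> k_times_cont_diff k g \<Longrightarrow> k_times_cont_diff k (\<lambda>z. h z + g z)"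
proof (induction k arbitrary: h g)
  case (Suc k)
  have "ddir v (\<lambda>z. h z + g z) z = ddir v h z + ddir v g z" for v z
    using Suc.prems by (intro ddir_eq has_derivative_add has_derivative_ddir) auto
  then show ?case using Suc by simp
qed (simp add: continuous_on_add)

lemma kcd_mult:
  "k_times_cont_diff k h \<Longrightarrow> k_times_cont_diff k g \<Longrightarrow> k_times_cont_diff k (\<lambda>z. h z * g z)"
proof (induction k arbitrary: h g)
  case (Suc k)
  have "ddir v (\<lambda>z. h z * g z) z = h z * ddir v g z + ddir v h z * g z" for v z
    using Suc.prems by (intro ddir_eq has_derivative_mult has_derivative_ddir) auto
  moreover have "k_times_cont_diff k h" "k_times_cont_diff k g"
    using Suc.prems kcd_antimono by blast+
  ultimately show ?case using Suc by (simp add: kcd_add)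
qed (simp add: continuous_on_mult)

lemma kcd_compose:
  fixes H :: "real \<Rightarrow> real"
  shows "k_times_cont_diff k H \<Longrightarrow> k_times_cont_diff k h \<Longrightarrow> k_times_cont_diff k (\<lambda>z. H (h z))"
proof (induction k arbitrary: h H)
  case 0
  then show ?case using continuous_on_compose2 by fastforce
next
  case (Suc k)
  have d: "H differentiable (at x)" "h differentiable (at z)" for x z
    using Suc.prems by auto
  have "ddir v (\<lambda>z. H (h z)) z = ddir 1 H (h z) * ddir v h z" for v z
  proof -
    have "ddir v (\<lambda>z. H (h z)) z = ddir (ddir v h z) H (h z)"
      using has_derivative_compose[OF has_derivative_ddir[OF d(2)] has_derivative_ddir[OF d(1)]]
      by (intro ddir_eq) auto
    also have "\<dots> = ddir (ddir v h z *\<^sub>R 1) H (h z)" by simp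
    also have "\<dots> = ddir v h z * ddir 1 H (h z)" by (rule ddir_scale[OF d(1)])
    finally show ?thesis by simp
  qed
  moreover have "(\<lambda>z. H (h z)) differentiable (at z)" for z
    using differentiable_compose[OF d(1) d(2)] .
  moreover have "k_times_cont_diff k (\<lambda>z. ddir 1 H (h z) * ddir v h z)" for v
    by (rule kcd_mult[OF Suc.IH]) (use Suc.prems kcd_antimono in auto)
  ultimately show ?case by simp
qed

lemma smooth_const: "smooth (\<lambda>_. c)"
  by (simp add: kcd_const)

lemma smooth_add: "smooth h \<Longrightarrow> smooth g \<Longrightarrow> smooth (\<lambda>z. h z + g z)"
  by (simp add: kcd_add)

lemma smooth_mult: "smooth h \<Longrightarrow> smooth g \<Longrightarrow> smooth (\<lambda>z. h z * g z)"
  by (simp add: kcd_mult)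

lemma smooth_compose: "smooth H \<Longrightarrow> smooth h \<Longrightarrow> smooth (\<lambda>z. H (h z))"
  by (simp add: kcd_compose)

lemma smooth_linear: "bounded_linear h \<Longrightarrow> smooth h"
  by (simp add: kcd_linear)

lemma smooth_diff: "smooth h \<Longrightarrow> smooth g \<Longrightarrow> smooth (\<lambda>z. h z - g z)"
  using smooth_add[of h "\<lambda>z. (-1) * g z"] smooth_mult[OF smooth_const[of "-1"], of g] by simp

lemma smooth_sum: "finite I \<Longrightarrow> (\<And>i. i \<in> I \<Longrightarrow> smooth (h i)) \<Longrightarrow> smooth (\<lambda>z. \<Sum>i\<in>I. h i z)"
  by (induction rule: finite_induct) (simp_all add: kcd_const kcd_add)

lemma smooth_inner_self: "smooth (\<lambda>z. z \<bullet> z)"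
proof -
  have "smooth (\<lambda>z::'a. \<Sum>b\<in>Basis. (z \<bullet> b) * (z \<bullet> b))"
    by (intro smooth_sum smooth_mult smooth_linear) (auto intro: bounded_linear_intros)
  moreover have "(\<lambda>z::'a. \<Sum>b\<in>Basis. (z \<bullet> b) * (z \<bullet> b)) = (\<lambda>z. z \<bullet> z)"
    by (simp add: euclidean_inner[symmetric])
  ultimately show ?thesis by simp
qed

lemma smooth_real_deriv:
  fixes H :: "real \<Rightarrow> real"
  assumes "smooth H"
  shows "(H has_real_derivative ddir 1 H x) (at x)"
proof -
  have "ddir v H x = ddir 1 H x * v" for v
    using ddir_scale[OF smooth_differentiable[OF assms], where c = v and v = 1 and z = x]
    by (simp add: mult.commute)
  then have "(\<lambda>v. ddir v H x) = (*) (ddir 1 H x)" by (intro ext)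
  then show ?thesis
    using has_derivative_ddir[OF smooth_differentiable[OF assms], of x]
    unfolding has_field_derivative_def by metis
qed

lemma smooth_antiderivative:
  fixes H :: "real \<Rightarrow> real"
  assumes "smooth h" and "\<And>x. (H has_real_derivative h x) (at x)"
  shows "smooth H"
proof
  fix k show "k_times_cont_diff k H"
  proof (cases k)
    case 0
    show ?thesis unfolding 0 k_times_cont_diff.simps
      by (intro DERIV_continuous_on[of _ _ h]) (use assms(2) in auto)
  next
    case (Suc n)
    have "H differentiable (at x)" for x
      using assms(2) by (meson differentiableI has_field_derivative_def)
    moreover have "k_times_cont_diff n (ddir v H)" for v
      unfolding ddir_real[OF assms(2)] using assms(1) by (simp add: kcd_mult kcd_const)
    ultimately show ?thesis by (simp add: Suc)
  qed
qed

lemma smooth_compose_linear: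
  assumes "bounded_linear L" and "smooth h"
  shows "smooth (\<lambda>z. h (c + L z))"
proof -
  define P where "P = (\<lambda>q. \<exists>h. smooth h \<and> q = (\<lambda>z. h (c + L z)))"
  have d: "((\<lambda>z. h (c + L z)) has_derivative (\<lambda>v. ddir (L v) h (c + L z))) (at z)" if "smooth h" for h z
  proof -
    have "((\<lambda>z. c + L z) has_derivative L) (at z)"
      using has_derivative_add[OF has_derivative_const bounded_linear_imp_has_derivative[OF assms(1)]]
      by simp
    from has_derivative_compose[OF this has_derivative_ddir[OF smooth_differentiable[OF that]]]
    show ?thesis .
  qed
  show ?thesis
  proof (rule smooth_coinduct[of P])
    show "P (\<lambda>z. h (c + L z))" using assms(2) P_def by blast
    show "q differentiable (at z)" if "P q" for q z
      using that d unfolding P_def by (blast intro: differentiableI)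
    show "P (ddir v q)" if "P q" for q v
    proof -
      from that obtain h where h: "smooth h" "q = (\<lambda>z. h (c + L z))" unfolding P_def by blast
      then have "ddir v q = (\<lambda>z. ddir (L v) h (c + L z))" using ddir_eq[OF d[OF h(1)]] by auto
      then show ?thesis unfolding P_def using smooth_ddir[OF h(1)] by blast
    qed
  qed
qed

text \<open>A closed set has an open complement, so \<open>h\<close> vanishes near \<open>z\<close>
  and not merely at \<open>z\<close>.\<close>

lemma ddir_outside_support:
  assumes "closed K" and "\<And>z. z \<notin> K \<Longrightarrow> h z = 0" and "z \<notin> K"
  shows "ddir v h z = 0"
proof (rule ddir_eq)
  have "((\<lambda>_. 0) has_derivative (\<lambda>_. 0)) (at z)" by simp
  then show "(h has_derivative (\<lambda>_. 0)) (at z)"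
    by (rule has_derivative_transform_within_open[of _ _ _ _ "- K"]) (use assms in auto)
qed

subsection \<open>Smooth bumps and steps\<close>

definition exp_cutoff :: "real \<Rightarrow> real" where
  "exp_cutoff x = (if x > 0 then exp (- (1 / x)) else 0)"

lemma exp_cutoff_ge_0: "0 \<le> exp_cutoff x"
  by (simp add: exp_cutoff_def)

lemma exp_cutoff_pos_iff: "0 < exp_cutoff x \<longleftrightarrow> 0 < x"
  by (simp add: exp_cutoff_def)

text \<open>With \<open>y = 1/x\<close> this is the decay of \<open>y^n exp(-y)\<close> at infinity,
  applied to each monomial.\<close>

lemma poly_exp_decay: "((\<lambda>x. poly q (1 / x) * exp (- (1 / x :: real))) \<longlongrightarrow> 0) (at_right 0)"
proof -
  have *: "((\<lambda>y. poly q y * exp (- y)) \<longlongrightarrow> (0::real)) at_top"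
  proof (induction q)
    case (pCons a q)
    have lim: "((\<lambda>y. y ^ n * exp (- y)) \<longlongrightarrow> (0::real)) at_top" for n
      using tendsto_power_div_exp_0[of n] by (simp add: exp_minus field_simps)
    have "((\<lambda>y::real. \<Sum>i\<le>degree (pCons a q). coeff (pCons a q) i * (y ^ i * exp (- y))) \<longlongrightarrow>
        (\<Sum>i\<le>degree (pCons a q). coeff (pCons a q) i * 0)) at_top"
      by (intro tendsto_sum tendsto_mult tendsto_const lim)
    then show ?case by (simp add: poly_altdef[of "pCons a q"] sum_distrib_right mult.assoc del: poly_pCons)
  qed simp
  have "filterlim (\<lambda>x. 1 / x) at_top (at_right (0::real))"
    by (simp add: filterlim_inverse_at_top_right divide_inverse)
  from filterlim_compose[OF * this] show ?thesis .
qed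

lemma smooth_exp_cutoff: "smooth exp_cutoff"
proof -
  define F where "F = (\<lambda>(q::real poly) x. if x > 0 then poly q (1 / x) * exp (- (1 / x)) else 0 :: real)"
  \<comment> \<open>Differentiating \<open>poly q (1/x) exp(-1/x)\<close> brings out
    \<open>1/x^2\<close> and the polynomial \<open>q - pderiv q\<close>, so the family
    \<open>F\<close> is closed under derivatives.\<close>
  define Dp where "Dp = (\<lambda>q::real poly. [:0,0,1:] * (q - pderiv q))"
  have der: "(F q has_real_derivative F (Dp q) x) (at x)" for q x
  proof -
    consider "x > 0" | "x < 0" | "x = 0" by linarith
    then show ?thesis
    proof cases
      case 1
      have "((\<lambda>x. poly q (1 / x) * exp (- (1 / x))) has_real_derivative
          poly (Dp q) (1 / x) * exp (- (1 / x))) (at x)"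
      proof -
        have i: "((\<lambda>x. 1 / x) has_real_derivative - ((1 / x) ^ 2)) (at x)"
          using 1 by (auto intro!: derivative_eq_intros simp: power2_eq_square)
        have p: "((\<lambda>x. poly q (1 / x)) has_real_derivative poly (pderiv q) (1 / x) * (- ((1 / x) ^ 2))) (at x)"
          by (rule DERIV_chain2[OF poly_DERIV i])
        have e: "((\<lambda>x. exp (- (1 / x))) has_real_derivative exp (- (1 / x)) * (- (- ((1 / x) ^ 2)))) (at x)"
          by (rule DERIV_chain2[OF DERIV_exp DERIV_minus[OF i]])
        show ?thesis
          by (rule DERIV_cong[OF DERIV_mult[OF p e]])
            (simp add: Dp_def algebra_simps power2_eq_square)
      qed
      then have "(F q has_real_derivative poly (Dp q) (1 / x) * exp (- (1 / x))) (at x)"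
        by (rule has_field_derivative_transform_within_open[of _ _ _ "{0<..}"])
          (use 1 in \<open>auto simp: F_def\<close>)
      then show ?thesis using 1 by (simp add: F_def)
    next
      case 2
      have "((\<lambda>x. 0) has_real_derivative 0) (at x)" by simp
      then have "(F q has_real_derivative 0) (at x)"
        by (rule has_field_derivative_transform_within_open[of _ _ _ "{..<0}"])
          (use 2 in \<open>auto simp: F_def\<close>)
      then show ?thesis using 2 by (simp add: F_def)
    next
      case 3
      \<comment> \<open>At the origin the difference quotient from the right is again of the
        decaying form, with \<open>q\<close> multiplied by the variable.\<close>
      have "((\<lambda>h. F q h / h) \<longlongrightarrow> 0) (at 0)"
        unfolding filterlim_at_split
      proof
        show "((\<lambda>h. F q h / h) \<longlongrightarrow> 0) (at_left 0)"
          by (rule tendsto_eventually) (auto simp: F_def eventually_at_filter)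
        have "((\<lambda>x. poly ([:0,1:] * q) (1 / x) * exp (- (1 / x :: real))) \<longlongrightarrow> 0) (at_right 0)"
          by (rule poly_exp_decay)
        then show "((\<lambda>h. F q h / h) \<longlongrightarrow> 0) (at_right 0)"
          by (rule Lim_transform_eventually) (auto simp: F_def eventually_at_filter)
      qed
      moreover have "(\<lambda>h. (F q (0 + h) - F q 0) / h) = (\<lambda>h. F q h / h)" "F (Dp q) 0 = 0"
        by (auto simp: F_def)
      ultimately show ?thesis using 3 unfolding DERIV_def by simp
    qed
  qed
  define P where "P = (\<lambda>h. \<exists>q. h = F q)"
  have "smooth (F [:1:])"
  proof (rule smooth_coinduct[of P])
    show "P (F [:1:])" by (auto simp: P_def)
    show "h differentiable (at z)" if "P h" for h z
      using that der unfolding P_def by (meson differentiableI has_field_derivative_def)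
    show "P (ddir v h)" if "P h" for h v
    proof -
      from that obtain q where q: "h = F q" unfolding P_def by blast
      have "ddir v h = F (smult v (Dp q))"
        unfolding q ddir_real[OF der] by (auto simp: F_def)
      then show ?thesis unfolding P_def by blast
    qed
  qed
  moreover have "F [:1:] = exp_cutoff" by (auto simp: F_def exp_cutoff_def)
  ultimately show ?thesis by simp
qed

lemma smooth_ball_bump: "smooth (\<lambda>z::'b::euclidean_space. exp_cutoff (r - z \<bullet> z))"
  by (rule smooth_compose[OF smooth_exp_cutoff smooth_diff[OF smooth_const smooth_inner_self]])

lemma exists_antiderivative:
  fixes h :: "real \<Rightarrow> real"
  assumes "continuous_on UNIV h"
  obtains H where "\<And>x. (H has_real_derivative h x) (at x)"
proof -
  have "\<exists>F. \<forall>x. -\<infinity> < ereal x \<longrightarrow> ereal x < \<infinity> \<longrightarrow> (F has_vector_derivative h x) (at x)"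
    by (rule einterval_antiderivative) (use assms in \<open>auto simp: continuous_on_eq_continuous_at\<close>)
  then show ?thesis using that by (auto simp: has_real_derivative_iff_has_vector_derivative)
qed

text \<open>A smooth stand-in for the Heaviside function at unit scale. Flatness outside the unit
  interval makes the rescaled steps \<open>S (n x)\<close> converge pointwise, and the slope bound
  \<open>C\<close> controls their derivatives.\<close>

definition smooth_step :: "(real \<Rightarrow> real) \<Rightarrow> real \<Rightarrow> bool" where
  "smooth_step S C \<longleftrightarrow> smooth S \<and> mono S \<and> (\<forall>x. (x \<le> 0 \<longrightarrow> S x = 0) \<and> (1 \<le> x \<longrightarrow> S x = 1) \<and> 0 \<le> S x \<and> S x \<le> 1 \<and>
     0 \<le> ddir 1 S x \<and> ddir 1 S x \<le> C \<and> (x \<le> 0 \<or> 1 \<le> x \<longrightarrow> ddir 1 S x = 0))"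

lemma smooth_stepD:
  assumes "smooth_step S C"
  shows "smooth S" "x \<le> 0 \<Longrightarrow> S x = 0" "1 \<le> x \<Longrightarrow> S x = 1" "mono S" "0 \<le> S x" "S x \<le> 1"
    "0 \<le> ddir 1 S x" "ddir 1 S x \<le> C" "x \<le> 0 \<or> 1 \<le> x \<Longrightarrow> ddir 1 S x = 0"
  using assms unfolding smooth_step_def by blast+

text \<open>The step is an antiderivative of the bump
  \<open>exp_cutoff x * exp_cutoff (1 - x)\<close>, divided by its total increase
  \<open>H 1 - H 0\<close>, which is positive because the bump is positive inside the unit
  interval.\<close>

lemma exists_smooth_step: "\<exists>S C. smooth_step S C"
proof -
  define b where "b x = exp_cutoff x * exp_cutoff (1 - x)" for x
  have sb: "smooth b"
    unfolding b_def
    by (rule smooth_mult[OF smooth_exp_cutoff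
        smooth_compose[OF smooth_exp_cutoff smooth_diff[OF smooth_const smooth_linear[OF bounded_linear_ident]]]])
  have b0: "0 \<le> b x" "x \<le> 0 \<or> 1 \<le> x \<Longrightarrow> b x = 0" "b x \<le> 1" for x
    by (auto simp: b_def exp_cutoff_def mult_le_one)
  have bpos: "0 < x \<Longrightarrow> x < 1 \<Longrightarrow> b x > 0" for x by (simp add: b_def exp_cutoff_def)
  obtain H where H: "\<And>x. (H has_real_derivative b x) (at x)"
    using exists_antiderivative[OF smooth_continuous[OF sb]] by blast
  have mono: "mono H"
    by (rule monoI, rule DERIV_nonneg_imp_nondecreasing) (use H b0(1) in blast)+
  have cH: "continuous_on A H" for A
    by (rule DERIV_continuous_on[of _ _ b]) (meson H has_field_derivative_at_within)
  have "H 0 < H 1"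
    by (rule DERIV_pos_imp_increasing_open[OF zero_less_one _ cH]) (use H bpos in blast)
  have H0: "H x = H 0" if "x \<le> 0" for x
  proof (cases "x = 0")
    case False
    have "DERIV H y :> 0" if "y < 0" for y
      using H[of y] b0(2)[of y] that by simp
    then show ?thesis
      using DERIV_isconst_end[of x 0 H] cH that False by auto
  qed auto
  have H1: "H x = H 1" if "1 \<le> x" for x
  proof (cases "x = 1")
    case False
    have "DERIV H y :> 0" if "1 < y" for y
      using H[of y] b0(2)[of y] that by simp
    then show ?thesis
      using DERIV_isconst_end[of 1 x H] cH that False by auto
  qed auto
  define S where "S x = (H x + (- H 0)) * (1 / (H 1 - H 0))" for x
  have c: "0 < 1 / (H 1 - H 0)" using \<open>H 0 < H 1\<close> by simp
  have ms: "mono S"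
    unfolding S_def using monoD[OF mono] c by (intro monoI mult_right_mono add_right_mono) auto
  have S0: "S x = 0" if "x \<le> 0" for x using H0[OF that] by (simp add: S_def)
  have S1: "S x = 1" if "1 \<le> x" for x using H1[OF that] \<open>H 0 < H 1\<close> by (simp add: S_def)
  have "(S has_real_derivative b x * (1 / (H 1 - H 0))) (at x)" for x
    unfolding S_def by (rule DERIV_cong[OF DERIV_cmult_right[OF DERIV_add[OF H DERIV_const]]]) simp
  then have d: "ddir 1 S x = b x * (1 / (H 1 - H 0))" for x by (rule ddir_real[THEN trans]) simp
  have "0 \<le> S x" "S x \<le> 1" for x
    using monoD[OF ms, of "min 0 x" x] monoD[OF ms, of x "max 1 x"] S0[of "min 0 x"] S1[of "max 1 x"] by simp_all
  moreover have "b x * (1 / (H 1 - H 0)) \<le> 1 / (H 1 - H 0)" for x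
    using mult_right_mono[OF b0(3)[of x], of "1 / (H 1 - H 0)"] c by simp
  moreover have "smooth S" unfolding S_def
    by (rule smooth_mult[OF smooth_add[OF smooth_antiderivative[OF sb H] smooth_const] smooth_const])
  ultimately have "smooth_step S (1 / (H 1 - H 0))"
    unfolding smooth_step_def d using ms S0 S1 b0 c by (simp add: less_imp_le)
  then show ?thesis by blast
qed

lemma smooth_affine:
  fixes S :: "real \<Rightarrow> real"
  assumes "smooth S"
  shows "smooth (\<lambda>t. S (c + a * t))" and "ddir 1 (\<lambda>t. S (c + a * t)) t = a * ddir 1 S (c + a * t)"
proof -
  show "smooth (\<lambda>t. S (c + a * t))"
    by (rule smooth_compose_linear[OF bounded_linear_mult_right assms])
  have "((\<lambda>t. c + a * t) has_real_derivative a) (at t)" by (auto intro!: derivative_eq_intros)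
  from DERIV_chain2[OF smooth_real_deriv[OF assms] this]
  have "ddir 1 (\<lambda>t. S (c + a * t)) t = ddir 1 S (c + a * t) * a * 1" by (rule ddir_real)
  then show "ddir 1 (\<lambda>t. S (c + a * t)) t = a * ddir 1 S (c + a * t)" by simp
qed

text \<open>For \<open>x > 0\<close> the argument eventually exceeds 1, so the sequence is
  eventually constant. The value \<open>c\<close> is left free because the fact serves both for the
  step (\<open>c = 1\<close>) and for \<open>y S'(y)\<close>, which vanishes again beyond 1
  (\<open>c = 0\<close>).\<close>

lemma step_tendsto:
  fixes S :: "real \<Rightarrow> real"
  assumes "\<And>x. x \<le> 0 \<Longrightarrow> S x = 0" "\<And>x. 1 \<le> x \<Longrightarrow> S x = c"
  shows "(\<lambda>n. S (real (Suc n) * x)) \<longlonglongrightarrow> (if x > 0 then c else 0)"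
proof (cases "x > 0")
  case True
  then obtain N where N: "1 / real (Suc N) < x" using nat_approx_posE by blast
  have "S (real (Suc n) * x) = c" if "n \<ge> N" for n
  proof -
    have "1 / real (Suc n) \<le> 1 / real (Suc N)" using that by (simp add: frac_le)
    then have "1 / real (Suc n) < x" using N by linarith
    then show ?thesis by (intro assms(2)) (simp add: divide_less_eq mult.commute del: of_nat_Suc)
  qed
  then show ?thesis using True by (intro tendsto_eventually eventually_sequentiallyI[of N]) simp
next
  case False
  then have "S (real (Suc n) * x) = 0" for n by (intro assms(1)) (simp add: mult_le_0_iff del: of_nat_Suc)
  then show ?thesis using False by simp
qed

section \<open>Mollification\<close>

lemma test_functionI:
  "smooth h \<Longrightarrow> compact K \<Longrightarrow> K \<subseteq> S \<Longrightarrow> (\<And>z. z \<notin> K \<Longrightarrow> h z = 0) \<Longrightarrow> test_function S h"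
  unfolding test_function_def by blast

lemma continuous_lebesgue_measurable:
  fixes h :: "'b::euclidean_space \<Rightarrow> 'c::euclidean_space"
  shows "continuous_on UNIV h \<Longrightarrow> h \<in> borel_measurable lebesgue"
  by (simp add: borel_measurable_continuous_onI measurable_completion)

lemma compact_support_bounded:
  fixes h :: "'b::euclidean_space \<Rightarrow> real"
  assumes "continuous_on UNIV h" "compact K" "\<And>z. z \<notin> K \<Longrightarrow> h z = 0"
  obtains B where "0 \<le> B" "\<And>z. \<bar>h z\<bar> \<le> B"
proof -
  have "compact (h ` K)"
    using assms by (meson compact_continuous_image continuous_on_subset subset_UNIV)
  then obtain B where "\<forall>y\<in>h ` K. norm y \<le> B"
    using compact_imp_bounded bounded_iff by metis
  then have "\<bar>h z\<bar> \<le> max 0 B" for z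
    using assms(3)[of z] by (cases "z \<in> K") (auto simp: le_max_iff_disj)
  then show ?thesis using that[of "max 0 B"] by simp
qed

lemma test_function_ddir:
  assumes "test_function S h"
  shows "test_function S (ddir v h)"
proof -
  from assms obtain K where "compact K" "K \<subseteq> S" "\<And>z. z \<notin> K \<Longrightarrow> h z = 0" and h: "smooth h"
    unfolding test_function_def by blast
  then show ?thesis
    by (intro test_functionI[of _ K] smooth_ddir)
      (auto intro: ddir_outside_support compact_imp_closed)
qed

lemma test_function_bounded:
  assumes "test_function S h"
  obtains B where "0 \<le> B" "\<And>z. \<bar>h z\<bar> \<le> B"
  using assms compact_support_bounded[of h] smooth_continuous[of h]
  unfolding test_function_def by metis

lemma compact_support_integrable:
  fixes h :: "'b::euclidean_space \<Rightarrow> real"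
  assumes "continuous_on UNIV h" "compact K" "\<And>z. z \<notin> K \<Longrightarrow> h z = 0"
  shows "integrable lebesgue h"
proof -
  have "integrable lborel (\<lambda>z. indicator K z *\<^sub>R h z)"
    using assms(1,2) by (intro borel_integrable_compact) (auto intro: continuous_on_subset)
  moreover have "(\<lambda>z. indicator K z *\<^sub>R h z) = h"
    using assms(3) by (intro ext) (auto simp: indicator_def)
  ultimately have "integrable lborel h" by simp
  then show ?thesis
    by (subst integrable_completion) (auto dest: borel_measurable_integrable)
qed

lemma test_function_integrable: "test_function S h \<Longrightarrow> integrable lebesgue h"
  using compact_support_integrable[of h] smooth_continuous[of h]
  unfolding test_function_def by metis

lemma bounded_mult_integrable:
  fixes h \<kappa> :: "'b \<Rightarrow> real"
  assumes "integrable M h" "\<kappa> \<in> borel_measurable M" "\<And>z. \<bar>\<kappa> z\<bar> \<le> B"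
  shows "integrable M (\<lambda>z. \<kappa> z * h z)"
proof (rule Bochner_Integration.integrable_bound)
  show "integrable M (\<lambda>z. B * h z)" using assms(1) by simp
  show "AE z in M. norm (\<kappa> z * h z) \<le> norm (B * h z)"
  proof (rule AE_I2)
    fix z
    have "\<bar>\<kappa> z\<bar> \<le> \<bar>B\<bar>" using assms(3)[of z] by linarith
    then show "norm (\<kappa> z * h z) \<le> norm (B * h z)" by (simp add: abs_mult mult_right_mono)
  qed
qed (use assms in auto)

text \<open>Borel measurability of \<open>h\<close> lets the translation invariance of
  \<open>lborel\<close> be carried to its completion; Lebesgue measurable functions are handled
  later through a Borel representative.\<close>

lemma integral_lebesgue_shift:
  fixes h :: "'b::euclidean_space \<Rightarrow> real"
  assumes "h \<in> borel_measurable borel"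
  shows "(LINT z|lebesgue. h (z + c)) = (LINT z|lebesgue. h z)"
    and "integrable lebesgue (\<lambda>z. h (z + c)) \<longleftrightarrow> integrable lebesgue h"
proof -
  have [measurable]: "(\<lambda>z. h (z + c)) \<in> borel_measurable borel"
    using assms by measurable
  have d: "(lborel :: 'b measure) = distr lborel borel ((+) c)"
    by (simp add: lborel_distr_plus)
  have "(LINT z|lborel. h z) = (LINT z|lborel. h (c + z))"
    by (subst d, subst integral_distr) (use assms in auto)
  then show "(LINT z|lebesgue. h (z + c)) = (LINT z|lebesgue. h z)"
    using assms by (simp add: integral_completion add.commute)
  have "integrable lborel h \<longleftrightarrow> integrable lborel (\<lambda>z. h (c + z))"
    by (subst d, subst integrable_distr_eq) (use assms in auto)
  then show "integrable lebesgue (\<lambda>z. h (z + c)) \<longleftrightarrow> integrable lebesgue h"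
    using assms by (simp add: integrable_completion add.commute)
qed

lemma ddir_representation:
  assumes "h differentiable (at z)"
  shows "ddir v h z = (\<Sum>b\<in>Basis. (v \<bullet> b) * ddir b h z)"
proof -
  have l: "linear (\<lambda>v. ddir v h z)"
    using has_derivative_ddir[OF assms] has_derivative_linear by blast
  have "ddir v h z = ddir (\<Sum>b\<in>Basis. (v \<bullet> b) *\<^sub>R b) h z" by (simp add: euclidean_representation)
  also have "\<dots> = (\<Sum>b\<in>Basis. ddir ((v \<bullet> b) *\<^sub>R b) h z)" by (rule linear_sum[OF l])
  also have "\<dots> = (\<Sum>b\<in>Basis. (v \<bullet> b) * ddir b h z)"
    using linear_cmul[OF l] by simp
  finally show ?thesis .
qed

text \<open>Each partial derivative is itself a test function and hence bounded; the sum of these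
  bounds controls all directions at once, and the mean value inequality turns it into a Lipschitz
  constant.\<close>

lemma test_function_lipschitz:
  assumes "test_function S h"
  obtains L where "0 \<le> L" "\<And>v z. \<bar>ddir v h z\<bar> \<le> L * norm v" "\<And>x y. \<bar>h x - h y\<bar> \<le> L * norm (x - y)"
proof -
  have sm: "smooth h" using assms by (simp add: test_function_def)
  have "\<forall>b. \<exists>B. 0 \<le> B \<and> (\<forall>z. \<bar>ddir b h z\<bar> \<le> B)"
    using test_function_bounded[OF test_function_ddir[OF assms]] by metis
  then obtain B where B: "\<And>b. 0 \<le> B b" "\<And>b z. \<bar>ddir b h z\<bar> \<le> B b" by metis
  define L where "L = (\<Sum>b\<in>Basis. B b)"
  have L0: "0 \<le> L" unfolding L_def using B(1) by (simp add: sum_nonneg)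
  have d: "\<bar>ddir v h z\<bar> \<le> L * norm v" for v z
  proof -
    have "\<bar>ddir v h z\<bar> \<le> (\<Sum>b\<in>Basis. \<bar>(v \<bullet> b) * ddir b h z\<bar>)"
      by (subst ddir_representation[OF smooth_differentiable[OF sm]]) (rule sum_abs)
    also have "\<dots> \<le> (\<Sum>b\<in>Basis. norm v * B b)"
      by (intro sum_mono) (auto simp: abs_mult intro!: mult_mono B Basis_le_norm)
    finally show ?thesis by (simp add: L_def sum_distrib_left mult.commute)
  qed
  have "\<bar>h x - h y\<bar> \<le> L * norm (x - y)" for x y
  proof -
    have "norm (h x - h y) \<le> L * norm (x - y)"
      by (rule differentiable_bound[of UNIV _ "\<lambda>z v. ddir v h z"])
        (use d L0 in \<open>auto intro!: onorm_bound has_derivative_ddir smooth_differentiable[OF sm]\<close>)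
    then show ?thesis by simp
  qed
  with L0 d that show ?thesis by blast
qed

section \<open>Convolution with a test function\<close>

definition conv :: "('b::euclidean_space \<Rightarrow> real) \<Rightarrow> ('b \<Rightarrow> real) \<Rightarrow> 'b \<Rightarrow> real" where
  "conv \<kappa> h z = (LINT y|lebesgue. \<kappa> (z - y) * h y)"

lemma continuous_reflect:
  fixes \<kappa> :: "'b::euclidean_space \<Rightarrow> real"
  assumes "continuous_on UNIV \<kappa>"
  shows "continuous_on UNIV (\<lambda>y. \<kappa> (z - y))"
proof -
  have "continuous_on UNIV (\<lambda>y. z - y)" by (intro continuous_intros)
  from continuous_on_compose2[OF assms this] show ?thesis by simp
qed

lemma conv_integrand_integrable:
  assumes "test_function S \<kappa>" and "integrable lebesgue h"
  shows "integrable lebesgue (\<lambda>y. \<kappa> (z - y) * h y)"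
proof -
  obtain B where B: "0 \<le> B" "\<And>z. \<bar>\<kappa> z\<bar> \<le> B" by (rule test_function_bounded[OF assms(1)]) (rule that)
  have \<kappa>: "continuous_on UNIV \<kappa>"
    using assms(1) unfolding test_function_def by (intro smooth_continuous) blast
  show ?thesis
    by (rule bounded_mult_integrable[OF assms(2) continuous_lebesgue_measurable[OF continuous_reflect[OF \<kappa>]]])
      (rule B(2))
qed

text \<open>Differentiation under the integral sign. The remainder of the first-order expansion of
  the kernel, divided by the increment, tends to zero pointwise and is bounded by
  \<open>2 L\<close>, so dominated convergence with \<open>2 L |h|\<close> applies along every
  sequence of increments.\<close>

lemma conv_has_derivative:
  fixes h :: "'b::euclidean_space \<Rightarrow> real"
  assumes \<kappa>: "test_function S \<kappa>" and h: "integrable lebesgue h"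
  shows "(conv \<kappa> h has_derivative (\<lambda>v. conv (ddir v \<kappa>) h z)) (at z)"
proof -
  have sm: "smooth \<kappa>" using \<kappa> by (simp add: test_function_def)
  obtain L where L: "0 \<le> L" "\<And>v z. \<bar>ddir v \<kappa> z\<bar> \<le> L * norm v"
    "\<And>x y. \<bar>\<kappa> x - \<kappa> y\<bar> \<le> L * norm (x - y)"
    by (rule test_function_lipschitz[OF \<kappa>]) (rule that)
  have int1: "integrable lebesgue (\<lambda>y. ddir v \<kappa> (z - y) * h y)" for v z
    by (rule conv_integrand_integrable[OF test_function_ddir[OF \<kappa>] h])
  have int0: "integrable lebesgue (\<lambda>y. \<kappa> (z - y) * h y)" for z
    by (rule conv_integrand_integrable[OF \<kappa> h])
  have lin: "linear (\<lambda>v. ddir v \<kappa> z)" for z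
    using has_derivative_ddir[OF smooth_differentiable[OF sm]] has_derivative_linear by blast
  have "bounded_linear (\<lambda>v. conv (ddir v \<kappa>) h z)"
  proof (rule bounded_linear_intro)
    show "conv (ddir (x + y) \<kappa>) h z = conv (ddir x \<kappa>) h z + conv (ddir y \<kappa>) h z" for x y
      unfolding conv_def using int1
      by (subst Bochner_Integration.integral_add[symmetric])
        (auto simp: linear_add[OF lin] algebra_simps)
    show "conv (ddir (r *\<^sub>R x) \<kappa>) h z = r *\<^sub>R conv (ddir x \<kappa>) h z" for r x
      unfolding conv_def using linear_cmul[OF lin] by (simp add: mult.assoc)
    show "norm (conv (ddir x \<kappa>) h z) \<le> norm x * (L * (LINT y|lebesgue. \<bar>h y\<bar>))" for x
    proof -
      have "norm (conv (ddir x \<kappa>) h z) \<le> (LINT y|lebesgue. (L * norm x) * \<bar>h y\<bar>)"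
        unfolding conv_def using h int1 L(2)
        by (intro Bochner_Integration.integral_norm_bound_integral)
          (auto simp: abs_mult intro!: mult_right_mono)
      then show ?thesis by (simp add: mult_ac)
    qed
  qed
  moreover have "(\<lambda>v. norm (conv \<kappa> h (z + v) - conv \<kappa> h z - conv (ddir v \<kappa>) h z) / norm v) \<midarrow>0\<rightarrow> 0"
    unfolding tendsto_at_iff_sequentially
  proof (intro allI impI)
    fix V :: "nat \<Rightarrow> 'b" assume "\<forall>i. V i \<in> UNIV - {0}" and V0: "V \<longlonglongrightarrow> 0"
    then have nz: "V i \<noteq> 0" for i by auto
    define R where "R i y = (\<kappa> (z + V i - y) - \<kappa> (z - y) - ddir (V i) \<kappa> (z - y)) / norm (V i)" for i y
    have Rint: "(LINT y|lebesgue. R i y * h y) =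
        (conv \<kappa> h (z + V i) - conv \<kappa> h z - conv (ddir (V i) \<kappa>) h z) / norm (V i)" for i
    proof -
      have "(LINT y|lebesgue. R i y * h y) = (LINT y|lebesgue.
          (\<kappa> (z + V i - y) * h y - \<kappa> (z - y) * h y - ddir (V i) \<kappa> (z - y) * h y) / norm (V i))"
        by (intro Bochner_Integration.integral_cong) (auto simp: R_def field_simps)
      also have "\<dots> = (conv \<kappa> h (z + V i) - conv \<kappa> h z - conv (ddir (V i) \<kappa>) h z) / norm (V i)"
        unfolding conv_def integral_divide_zero using int0 int1 by simp
      finally show ?thesis .
    qed
    have lim: "(\<lambda>i. R i y * h y) \<longlonglongrightarrow> 0 * h y" for y
    proof (intro tendsto_mult_right)
      have "(\<lambda>v. norm (\<kappa> (z - y + v) - \<kappa> (z - y) - ddir v \<kappa> (z - y)) / norm v) \<midarrow>0\<rightarrow> 0"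
        using has_derivative_ddir[OF smooth_differentiable[OF sm], of "z - y"]
        unfolding has_derivative_at by blast
      moreover have "filterlim V (at 0) sequentially"
        using V0 nz by (simp add: filterlim_at)
      ultimately have "(\<lambda>i. norm (\<kappa> (z - y + V i) - \<kappa> (z - y) - ddir (V i) \<kappa> (z - y)) / norm (V i)) \<longlonglongrightarrow> 0"
        by (rule filterlim_compose)
      then have "(\<lambda>i. norm (R i y)) \<longlonglongrightarrow> 0"
        by (simp add: R_def algebra_simps)
      then show "(\<lambda>i. R i y) \<longlonglongrightarrow> 0" by (rule tendsto_norm_zero_cancel)
    qed
    have bound: "norm (R i y * h y) \<le> 2 * L * \<bar>h y\<bar>" for i y
    proof -
      have "\<bar>\<kappa> (z + V i - y) - \<kappa> (z - y) - ddir (V i) \<kappa> (z - y)\<bar> \<le> 2 * L * norm (V i)"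
        using L(3)[of "z + V i - y" "z - y"] L(2)[where v = "V i" and z = "z - y"] by (simp add: algebra_simps)
      then have "\<bar>R i y\<bar> \<le> 2 * L"
        using nz[of i] by (simp add: R_def divide_le_eq)
      then show ?thesis by (simp add: abs_mult mult_right_mono)
    qed
    have ri: "integrable lebesgue (\<lambda>y. R i y * h y)" for i
    proof -
      have "(\<lambda>y. R i y * h y) =
        (\<lambda>y. (\<kappa> (z + V i - y) * h y - \<kappa> (z - y) * h y - ddir (V i) \<kappa> (z - y) * h y) / norm (V i))"
        by (auto simp: R_def field_simps)
      then show ?thesis using int0 int1 by simp
    qed
    have "(\<lambda>i. LINT y|lebesgue. R i y * h y) \<longlonglongrightarrow> (LINT y|lebesgue. 0 * h y)"
      by (rule integral_dominated_convergence[where w="\<lambda>y. 2 * L * \<bar>h y\<bar>"])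
        (use lim bound h ri in \<open>auto dest: borel_measurable_integrable\<close>)
    then have "(\<lambda>i. norm ((conv \<kappa> h (z + V i) - conv \<kappa> h z - conv (ddir (V i) \<kappa>) h z) / norm (V i))) \<longlonglongrightarrow> 0"
      unfolding Rint by (intro tendsto_norm_zero) simp
    then show "((\<lambda>v. norm (conv \<kappa> h (z + v) - conv \<kappa> h z - conv (ddir v \<kappa>) h z) / norm v) \<circ> V) \<longlonglongrightarrow> 0"
      by (simp add: o_def)
  qed
  ultimately show ?thesis unfolding has_derivative_at by blast
qed

lemma ddir_conv:
  "test_function S \<kappa> \<Longrightarrow> integrable lebesgue h \<Longrightarrow> ddir v (conv \<kappa> h) z = conv (ddir v \<kappa>) h z"
  by (intro ddir_eq conv_has_derivative)

lemma smooth_conv: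
  assumes "test_function S \<kappa>" and "integrable lebesgue h"
  shows "smooth (conv \<kappa> h)"
proof (rule smooth_coinduct[where P="\<lambda>q. \<exists>\<kappa>. test_function S \<kappa> \<and> q = conv \<kappa> h"])
  show "\<exists>\<kappa>'. test_function S \<kappa>' \<and> conv \<kappa> h = conv \<kappa>' h" using assms(1) by blast
  show "q differentiable (at z)" if "\<exists>\<kappa>. test_function S \<kappa> \<and> q = conv \<kappa> h" for q z
    using that conv_has_derivative[OF _ assms(2)] differentiableI by metis
  show "\<exists>\<kappa>. test_function S \<kappa> \<and> ddir v q = conv \<kappa> h" if "\<exists>\<kappa>. test_function S \<kappa> \<and> q = conv \<kappa> h" for q v
    using that ddir_conv[OF _ assms(2)] test_function_ddir by blast
qed

text \<open>The index \<open>Suc n\<close> keeps the radius \<open>1 / Suc n\<close> meaningful for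
  \<open>n = 0\<close>. Writing the bump in \<open>z \<bullet> z\<close> instead of
  \<open>norm z\<close> keeps it smooth at the origin.\<close>

definition moll_kernel :: "nat \<Rightarrow> 'b::euclidean_space \<Rightarrow> real" where
  "moll_kernel n z = exp_cutoff ((1 / real (Suc n))\<^sup>2 - z \<bullet> z) /
     (LINT y|lebesgue. exp_cutoff ((1 / real (Suc n))\<^sup>2 - (y::'b) \<bullet> y))"

abbreviation moll :: "nat \<Rightarrow> ('b::euclidean_space \<Rightarrow> real) \<Rightarrow> 'b \<Rightarrow> real" where
  "moll n \<equiv> conv (moll_kernel n)"

lemma
  fixes z :: "'b::euclidean_space"
  shows moll_kernel_test: "test_function UNIV (moll_kernel n :: 'b \<Rightarrow> real)"
  and moll_kernel_outside: "z \<notin> cball 0 (1 / real (Suc n)) \<Longrightarrow> moll_kernel n z = 0"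
  and moll_kernel_nonneg: "0 \<le> moll_kernel n z"
  and integral_moll_kernel: "(LINT z|lebesgue. moll_kernel n (z::'b)) = 1"
proof -
  define e where "e = 1 / real (Suc n)"
  define \<beta> where "\<beta> z = exp_cutoff (e\<^sup>2 - z \<bullet> z)" for z :: 'b
  have e: "e > 0" by (simp add: e_def)
  have out: "\<beta> z = 0" if "z \<notin> cball 0 e" for z :: 'b
  proof -
    have "e\<^sup>2 < (norm z)\<^sup>2" using that e by (simp add: power_strict_mono)
    then show ?thesis by (simp add: \<beta>_def exp_cutoff_def power2_norm_eq_inner)
  qed
  have pos: "\<beta> z > 0" if "z \<in> ball 0 e" for z :: 'b
  proof -
    have "(norm z)\<^sup>2 < e\<^sup>2" using that e by (simp add: power_strict_mono)
    then show ?thesis by (simp add: \<beta>_def exp_cutoff_pos_iff power2_norm_eq_inner)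
  qed
  have "smooth \<beta>" unfolding \<beta>_def by (rule smooth_ball_bump)
  then have t: "test_function UNIV \<beta>"
    by (rule test_functionI[of _ "cball 0 e"]) (use out in auto)
  have nn: "0 \<le> \<beta> z" for z :: 'b by (simp add: \<beta>_def exp_cutoff_ge_0)
  \<comment> \<open>A vanishing integral would make the nonnegative bump zero almost everywhere on a
    ball where it is positive.\<close>
  have "(LINT y|lebesgue. \<beta> y) \<noteq> 0"
  proof
    assume "(LINT y|lebesgue. \<beta> y) = 0"
    then have "AE y in lebesgue. \<beta> y = 0"
      using integral_nonneg_eq_0_iff_AE[OF test_function_integrable[OF t]] nn by simp
    then have "AE y in lebesgue. y \<notin> ball (0::'b) e"
    proof (rule AE_mp, intro AE_I2 impI)
      show "y \<notin> ball (0::'b) e" if "\<beta> y = 0" for y using pos[of y] that by fastforce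
    qed
    then have "ball (0::'b) e \<in> null_sets lebesgue"
      by (subst (asm) AE_iff_null_sets[symmetric]) auto
    then have "negligible (ball (0::'b) e)" by (simp add: negligible_iff_null_sets)
    then show False using e open_not_negligible[of "ball (0::'b) e"] by auto
  qed
  moreover have "(LINT y|lebesgue. \<beta> y) \<ge> 0" using nn by simp
  ultimately have I: "(LINT y|lebesgue. \<beta> y) > 0" by simp
  have k: "moll_kernel n = (\<lambda>z. \<beta> z * (1 / (LINT y|lebesgue. \<beta> y)))"
    by (auto simp: moll_kernel_def \<beta>_def e_def)
  have out': "moll_kernel n z = 0" if "z \<notin> cball 0 e" for z :: 'b
    using out[OF that] by (simp add: k)
  show "z \<notin> cball 0 (1 / real (Suc n)) \<Longrightarrow> moll_kernel n z = 0" for z :: 'b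
    using out' by (simp add: e_def)
  have "smooth \<beta>" using t by (simp add: test_function_def)
  then have "smooth (\<lambda>z. \<beta> z * (1 / (LINT y|lebesgue. \<beta> y)))"
    by (rule smooth_mult[OF _ smooth_const])
  then show "test_function UNIV (moll_kernel n :: 'b \<Rightarrow> real)"
    by (intro test_functionI[of _ "cball 0 e"] out') (auto simp: k)
  show "0 \<le> moll_kernel n z" for z :: 'b
    using I nn[of z] by (simp add: k)
  show "(LINT z|lebesgue. moll_kernel n (z::'b)) = 1"
    using I by (simp add: k)
qed

lemma conv_AE_cong:
  assumes "AE y in lebesgue. h y = h' y" and "continuous_on UNIV \<kappa>"
    and "h \<in> borel_measurable lebesgue" and "h' \<in> borel_measurable lebesgue"
  shows "conv \<kappa> h = conv \<kappa> h'"
proof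
  fix z
  have [measurable]: "(\<lambda>y. \<kappa> (z - y)) \<in> borel_measurable lebesgue"
    by (rule continuous_lebesgue_measurable[OF continuous_reflect[OF assms(2)]])
  show "conv \<kappa> h z = conv \<kappa> h' z"
    unfolding conv_def by (rule integral_cong_AE) (use assms in auto)
qed

lemma borel_representative:
  fixes h :: "'b::euclidean_space \<Rightarrow> real"
  assumes "h \<in> borel_measurable lebesgue"
  obtains h' where "h' \<in> borel_measurable borel" "AE z in lebesgue. h z = h' z"
proof -
  obtain h' where "h' \<in> borel_measurable lborel" "AE z in lborel. h z = h' z"
    using completion_ex_borel_measurable_real[OF assms] by blast
  then show ?thesis using that[of h'] AE_completion by auto
qed

lemma conv_diff:
  assumes "test_function S \<kappa>" "integrable lebesgue h" "integrable lebesgue h'"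
  shows "conv \<kappa> (\<lambda>y. h y - h' y) z = conv \<kappa> h z - conv \<kappa> h' z"
  unfolding conv_def
  by (subst Bochner_Integration.integral_diff[symmetric])
    (auto simp: right_diff_distrib intro!: conv_integrand_integrable assms)

lemma conv_cmult: "conv \<kappa> (\<lambda>y. c * h y) z = c * conv \<kappa> h z"
  unfolding conv_def by (simp flip: integral_mult_right_zero add: mult.left_commute)

lemma conv_add:
  assumes "test_function S \<kappa>" "integrable lebesgue h" "integrable lebesgue h'"
  shows "conv \<kappa> (\<lambda>y. h y + h' y) z = conv \<kappa> h z + conv \<kappa> h' z"
  unfolding conv_def
  by (subst Bochner_Integration.integral_add[symmetric])
    (auto simp: distrib_left intro!: conv_integrand_integrable assms)

text \<open>Fubini's theorem, applied to a Borel representative of \<open>h\<close> so that the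
  integrand is jointly Borel: for every fixed \<open>y\<close> the translated kernel integrates to 1
  in the outer variable.\<close>

lemma
  fixes h \<kappa> :: "'b::euclidean_space \<Rightarrow> real"
  assumes \<kappa>: "test_function UNIV \<kappa>" "\<And>z. 0 \<le> \<kappa> z" "(LINT z|lebesgue. \<kappa> z) = 1"
    and h: "integrable lebesgue h"
  shows integrable_conv: "integrable lebesgue (conv \<kappa> h)"
    and integral_conv: "(LINT z|lebesgue. conv \<kappa> h z) = (LINT z|lebesgue. h z)"
    and integral_abs_conv_le: "(LINT z|lebesgue. \<bar>conv \<kappa> h z\<bar>) \<le> (LINT z|lebesgue. \<bar>h z\<bar>)"
proof -
  have \<kappa>c: "continuous_on UNIV \<kappa>" using \<kappa>(1) smooth_continuous[of \<kappa>] by (simp add: test_function_def)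
  have [measurable]: "\<kappa> \<in> borel_measurable borel"
    by (rule borel_measurable_continuous_onI[OF \<kappa>c])
  obtain h' where h'[measurable]: "h' \<in> borel_measurable borel" and ae: "AE z in lebesgue. h z = h' z"
    using borel_representative h by blast
  have meas': "h' \<in> borel_measurable lebesgue" by (simp add: measurable_completion)
  have h'_int: "integrable lebesgue h'" using integrable_cong_AE[OF _ meas' ae] h by auto
  then have h'i: "integrable lborel h'" by (simp add: integrable_completion)
  have c: "conv \<kappa> h = conv \<kappa> h'"
    by (rule conv_AE_cong[OF ae \<kappa>c _ meas']) (use h in auto)
  have cb: "conv \<kappa> h' z = (LINT y|lborel. \<kappa> (z - y) * h' y)" for z
    unfolding conv_def by (subst integral_completion) auto
  have shift: "(LINT z|lborel. \<kappa> (z - y)) = 1" "integrable lborel (\<lambda>z. \<kappa> (z - y))" for y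
  proof -
    show "(LINT z|lborel. \<kappa> (z - y)) = 1"
      using integral_lebesgue_shift(1)[of \<kappa> "- y"] \<kappa>(3) by (simp add: integral_completion)
    have "integrable lebesgue (\<lambda>z. \<kappa> (z - y))"
      using integral_lebesgue_shift(2)[of \<kappa> "- y"] test_function_integrable[OF \<kappa>(1)] by simp
    then show "integrable lborel (\<lambda>z. \<kappa> (z - y))" by (simp add: integrable_completion)
  qed
  have F: "integrable (lborel \<Otimes>\<^sub>M lborel) (\<lambda>(y, z). \<kappa> (z - y) * h' y)"
  proof (rule lborel_pair.Fubini_integrable)
    have "(LINT z|lborel. norm (case (y, z) of (y, z) \<Rightarrow> \<kappa> (z - y) * h' y)) = \<bar>h' y\<bar>" for y
      using shift(1)[of y] \<kappa>(2) by (simp add: abs_mult)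
    then show "integrable lborel (\<lambda>y. LINT z|lborel. norm (case (y, z) of (y, z) \<Rightarrow> \<kappa> (z - y) * h' y))"
      using h'i by simp
    show "AE y in lborel. integrable lborel (\<lambda>z. case (y, z) of (y, z) \<Rightarrow> \<kappa> (z - y) * h' y)"
      using shift(2) by simp
  qed measurable
  have ci: "integrable lborel (conv \<kappa> h')"
    using lborel_pair.integrable_snd[OF F] unfolding cb .
  have cm: "conv \<kappa> h' \<in> borel_measurable borel" using ci by auto
  show "integrable lebesgue (conv \<kappa> h)" using ci cm by (simp add: c integrable_completion)
  have ih: "(LINT z|lebesgue. h z) = (LINT z|lborel. h' z)"
    using integral_cong_AE[OF _ meas' ae] h by (simp add: integral_completion)
  have iah: "(LINT z|lebesgue. \<bar>h z\<bar>) = (LINT z|lborel. \<bar>h' z\<bar>)"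
  proof -
    have "(LINT z|lebesgue. \<bar>h z\<bar>) = (LINT z|lebesgue. \<bar>h' z\<bar>)"
      by (rule integral_cong_AE) (use ae h meas' in auto)
    then show ?thesis by (simp add: integral_completion)
  qed
  have "(LINT z|lborel. conv \<kappa> h' z) = (LINT y|lborel. LINT z|lborel. \<kappa> (z - y) * h' y)"
    unfolding cb using lborel_pair.Fubini_integral[OF F] by simp
  also have "\<dots> = (LINT y|lborel. h' y)" using shift(1) by simp
  finally show "(LINT z|lebesgue. conv \<kappa> h z) = (LINT z|lebesgue. h z)"
    using cm by (simp add: c ih integral_completion)
  have Fa: "integrable (lborel \<Otimes>\<^sub>M lborel) (\<lambda>(y, z). \<kappa> (z - y) * \<bar>h' y\<bar>)"
    using integrable_norm[OF F] \<kappa>(2) by (simp add: case_prod_unfold abs_mult)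
  have "(LINT z|lborel. \<bar>conv \<kappa> h' z\<bar>) \<le> (LINT z|lborel. LINT y|lborel. \<kappa> (z - y) * \<bar>h' y\<bar>)"
  proof (rule integral_mono)
    show "integrable lborel (\<lambda>z. LINT y|lborel. \<kappa> (z - y) * \<bar>h' y\<bar>)"
      using lborel_pair.integrable_snd[OF Fa] .
    show "\<bar>conv \<kappa> h' z\<bar> \<le> (LINT y|lborel. \<kappa> (z - y) * \<bar>h' y\<bar>)" for z
      unfolding cb using integral_abs_bound[of lborel "\<lambda>y. \<kappa> (z - y) * h' y"] \<kappa>(2) by (simp add: abs_mult)
  qed (use ci in simp)
  also have "\<dots> = (LINT y|lborel. LINT z|lborel. \<kappa> (z - y) * \<bar>h' y\<bar>)"
    using lborel_pair.Fubini_integral[OF Fa] by simp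
  also have "\<dots> = (LINT y|lborel. \<bar>h' y\<bar>)" using shift(1) by simp
  finally show "(LINT z|lebesgue. \<bar>conv \<kappa> h z\<bar>) \<le> (LINT z|lebesgue. \<bar>h z\<bar>)"
    using cm by (simp add: c iah integral_completion)
qed

lemmas integrable_moll = integrable_conv[OF moll_kernel_test moll_kernel_nonneg integral_moll_kernel]
lemmas integral_moll = integral_conv[OF moll_kernel_test moll_kernel_nonneg integral_moll_kernel]
lemmas integral_abs_moll_le =
  integral_abs_conv_le[OF moll_kernel_test moll_kernel_nonneg integral_moll_kernel]

text \<open>The kernel depends on \<open>z\<close> only through \<open>z \<bullet> z\<close> and is
  therefore even, so the reflection reduces to a translation.\<close>

lemma integral_moll_kernel_shift:
  "integrable lebesgue (\<lambda>y. moll_kernel n (z - y))" "(LINT y|lebesgue. moll_kernel n (z - y)) = 1"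
proof -
  have s: "moll_kernel n (z - y) = moll_kernel n (y + (- z))" for y
    by (simp add: moll_kernel_def inner_diff_left inner_diff_right inner_commute algebra_simps)
  have m: "moll_kernel n \<in> borel_measurable borel"
    using moll_kernel_test[of n] smooth_continuous
    by (intro borel_measurable_continuous_onI) (auto simp: test_function_def)
  show "integrable lebesgue (\<lambda>y. moll_kernel n (z - y))"
    unfolding s integral_lebesgue_shift(2)[OF m] by (rule test_function_integrable[OF moll_kernel_test])
  show "(LINT y|lebesgue. moll_kernel n (z - y)) = 1"
    unfolding s integral_lebesgue_shift(1)[OF m] by (rule integral_moll_kernel)
qed

section \<open>Convergence of mollifications in L1\<close>

definition moll_converges :: "('b::euclidean_space \<Rightarrow> real) \<Rightarrow> bool" where
  "moll_converges h \<longleftrightarrow> (\<lambda>n. LINT z|lebesgue. \<bar>moll n h z - h z\<bar>) \<longlonglongrightarrow> 0"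

text \<open>Three-epsilon argument: mollification does not increase the \<open>L^1\<close> norm, so
  the class of functions with convergent mollifications is closed in \<open>L^1\<close>.\<close>

lemma moll_converges_approx:
  fixes h :: "'b::euclidean_space \<Rightarrow> real"
  assumes h: "integrable lebesgue h"
    and a: "\<And>e. e > 0 \<Longrightarrow> \<exists>h'. integrable lebesgue h' \<and> moll_converges h' \<and> (LINT z|lebesgue. \<bar>h z - h' z\<bar>) < e"
  shows "moll_converges h"
  unfolding moll_converges_def
proof (rule LIMSEQ_I)
  fix e :: real assume "e > 0"
  then obtain h' where h': "integrable lebesgue h'" "moll_converges h'"
    and close: "(LINT z|lebesgue. \<bar>h z - h' z\<bar>) < e / 3"
    using a[of "e / 3"] by auto
  obtain N where N: "\<And>n. n \<ge> N \<Longrightarrow> (LINT z|lebesgue. \<bar>moll n h' z - h' z\<bar>) < e / 3"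
    using order_tendstoD(2)[of _ 0 sequentially "e / 3"] h'(2) \<open>e > 0\<close>
    unfolding moll_converges_def eventually_sequentially by auto
  show "\<exists>N. \<forall>n\<ge>N. norm ((LINT z|lebesgue. \<bar>moll n h z - h z\<bar>) - 0) < e"
  proof (intro exI allI impI)
    fix n assume "n \<ge> N"
    define d where "d z = h z - h' z" for z
    have d: "integrable lebesgue d" unfolding d_def using h h' by simp
    have md: "moll n h z - h z = moll n d z + (moll n h' z - h' z) - d z" for z
      unfolding d_def conv_diff[OF moll_kernel_test h h'(1)] by simp
    have "(LINT z|lebesgue. \<bar>moll n h z - h z\<bar>) \<le>
        (LINT z|lebesgue. \<bar>moll n d z\<bar> + \<bar>moll n h' z - h' z\<bar> + \<bar>d z\<bar>)"
    proof (rule integral_mono)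
      show "integrable lebesgue (\<lambda>z. \<bar>moll n h z - h z\<bar>)"
        "integrable lebesgue (\<lambda>z. \<bar>moll n d z\<bar> + \<bar>moll n h' z - h' z\<bar> + \<bar>d z\<bar>)"
        using integrable_moll[OF h] integrable_moll[OF d] integrable_moll[OF h'(1)] h d h' by simp_all
      show "\<bar>moll n h z - h z\<bar> \<le> \<bar>moll n d z\<bar> + \<bar>moll n h' z - h' z\<bar> + \<bar>d z\<bar>" for z
        unfolding md by linarith
    qed
    also have "\<dots> = (LINT z|lebesgue. \<bar>moll n d z\<bar>) + (LINT z|lebesgue. \<bar>moll n h' z - h' z\<bar>)
        + (LINT z|lebesgue. \<bar>d z\<bar>)"
      using integrable_moll[OF d] integrable_moll[OF h'(1)] h' d by simp
    also have "\<dots> < e / 3 + e / 3 + e / 3"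
      using integral_abs_moll_le[OF d, of n] N[OF \<open>n \<ge> N\<close>] close unfolding d_def by linarith
    finally show "norm ((LINT z|lebesgue. \<bar>moll n h z - h z\<bar>) - 0) < e" by simp
  qed
qed

text \<open>Since mollification preserves the integral, only the negative part of \<open>moll n 1\<^sub>U - 1\<^sub>U\<close> has to be
  controlled; it lives on \<open>U\<close>, where the mollification is eventually equal to \<open>1\<close>.\<close>

lemma moll_converges_open:
  fixes U :: "'b::euclidean_space set"
  assumes "open U" "U \<in> lmeasurable"
  shows "moll_converges (indicator U)"
proof -
  let ?h = "indicator U :: 'b \<Rightarrow> real"
  have h: "integrable lebesgue ?h" using assms by (simp add: lmeasurable_iff_integrable)
  define a where "a n z = ?h z - moll n ?h z" for n z
  have ai: "integrable lebesgue (a n)" for n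
    unfolding a_def using h integrable_moll[OF h] by simp
  have a0: "(LINT z|lebesgue. a n z) = 0" for n
    unfolding a_def using h integrable_moll[OF h] integral_moll[OF h] by simp
  have m0: "0 \<le> moll n ?h z" for n z
    unfolding conv_def by (intro Bochner_Integration.integral_nonneg) (simp add: moll_kernel_nonneg)
  have lim: "(\<lambda>n. max 0 (a n z)) \<longlonglongrightarrow> 0" for z
  proof (cases "z \<in> U")
    case True
    then obtain e where e: "e > 0" "cball z e \<subseteq> U" using assms(1) open_contains_cball by blast
    obtain N where N: "1 / real (Suc N) < e" using e(1) nat_approx_posE by blast
    have "max 0 (a n z) = 0" if "n \<ge> N" for n
    proof -
      have "1 / real (Suc n) \<le> 1 / real (Suc N)" using that by (simp add: frac_le)
      then have n: "1 / real (Suc n) < e" using N by linarith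
      have eq: "moll_kernel n (z - y) * ?h y = moll_kernel n (z - y)" for y
      proof (cases "y \<in> U")
        case False
        then have "e < dist z y" using e(2) by (meson mem_cball not_le subsetD)
        then have "moll_kernel n (z - y) = 0"
          using n by (intro moll_kernel_outside) (simp add: dist_norm norm_minus_commute[of y z])
        then show ?thesis by simp
      qed simp
      have "moll n ?h z = 1" unfolding conv_def eq by (rule integral_moll_kernel_shift(2))
      then show ?thesis using True by (simp add: a_def)
    qed
    then show ?thesis by (intro tendsto_eventually eventually_sequentiallyI[of N])
  next
    case False
    then have "max 0 (a n z) = 0" for n using m0[of n z] by (simp add: a_def)
    then show ?thesis by simp
  qed
  have "(\<lambda>n. LINT z|lebesgue. max 0 (a n z)) \<longlonglongrightarrow> (LINT z|(lebesgue :: 'b measure). (0::real))"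
  proof (rule integral_dominated_convergence[where w="?h"])
    show "(\<lambda>z. max 0 (a n z)) \<in> borel_measurable lebesgue" for n
      using borel_measurable_integrable[OF ai[of n]] by measurable
    show "AE z in lebesgue. norm (max 0 (a n z)) \<le> ?h z" for n
    proof (rule AE_I2)
      show "norm (max 0 (a n z)) \<le> ?h z" for z using m0[of n z] by (simp add: a_def)
    qed
  qed (use lim h in simp_all)
  then have "(\<lambda>n. 2 * (LINT z|lebesgue. max 0 (a n z))) \<longlonglongrightarrow> 2 * 0"
    by (intro tendsto_mult tendsto_const) simp
  moreover have "(LINT z|lebesgue. \<bar>moll n ?h z - ?h z\<bar>) = 2 * (LINT z|lebesgue. max 0 (a n z))" for n
  proof -
    \<comment> \<open>Pointwise \<open>|a| = 2 max(0, a) - a\<close>, and \<open>a\<close> has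
      integral zero.\<close>
    have "(LINT z|lebesgue. \<bar>moll n ?h z - ?h z\<bar>) = (LINT z|lebesgue. 2 * max 0 (a n z) - a n z)"
      by (intro Bochner_Integration.integral_cong) (auto simp: a_def max_def)
    also have "\<dots> = 2 * (LINT z|lebesgue. max 0 (a n z))"
      using ai a0 by (subst Bochner_Integration.integral_diff) auto
    finally show ?thesis .
  qed
  ultimately show ?thesis by (simp add: moll_converges_def)
qed

lemma moll_converges_cmult:
  assumes "moll_converges h"
  shows "moll_converges (\<lambda>z. c * h z)"
proof -
  have "(\<lambda>n. \<bar>c\<bar> * (LINT z|lebesgue. \<bar>moll n h z - h z\<bar>)) \<longlonglongrightarrow> \<bar>c\<bar> * 0"
    using assms unfolding moll_converges_def by (intro tendsto_mult tendsto_const)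
  moreover have "\<bar>moll n (\<lambda>z. c * h z) z - c * h z\<bar> = \<bar>c\<bar> * \<bar>moll n h z - h z\<bar>" for n z
    unfolding conv_cmult by (simp add: abs_mult flip: right_diff_distrib)
  ultimately show ?thesis by (simp add: moll_converges_def)
qed

text \<open>Density argument along \<open>integrable_induct\<close>: outer regularity passes from
  open sets to measurable sets of finite measure, and the approximation lemma handles the final
  limit of simple functions.\<close>

theorem moll_L1_convergence:
  fixes h :: "'b::euclidean_space \<Rightarrow> real"
  assumes "integrable lebesgue h"
  shows "(\<lambda>n. LINT z|lebesgue. \<bar>moll n h z - h z\<bar>) \<longlonglongrightarrow> 0"
proof -
  have "moll_converges h" using assms
  proof (induction rule: integrable_induct)
    case (base A c)
    have A: "A \<in> lmeasurable" using base by (auto simp: fmeasurable_def)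
    have iA: "integrable lebesgue (indicator A :: 'b \<Rightarrow> real)" using A by (simp add: lmeasurable_iff_integrable)
    have "moll_converges (indicator A :: 'b \<Rightarrow> real)"
    proof (rule moll_converges_approx[OF iA])
      fix e :: real assume "e > 0"
      then obtain T where T: "open T" "A \<subseteq> T" "(T - A) \<in> lmeasurable" "emeasure lebesgue (T - A) < ennreal e"
        using sets_lebesgue_outer_open[OF base(1)] by blast
      have Tm: "T \<in> lmeasurable"
        using fmeasurable.Un[OF A T(3)] T(2) by (simp add: Un_absorb1)
      have "(LINT z|lebesgue. \<bar>indicator A z - indicator T z :: real\<bar>) = (LINT z|lebesgue. indicator (T - A) z)"
        using T(2) by (intro Bochner_Integration.integral_cong) (auto simp: indicator_def)
      also have "\<dots> < e"
        using T(3,4) \<open>e > 0\<close> by (simp add: emeasure_eq_measure2 ennreal_less_iff)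
      finally show "\<exists>h'. integrable lebesgue h' \<and> moll_converges h' \<and>
          (LINT z|lebesgue. \<bar>indicator A z - h' z\<bar>) < e"
        using moll_converges_open[OF T(1) Tm] Tm by (auto simp: lmeasurable_iff_integrable)
    qed
    from moll_converges_cmult[OF this, of c] show ?case by (simp add: mult.commute)
  next
    case (add f g)
    have lim: "(\<lambda>n. (LINT z|lebesgue. \<bar>moll n f z - f z\<bar>) + (LINT z|lebesgue. \<bar>moll n g z - g z\<bar>)) \<longlonglongrightarrow> 0 + 0"
      using add.IH unfolding moll_converges_def by (intro tendsto_add)
    have le: "(LINT z|lebesgue. \<bar>moll n (\<lambda>x. f x + g x) z - (f z + g z)\<bar>) \<le>
      (LINT z|lebesgue. \<bar>moll n f z - f z\<bar>) + (LINT z|lebesgue. \<bar>moll n g z - g z\<bar>)" for n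
    proof -
      note i = integrable_moll[OF add.hyps(1)] integrable_moll[OF add.hyps(2)] add.hyps
      show ?thesis
      proof -
        have "(LINT z|lebesgue. \<bar>moll n f z + moll n g z - (f z + g z)\<bar>) \<le>
          (LINT z|lebesgue. \<bar>moll n f z - f z\<bar> + \<bar>moll n g z - g z\<bar>)"
          using i by (intro integral_mono) auto
        also have "\<dots> = (LINT z|lebesgue. \<bar>moll n f z - f z\<bar>) + (LINT z|lebesgue. \<bar>moll n g z - g z\<bar>)"
          using i by (intro Bochner_Integration.integral_add) auto
        finally show ?thesis unfolding conv_add[OF moll_kernel_test add.hyps] .
      qed
    qed
    show ?case unfolding moll_converges_def
    proof (rule Lim_null_comparison)
      show "\<forall>\<^sub>F n in sequentially. norm (LINT z|lebesgue. \<bar>moll n (\<lambda>x. f x + g x) z - (f z + g z)\<bar>) \<le>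
        (LINT z|lebesgue. \<bar>moll n f z - f z\<bar>) + (LINT z|lebesgue. \<bar>moll n g z - g z\<bar>)"
        using le by simp
    qed (use lim in simp)
  next
    case (lim f s)
    show ?case
    proof (rule moll_converges_approx[OF lim.hyps(4)])
      fix e :: real assume "e > 0"
      have "(\<lambda>i. LINT z|lebesgue. \<bar>f z - s i z\<bar>) \<longlonglongrightarrow> (LINT z|(lebesgue :: 'b measure). (0::real))"
      proof (rule integral_dominated_convergence[where w="\<lambda>z. 3 * \<bar>f z\<bar>"])
        show "AE z in lebesgue. (\<lambda>i. \<bar>f z - s i z\<bar>) \<longlonglongrightarrow> 0"
          (is "AE z in _. ?B z")
        proof (rule AE_I2)
          fix z :: 'b
          have "(\<lambda>i. \<bar>f z - s i z\<bar>) \<longlonglongrightarrow> \<bar>f z - f z\<bar>"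
            using lim.hyps(2)[of z] by (intro tendsto_intros) auto
          then show "?B z" by simp
        qed
        show "AE z in lebesgue. norm \<bar>f z - s i z\<bar> \<le> 3 * \<bar>f z\<bar>"
          (is "AE z in _. ?B z") for i
        proof (rule AE_I2)
          fix z :: 'b
          have "\<bar>s i z\<bar> \<le> 2 * \<bar>f z\<bar>" using lim.hyps(3)[of z i] by simp
          then show "?B z" by simp
        qed
      qed (use lim.hyps in auto)
      then have "(\<lambda>i. LINT z|lebesgue. \<bar>f z - s i z\<bar>) \<longlonglongrightarrow> 0" by simp
      from order_tendstoD(2)[OF this \<open>e > 0\<close>]
      obtain i where "(LINT z|lebesgue. \<bar>f z - s i z\<bar>) < e"
        unfolding eventually_sequentially by blast
      then show "\<exists>h'. integrable lebesgue h' \<and> moll_converges h' \<and> (LINT z|lebesgue. \<bar>f z - h' z\<bar>) < e"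
        using lim.hyps(1) lim.IH by blast
    qed
  qed
  then show ?thesis by (simp add: moll_converges_def)
qed

text \<open>Thinning the sequence once for each function yields one subsequence that serves all of
  them. The chain rule needs this, since a function and its derivative must converge
  together.\<close>

lemma moll_AE_subseq:
  fixes F :: "('b::euclidean_space \<Rightarrow> real) set"
  assumes "finite F" and "\<And>h. h \<in> F \<Longrightarrow> integrable lebesgue h"
  obtains r :: "nat \<Rightarrow> nat" where "strict_mono r"
    "\<And>h. h \<in> F \<Longrightarrow> AE z in lebesgue. (\<lambda>n. moll (r n) h z) \<longlonglongrightarrow> h z"
proof -
  have "\<exists>r::nat \<Rightarrow> nat. strict_mono r \<and> (\<forall>h\<in>F. AE z in lebesgue. (\<lambda>n. moll (r n) h z) \<longlonglongrightarrow> h z)"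
    using assms
  proof (induction rule: finite_induct)
    case empty
    have "strict_mono (id :: nat \<Rightarrow> nat)" by (simp add: strict_mono_def)
    then show ?case by blast
  next
    case (insert h F)
    then obtain r :: "nat \<Rightarrow> nat" where r: "strict_mono r"
      "\<forall>h\<in>F. AE z in lebesgue. (\<lambda>n. moll (r n) h z) \<longlonglongrightarrow> h z" by auto
    have h: "integrable lebesgue h" using insert by simp
    have "(\<lambda>n. LINT z|lebesgue. norm (moll (r n) h z - h z)) \<longlonglongrightarrow> 0"
      using LIMSEQ_subseq_LIMSEQ[OF moll_L1_convergence[OF h] r(1)] by (simp add: o_def)
    then obtain r' :: "nat \<Rightarrow> nat" where r': "strict_mono r'"
      "AE z in lebesgue. (\<lambda>n. moll (r (r' n)) h z - h z) \<longlonglongrightarrow> 0"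
      using tendsto_L1_AE_subseq[of lebesgue "\<lambda>n z. moll (r n) h z - h z"] integrable_moll[OF h] h by auto
    have "AE z in lebesgue. (\<lambda>n. moll ((r \<circ> r') n) h' z) \<longlonglongrightarrow> h' z" if "h' \<in> insert h F" for h'
    proof (cases "h' = h")
      case True
      then show ?thesis using r'(2) by (simp add: LIM_zero_iff)
    next
      case False
      then have "AE z in lebesgue. (\<lambda>n. moll (r n) h' z) \<longlonglongrightarrow> h' z" using r(2) that by auto
      then show ?thesis
      proof (rule AE_mp, intro AE_I2 impI)
        fix z assume "(\<lambda>n. moll (r n) h' z) \<longlonglongrightarrow> h' z"
        from LIMSEQ_subseq_LIMSEQ[OF this r'(1)]
        show "(\<lambda>n. moll ((r \<circ> r') n) h' z) \<longlonglongrightarrow> h' z" by (simp add: o_def)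
      qed
    qed
    moreover have "strict_mono (r \<circ> r')" using r(1) r'(1) by (rule strict_mono_o)
    ultimately show ?case by blast
  qed
  then show ?thesis using that by blast
qed

section \<open>Weak directional derivatives\<close>

lemma line_has_derivative:
  fixes h :: "'b::euclidean_space \<Rightarrow> real"
  assumes "h differentiable (at z)"
  shows "((\<lambda>s. h (z + s *\<^sub>R e)) has_real_derivative ddir e h z) (at 0)"
proof -
  have 1: "((\<lambda>s. z + s *\<^sub>R e) has_derivative (\<lambda>s. s *\<^sub>R e)) (at (0::real))"
    by (auto intro!: derivative_eq_intros)
  have "(h has_derivative (\<lambda>v. ddir v h z)) (at (z + 0 *\<^sub>R e))"
    using has_derivative_ddir[OF assms] by simp
  from has_derivative_compose[OF 1 this]
  have "((\<lambda>s. h (z + s *\<^sub>R e)) has_derivative (\<lambda>s. ddir (s *\<^sub>R e) h z)) (at 0)" by simp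
  moreover have "(\<lambda>s. ddir (s *\<^sub>R e) h z) = (*) (ddir e h z)"
    unfolding ddir_scale[OF assms] by (auto simp: mult.commute)
  ultimately show ?thesis
    unfolding has_field_derivative_def by simp
qed

text \<open>Translation invariance makes the integral of every difference quotient vanish, so no Fubini
  argument is needed.\<close>

lemma integral_line_derivative_eq_0:
  fixes h d :: "'b::euclidean_space \<Rightarrow> real"
  assumes cont: "continuous_on UNIV h" and K: "compact K" "\<And>z. z \<notin> K \<Longrightarrow> h z = 0"
    and lip: "\<And>z s. \<bar>s\<bar> \<le> 1 \<Longrightarrow> \<bar>h (z + s *\<^sub>R e) - h z\<bar> \<le> L * \<bar>s\<bar>"
    and d: "AE z in lebesgue. ((\<lambda>s. h (z + s *\<^sub>R e)) has_real_derivative d z) (at 0)"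
    and dm: "d \<in> borel_measurable lebesgue"
  shows "integrable lebesgue d" and "(LINT z|lebesgue. d z) = 0"
proof -
  define q where "q n z = (h (z + (1 / real (Suc n)) *\<^sub>R e) - h z) * real (Suc n)" for n z
  \<comment> \<open>\<open>K'\<close> contains every point from which a step of length at most
    \<open>norm e\<close> can reach \<open>K\<close>, so the quotients \<open>q n\<close> have a
    common compact support.\<close>
  define K' where "K' = (\<Union>x\<in>K. cball x (norm e))"
  have cK': "compact K'" unfolding K'_def by (rule compact_minkowski_sum_cball[OF K(1)])
  have hb: "h \<in> borel_measurable borel" by (rule borel_measurable_continuous_onI[OF cont])
  have hi: "integrable lebesgue h" by (rule compact_support_integrable[OF cont K])
  have shift: "integrable lebesgue (\<lambda>z. h (z + c))" "(LINT z|lebesgue. h (z + c)) = (LINT z|lebesgue. h z)" for c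
    using integral_lebesgue_shift[OF hb, of c] hi by auto
  have qi: "integrable lebesgue (q n)" for n
    unfolding q_def by (intro integrable_mult_left Bochner_Integration.integrable_diff shift(1) hi)
  have q0: "(LINT z|lebesgue. q n z) = 0" for n
    unfolding q_def using shift hi by simp
  have s1: "\<bar>1 / real (Suc n)\<bar> \<le> 1" for n by simp
  have qb: "\<bar>q n z\<bar> \<le> L * indicator K' z" for n z
  proof (cases "z \<in> K'")
    case True
    have "\<bar>q n z\<bar> = \<bar>h (z + (1 / real (Suc n)) *\<^sub>R e) - h z\<bar> * real (Suc n)"
      by (simp add: q_def abs_mult)
    also have "\<dots> \<le> (L * \<bar>1 / real (Suc n)\<bar>) * real (Suc n)"
      by (rule mult_right_mono[OF lip[OF s1]]) simp
    also have "\<dots> = L" by (simp add: field_simps)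
    finally show ?thesis using True by simp
  next
    case False
    have "z \<notin> K" using False by (force simp: K'_def)
    moreover have "z + (1 / real (Suc n)) *\<^sub>R e \<notin> K"
    proof
      assume a: "z + (1 / real (Suc n)) *\<^sub>R e \<in> K"
      have "dist (z + (1 / real (Suc n)) *\<^sub>R e) z = norm e / real (Suc n)" by (simp add: dist_norm)
      also have "\<dots> \<le> norm e" by (simp add: divide_le_eq mult_le_cancel_left1)
      finally show False using a False unfolding K'_def by auto
    qed
    ultimately show ?thesis using False K(2) by (simp add: q_def)
  qed
  have lim: "AE z in lebesgue. (\<lambda>n. q n z) \<longlonglongrightarrow> d z"
    using d
  proof (rule AE_mp, intro AE_I2 impI)
    fix z assume "((\<lambda>s. h (z + s *\<^sub>R e)) has_real_derivative d z) (at 0)"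
    then have "((\<lambda>s. (h (z + s *\<^sub>R e) - h z) / s) \<longlongrightarrow> d z) (at 0)"
      unfolding has_field_derivative_iff by simp
    moreover have "filterlim (\<lambda>n. 1 / real (Suc n)) (at 0) sequentially"
      unfolding filterlim_at using LIMSEQ_inverse_real_of_nat by (simp add: inverse_eq_divide)
    ultimately have "(\<lambda>n. (h (z + (1 / real (Suc n)) *\<^sub>R e) - h z) / (1 / real (Suc n))) \<longlonglongrightarrow> d z"
      by (rule filterlim_compose)
    then show "(\<lambda>n. q n z) \<longlonglongrightarrow> d z" by (simp add: q_def)
  qed
  have w: "integrable lebesgue (\<lambda>z. L * indicator K' z)"
    using lmeasurable_compact[OF cK'] by (simp add: lmeasurable_iff_integrable)
  have qm: "q n \<in> borel_measurable lebesgue" for n using qi by auto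
  have b: "AE z in lebesgue. norm (q n z) \<le> L * indicator K' z" for n using qb by simp
  show "integrable lebesgue d" by (rule integrable_dominated_convergence[OF dm qm w lim b])
  have "(\<lambda>n. LINT z|lebesgue. q n z) \<longlonglongrightarrow> (LINT z|lebesgue. d z)"
    by (rule integral_dominated_convergence[OF dm qm w lim b])
  then show "(LINT z|lebesgue. d z) = 0" unfolding q0 by (simp add: LIMSEQ_const_iff)
qed

lemma integral_ddir_test_function:
  assumes "test_function S h"
  shows "(LINT z|lebesgue. ddir e h z) = 0"
proof -
  from assms obtain K where K: "compact K" "\<And>z. z \<notin> K \<Longrightarrow> h z = 0" and h: "smooth h"
    unfolding test_function_def by blast
  obtain L where L: "0 \<le> L" "\<And>v z. \<bar>ddir v h z\<bar> \<le> L * norm v" "\<And>x y. \<bar>h x - h y\<bar> \<le> L * norm (x - y)"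
    by (rule test_function_lipschitz[OF assms]) (rule that)
  show ?thesis
  proof (rule integral_line_derivative_eq_0(2)[OF smooth_continuous[OF h] K])
    show "\<bar>h (z + s *\<^sub>R e) - h z\<bar> \<le> (L * norm e) * \<bar>s\<bar>" for z s
      using L(3)[of "z + s *\<^sub>R e" z] by (simp add: mult_ac)
    show "AE z in lebesgue. ((\<lambda>s. h (z + s *\<^sub>R e)) has_real_derivative ddir e h z) (at 0)"
      by (intro AE_I2 line_has_derivative smooth_differentiable[OF h])
    show "ddir e h \<in> borel_measurable lebesgue"
      by (rule continuous_lebesgue_measurable[OF smooth_continuous[OF smooth_ddir[OF h]]])
  qed auto
qed

text \<open>Truncation to a compact set turns local integrability into integrability on the whole
  space, where mollification is defined.\<close>

abbreviation rst :: "'b set \<Rightarrow> ('b \<Rightarrow> real) \<Rightarrow> 'b \<Rightarrow> real" where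
  "rst K h \<equiv> \<lambda>z. indicator K z * h z"

text \<open>A single notion for the components of the spatial gradient and for the time derivative;
  \<open>weak_deriv_t_iff\<close> and \<open>weak_grad_x_iff\<close> give the translation.\<close>

definition weak_ddir :: "'b::euclidean_space set \<Rightarrow> 'b \<Rightarrow> ('b \<Rightarrow> real) \<Rightarrow> ('b \<Rightarrow> real) \<Rightarrow> bool" where
  "weak_ddir S e w v \<longleftrightarrow> locally_L1 S w \<and> locally_L1 S v \<and>
     (\<forall>\<eta>. test_function S \<eta> \<longrightarrow>
        (LINT z:S|lebesgue. w z * ddir e \<eta> z) = - (LINT z:S|lebesgue. v z * \<eta> z))"

lemma locally_L1_rst:
  fixes h :: "'b::euclidean_space \<Rightarrow> real"
  shows "locally_L1 S h \<Longrightarrow> compact K \<Longrightarrow> K \<subseteq> S \<Longrightarrow> integrable lebesgue (rst K h)"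
  unfolding locally_L1_def set_integrable_def by simp

lemma locally_L1_I:
  fixes h :: "'b::euclidean_space \<Rightarrow> real"
  assumes "\<And>K. compact K \<Longrightarrow> K \<subseteq> S \<Longrightarrow> integrable lebesgue (rst K h)"
  shows "locally_L1 S h"
  unfolding locally_L1_def set_integrable_def using assms by simp

lemma set_integral_rst:
  fixes w \<phi> :: "'b::euclidean_space \<Rightarrow> real"
  assumes "K \<subseteq> S" and "\<And>z. z \<notin> K \<Longrightarrow> \<phi> z = 0"
  shows "(LINT z:S|lebesgue. w z * \<phi> z) = (LINT z|lebesgue. rst K w z * \<phi> z)"
  unfolding set_lebesgue_integral_def
  by (intro Bochner_Integration.integral_cong) (use assms in \<open>auto simp: indicator_def\<close>)

lemma abs_mult_mono: "\<bar>a\<bar> \<le> A \<Longrightarrow> \<bar>b\<bar> \<le> B \<Longrightarrow> \<bar>a * b\<bar> \<le> A * (B::real)"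
  unfolding abs_mult by (intro mult_mono) auto

text \<open>Completeness of Lebesgue measure: the part of a preimage inside the exceptional null set
  is measurable whatever it is.\<close>

lemma lebesgue_measurable_AE_cong:
  fixes h h' :: "'b::euclidean_space \<Rightarrow> real"
  assumes h: "h \<in> borel_measurable lebesgue" and ae: "AE z in lebesgue. h' z = h z"
  shows "h' \<in> borel_measurable lebesgue"
proof (rule measurableI)
  obtain N where N: "{z \<in> space lebesgue. \<not> (h' z = h z)} \<subseteq> N" "emeasure lebesgue N = 0" "N \<in> sets lebesgue"
    using ae by (rule AE_E) (rule that)
  then have Nn: "N \<in> null_sets lebesgue" by (simp add: null_sets_def)
  fix A :: "real set" assume A: "A \<in> sets borel"
  have 1: "h -` A \<in> sets lebesgue" using measurable_sets[OF h A] by simp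
  have 2: "h' -` A \<inter> N \<in> sets lebesgue"
    using null_sets_completion_subset[OF _ Nn, of "h' -` A \<inter> N"] by (simp add: null_sets_def)
  have "h' -` A \<inter> space lebesgue = (h -` A - N) \<union> (h' -` A \<inter> N)" using N(1) by auto
  moreover have "(h -` A - N) \<union> (h' -` A \<inter> N) \<in> sets lebesgue" by (intro sets.Un sets.Diff 1 2 N(3))
  ultimately show "h' -` A \<inter> space lebesgue \<in> sets lebesgue" by (simp only:)
qed simp

lemma continuous_rst_integrable:
  fixes h \<phi> :: "'b::euclidean_space \<Rightarrow> real"
  assumes h: "locally_L1 S h" and K: "compact K" "K \<subseteq> S"
    and \<phi>: "continuous_on UNIV \<phi>" "\<And>z. z \<notin> K \<Longrightarrow> \<phi> z = 0"
  shows "integrable lebesgue (\<lambda>z. rst K h z * \<phi> z)"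
proof -
  obtain B where B: "0 \<le> B" "\<And>z. \<bar>\<phi> z\<bar> \<le> B" by (rule compact_support_bounded[OF \<phi>(1) K(1)]) (rule \<phi>(2), assumption, rule that)
  from bounded_mult_integrable[OF locally_L1_rst[OF h K] continuous_lebesgue_measurable[OF \<phi>(1)] B(2)]
  show ?thesis by (simp add: mult.commute)
qed

lemma set_integral_diff_continuous:
  fixes h k \<phi> :: "'b::euclidean_space \<Rightarrow> real"
  assumes h: "locally_L1 S h" and k: "locally_L1 S k" and K: "compact K" "K \<subseteq> S"
    and \<phi>: "continuous_on UNIV \<phi>" "\<And>z. z \<notin> K \<Longrightarrow> \<phi> z = 0"
  shows "(LINT z:S|lebesgue. (h z - k z) * \<phi> z) = (LINT z:S|lebesgue. h z * \<phi> z) - (LINT z:S|lebesgue. k z * \<phi> z)"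
proof -
  have "(LINT z:S|lebesgue. (h z - k z) * \<phi> z) = (LINT z|lebesgue. rst K h z * \<phi> z - rst K k z * \<phi> z)"
    by (subst set_integral_rst[OF K(2) \<phi>(2)])
      (auto intro!: Bochner_Integration.integral_cong simp: algebra_simps)
  also have "\<dots> = (LINT z|lebesgue. rst K h z * \<phi> z) - (LINT z|lebesgue. rst K k z * \<phi> z)"
    by (intro Bochner_Integration.integral_diff continuous_rst_integrable[OF h K \<phi>] continuous_rst_integrable[OF k K \<phi>])
  also have "(LINT z|lebesgue. rst K h z * \<phi> z) = (LINT z:S|lebesgue. h z * \<phi> z)"
    by (rule set_integral_rst[OF K(2) \<phi>(2), symmetric])
  also have "(LINT z|lebesgue. rst K k z * \<phi> z) = (LINT z:S|lebesgue. k z * \<phi> z)"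
    by (rule set_integral_rst[OF K(2) \<phi>(2), symmetric])
  finally show ?thesis .
qed

lemma locally_L1_diff:
  fixes h k :: "'b::euclidean_space \<Rightarrow> real"
  assumes "locally_L1 S h" "locally_L1 S k"
  shows "locally_L1 S (\<lambda>z. h z - k z)"
proof (rule locally_L1_I)
  fix K assume K: "compact K" "K \<subseteq> S"
  have "rst K (\<lambda>z. h z - k z) = (\<lambda>z. rst K h z - rst K k z)" by (auto simp: algebra_simps)
  then show "integrable lebesgue (rst K (\<lambda>z. h z - k z))"
    using locally_L1_rst[OF assms(1) K] locally_L1_rst[OF assms(2) K] by simp
qed

lemma weak_ddir_diff:
  fixes w v w' v' :: "'b::euclidean_space \<Rightarrow> real"
  assumes "weak_ddir S e w v" "weak_ddir S e w' v'"
  shows "weak_ddir S e (\<lambda>z. w z - w' z) (\<lambda>z. v z - v' z)"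
  unfolding weak_ddir_def
proof (intro conjI allI impI)
  have l: "locally_L1 S w" "locally_L1 S v" "locally_L1 S w'" "locally_L1 S v'"
    using assms by (auto simp: weak_ddir_def)
  then show "locally_L1 S (\<lambda>z. w z - w' z)" "locally_L1 S (\<lambda>z. v z - v' z)" by (auto intro: locally_L1_diff)
  fix \<zeta> :: "'b \<Rightarrow> real" assume \<zeta>: "test_function S \<zeta>"
  then obtain K where K: "compact K" "K \<subseteq> S" "\<And>z. z \<notin> K \<Longrightarrow> \<zeta> z = 0" and sm: "smooth \<zeta>"
    unfolding test_function_def by blast
  have D0: "ddir e \<zeta> z = 0" if "z \<notin> K" for z
    by (rule ddir_outside_support[OF compact_imp_closed[OF K(1)] K(3) that])
  have 1: "(LINT z:S|lebesgue. (w z - w' z) * ddir e \<zeta> z) =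
      (LINT z:S|lebesgue. w z * ddir e \<zeta> z) - (LINT z:S|lebesgue. w' z * ddir e \<zeta> z)"
    by (rule set_integral_diff_continuous[OF l(1,3) K(1,2) smooth_continuous[OF smooth_ddir[OF sm]] D0])
  have 2: "(LINT z:S|lebesgue. (v z - v' z) * \<zeta> z) = (LINT z:S|lebesgue. v z * \<zeta> z) - (LINT z:S|lebesgue. v' z * \<zeta> z)"
    by (rule set_integral_diff_continuous[OF l(2,4) K(1,2) smooth_continuous[OF sm] K(3)])
  show "(LINT z:S|lebesgue. (w z - w' z) * ddir e \<zeta> z) = - (LINT z:S|lebesgue. (v z - v' z) * \<zeta> z)"
    unfolding 1 2 using assms \<zeta> by (simp add: weak_ddir_def)
qed

text \<open>The limit \<open>h\<close> comes without measurability; it is recovered from the almost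
  everywhere limit of the measurable truncations.\<close>

lemma rst_tendsto_integrable:
  fixes h :: "'b::euclidean_space \<Rightarrow> real" and hn :: "nat \<Rightarrow> 'b \<Rightarrow> real"
  assumes hn: "\<And>n. locally_L1 S (hn n)" and W: "locally_L1 S W"
    and bd: "\<And>n. AE z in lebesgue. z \<in> S \<longrightarrow> \<bar>hn n z\<bar> \<le> W z"
    and lim: "AE z in lebesgue. z \<in> S \<longrightarrow> (\<lambda>n. hn n z) \<longlonglongrightarrow> h z"
    and K: "compact K" "K \<subseteq> S"
  shows "integrable lebesgue (rst K h)"
proof (rule integrable_dominated_convergence)
  have m: "rst K (hn n) \<in> borel_measurable lebesgue" for n using locally_L1_rst[OF hn K] by simp
  show "rst K (hn n) \<in> borel_measurable lebesgue" for n by (rule m)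
  have "(\<lambda>z. lim (\<lambda>n. rst K (hn n) z)) \<in> borel_measurable lebesgue" by (rule borel_measurable_lim_metric[OF m])
  moreover have "AE z in lebesgue. rst K h z = lim (\<lambda>n. rst K (hn n) z)"
    using lim by eventually_elim (use K in \<open>auto intro!: limI[symmetric] tendsto_intros simp: indicator_def\<close>)
  ultimately show "rst K h \<in> borel_measurable lebesgue" by (rule lebesgue_measurable_AE_cong)
  show "integrable lebesgue (rst K W)" by (rule locally_L1_rst[OF W K])
  show "AE z in lebesgue. (\<lambda>n. rst K (hn n) z) \<longlonglongrightarrow> rst K h z"
    using lim by eventually_elim (use K in \<open>auto simp: indicator_def\<close>)
  show "AE z in lebesgue. norm (rst K (hn n) z) \<le> rst K W z" for n
    using bd[of n] by eventually_elim (use K in \<open>auto simp: indicator_def\<close>)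
qed

lemma locally_L1_limit:
  fixes h :: "'b::euclidean_space \<Rightarrow> real" and hn :: "nat \<Rightarrow> 'b \<Rightarrow> real"
  assumes "\<And>n. locally_L1 S (hn n)" "locally_L1 S W"
    and "\<And>n. AE z in lebesgue. z \<in> S \<longrightarrow> \<bar>hn n z\<bar> \<le> W z"
    and "AE z in lebesgue. z \<in> S \<longrightarrow> (\<lambda>n. hn n z) \<longlonglongrightarrow> h z"
  shows "locally_L1 S h"
  by (rule locally_L1_I) (rule rst_tendsto_integrable[OF assms])

lemma set_integral_limit:
  fixes h \<kappa> :: "'b::euclidean_space \<Rightarrow> real" and hn :: "nat \<Rightarrow> 'b \<Rightarrow> real"
  assumes hn: "\<And>n. locally_L1 S (hn n)" and W: "locally_L1 S W"
    and bd: "\<And>n. AE z in lebesgue. z \<in> S \<longrightarrow> \<bar>hn n z\<bar> \<le> W z"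
    and lim: "AE z in lebesgue. z \<in> S \<longrightarrow> (\<lambda>n. hn n z) \<longlonglongrightarrow> h z"
    and \<kappa>: "continuous_on UNIV \<kappa>" and K: "compact K" "K \<subseteq> S" "\<And>z. z \<notin> K \<Longrightarrow> \<kappa> z = 0"
  shows "(\<lambda>n. LINT z:S|lebesgue. hn n z * \<kappa> z) \<longlonglongrightarrow> (LINT z:S|lebesgue. h z * \<kappa> z)"
proof -
  obtain B where B: "0 \<le> B" "\<And>z. \<bar>\<kappa> z\<bar> \<le> B" by (rule compact_support_bounded[OF \<kappa> K(1)]) (rule K(3), assumption, rule that)
  have \<kappa>m: "\<kappa> \<in> borel_measurable lebesgue" by (rule continuous_lebesgue_measurable[OF \<kappa>])
  have ih: "integrable lebesgue (rst K h)" by (rule rst_tendsto_integrable[OF hn W bd lim K(1,2)])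
  have "(\<lambda>n. LINT z|lebesgue. rst K (hn n) z * \<kappa> z) \<longlonglongrightarrow> (LINT z|lebesgue. rst K h z * \<kappa> z)"
  proof (rule integral_dominated_convergence)
    show "(\<lambda>z. rst K h z * \<kappa> z) \<in> borel_measurable lebesgue" by (rule borel_measurable_times[OF borel_measurable_integrable[OF ih] \<kappa>m])
    show "(\<lambda>z. rst K (hn n) z * \<kappa> z) \<in> borel_measurable lebesgue" for n
      by (rule borel_measurable_times[OF borel_measurable_integrable[OF locally_L1_rst[OF hn K(1,2)]] \<kappa>m])
    show "integrable lebesgue (\<lambda>z. rst K W z * B)" using locally_L1_rst[OF W K(1,2)] by simp
    show "AE z in lebesgue. (\<lambda>n. rst K (hn n) z * \<kappa> z) \<longlonglongrightarrow> rst K h z * \<kappa> z"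
      using lim by eventually_elim (use K in \<open>auto simp: indicator_def intro!: tendsto_mult\<close>)
    show "AE z in lebesgue. norm (rst K (hn n) z * \<kappa> z) \<le> rst K W z * B" for n
      using bd[of n]
    proof eventually_elim
      case (elim z)
      show ?case
      proof (cases "z \<in> K")
        case True
        then have "\<bar>hn n z\<bar> \<le> W z" using elim K by blast
        then have "\<bar>hn n z * \<kappa> z\<bar> \<le> W z * B" by (rule abs_mult_mono) (rule B(2))
        then show ?thesis using True by simp
      qed simp
    qed
  qed
  then show ?thesis by (subst (1 2) set_integral_rst[OF K(2,3)])
qed

text \<open>For each fixed test function both sides of the defining identity pass to the limit by
  dominated convergence, the bounds \<open>W\<close> and \<open>Y\<close> being integrable on its
  support.\<close>

lemma weak_ddir_limit:
  fixes w v :: "'b::euclidean_space \<Rightarrow> real"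
  assumes wn: "\<And>n. weak_ddir S e (wn n) (vn n)" and W: "locally_L1 S W" "locally_L1 S Y"
    and w: "\<And>n. AE z in lebesgue. z \<in> S \<longrightarrow> \<bar>wn n z\<bar> \<le> W z"
      "AE z in lebesgue. z \<in> S \<longrightarrow> (\<lambda>n. wn n z) \<longlonglongrightarrow> w z"
    and v: "\<And>n. AE z in lebesgue. z \<in> S \<longrightarrow> \<bar>vn n z\<bar> \<le> Y z"
      "AE z in lebesgue. z \<in> S \<longrightarrow> (\<lambda>n. vn n z) \<longlonglongrightarrow> v z"
  shows "weak_ddir S e w v"
proof -
  have lw: "locally_L1 S (wn n)" and lv: "locally_L1 S (vn n)" for n using wn[of n] by (auto simp: weak_ddir_def)
  have "(LINT z:S|lebesgue. w z * ddir e \<eta> z) = - (LINT z:S|lebesgue. v z * \<eta> z)" if \<eta>: "test_function S \<eta>" for \<eta>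
  proof -
    obtain K where K: "compact K" "K \<subseteq> S" "\<And>z. z \<notin> K \<Longrightarrow> \<eta> z = 0" and \<eta>s: "smooth \<eta>"
      using \<eta> unfolding test_function_def by blast
    have D\<eta>0: "ddir e \<eta> z = 0" if "z \<notin> K" for z
      by (rule ddir_outside_support[OF compact_imp_closed[OF K(1)] K(3) that])
    have "(\<lambda>n. LINT z:S|lebesgue. wn n z * ddir e \<eta> z) \<longlonglongrightarrow> (LINT z:S|lebesgue. w z * ddir e \<eta> z)"
      by (rule set_integral_limit[OF lw W(1) w smooth_continuous[OF smooth_ddir[OF \<eta>s]] K(1,2) D\<eta>0])
    moreover have "(LINT z:S|lebesgue. wn n z * ddir e \<eta> z) = - (LINT z:S|lebesgue. vn n z * \<eta> z)" for n
      using wn[of n] \<eta> by (simp add: weak_ddir_def)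
    ultimately have "(\<lambda>n. - (LINT z:S|lebesgue. vn n z * \<eta> z)) \<longlonglongrightarrow> (LINT z:S|lebesgue. w z * ddir e \<eta> z)" by simp
    moreover have "(\<lambda>n. - (LINT z:S|lebesgue. vn n z * \<eta> z)) \<longlonglongrightarrow> - (LINT z:S|lebesgue. v z * \<eta> z)"
      by (intro tendsto_minus set_integral_limit[OF lv W(2) v smooth_continuous[OF \<eta>s] K])
    ultimately show ?thesis by (rule LIMSEQ_unique)
  qed
  moreover have "locally_L1 S w" by (rule locally_L1_limit[OF lw W(1) w])
  moreover have "locally_L1 S v" by (rule locally_L1_limit[OF lv W(2) v])
  ultimately show ?thesis by (simp add: weak_ddir_def)
qed

lemma locally_L1_abs:
  fixes h :: "'b::euclidean_space \<Rightarrow> real"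
  assumes "locally_L1 S h"
  shows "locally_L1 S (\<lambda>z. c * \<bar>h z\<bar>)"
proof (rule locally_L1_I)
  fix K assume K: "compact K" "K \<subseteq> S"
  have "rst K (\<lambda>z. c * \<bar>h z\<bar>) = (\<lambda>z. c * \<bar>rst K h z\<bar>)" by (auto simp: indicator_def)
  then show "integrable lebesgue (rst K (\<lambda>z. c * \<bar>h z\<bar>))" using locally_L1_rst[OF assms K] by simp
qed

section \<open>Chain rule, positive part and uniqueness for weak derivatives\<close>

lemma compact_enlarge:
  fixes K :: "'b::euclidean_space set"
  assumes "compact K" "open S" "K \<subseteq> S"
  obtains K' \<delta> where "compact K'" "K' \<subseteq> S" "0 < \<delta>" "\<And>z. z \<in> K \<Longrightarrow> cball z \<delta> \<subseteq> K'"
proof -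
  obtain \<delta> where "\<delta> > 0" "(\<Union>x\<in>K. cball x \<delta>) \<subseteq> S"
    using compact_subset_open_imp_cball_epsilon_subset[OF assms] by blast
  then show ?thesis using that[of "\<Union>x\<in>K. cball x \<delta>" \<delta>] compact_minkowski_sum_cball[OF assms(1)] by blast
qed

text \<open>As a function of \<open>y\<close>, the reflected kernel
  \<open>moll_kernel n (z - y)\<close> is a test function supported in the ball around
  \<open>z\<close>. The definition of the weak derivative applies to it, and the minus sign from the
  reflection cancels the one from integration by parts.\<close>

lemma ddir_moll_rst:
  assumes w: "weak_ddir S e w v" and K: "compact K" "K \<subseteq> S" and z: "cball z (1 / real (Suc n)) \<subseteq> K"
  shows "ddir e (moll n (rst K w)) z = moll n (rst K v) z"
proof -
  define \<eta> where "\<eta> y = moll_kernel n (z - y)" for y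
  have sm: "smooth (moll_kernel n :: 'a \<Rightarrow> real)" using moll_kernel_test[where 'b='a and n=n] by (simp add: test_function_def)
  have bl: "bounded_linear (uminus :: 'a \<Rightarrow> 'a)" by (rule bounded_linear_minus[OF bounded_linear_ident])
  have "smooth \<eta>"
    using smooth_compose_linear[OF bl sm, of z] unfolding \<eta>_def by simp
  moreover have out: "\<eta> y = 0" if "y \<notin> cball z (1 / real (Suc n))" for y
    unfolding \<eta>_def using that by (intro moll_kernel_outside) (simp add: dist_norm norm_minus_commute[of y z])
  ultimately have test: "test_function S \<eta>"
    using z K by (intro test_functionI[of _ "cball z (1 / real (Suc n))"]) auto
  have out': "\<eta> y = 0" if "y \<notin> K" for y using out that z by blast
  have d: "ddir e \<eta> y = - ddir e (moll_kernel n) (z - y)" for y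
  proof -
    have 1: "((\<lambda>y. z - y) has_derivative uminus) (at y)" by (auto intro!: derivative_eq_intros)
    have "(\<eta> has_derivative (\<lambda>v. ddir (- v) (moll_kernel n) (z - y))) (at y)"
      unfolding \<eta>_def by (rule has_derivative_compose[OF 1 has_derivative_ddir[OF smooth_differentiable[OF sm]]])
    then have "ddir e \<eta> y = ddir ((-1) *\<^sub>R e) (moll_kernel n) (z - y)" by (simp add: ddir_eq)
    also have "\<dots> = (-1) * ddir e (moll_kernel n) (z - y)" by (rule ddir_scale[OF smooth_differentiable[OF sm]])
    finally show ?thesis by simp
  qed
  have out'': "ddir e \<eta> y = 0" if "y \<notin> K" for y
    by (rule ddir_outside_support[OF compact_imp_closed[OF K(1)] out' that])
  have "ddir e (moll n (rst K w)) z = (LINT y|lebesgue. ddir e (moll_kernel n) (z - y) * rst K w y)"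
    using ddir_conv[OF moll_kernel_test locally_L1_rst[OF _ K]] w by (simp add: weak_ddir_def conv_def)
  also have "\<dots> = - (LINT y|lebesgue. rst K w y * ddir e \<eta> y)"
    unfolding d by (simp flip: Bochner_Integration.integral_minus add: mult.commute)
  also have "\<dots> = - (LINT z:S|lebesgue. w z * ddir e \<eta> z)"
    using set_integral_rst[OF K(2) out''] by simp
  also have "\<dots> = (LINT z:S|lebesgue. v z * \<eta> z)"
    using w test by (simp add: weak_ddir_def)
  also have "\<dots> = (LINT y|lebesgue. rst K v y * \<eta> y)"
    by (rule set_integral_rst[OF K(2) out'])
  also have "\<dots> = moll n (rst K v) z"
    unfolding conv_def \<eta>_def by (simp add: mult.commute)
  finally show ?thesis .
qed

text \<open>Dominated convergence with dominators that vary and converge in \<open>L^1\<close>. For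
  mollified derivatives no fixed integrable bound is at hand, but the mollifications themselves
  converge in \<open>L^1\<close>.\<close>

lemma integral_convergence_L1_dominator:
  fixes f g :: "'b \<Rightarrow> real"
  assumes fm: "f \<in> borel_measurable M" and sm: "\<And>n. s n \<in> borel_measurable M"
    and g: "integrable M g" "\<And>n. integrable M (G n)" and G: "(\<lambda>n. LINT z|M. \<bar>G n z - g z\<bar>) \<longlonglongrightarrow> 0"
    and lim: "AE z in M. (\<lambda>n. s n z) \<longlonglongrightarrow> f z"
    and bs: "\<And>n. AE z in M. \<bar>s n z\<bar> \<le> G n z" and bf: "AE z in M. \<bar>f z\<bar> \<le> g z"
  shows "(\<lambda>n. LINT z|M. s n z) \<longlonglongrightarrow> (LINT z|M. f z)"
proof -
  \<comment> \<open>Clipping at the limiting dominator \<open>g\<close> produces a sequence covered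
    by the classical theorem; what is clipped off is at most \<open>|G n - g|\<close>.\<close>
  define t where "t n z = max (- g z) (min (g z) (s n z))" for n z
  have gm: "g \<in> borel_measurable M" using g(1) by auto
  have tm: "t n \<in> borel_measurable M" for n unfolding t_def using gm sm by measurable
  have tlim: "AE z in M. (\<lambda>n. t n z) \<longlonglongrightarrow> f z"
    using lim bf
  proof eventually_elim
    case (elim z)
    have "(\<lambda>n. t n z) \<longlonglongrightarrow> max (- g z) (min (g z) (f z))"
      unfolding t_def by (intro tendsto_max tendsto_min tendsto_const elim(1))
    moreover have "max (- g z) (min (g z) (f z)) = f z" using elim(2) by linarith
    ultimately show ?case by simp
  qed
  have tb: "AE z in M. norm (t n z) \<le> g z" for n
    using bf by eventually_elim (unfold t_def real_norm_def, linarith)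
  have 1: "(\<lambda>n. LINT z|M. t n z) \<longlonglongrightarrow> (LINT z|M. f z)"
    by (rule integral_dominated_convergence[OF fm tm g(1) tlim tb])
  have ti: "integrable M (t n)" for n by (rule Bochner_Integration.integrable_bound[OF g(1) tm])
      (use tb[of n] in eventually_elim, auto)
  have si: "integrable M (s n)" for n by (rule Bochner_Integration.integrable_bound[OF g(2)[of n] sm])
      (use bs[of n] in eventually_elim, auto)
  have "\<bar>(LINT z|M. s n z) - (LINT z|M. t n z)\<bar> \<le> (LINT z|M. \<bar>G n z - g z\<bar>)" for n
  proof -
    have "\<bar>(LINT z|M. s n z) - (LINT z|M. t n z)\<bar> = \<bar>LINT z|M. s n z - t n z\<bar>"
      using ti si by simp
    also have "\<dots> \<le> (LINT z|M. \<bar>s n z - t n z\<bar>)" by (rule integral_abs_bound)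
    also have "\<dots> \<le> (LINT z|M. \<bar>G n z - g z\<bar>)"
    proof (rule integral_mono_AE)
      show "AE z in M. \<bar>s n z - t n z\<bar> \<le> \<bar>G n z - g z\<bar>"
        using bs[of n] bf by eventually_elim (simp add: t_def max_def min_def, linarith)
    qed (use ti si g in auto)
    finally show ?thesis .
  qed
  then have 2: "(\<lambda>n. (LINT z|M. s n z) - (LINT z|M. t n z)) \<longlonglongrightarrow> 0"
    by (intro Lim_null_comparison[OF _ G]) simp
  from tendsto_add[OF 1 2] show ?thesis by simp
qed

lemma moll_dominator_L1:
  fixes h :: "'b::euclidean_space \<Rightarrow> real"
  assumes h: "integrable lebesgue h" and r: "strict_mono (r :: nat \<Rightarrow> nat)"
  shows "(\<lambda>n. LINT z|lebesgue. \<bar>(c z + C * \<bar>moll (r n) h z\<bar>) - (c z + C * \<bar>h z\<bar>)\<bar>) \<longlonglongrightarrow> 0"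
proof -
  have "(\<lambda>n. \<bar>C\<bar> * (LINT z|lebesgue. \<bar>moll (r n) h z - h z\<bar>)) \<longlonglongrightarrow> \<bar>C\<bar> * 0"
    using LIMSEQ_subseq_LIMSEQ[OF moll_L1_convergence[OF h] r]
    by (intro tendsto_mult tendsto_const) (simp add: o_def)
  then have lim: "(\<lambda>n. \<bar>C\<bar> * (LINT z|lebesgue. \<bar>moll (r n) h z - h z\<bar>)) \<longlonglongrightarrow> 0" by simp
  have "(LINT z|lebesgue. \<bar>(c z + C * \<bar>moll (r n) h z\<bar>) - (c z + C * \<bar>h z\<bar>)\<bar>) \<le>
      \<bar>C\<bar> * (LINT z|lebesgue. \<bar>moll (r n) h z - h z\<bar>)" for n
  proof -
    note i = integrable_moll[OF h, of "r n"] h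
    have e: "\<bar>(c z + C * \<bar>moll (r n) h z\<bar>) - (c z + C * \<bar>h z\<bar>)\<bar> = \<bar>C\<bar> * \<bar>\<bar>moll (r n) h z\<bar> - \<bar>h z\<bar>\<bar>" for z
      by (simp add: abs_mult flip: right_diff_distrib)
    have "(LINT z|lebesgue. \<bar>C\<bar> * \<bar>\<bar>moll (r n) h z\<bar> - \<bar>h z\<bar>\<bar>) \<le> (LINT z|lebesgue. \<bar>C\<bar> * \<bar>moll (r n) h z - h z\<bar>)"
      using i by (intro integral_mono mult_left_mono abs_triangle_ineq3) auto
    then show ?thesis unfolding e by simp
  qed
  then show ?thesis by (intro Lim_null_comparison[OF _ lim]) simp
qed

lemma smooth_lipschitz:
  fixes \<theta> :: "real \<Rightarrow> real"
  assumes "smooth \<theta>" "\<And>x. \<bar>ddir 1 \<theta> x\<bar> \<le> L"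
  shows "\<bar>\<theta> x\<bar> \<le> \<bar>\<theta> 0\<bar> + L * \<bar>x\<bar>"
proof -
  have "norm (\<theta> x - \<theta> 0) \<le> L * norm (x - 0)"
    by (rule field_differentiable_bound[of UNIV \<theta> "ddir 1 \<theta>"])
      (use assms smooth_real_deriv[OF assms(1)] in auto)
  then show ?thesis by simp
qed

text \<open>Mollified functions obey the classical chain rule, and the derivative of their product
  with \<open>\<eta>\<close> integrates to zero. The two limits use varying dominators, because
  \<open>w\<close> and \<open>v\<close> are only locally integrable.\<close>

lemma weak_ddir_chain_integral:
  fixes \<eta> w v :: "'b::euclidean_space \<Rightarrow> real"
  assumes S: "open S" and w: "weak_ddir S e w v"
    and \<theta>: "smooth \<theta>" "\<And>x. \<bar>ddir 1 \<theta> x\<bar> \<le> L" and \<eta>: "test_function S \<eta>"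
  shows "(LINT z:S|lebesgue. \<theta> (w z) * ddir e \<eta> z) = - (LINT z:S|lebesgue. (ddir 1 \<theta> (w z) * v z) * \<eta> z)"
proof -
  obtain K where K: "compact K" "K \<subseteq> S" "\<And>z. z \<notin> K \<Longrightarrow> \<eta> z = 0" and \<eta>s: "smooth \<eta>"
    using \<eta> unfolding test_function_def by blast
  \<comment> \<open>The mollifier reaches outside the support \<open>K\<close> of
    \<open>\<eta>\<close>; the margin \<open>\<delta>\<close> keeps it inside \<open>K'\<close>,
    where \<open>w\<close> and \<open>v\<close> are not truncated.\<close>
  obtain K' \<delta> where K': "compact K'" "K' \<subseteq> S" "0 < \<delta>" "\<And>z. z \<in> K \<Longrightarrow> cball z \<delta> \<subseteq> K'"
    by (rule compact_enlarge[OF K(1) S K(2)]) (rule that)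
  have KK': "K \<subseteq> K'" using K'(3,4) by force
  have D\<eta>0: "ddir e \<eta> z = 0" if "z \<notin> K" for z
    by (rule ddir_outside_support[OF compact_imp_closed[OF K(1)] K(3) that])
  define w1 where "w1 = rst K' w"
  define v1 where "v1 = rst K' v"
  have wi: "integrable lebesgue w1" and vi: "integrable lebesgue v1"
    unfolding w1_def v1_def using w locally_L1_rst[OF _ K'(1,2)] by (auto simp: weak_ddir_def)
  obtain r :: "nat \<Rightarrow> nat" where r: "strict_mono r"
    "\<And>h. h \<in> {w1, v1} \<Longrightarrow> AE z in lebesgue. (\<lambda>n. moll (r n) h z) \<longlonglongrightarrow> h z"
    by (rule moll_AE_subseq[of "{w1, v1}"]) (use wi vi that in auto)
  define W where "W n = moll (r n) w1" for n
  define V where "V n = moll (r n) v1" for n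
  have Wi: "integrable lebesgue (W n)" and Vi: "integrable lebesgue (V n)" for n
    unfolding W_def V_def by (intro integrable_moll wi vi)+
  have Ws: "smooth (W n)" for n unfolding W_def by (rule smooth_conv[OF moll_kernel_test wi])
  have AEW: "AE z in lebesgue. (\<lambda>n. W n z) \<longlonglongrightarrow> w1 z" and AEV: "AE z in lebesgue. (\<lambda>n. V n z) \<longlonglongrightarrow> v1 z"
    using r(2) unfolding W_def V_def by auto
  have \<theta>'s: "smooth (ddir 1 \<theta>)" by (rule smooth_ddir[OF \<theta>(1)])
  have \<theta>m[measurable]: "\<theta> \<in> borel_measurable borel" and \<theta>'m[measurable]: "ddir 1 \<theta> \<in> borel_measurable borel"
    using smooth_continuous[OF \<theta>(1)] smooth_continuous[OF \<theta>'s] by (auto intro: borel_measurable_continuous_onI)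
  have \<theta>c: "isCont \<theta> x" "isCont (ddir 1 \<theta>) x" for x
    using smooth_continuous[OF \<theta>(1), of UNIV] smooth_continuous[OF \<theta>'s, of UNIV]
    by (auto simp: continuous_on_eq_continuous_at)
  have L0: "0 \<le> L" using \<theta>(2)[of 0] by linarith
  have \<theta>lip: "\<bar>\<theta> x\<bar> \<le> \<bar>\<theta> 0\<bar> + L * \<bar>x\<bar>" for x by (rule smooth_lipschitz[OF \<theta>])
  obtain B where B: "0 \<le> B" "\<And>z. \<bar>\<eta> z\<bar> \<le> B"
    by (rule test_function_bounded[OF \<eta>]) (rule that)
  obtain B' where B': "0 \<le> B'" "\<And>z. \<bar>ddir e \<eta> z\<bar> \<le> B'"
    by (rule test_function_bounded[OF test_function_ddir[OF \<eta>]]) (rule that)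
  have \<eta>m[measurable]: "\<eta> \<in> borel_measurable lebesgue" and D\<eta>m[measurable]: "ddir e \<eta> \<in> borel_measurable lebesgue"
    using test_function_integrable[OF \<eta>] test_function_integrable[OF test_function_ddir[OF \<eta>, of e]] by auto
  have wm[measurable]: "w1 \<in> borel_measurable lebesgue" "v1 \<in> borel_measurable lebesgue"
    "W n \<in> borel_measurable lebesgue" "V n \<in> borel_measurable lebesgue" for n
    using wi vi Wi Vi by auto
  have c\<eta>: "integrable lebesgue (\<lambda>z. \<bar>\<theta> 0\<bar> * \<bar>ddir e \<eta> z\<bar>)"
    using test_function_integrable[OF test_function_ddir[OF \<eta>]] by simp
  have L1: "(\<lambda>n. LINT z|lebesgue. \<theta> (W n z) * ddir e \<eta> z) \<longlonglongrightarrow> (LINT z|lebesgue. \<theta> (w1 z) * ddir e \<eta> z)"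
  proof (rule integral_convergence_L1_dominator[where g="\<lambda>z. \<bar>\<theta> 0\<bar> * \<bar>ddir e \<eta> z\<bar> + (B' * L) * \<bar>w1 z\<bar>"
        and G="\<lambda>n z. \<bar>\<theta> 0\<bar> * \<bar>ddir e \<eta> z\<bar> + (B' * L) * \<bar>W n z\<bar>"])
    have bd: "\<bar>\<theta> x * ddir e \<eta> z\<bar> \<le> \<bar>\<theta> 0\<bar> * \<bar>ddir e \<eta> z\<bar> + (B' * L) * \<bar>x\<bar>" for x z
    proof -
      have "\<bar>\<theta> x * ddir e \<eta> z\<bar> \<le> (\<bar>\<theta> 0\<bar> + L * \<bar>x\<bar>) * \<bar>ddir e \<eta> z\<bar>"
        unfolding abs_mult by (intro mult_right_mono \<theta>lip) simp
      also have "\<dots> \<le> \<bar>\<theta> 0\<bar> * \<bar>ddir e \<eta> z\<bar> + (B' * L) * \<bar>x\<bar>"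
        using mult_right_mono[OF B'(2)[of z], of "L * \<bar>x\<bar>"] L0 by (simp add: algebra_simps)
      finally show ?thesis .
    qed
    then show "AE z in lebesgue. \<bar>\<theta> (W n z) * ddir e \<eta> z\<bar> \<le> \<bar>\<theta> 0\<bar> * \<bar>ddir e \<eta> z\<bar> + (B' * L) * \<bar>W n z\<bar>"
      "AE z in lebesgue. \<bar>\<theta> (w1 z) * ddir e \<eta> z\<bar> \<le> \<bar>\<theta> 0\<bar> * \<bar>ddir e \<eta> z\<bar> + (B' * L) * \<bar>w1 z\<bar>" for n
      by simp_all
    show "AE z in lebesgue. (\<lambda>n. \<theta> (W n z) * ddir e \<eta> z) \<longlonglongrightarrow> \<theta> (w1 z) * ddir e \<eta> z"
      using AEW by eventually_elim (intro tendsto_mult_right isCont_tendsto_compose[OF \<theta>c(1)])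
    show "(\<lambda>n. LINT z|lebesgue. \<bar>(\<bar>\<theta> 0\<bar> * \<bar>ddir e \<eta> z\<bar> + (B' * L) * \<bar>W n z\<bar>) -
        (\<bar>\<theta> 0\<bar> * \<bar>ddir e \<eta> z\<bar> + (B' * L) * \<bar>w1 z\<bar>)\<bar>) \<longlonglongrightarrow> 0"
      unfolding W_def by (rule moll_dominator_L1[OF wi r(1)])
  qed (use c\<eta> wi Wi in simp_all)
  have L2: "(\<lambda>n. LINT z|lebesgue. (ddir 1 \<theta> (W n z) * V n z) * \<eta> z) \<longlonglongrightarrow>
      (LINT z|lebesgue. (ddir 1 \<theta> (w1 z) * v1 z) * \<eta> z)"
  proof (rule integral_convergence_L1_dominator[where g="\<lambda>z. 0 + (L * B) * \<bar>v1 z\<bar>"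
        and G="\<lambda>n z. 0 + (L * B) * \<bar>V n z\<bar>"])
    have bd: "\<bar>(ddir 1 \<theta> x * y) * \<eta> z\<bar> \<le> 0 + (L * B) * \<bar>y\<bar>" for x y z
    proof -
      have "\<bar>(ddir 1 \<theta> x * y) * \<eta> z\<bar> = (\<bar>ddir 1 \<theta> x\<bar> * \<bar>\<eta> z\<bar>) * \<bar>y\<bar>" by (simp add: abs_mult)
      also have "\<dots> \<le> (L * B) * \<bar>y\<bar>" by (intro mult_right_mono mult_mono \<theta>(2) B L0) auto
      finally show ?thesis by simp
    qed
    then show "AE z in lebesgue. \<bar>(ddir 1 \<theta> (W n z) * V n z) * \<eta> z\<bar> \<le> 0 + (L * B) * \<bar>V n z\<bar>"
      "AE z in lebesgue. \<bar>(ddir 1 \<theta> (w1 z) * v1 z) * \<eta> z\<bar> \<le> 0 + (L * B) * \<bar>v1 z\<bar>" for n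
      by simp_all
    show "AE z in lebesgue. (\<lambda>n. (ddir 1 \<theta> (W n z) * V n z) * \<eta> z) \<longlonglongrightarrow> (ddir 1 \<theta> (w1 z) * v1 z) * \<eta> z"
      using AEW AEV by eventually_elim (intro tendsto_mult tendsto_const isCont_tendsto_compose[OF \<theta>c(2)])
    show "(\<lambda>n. LINT z|lebesgue. \<bar>(0 + (L * B) * \<bar>V n z\<bar>) - (0 + (L * B) * \<bar>v1 z\<bar>)\<bar>) \<longlonglongrightarrow> 0"
      unfolding V_def by (rule moll_dominator_L1[OF vi r(1)])
  qed (use vi Vi in simp_all)
  obtain N where N: "1 / real (Suc N) < \<delta>" using K'(3) nat_approx_posE by blast
  have eq: "(LINT z|lebesgue. \<theta> (W n z) * ddir e \<eta> z) = - (LINT z|lebesgue. (ddir 1 \<theta> (W n z) * V n z) * \<eta> z)"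
    if n: "n \<ge> N" for n
  proof -
    have "N \<le> r n" using seq_suble[OF r(1), of n] n by simp
    then have "1 / real (Suc (r n)) \<le> 1 / real (Suc N)" by (simp add: frac_le)
    then have small: "1 / real (Suc (r n)) \<le> \<delta>" using N by simp
    have DW: "ddir e (W n) z = V n z" if "z \<in> K" for z
      unfolding W_def V_def w1_def v1_def
    proof (rule ddir_moll_rst[OF w K'(1,2)])
      show "cball z (1 / real (Suc (r n))) \<subseteq> K'"
        using K'(4)[OF that] subset_cball[OF small, of z] by blast
    qed
    define \<zeta> where "\<zeta> z = \<theta> (W n z) * \<eta> z" for z
    have sW: "smooth (\<lambda>z. \<theta> (W n z))" by (rule smooth_compose[OF \<theta>(1) Ws])
    have \<zeta>: "test_function UNIV \<zeta>" unfolding \<zeta>_def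
      by (rule test_functionI[OF smooth_mult[OF sW \<eta>s] K(1)]) (use K(3) in auto)
    have dz: "ddir e \<zeta> z = \<theta> (W n z) * ddir e \<eta> z + (ddir 1 \<theta> (W n z) * V n z) * \<eta> z" for z
    proof -
      have 1: "((\<lambda>z. \<theta> (W n z)) has_derivative (\<lambda>u. ddir 1 \<theta> (W n z) * ddir u (W n) z)) (at z)"
        using has_derivative_compose[OF has_derivative_ddir[OF smooth_differentiable[OF Ws]]
            smooth_real_deriv[OF \<theta>(1), unfolded has_field_derivative_def]] .
      have "ddir e \<zeta> z = \<theta> (W n z) * ddir e \<eta> z + (ddir 1 \<theta> (W n z) * ddir e (W n) z) * \<eta> z"
        unfolding \<zeta>_def
        by (rule ddir_eq[OF has_derivative_mult[OF 1 has_derivative_ddir[OF smooth_differentiable[OF \<eta>s]]]])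
      \<comment> \<open>\<open>DW\<close> is known only on \<open>K\<close>; elsewhere
        \<open>\<eta>\<close> is zero and the term drops out.\<close>
      then show ?thesis using DW[of z] K(3)[of z] by (cases "z \<in> K") auto
    qed
    have i1: "integrable lebesgue (\<lambda>z. (ddir 1 \<theta> (W n z) * V n z) * \<eta> z)"
    proof -
      have "integrable lebesgue (\<lambda>z. (ddir 1 \<theta> (W n z) * \<eta> z) * V n z)"
      proof (rule bounded_mult_integrable[OF Vi, where B = "L * B"])
        show "\<bar>ddir 1 \<theta> (W n z) * \<eta> z\<bar> \<le> L * B" for z
          unfolding abs_mult by (intro mult_mono \<theta>(2) B L0) auto
      qed measurable
      then show ?thesis by (simp add: mult_ac)
    qed
    have i2: "integrable lebesgue (ddir e \<zeta>)"
      by (rule test_function_integrable[OF test_function_ddir[OF \<zeta>]])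
    have "(LINT z|lebesgue. \<theta> (W n z) * ddir e \<eta> z) =
        (LINT z|lebesgue. ddir e \<zeta> z - (ddir 1 \<theta> (W n z) * V n z) * \<eta> z)"
      unfolding dz by simp
    also have "\<dots> = (LINT z|lebesgue. ddir e \<zeta> z) - (LINT z|lebesgue. (ddir 1 \<theta> (W n z) * V n z) * \<eta> z)"
      by (rule Bochner_Integration.integral_diff[OF i2 i1])
    finally show ?thesis using integral_ddir_test_function[OF \<zeta>, of e] by simp
  qed
  have "(\<lambda>n. LINT z|lebesgue. \<theta> (W n z) * ddir e \<eta> z) \<longlonglongrightarrow> - (LINT z|lebesgue. (ddir 1 \<theta> (w1 z) * v1 z) * \<eta> z)"
    by (rule Lim_transform_eventually[OF tendsto_minus[OF L2]])
      (rule eventually_sequentiallyI[of N], simp add: eq)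
  then have fin: "(LINT z|lebesgue. \<theta> (w1 z) * ddir e \<eta> z) = - (LINT z|lebesgue. (ddir 1 \<theta> (w1 z) * v1 z) * \<eta> z)"
    by (rule LIMSEQ_unique[OF L1])
  have "(LINT z:S|lebesgue. \<theta> (w z) * ddir e \<eta> z) = (LINT z|lebesgue. \<theta> (w1 z) * ddir e \<eta> z)"
    unfolding set_lebesgue_integral_def
  proof (rule Bochner_Integration.integral_cong)
    show "indicator S z *\<^sub>R (\<theta> (w z) * ddir e \<eta> z) = \<theta> (w1 z) * ddir e \<eta> z" for z
      using D\<eta>0[of z] KK' K'(2) K(2) by (cases "z \<in> K") (auto simp: w1_def indicator_def)
  qed simp
  moreover have "(LINT z:S|lebesgue. (ddir 1 \<theta> (w z) * v z) * \<eta> z) = (LINT z|lebesgue. (ddir 1 \<theta> (w1 z) * v1 z) * \<eta> z)"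
    unfolding set_lebesgue_integral_def
  proof (rule Bochner_Integration.integral_cong)
    show "indicator S z *\<^sub>R ((ddir 1 \<theta> (w z) * v z) * \<eta> z) = (ddir 1 \<theta> (w1 z) * v1 z) * \<eta> z" for z
      using K(3)[of z] KK' K'(2) K(2) by (cases "z \<in> K") (auto simp: w1_def v1_def indicator_def)
  qed simp
  ultimately show ?thesis using fin by simp
qed

lemma weak_ddir_chain:
  fixes w v :: "'b::euclidean_space \<Rightarrow> real"
  assumes S: "open S" and w: "weak_ddir S e w v"
    and \<theta>: "smooth \<theta>" "\<And>x. \<bar>ddir 1 \<theta> x\<bar> \<le> L"
  shows "weak_ddir S e (\<lambda>z. \<theta> (w z)) (\<lambda>z. ddir 1 \<theta> (w z) * v z)"
  unfolding weak_ddir_def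
proof (intro conjI allI impI)
  have lw: "locally_L1 S w" and lv: "locally_L1 S v" using w by (auto simp: weak_ddir_def)
  have [measurable]: "\<theta> \<in> borel_measurable borel" "ddir 1 \<theta> \<in> borel_measurable borel"
    by (intro borel_measurable_continuous_onI smooth_continuous smooth_ddir \<theta>(1))+
  show "locally_L1 S (\<lambda>z. \<theta> (w z))"
  proof (rule locally_L1_I)
    fix K assume K: "compact K" "K \<subseteq> S"
    note i = locally_L1_rst[OF lw K]
    have [measurable]: "rst K w \<in> borel_measurable lebesgue" "K \<in> sets lebesgue"
      using i lmeasurable_compact[OF K(1)] by auto
    have e: "rst K (\<lambda>z. \<theta> (w z)) = (\<lambda>z. indicator K z * \<theta> (rst K w z))" by (auto simp: indicator_def)
    show "integrable lebesgue (rst K (\<lambda>z. \<theta> (w z)))"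
    proof (rule Bochner_Integration.integrable_bound)
      show "integrable lebesgue (\<lambda>z. \<bar>\<theta> 0\<bar> * indicat_real K z + L * \<bar>rst K w z\<bar>)"
        using i lmeasurable_compact[OF K(1)] by (simp add: lmeasurable_iff_integrable)
      show "rst K (\<lambda>z. \<theta> (w z)) \<in> borel_measurable lebesgue" unfolding e by measurable
      show "AE z in lebesgue. norm (rst K (\<lambda>z. \<theta> (w z)) z) \<le> norm (\<bar>\<theta> 0\<bar> * indicat_real K z + L * \<bar>rst K w z\<bar>)"
        using smooth_lipschitz[OF \<theta>] by (intro AE_I2) (auto simp: indicator_def intro: order_trans[OF _ abs_ge_self])
    qed
  qed
  show "locally_L1 S (\<lambda>z. ddir 1 \<theta> (w z) * v z)"
  proof (rule locally_L1_I)
    fix K assume K: "compact K" "K \<subseteq> S"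
    have [measurable]: "rst K w \<in> borel_measurable lebesgue" using locally_L1_rst[OF lw K] by auto
    have "integrable lebesgue (\<lambda>z. ddir 1 \<theta> (rst K w z) * rst K v z)"
      by (rule bounded_mult_integrable[OF locally_L1_rst[OF lv K] _ \<theta>(2)]) measurable
    moreover have "(\<lambda>z. ddir 1 \<theta> (rst K w z) * rst K v z) = rst K (\<lambda>z. ddir 1 \<theta> (w z) * v z)"
      by (auto simp: indicator_def)
    ultimately show "integrable lebesgue (rst K (\<lambda>z. ddir 1 \<theta> (w z) * v z))" by simp
  qed
qed (rule weak_ddir_chain_integral[OF S w \<theta>])

text \<open>The choice \<open>\<theta> n x = x S((n+1) x)\<close> has derivative
  \<open>S(y) + y S'(y)\<close> with \<open>y = (n+1) x\<close>. The second term lives on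
  \<open>0 < y < 1\<close>, hence is bounded by \<open>C\<close> uniformly in \<open>n\<close>, and
  for fixed \<open>x\<close> it is eventually zero.\<close>

lemma smooth_positive_part:
  obtains \<theta> :: "nat \<Rightarrow> real \<Rightarrow> real" and L where "\<And>n. smooth (\<theta> n)" "\<And>n x. \<bar>ddir 1 (\<theta> n) x\<bar> \<le> L"
    "\<And>n x. \<bar>\<theta> n x\<bar> \<le> \<bar>x\<bar>" "\<And>x. (\<lambda>n. \<theta> n x) \<longlonglongrightarrow> max 0 x"
    "\<And>x. (\<lambda>n. ddir 1 (\<theta> n) x) \<longlonglongrightarrow> (if x > 0 then 1 else 0)"
proof -
  obtain S C where "smooth_step S C" using exists_smooth_step by blast
  note S = smooth_stepD[OF this]
  define \<theta> where "\<theta> n x = x * S (0 + real (Suc n) * x)" for n x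
  have der: "((\<lambda>x. S (0 + real (Suc n) * x)) has_real_derivative real (Suc n) * ddir 1 S (0 + real (Suc n) * x)) (at x)" for n x
    using smooth_real_deriv[OF smooth_affine(1)[OF S(1), of 0 "real (Suc n)"], of x] unfolding smooth_affine(2)[OF S(1)] .
  have dd: "ddir 1 (\<theta> n) x = S (real (Suc n) * x) + (real (Suc n) * x) * ddir 1 S (real (Suc n) * x)" for n x
    unfolding \<theta>_def using ddir_real[OF DERIV_mult[OF DERIV_ident der[of n x]]] by (simp add: mult_ac)
  have yS: "\<bar>y * ddir 1 S y\<bar> \<le> C" for y
  proof (cases "y \<le> 0 \<or> 1 \<le> y")
    case True
    then have "ddir 1 S y = 0" by (rule S(9))
    then show ?thesis using S(7,8)[of y] by simp
  next
    case False
    then have "\<bar>y\<bar> * \<bar>ddir 1 S y\<bar> \<le> 1 * C" using S(7,8)[of y] by (intro mult_mono) auto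
    then show ?thesis by (simp add: abs_mult)
  qed
  show ?thesis
  proof (rule that)
    show "smooth (\<theta> n)" for n
      unfolding \<theta>_def by (rule smooth_mult[OF smooth_linear[OF bounded_linear_ident] smooth_affine(1)[OF S(1)]])
    show "\<bar>ddir 1 (\<theta> n) x\<bar> \<le> 1 + C" for n x
      using yS[of "real (Suc n) * x"] S(5,6)[of "real (Suc n) * x"] unfolding dd by linarith
    show "\<bar>\<theta> n x\<bar> \<le> \<bar>x\<bar>" for n x
      using S(5,6)[of "real (Suc n) * x"] by (simp add: \<theta>_def abs_mult mult_left_le del: of_nat_Suc)
    show "(\<lambda>n. \<theta> n x) \<longlonglongrightarrow> max 0 x" for x
    proof -
      have "(\<lambda>n. \<theta> n x) \<longlonglongrightarrow> x * (if x > 0 then 1 else 0)"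
        unfolding \<theta>_def add_0 by (rule tendsto_mult_left[OF step_tendsto[of S 1, OF S(2,3)]])
      then show ?thesis by (cases "x > 0") auto
    qed
    show "(\<lambda>n. ddir 1 (\<theta> n) x) \<longlonglongrightarrow> (if x > 0 then 1 else 0)" for x
      unfolding dd using tendsto_add[OF step_tendsto[of S 1 x, OF S(2,3)] step_tendsto[of "\<lambda>y. y * ddir 1 S y" 0 x]] S(9) by simp
  qed
qed

text \<open>The smooth approximations have derivatives tending to \<open>v\<close> where
  \<open>w > 0\<close> and to 0 elsewhere, the zero set included; this is what later forces
  gradients to vanish on zero sets.\<close>

lemma weak_ddir_positive_part:
  fixes w v :: "'b::euclidean_space \<Rightarrow> real"
  assumes S: "open S" and w: "weak_ddir S e w v"
  shows "weak_ddir S e (\<lambda>z. max 0 (w z)) (\<lambda>z. if w z > 0 then v z else 0)"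
proof -
  have lw: "locally_L1 S w" and lv: "locally_L1 S v" using w by (auto simp: weak_ddir_def)
  obtain \<theta> :: "nat \<Rightarrow> real \<Rightarrow> real" and L where \<theta>: "\<And>n. smooth (\<theta> n)" "\<And>n x. \<bar>ddir 1 (\<theta> n) x\<bar> \<le> L"
    "\<And>n x. \<bar>\<theta> n x\<bar> \<le> \<bar>x\<bar>" "\<And>x. (\<lambda>n. \<theta> n x) \<longlonglongrightarrow> max 0 x"
    "\<And>x. (\<lambda>n. ddir 1 (\<theta> n) x) \<longlonglongrightarrow> (if x > 0 then 1 else 0)"
    by (rule smooth_positive_part) (rule that)
  show ?thesis
  proof (rule weak_ddir_limit)
    show "weak_ddir S e (\<lambda>z. \<theta> n (w z)) (\<lambda>z. ddir 1 (\<theta> n) (w z) * v z)" for n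
      by (rule weak_ddir_chain[OF S w \<theta>(1,2)])
    show "locally_L1 S (\<lambda>z. 1 * \<bar>w z\<bar>)" "locally_L1 S (\<lambda>z. L * \<bar>v z\<bar>)" by (rule locally_L1_abs[OF lw] locally_L1_abs[OF lv])+
    show "AE z in lebesgue. z \<in> S \<longrightarrow> \<bar>ddir 1 (\<theta> n) (w z) * v z\<bar> \<le> L * \<bar>v z\<bar>" for n
      unfolding abs_mult by (intro AE_I2 impI mult_right_mono \<theta>(2)) simp
    show "AE z in lebesgue. z \<in> S \<longrightarrow> (\<lambda>n. ddir 1 (\<theta> n) (w z) * v z) \<longlonglongrightarrow> (if w z > 0 then v z else 0)"
    proof (intro AE_I2 impI)
      fix z
      have "(\<lambda>n. ddir 1 (\<theta> n) (w z) * v z) \<longlonglongrightarrow> (if w z > 0 then 1 else 0) * v z" by (intro tendsto_mult_right \<theta>(5))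
      then show "(\<lambda>n. ddir 1 (\<theta> n) (w z) * v z) \<longlonglongrightarrow> (if w z > 0 then v z else 0)" by (simp split: if_splits)
    qed
  qed (use \<theta>(3,4) in simp_all)
qed

text \<open>The difference of the two derivatives is a weak derivative of the zero function, so its
  mollifications vanish on compact subsets, and along a subsequence they converge to it almost
  everywhere.\<close>

lemma weak_ddir_unique:
  fixes w v v' :: "'b::euclidean_space \<Rightarrow> real"
  assumes S: "open S" and w: "weak_ddir S e w v" "weak_ddir S e w v'"
  shows "AE z in lebesgue. z \<in> S \<longrightarrow> v z = v' z"
proof -
  have z0: "weak_ddir S e (\<lambda>z. 0) (\<lambda>z. v z - v' z)" using weak_ddir_diff[OF w] by simp
  have on_compact: "AE z in lebesgue. z \<in> K \<longrightarrow> v z = v' z" if K: "compact K" "K \<subseteq> S" for K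
  proof -
    obtain K' \<delta> where K': "compact K'" "K' \<subseteq> S" "0 < \<delta>" "\<And>z. z \<in> K \<Longrightarrow> cball z \<delta> \<subseteq> K'"
      by (rule compact_enlarge[OF K(1) S K(2)]) (rule that)
    define d where "d = rst K' (\<lambda>z. v z - v' z)"
    have di: "integrable lebesgue d"
      unfolding d_def using z0 locally_L1_rst[OF _ K'(1,2)] by (simp add: weak_ddir_def)
    obtain r :: "nat \<Rightarrow> nat" where r: "strict_mono r"
      "\<And>h. h \<in> {d} \<Longrightarrow> AE z in lebesgue. (\<lambda>n. moll (r n) h z) \<longlonglongrightarrow> h z"
      by (rule moll_AE_subseq[of "{d}"]) (use di that in auto)
    obtain N where N: "1 / real (Suc N) < \<delta>" using K'(3) nat_approx_posE by blast
    have zero: "moll (r n) d z = 0" if "z \<in> K" "n \<ge> N" for n z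
    proof -
      have "N \<le> r n" using seq_suble[OF r(1), of n] that(2) by simp
      then have "1 / real (Suc (r n)) \<le> 1 / real (Suc N)" by (simp add: frac_le)
      then have small: "1 / real (Suc (r n)) \<le> \<delta>" using N by simp
      have "ddir e (moll (r n) (rst K' (\<lambda>z. 0))) z = moll (r n) d z"
        unfolding d_def
        by (rule ddir_moll_rst[OF z0 K'(1,2)]) (use K'(4)[OF that(1)] subset_cball[OF small, of z] in blast)
      moreover have "moll (r n) (rst K' (\<lambda>z. 0)) = (\<lambda>z. 0)" by (simp add: conv_def fun_eq_iff)
      moreover have "ddir e (\<lambda>z. 0) z = 0" by (rule ddir_eq[OF has_derivative_const])
      ultimately show ?thesis by simp
    qed
    have "AE z in lebesgue. (\<lambda>n. moll (r n) d z) \<longlonglongrightarrow> d z" using r(2) by simp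
    then show ?thesis
    proof (rule AE_mp, intro AE_I2 impI)
      fix z assume l: "(\<lambda>n. moll (r n) d z) \<longlonglongrightarrow> d z" and "z \<in> K"
      have "(\<lambda>n. moll (r n) d z) \<longlonglongrightarrow> 0"
        by (intro tendsto_eventually eventually_sequentiallyI[of N]) (simp add: zero \<open>z \<in> K\<close>)
      then have "d z = 0" using LIMSEQ_unique[OF l] by simp
      moreover have "z \<in> K'" using K'(4)[OF \<open>z \<in> K\<close>] K'(3) by force
      ultimately show "v z = v' z" by (simp add: d_def)
    qed
  qed
  obtain C :: "nat \<Rightarrow> 'b set" where C: "\<And>n. compact (C n)" "\<And>n. C n \<subseteq> S" "\<Union>(range C) = S"
    by (rule open_Union_compact_subsets[OF S]) (rule that)
  have "AE z in lebesgue. \<forall>n::nat. z \<in> C n \<longrightarrow> v z = v' z"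
    unfolding AE_all_countable using on_compact[OF C(1,2)] by blast
  then show ?thesis
  proof (rule AE_mp, intro AE_I2 impI)
    fix z assume "\<forall>n. z \<in> C n \<longrightarrow> v z = v' z" "z \<in> S"
    then show "v z = v' z" using C(3) by blast
  qed
qed

section \<open>Continuous weights and vector-valued gradients\<close>

lemma smooth_real_polynomial: "real_polynomial_function g \<Longrightarrow> smooth g"
proof (induction rule: real_polynomial_function.induct)
  case (linear f)
  then show ?case by (rule smooth_linear)
next
  case (const c)
  show ?case by (rule smooth_const)
next
  case (add f g)
  then show ?case by (intro smooth_add)
next
  case (mult f g)
  then show ?case by (intro smooth_mult)
qed

lemma open_spacetime: "open (spacetime :: ('a::euclidean_space \<times> real) set)"
  unfolding spacetime_def by (intro open_Times) auto

text \<open>The weight is only continuous; Stone--Weierstrass replaces it by polynomials, for which its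
  product with a test function is again a test function.\<close>

lemma weak_ddir_time_weight:
  fixes f :: "'a::euclidean_space \<Rightarrow> real"
  assumes w: "weak_ddir spacetime (0, 1) u v" and f: "continuous_on UNIV f" and \<eta>: "test_function spacetime \<eta>"
  shows "(LINT z:spacetime|lebesgue. u z * (f (fst z) * ddir (0, 1) \<eta> z)) =
    - (LINT z:spacetime|lebesgue. v z * (f (fst z) * \<eta> z))"
proof -
  let ?S = "spacetime :: ('a \<times> real) set"
  have lu: "locally_L1 ?S u" and lv: "locally_L1 ?S v" using w by (auto simp: weak_ddir_def)
  obtain K where K: "compact K" "K \<subseteq> ?S" "\<And>z. z \<notin> K \<Longrightarrow> \<eta> z = 0" and \<eta>s: "smooth \<eta>"
    using \<eta> unfolding test_function_def by blast
  have D\<eta>0: "ddir (0, 1) \<eta> z = 0" if "z \<notin> K" for z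
    by (rule ddir_outside_support[OF compact_imp_closed[OF K(1)] K(3) that])
  have cK: "compact (fst ` K)" by (rule compact_continuous_image[OF continuous_on_fst[OF continuous_on_id] K(1)])
  have fK: "continuous_on (fst ` K) f" using f continuous_on_subset by blast
  have "\<exists>g. real_polynomial_function g \<and> (\<forall>x\<in>fst ` K. \<bar>f x - g x\<bar> < 1 / real (Suc n))" for n
    by (rule Stone_Weierstrass_real_polynomial_function[OF cK fK, of "1 / real (Suc n)"]) auto
  then obtain g where g: "\<And>n. real_polynomial_function (g n)"
    "\<And>n x. x \<in> fst ` K \<Longrightarrow> \<bar>f x - g n x\<bar> < 1 / real (Suc n)" by metis
  have glim: "(\<lambda>n. g n x) \<longlonglongrightarrow> f x" if "x \<in> fst ` K" for x
  proof (rule Lim_transform[OF tendsto_const])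
    have c: "(\<lambda>n. 1 / real (Suc n)) \<longlonglongrightarrow> 0" using LIMSEQ_inverse_real_of_nat by (simp add: inverse_eq_divide)
    show "(\<lambda>n. g n x - f x) \<longlonglongrightarrow> 0"
      by (rule Lim_null_comparison[OF _ c], rule always_eventually)
        (use g(2)[OF that] in \<open>auto simp: less_imp_le abs_minus_commute\<close>)
  qed
  have gs: "smooth (\<lambda>z. g n (fst z))" for n
    using smooth_compose_linear[OF bounded_linear_fst smooth_real_polynomial[OF g(1)[of n]], of 0] by simp
  obtain M where M: "\<And>x. x \<in> fst ` K \<Longrightarrow> \<bar>f x\<bar> \<le> M"
    using compact_imp_bounded[OF compact_continuous_image[OF fK cK]] unfolding bounded_iff by auto
  have gM: "\<bar>g n x\<bar> \<le> M + 1" if "x \<in> fst ` K" for n x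
  proof -
    have "1 / real (Suc n) \<le> 1" by simp
    then show ?thesis using g(2)[OF that, of n] M[OF that] by linarith
  qed
  have eq: "(LINT z|lebesgue. rst K u z * (g n (fst z) * ddir (0, 1) \<eta> z)) = - (LINT z|lebesgue. rst K v z * (g n (fst z) * \<eta> z))" for n
  proof -
    define \<zeta> where "\<zeta> z = g n (fst z) * \<eta> z" for z
    have t: "test_function ?S \<zeta>"
      unfolding \<zeta>_def by (rule test_functionI[OF smooth_mult[OF gs \<eta>s] K(1,2)]) (simp add: K(3))
    have d: "ddir (0, 1) \<zeta> z = g n (fst z) * ddir (0, 1) \<eta> z" for z
    proof -
      have gd: "(g n has_derivative (\<lambda>v. ddir v (g n) (fst z))) (at (fst z))"
        by (rule has_derivative_ddir[OF smooth_differentiable[OF smooth_real_polynomial[OF g(1)]]])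
      have "((\<lambda>z. g n (fst z)) has_derivative (\<lambda>v. ddir (fst v) (g n) (fst z))) (at z)"
        by (rule has_derivative_compose[OF has_derivative_fst[OF has_derivative_ident] gd])
      from has_derivative_mult[OF this has_derivative_ddir[OF smooth_differentiable[OF \<eta>s]]]
      have "ddir (0, 1) \<zeta> z = g n (fst z) * ddir (0, 1) \<eta> z + ddir (fst (0::'a, 1::real)) (g n) (fst z) * \<eta> z"
        unfolding \<zeta>_def by (rule ddir_eq)
      \<comment> \<open>The direction \<open>(0, 1)\<close> has zero spatial component, so the
        polynomial weight is not differentiated.\<close>
      moreover have "ddir (0::'a) (g n) (fst z) = 0"
        using linear_0[OF has_derivative_linear[OF gd]] .
      ultimately show ?thesis by simp
    qed
    have "(LINT z:?S|lebesgue. u z * ddir (0, 1) \<zeta> z) = - (LINT z:?S|lebesgue. v z * \<zeta> z)"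
      using w t by (simp add: weak_ddir_def)
    moreover have "(LINT z:?S|lebesgue. u z * ddir (0, 1) \<zeta> z) = (LINT z|lebesgue. rst K u z * ddir (0, 1) \<zeta> z)"
      by (rule set_integral_rst[OF K(2)]) (simp add: d D\<eta>0)
    moreover have "(LINT z:?S|lebesgue. v z * \<zeta> z) = (LINT z|lebesgue. rst K v z * \<zeta> z)"
      by (rule set_integral_rst[OF K(2)]) (simp add: \<zeta>_def K(3))
    ultimately show ?thesis unfolding d by (simp add: \<zeta>_def)
  qed
  have lim: "(\<lambda>n. LINT z|lebesgue. rst K h z * (g n (fst z) * \<phi> z)) \<longlonglongrightarrow> (LINT z|lebesgue. rst K h z * (f (fst z) * \<phi> z))"
    if h: "locally_L1 ?S h" and \<phi>: "test_function UNIV \<phi>" for h \<phi>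
  proof -
    obtain B where B: "0 \<le> B" "\<And>z. \<bar>\<phi> z\<bar> \<le> B"
      by (rule test_function_bounded[OF \<phi>]) (rule that)
    have hi: "integrable lebesgue (rst K h)" by (rule locally_L1_rst[OF h K(1,2)])
    have [measurable]: "rst K h \<in> borel_measurable lebesgue" "\<phi> \<in> borel_measurable lebesgue"
      using hi test_function_integrable[OF \<phi>] by auto
    have "continuous_on UNIV (\<lambda>z::'a \<times> real. f (fst z))"
      by (rule continuous_on_compose2[OF f continuous_on_fst[OF continuous_on_id]]) simp
    then have [measurable]: "(\<lambda>z::'a \<times> real. f (fst z)) \<in> borel_measurable lebesgue" by (rule continuous_lebesgue_measurable)
    have [measurable]: "(\<lambda>z::'a \<times> real. g n (fst z)) \<in> borel_measurable lebesgue" for n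
      by (rule continuous_lebesgue_measurable[OF smooth_continuous[OF gs]])
    show ?thesis
    proof (rule integral_dominated_convergence[where w="\<lambda>z. ((M + 1) * B) * \<bar>rst K h z\<bar>"])
      show "AE z in lebesgue. (\<lambda>n. rst K h z * (g n (fst z) * \<phi> z)) \<longlonglongrightarrow> rst K h z * (f (fst z) * \<phi> z)"
        (is "AE z in _. ?B z")
      proof (rule AE_I2)
        fix z show "?B z"
          by (cases "z \<in> K") (auto intro!: tendsto_mult_left tendsto_mult_right glim)
      qed
      show "AE z in lebesgue. norm (rst K h z * (g n (fst z) * \<phi> z)) \<le> ((M + 1) * B) * \<bar>rst K h z\<bar>"
        (is "AE z in _. ?B z") for n
      proof (rule AE_I2)
        fix z show "?B z"
        proof (cases "z \<in> K")
          case True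
          have gz: "\<bar>g n (fst z)\<bar> \<le> M + 1" using gM True by blast
          have "\<bar>rst K h z\<bar> * (\<bar>g n (fst z)\<bar> * \<bar>\<phi> z\<bar>) \<le> \<bar>rst K h z\<bar> * ((M + 1) * B)"
            using gz by (intro mult_left_mono mult_mono B) auto
          then show ?thesis by (simp add: abs_mult mult_ac)
        qed simp
      qed
      show "integrable lebesgue (\<lambda>z. ((M + 1) * B) * \<bar>rst K h z\<bar>)" using hi by simp
    qed measurable
  qed
  have tU: "test_function UNIV \<eta>" using \<eta> unfolding test_function_def by blast
  have "(LINT z|lebesgue. rst K u z * (f (fst z) * ddir (0, 1) \<eta> z)) = - (LINT z|lebesgue. rst K v z * (f (fst z) * \<eta> z))"
    by (rule LIMSEQ_unique[OF lim[OF lu test_function_ddir[OF tU]]])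
      (use tendsto_minus[OF lim[OF lv tU]] eq in simp)
  moreover have "(LINT z:?S|lebesgue. u z * (f (fst z) * ddir (0, 1) \<eta> z)) = (LINT z|lebesgue. rst K u z * (f (fst z) * ddir (0, 1) \<eta> z))"
    by (rule set_integral_rst[OF K(2)]) (simp add: D\<eta>0)
  moreover have "(LINT z:?S|lebesgue. v z * (f (fst z) * \<eta> z)) = (LINT z|lebesgue. rst K v z * (f (fst z) * \<eta> z))"
    by (rule set_integral_rst[OF K(2)]) (simp add: K(3))
  ultimately show ?thesis by simp
qed

lemma weak_deriv_t_iff: "weak_deriv_t w v \<longleftrightarrow> weak_ddir spacetime (0, 1) w v"
  unfolding weak_deriv_t_def weak_ddir_def deriv_t_def by (simp add: mult.commute)

lemma grad_x_inner: "b \<in> Basis \<Longrightarrow> grad_x \<eta> z \<bullet> b = ddir (b, 0) \<eta> z"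
  unfolding grad_x_def by (simp add: inner_sum_left inner_Basis if_distrib sum.delta cong: if_cong)

text \<open>Both identities are compared component by component. Moving the inner product inside the
  Bochner integrals rests on the integrability of the vector integrands, which is the bulk of
  \<open>key\<close>.\<close>

lemma weak_grad_x_iff:
  fixes w :: "'a::euclidean_space \<times> real \<Rightarrow> real"
  assumes w: "locally_L1 spacetime w" and V: "locally_L1 spacetime V"
  shows "weak_grad_x w V \<longleftrightarrow> (\<forall>b\<in>Basis. weak_ddir spacetime (b, 0) w (\<lambda>z. V z \<bullet> b))"
proof -
  let ?S = "spacetime :: ('a \<times> real) set"
  have Vb: "locally_L1 ?S (\<lambda>z. V z \<bullet> b)" for b
  proof (rule locally_L1_I)
    fix K assume "compact K" "K \<subseteq> ?S"
    then have "integrable lebesgue (\<lambda>z. indicat_real K z *\<^sub>R V z)"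
      using V unfolding locally_L1_def set_integrable_def by blast
    from integrable_inner_left[OF this, of b] show "integrable lebesgue (rst K (\<lambda>z. V z \<bullet> b))" by simp
  qed
  have key: "(LINT z:?S|lebesgue. w z *\<^sub>R grad_x \<eta> z) \<bullet> b = (LINT z:?S|lebesgue. w z * ddir (b, 0) \<eta> z)"
    "(LINT z:?S|lebesgue. \<eta> z *\<^sub>R V z) \<bullet> b = (LINT z:?S|lebesgue. (V z \<bullet> b) * \<eta> z)"
    if \<eta>: "test_function ?S \<eta>" and b: "b \<in> Basis" for \<eta> b
  proof -
    obtain K where K: "compact K" "K \<subseteq> ?S" "\<And>z. z \<notin> K \<Longrightarrow> \<eta> z = 0" and \<eta>s: "smooth \<eta>"
      using \<eta> unfolding test_function_def by blast
    have D\<eta>0: "ddir v \<eta> z = 0" if "z \<notin> K" for z v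
      by (rule ddir_outside_support[OF compact_imp_closed[OF K(1)] K(3) that])
    have g: "indicator ?S z *\<^sub>R (w z *\<^sub>R grad_x \<eta> z) = (\<Sum>b\<in>Basis. (ddir (b, 0) \<eta> z * rst K w z) *\<^sub>R b)" for z
      using K(2) D\<eta>0[of z] by (cases "z \<in> K") (auto simp: grad_x_def scaleR_sum_right mult.commute)
    have "integrable lebesgue (\<lambda>z. indicator ?S z *\<^sub>R (w z *\<^sub>R grad_x \<eta> z))"
      unfolding g
    proof (intro Bochner_Integration.integrable_sum integrable_scaleR_left)
      fix c :: 'a
      obtain B where B: "0 \<le> B" "\<And>z. \<bar>ddir (c, 0) \<eta> z\<bar> \<le> B"
        by (rule test_function_bounded[OF test_function_ddir[OF \<eta>]]) (rule that)
      show "integrable lebesgue (\<lambda>z. ddir (c, 0) \<eta> z * rst K w z)"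
        by (rule bounded_mult_integrable[OF locally_L1_rst[OF w K(1,2)] _ B(2)])
          (use test_function_integrable[OF test_function_ddir[OF \<eta>, of "(c, 0)"]] in auto)
    qed
    note i1 = integral_inner_left[OF this, of b, symmetric]
    show "(LINT z:?S|lebesgue. w z *\<^sub>R grad_x \<eta> z) \<bullet> b = (LINT z:?S|lebesgue. w z * ddir (b, 0) \<eta> z)"
      unfolding set_lebesgue_integral_def i1
      by (intro Bochner_Integration.integral_cong) (simp_all add: grad_x_inner[OF b])
    obtain B where B: "0 \<le> B" "\<And>z. \<bar>\<eta> z\<bar> \<le> B"
      by (rule test_function_bounded[OF \<eta>]) (rule that)
    have iV: "integrable lebesgue (\<lambda>z. indicat_real K z *\<^sub>R V z)"
      using V K unfolding locally_L1_def set_integrable_def by blast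
    have g2: "indicator ?S z *\<^sub>R (\<eta> z *\<^sub>R V z) = \<eta> z *\<^sub>R (indicat_real K z *\<^sub>R V z)" for z
      using K(2,3) by (cases "z \<in> K") auto
    have "integrable lebesgue (\<lambda>z. indicator ?S z *\<^sub>R (\<eta> z *\<^sub>R V z))"
      unfolding g2
    proof (rule Bochner_Integration.integrable_bound)
      show "integrable lebesgue (\<lambda>z. B * norm (indicat_real K z *\<^sub>R V z))"
        by (intro integrable_mult_right integrable_norm iV)
      have [measurable]: "\<eta> \<in> borel_measurable lebesgue" using test_function_integrable[OF \<eta>] by auto
      have [measurable]: "(\<lambda>z. indicat_real K z *\<^sub>R V z) \<in> borel_measurable lebesgue" using iV by auto
      show "(\<lambda>z. \<eta> z *\<^sub>R (indicat_real K z *\<^sub>R V z)) \<in> borel_measurable lebesgue" by measurable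
      show "AE z in lebesgue. norm (\<eta> z *\<^sub>R (indicat_real K z *\<^sub>R V z)) \<le> norm (B * norm (indicat_real K z *\<^sub>R V z))"
        (is "AE z in _. ?B z")
      proof (rule AE_I2)
        fix z
        have "\<bar>\<eta> z\<bar> * norm (indicat_real K z *\<^sub>R V z) \<le> B * norm (indicat_real K z *\<^sub>R V z)"
          by (intro mult_right_mono B) simp
        then show "?B z"
          using B(1) by (simp only: norm_scaleR real_norm_def abs_mult abs_norm_cancel abs_of_nonneg)
      qed
    qed
    note i2 = integral_inner_left[OF this, of b, symmetric]
    show "(LINT z:?S|lebesgue. \<eta> z *\<^sub>R V z) \<bullet> b = (LINT z:?S|lebesgue. (V z \<bullet> b) * \<eta> z)"
      unfolding set_lebesgue_integral_def i2
      by (intro Bochner_Integration.integral_cong) (simp_all add: mult_ac)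
  qed
  show ?thesis
  proof
    assume W: "weak_grad_x w V"
    show "\<forall>b\<in>Basis. weak_ddir ?S (b, 0) w (\<lambda>z. V z \<bullet> b)"
    proof
      fix b :: 'a assume b: "b \<in> Basis"
      have "(LINT z:?S|lebesgue. w z * ddir (b, 0) \<eta> z) = - (LINT z:?S|lebesgue. (V z \<bullet> b) * \<eta> z)"
        if \<eta>: "test_function ?S \<eta>" for \<eta>
        using W \<eta> key[OF \<eta> b] unfolding weak_grad_x_def by (metis inner_minus_left)
      then show "weak_ddir ?S (b, 0) w (\<lambda>z. V z \<bullet> b)" using w Vb by (simp add: weak_ddir_def)
    qed
  next
    assume D: "\<forall>b\<in>Basis. weak_ddir ?S (b, 0) w (\<lambda>z. V z \<bullet> b)"
    have "(LINT z:?S|lebesgue. w z *\<^sub>R grad_x \<eta> z) = - (LINT z:?S|lebesgue. \<eta> z *\<^sub>R V z)"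
      if \<eta>: "test_function ?S \<eta>" for \<eta>
    proof (rule euclidean_eqI)
      fix b :: 'a assume b: "b \<in> Basis"
      show "(LINT z:?S|lebesgue. w z *\<^sub>R grad_x \<eta> z) \<bullet> b = (- (LINT z:?S|lebesgue. \<eta> z *\<^sub>R V z)) \<bullet> b"
        using D b \<eta> key[OF \<eta> b] unfolding weak_ddir_def by simp
    qed
    then show "weak_grad_x w V" using w V by (simp add: weak_grad_x_def)
  qed
qed

section \<open>Comparison of subsolutions with strong solutions\<close>

definition flux :: "real \<Rightarrow> 'a::euclidean_space \<Rightarrow> 'a" where
  "flux p V = norm V powr (p - 2) *\<^sub>R V"

lemma norm_flux: "norm (flux p V) = norm V powr (p - 1)"
proof (cases "V = 0")
  case False
  then have "norm V powr (p - 1) = norm V powr (p - 2) * norm V powr 1"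
    by (simp only: powr_add[symmetric]) simp
  then show ?thesis using False by (simp add: flux_def)
qed (simp add: flux_def)

lemma flux_0 [simp]: "flux p 0 = 0"
  by (simp add: flux_def)

lemma flux_inner_self: "flux p a \<bullet> a = norm a powr p"
proof (cases "a = 0")
  case False
  then have "norm a powr p = norm a powr (p - 2) * norm a powr 2"
    by (simp only: powr_add[symmetric]) simp
  then show ?thesis using False by (simp add: flux_def powr_numeral power2_norm_eq_inner)
qed simp

text \<open>Cauchy-Schwarz bounds the mixed terms by norms, after which only the monotonicity of the
  scalar map \<open>s \<mapsto> s powr (p - 1)\<close> remains.\<close>

lemma flux_monotone:
  fixes a b :: "'a::euclidean_space"
  assumes "1 < p"
  shows "0 \<le> (flux p a - flux p b) \<bullet> (a - b)"
proof -
  have sp: "x powr p = x powr (p - 1) * x" if "x \<ge> 0" for x :: real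
  proof (cases "x = 0")
    case False
    then have "x powr p = x powr (p - 1) * x powr 1" by (simp only: powr_add[symmetric]) simp
    then show ?thesis using that False by simp
  qed simp
  have cs: "flux p x \<bullet> y \<le> norm x powr (p - 1) * norm y" for x y :: 'a
    using norm_cauchy_schwarz[of "flux p x" y] by (simp add: norm_flux)
  have "(norm a powr (p - 1) - norm b powr (p - 1)) * (norm a - norm b) \<ge> 0"
  proof (cases "norm a \<le> norm b")
    case True
    then have "norm a powr (p - 1) \<le> norm b powr (p - 1)" using assms by (intro powr_mono2) auto
    then show ?thesis using True by (simp add: mult_nonpos_nonpos)
  next
    case False
    then have "norm b powr (p - 1) \<le> norm a powr (p - 1)" using assms by (intro powr_mono2) auto
    then show ?thesis using False by simp
  qed
  then have "0 \<le> norm a powr p + norm b powr p - norm a powr (p - 1) * norm b - norm b powr (p - 1) * norm a"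
    by (simp add: sp algebra_simps)
  also have "\<dots> \<le> flux p a \<bullet> a + flux p b \<bullet> b - flux p a \<bullet> b - flux p b \<bullet> a"
    using cs[of a b] cs[of b a] by (simp add: flux_inner_self)
  also have "\<dots> = (flux p a - flux p b) \<bullet> (a - b)" by (simp add: inner_diff_left inner_diff_right)
  finally show ?thesis .
qed

lemma flux_measurable [measurable]: "flux p \<in> borel_measurable borel"
  unfolding flux_def by measurable

lemma powr_add_le:
  fixes a b q :: real
  assumes "0 \<le> a" "0 \<le> b" "0 < q"
  shows "(a + b) powr q \<le> 2 powr q * (a powr q + b powr q)"
proof -
  have "(a + b) powr q \<le> (2 * max a b) powr q" using assms by (intro powr_mono2) auto
  also have "\<dots> = 2 powr q * (max a b) powr q" using assms by (simp add: powr_mult)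
  also have "\<dots> \<le> 2 powr q * (a powr q + b powr q)"
    using assms by (intro mult_left_mono) (auto simp: max_def)
  finally show ?thesis .
qed

text \<open>Young's inequality under the convolution integral, where the kernel is a probability
  density. A product of an \<open>L^q\<close> function with a mollified \<open>L^p\<close> function
  is thereby dominated by a fixed term and a mollification of \<open>|h|^p\<close>, so
  \<open>L^1\<close> convergence of mollifications is all that the later limit requires.\<close>

lemma abs_moll_le_Young:
  fixes h :: "'b::euclidean_space \<Rightarrow> real"
  assumes pq: "1 < p" "1 < q" "1 / p + 1 / q = 1" and h: "integrable lebesgue h"
    and hp: "integrable lebesgue (\<lambda>z. \<bar>h z\<bar> powr p)"
  shows "\<bar>A\<bar> * \<bar>moll n h z\<bar> \<le> \<bar>A\<bar> powr q / q + \<bar>moll n (\<lambda>z. \<bar>h z\<bar> powr p) z\<bar> / p"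
proof -
  let ?k = "\<lambda>y. moll_kernel n (z - y)"
  have i1: "integrable lebesgue (\<lambda>y. ?k y * h y)" and i2: "integrable lebesgue (\<lambda>y. ?k y * \<bar>h y\<bar> powr p)"
    by (intro conv_integrand_integrable[OF moll_kernel_test] h hp)+
  have "\<bar>A\<bar> * \<bar>moll n h z\<bar> \<le> \<bar>A\<bar> * (LINT y|lebesgue. \<bar>?k y * h y\<bar>)"
    unfolding conv_def by (intro mult_left_mono integral_abs_bound) simp
  also have "\<dots> = (LINT y|lebesgue. \<bar>A\<bar> * \<bar>?k y * h y\<bar>)" by simp
  also have "\<dots> \<le> (LINT y|lebesgue. ?k y * (\<bar>A\<bar> powr q / q) + (?k y * \<bar>h y\<bar> powr p) / p)"
  proof (rule integral_mono)
    show "integrable lebesgue (\<lambda>y. \<bar>A\<bar> * \<bar>?k y * h y\<bar>)" using i1 by simp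
    show "integrable lebesgue (\<lambda>y. ?k y * (\<bar>A\<bar> powr q / q) + (?k y * \<bar>h y\<bar> powr p) / p)"
      using integral_moll_kernel_shift(1)[of n z] i2 by simp
    show "\<bar>A\<bar> * \<bar>?k y * h y\<bar> \<le> ?k y * (\<bar>A\<bar> powr q / q) + (?k y * \<bar>h y\<bar> powr p) / p" for y
    proof -
      have "\<bar>h y\<bar> * \<bar>A\<bar> \<le> \<bar>h y\<bar> powr p / p + \<bar>A\<bar> powr q / q"
        by (rule Youngs_inequality) (use pq in auto)
      from mult_left_mono[OF this moll_kernel_nonneg[of n "z - y"]]
      show ?thesis by (simp add: abs_mult moll_kernel_nonneg algebra_simps)
    qed
  qed
  also have "\<dots> = (LINT y|lebesgue. ?k y * (\<bar>A\<bar> powr q / q)) + (LINT y|lebesgue. (?k y * \<bar>h y\<bar> powr p) / p)"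
    using integral_moll_kernel_shift(1)[of n z] i2 by (intro Bochner_Integration.integral_add) simp_all
  also have "\<dots> = \<bar>A\<bar> powr q / q + moll n (\<lambda>z. \<bar>h z\<bar> powr p) z / p"
    using integral_moll_kernel_shift(2)[of n z] by (simp add: conv_def)
  also have "\<dots> \<le> \<bar>A\<bar> powr q / q + \<bar>moll n (\<lambda>z. \<bar>h z\<bar> powr p) z\<bar> / p"
    using pq by (simp add: divide_right_mono)
  finally show ?thesis .
qed

section \<open>Testing with a cutoff of the difference\<close>

lemma rst_vector_measurable:
  fixes V :: "'b::euclidean_space \<Rightarrow> 'a::euclidean_space"
  assumes "\<And>b. b \<in> Basis \<Longrightarrow> locally_L1 S (\<lambda>z. V z \<bullet> b)" and "compact K" "K \<subseteq> S"
  shows "(\<lambda>z. indicat_real K z *\<^sub>R V z) \<in> borel_measurable lebesgue"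
proof (subst borel_measurable_euclidean_space, intro ballI)
  fix b :: 'a assume "b \<in> Basis"
  from locally_L1_rst[OF assms(1)[OF this] assms(2,3)]
  show "(\<lambda>z. (indicat_real K z *\<^sub>R V z) \<bullet> b) \<in> borel_measurable lebesgue" by auto
qed

text \<open>The test function is \<open>\<omega>(t) H(d_n)\<close>, with \<open>d_n\<close> a
  mollification of \<open>wt - w\<close>. In the limit the diffusion term becomes
  \<open>H'(wt - w)\<close> times a product that is nonnegative by monotonicity of the flux, and it
  may be dropped; the time term is what is left.\<close>

lemma comparison_smooth_cutoff:
  fixes w wt g :: "'a::euclidean_space \<times> real \<Rightarrow> real" and V Vt :: "'a \<times> real \<Rightarrow> 'a"
  assumes p: "1 < p" and f: "continuous_on UNIV f" "\<And>x. 0 \<le> f x" and c: "0 < c"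
    and wt: "\<And>b. b \<in> Basis \<Longrightarrow> weak_ddir spacetime (b, 0) wt (\<lambda>z. Vt z \<bullet> b)"
    and w: "\<And>b. b \<in> Basis \<Longrightarrow> weak_ddir spacetime (b, 0) w (\<lambda>z. V z \<bullet> b)"
    and Lt: "locally_L1 spacetime (\<lambda>z. norm (Vt z) powr p)" and L: "locally_L1 spacetime (\<lambda>z. norm (V z) powr p)"
    and g: "locally_L1 spacetime g"
    and ineq: "\<And>\<eta>. test_function spacetime \<eta> \<Longrightarrow> (\<And>z. 0 \<le> \<eta> z) \<Longrightarrow>
      (LINT z:spacetime|lebesgue. g z * (f (fst z) * \<eta> z)) +
      c * (\<Sum>b\<in>Basis. LINT z:spacetime|lebesgue. ((flux p (Vt z) - flux p (V z)) \<bullet> b) * (f (fst z) * ddir (b, 0) \<eta> z)) \<le> 0"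
    and wpos: "\<And>z. 0 \<le> w z" and R: "0 \<le> R"
    and supp: "\<And>x t. 0 < t \<Longrightarrow> t \<le> b0 + 1 \<Longrightarrow> R \<le> norm x \<Longrightarrow> wt (x, t) = 0"
    and \<omega>: "smooth \<omega>" "\<And>t. 0 \<le> \<omega> t" "\<And>t. t \<notin> {a0..b0} \<Longrightarrow> \<omega> t = 0" "0 < a0"
    and H: "smooth H" "\<And>x. x \<le> 0 \<Longrightarrow> H x = 0" "\<And>x. 0 \<le> H x" "\<And>x. H x \<le> 1"
      "\<And>x. 0 \<le> ddir 1 H x" "\<And>x. ddir 1 H x \<le> C"
  shows "(LINT z:spacetime|lebesgue. g z * (f (fst z) * (\<omega> (snd z) * H (wt z - w z)))) \<le> 0"
proof -
  let ?S = "spacetime :: ('a \<times> real) set"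
  \<comment> \<open>\<open>K0\<close> will carry the test functions. \<open>K1\<close> extends
    further by 1 in space and upwards in time and reaches down to half of \<open>a0\<close>, which
    leaves room for mollification at positive times.\<close>
  define K0 where "K0 = (cball 0 (R + 1) :: 'a set) \<times> {a0..b0}"
  define K1 where "K1 = (cball 0 (R + 2) :: 'a set) \<times> {a0 / 2..b0 + 1}"
  have cK: "compact K0" "compact K1" unfolding K0_def K1_def by (intro compact_Times compact_cball compact_Icc)+
  have KS: "K0 \<subseteq> ?S" "K1 \<subseteq> ?S" using \<omega>(4) by (auto simp: K0_def K1_def spacetime_def)
  have K01: "K0 \<subseteq> K1" using \<omega>(4) by (auto simp: K0_def K1_def)
  have lV: "locally_L1 ?S (\<lambda>z. V z \<bullet> b)" "locally_L1 ?S (\<lambda>z. Vt z \<bullet> b)" if "b \<in> Basis" for b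
    using w[OF that] wt[OF that] by (auto simp: weak_ddir_def)
  have "(SOME b. b \<in> (Basis :: 'a set)) \<in> Basis" by (rule someI_ex) (use nonempty_Basis in blast)
  then have lw: "locally_L1 ?S w" "locally_L1 ?S wt" using w wt by (auto simp: weak_ddir_def)
  define d where "d = rst K1 (\<lambda>z. wt z - w z)"
  define D where "D b = rst K1 (\<lambda>z. (Vt z - V z) \<bullet> b)" for b
  define P where "P b z = \<bar>D b z\<bar> powr p" for b z
  have d_eq: "d = (\<lambda>z. rst K1 wt z - rst K1 w z)" by (auto simp: d_def algebra_simps)
  have D_eq: "D b = (\<lambda>z. rst K1 (\<lambda>z. Vt z \<bullet> b) z - rst K1 (\<lambda>z. V z \<bullet> b) z)" for b
    by (auto simp: D_def inner_diff_left algebra_simps)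
  have di: "integrable lebesgue d"
    unfolding d_eq by (intro Bochner_Integration.integrable_diff locally_L1_rst[OF lw(1) cK(2) KS(2)] locally_L1_rst[OF lw(2) cK(2) KS(2)])
  have Di: "integrable lebesgue (D b)" if "b \<in> Basis" for b
    unfolding D_eq by (intro Bochner_Integration.integrable_diff locally_L1_rst[OF lV(1)[OF that] cK(2) KS(2)] locally_L1_rst[OF lV(2)[OF that] cK(2) KS(2)])
  have mV: "(\<lambda>z. indicat_real K z *\<^sub>R V z) \<in> borel_measurable lebesgue"
    "(\<lambda>z. indicat_real K z *\<^sub>R Vt z) \<in> borel_measurable lebesgue" if "compact K" "K \<subseteq> ?S" for K
    using rst_vector_measurable[OF lV(1) that] rst_vector_measurable[OF lV(2) that] by auto
  have np: "integrable lebesgue (rst K (\<lambda>z. norm (V z) powr p))" "integrable lebesgue (rst K (\<lambda>z. norm (Vt z) powr p))"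
    if "compact K" "K \<subseteq> ?S" for K
    using locally_L1_rst[OF L that] locally_L1_rst[OF Lt that] .
  have Pi: "integrable lebesgue (P b)" if b: "b \<in> Basis" for b
  proof (rule Bochner_Integration.integrable_bound)
    show "integrable lebesgue (\<lambda>z. 2 powr p * (rst K1 (\<lambda>z. norm (Vt z) powr p) z + rst K1 (\<lambda>z. norm (V z) powr p) z))"
      using np[OF cK(2) KS(2)] by simp
    have [measurable]: "D b \<in> borel_measurable lebesgue" using Di[OF b] by auto
    show "P b \<in> borel_measurable lebesgue" unfolding P_def by measurable
    show "AE z in lebesgue. norm (P b z) \<le> norm (2 powr p * (rst K1 (\<lambda>z. norm (Vt z) powr p) z + rst K1 (\<lambda>z. norm (V z) powr p) z))"
      (is "AE z in _. ?B z")
    proof (rule AE_I2)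
      fix z show "?B z"
      proof (cases "z \<in> K1")
        case True
        have "\<bar>D b z\<bar> \<le> norm (Vt z - V z)" using Basis_le_norm[OF b] True by (simp add: D_def)
        also have "\<dots> \<le> norm (Vt z) + norm (V z)" by (rule norm_triangle_ineq4)
        finally have "P b z \<le> (norm (Vt z) + norm (V z)) powr p"
          unfolding P_def using p by (intro powr_mono2) auto
        also have "\<dots> \<le> 2 powr p * (norm (Vt z) powr p + norm (V z) powr p)"
          using p by (intro powr_add_le) auto
        finally show ?thesis using True by (simp add: P_def)
      next
        case False
        then show ?thesis by (simp add: P_def D_def)
      qed
    qed
  qed
  obtain r :: "nat \<Rightarrow> nat" where r: "strict_mono r"
    "\<And>h. h \<in> insert d (D ` Basis) \<Longrightarrow> AE z in lebesgue. (\<lambda>n. moll (r n) h z) \<longlonglongrightarrow> h z"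
    by (rule moll_AE_subseq[of "insert d (D ` Basis)"]) (use di Di that in auto)
  define dn where "dn n = moll (r n) d" for n
  define Dn where "Dn b n = moll (r n) (D b)" for b n
  have dni: "integrable lebesgue (dn n)" for n unfolding dn_def by (rule integrable_moll[OF di])
  have Dni: "integrable lebesgue (Dn b n)" if "b \<in> Basis" for b n unfolding Dn_def by (rule integrable_moll[OF Di[OF that]])
  have dns: "smooth (dn n)" for n unfolding dn_def by (rule smooth_conv[OF moll_kernel_test di])
  obtain N where N: "1 / real (Suc N) < min 1 (a0 / 2)" using \<omega>(4) nat_approx_posE[of "min 1 (a0 / 2)"] by auto
  have small: "1 / real (Suc (r n)) < 1" "1 / real (Suc (r n)) < a0 / 2" if "n \<ge> N" for n
  proof -
    have "N \<le> r n" using seq_suble[OF r(1), of n] that by simp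
    then have "1 / real (Suc (r n)) \<le> 1 / real (Suc N)" by (simp add: frac_le)
    moreover have "1 / real (Suc N) < 1" "1 / real (Suc N) < a0 / 2"
      using N by (simp_all only: min_less_iff_conj)
    ultimately show "1 / real (Suc (r n)) < 1" "1 / real (Suc (r n)) < a0 / 2" by linarith+
  qed
  have cb: "cball z (1 / real (Suc (r n))) \<subseteq> K1" if "z \<in> K0" "n \<ge> N" for z n
  proof
    fix y assume y: "y \<in> cball z (1 / real (Suc (r n)))"
    have "dist (fst z) (fst y) \<le> dist z y" "dist (snd z) (snd y) \<le> dist z y"
      by (rule dist_fst_le, rule dist_snd_le)
    then have e: "dist (fst z) (fst y) < 1" "\<bar>snd z - snd y\<bar> < 1" "\<bar>snd z - snd y\<bar> < a0 / 2"
      using y small[OF that(2)] unfolding mem_cball dist_real_def by linarith+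
    have "norm (fst y) \<le> norm (fst z) + norm (fst y - fst z)" by (rule norm_triangle_sub)
    moreover have "norm (fst z) \<le> R + 1" using that(1) by (auto simp: K0_def mem_Times_iff)
    moreover have "norm (fst y - fst z) < 1" using e(1) by (simp add: dist_norm norm_minus_commute)
    ultimately have "norm (fst y) \<le> R + 2" by linarith
    moreover have "a0 \<le> snd z" "snd z \<le> b0" using that(1) by (auto simp: K0_def mem_Times_iff)
    then have "a0 / 2 \<le> snd y" "snd y \<le> b0 + 1" using e(2,3) by linarith+
    ultimately show "y \<in> K1" by (simp add: K1_def mem_Times_iff)
  qed
  \<comment> \<open>Far out only points with \<open>wt = 0\<close> are averaged, where
    \<open>wt - w\<close> is nonpositive. So \<open>H\<close> vanishes there, and the test function
    has compact support although \<open>w\<close> need not.\<close>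
  have neg: "dn n (x, t) \<le> 0" if "n \<ge> N" "R + 1 < norm x" for n x t
  proof -
    have "moll_kernel (r n) ((x, t) - y) * d y \<le> 0" for y
    proof (cases "y \<in> K1 \<and> y \<in> cball (x, t) (1 / real (Suc (r n)))")
      case True
      have "dist x (fst y) \<le> dist (x, t) y" using dist_fst_le[of "(x, t)" y] by simp
      then have "norm (x - fst y) < 1"
        using True small(1)[OF that(1)] unfolding mem_cball dist_norm[of x] by linarith
      then have "R \<le> norm (fst y)" using that(2) norm_triangle_sub[of x "fst y"] by linarith
      then have "wt (fst y, snd y) = 0" using True \<omega>(4) by (intro supp) (auto simp: K1_def mem_Times_iff)
      then have "d y \<le> 0" using True wpos[of y] by (simp add: d_def)
      then show ?thesis using moll_kernel_nonneg mult_nonneg_nonpos by blast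
    next
      case False
      then consider "y \<notin> K1" | "y \<notin> cball (x, t) (1 / real (Suc (r n)))" by blast
      then show ?thesis
      proof cases
        case 2
        then have "moll_kernel (r n) ((x, t) - y) = 0"
          by (intro moll_kernel_outside) (simp add: dist_norm norm_minus_commute[of y "(x, t)"])
        then show ?thesis by simp
      qed (simp add: d_def)
    qed
    then have "0 \<le> (LINT y|lebesgue. - (moll_kernel (r n) ((x, t) - y) * d y))"
      by (intro Bochner_Integration.integral_nonneg) simp
    then show ?thesis unfolding dn_def conv_def by simp
  qed
  define \<eta> where "\<eta> n z = \<omega> (snd z) * H (dn n z)" for n z
  have \<omega>s: "smooth (\<lambda>z::'a \<times> real. \<omega> (snd z))"
    using smooth_compose_linear[OF bounded_linear_snd \<omega>(1), of 0] by simp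
  have \<eta>0: "\<eta> n z = 0" if "n \<ge> N" "z \<notin> K0" for n z
  proof (cases "snd z \<in> {a0..b0}")
    case True
    then have "R + 1 < norm (fst z)" using that(2) by (auto simp: K0_def mem_Times_iff)
    then have "dn n z \<le> 0" using neg[OF that(1), of "fst z" "snd z"] by simp
    then show ?thesis by (simp add: \<eta>_def H(2))
  qed (simp add: \<eta>_def \<omega>(3))
  have \<eta>s: "smooth (\<eta> n)" for n
    unfolding \<eta>_def by (rule smooth_mult[OF \<omega>s smooth_compose[OF H(1) dns]])
  have \<eta>t: "test_function ?S (\<eta> n)" if "n \<ge> N" for n
    by (rule test_functionI[OF \<eta>s cK(1) KS(1) \<eta>0[OF that]])
  have \<eta>nn: "0 \<le> \<eta> n z" for n z by (simp add: \<eta>_def \<omega>(2) H(3))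
  have D\<eta>: "ddir (b, 0) (\<eta> n) z = indicator K0 z * (\<omega> (snd z) * (ddir 1 H (dn n z) * Dn b n z))"
    if "n \<ge> N" "b \<in> Basis" for n b z
  proof (cases "z \<in> K0")
    case True
    have 1: "((\<lambda>z. H (dn n z)) has_derivative (\<lambda>u. ddir 1 H (dn n z) * ddir u (dn n) z)) (at z)"
      using has_derivative_compose[OF has_derivative_ddir[OF smooth_differentiable[OF dns]]
          smooth_real_deriv[OF H(1), unfolded has_field_derivative_def]] .
    have 2: "((\<lambda>z. \<omega> (snd z)) has_derivative (\<lambda>u. ddir 1 \<omega> (snd z) * snd u)) (at z)"
      using has_derivative_compose[OF has_derivative_snd[OF has_derivative_ident]
          smooth_real_deriv[OF \<omega>(1), unfolded has_field_derivative_def]] .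
    have "ddir (b, 0) (\<eta> n) z = \<omega> (snd z) * (ddir 1 H (dn n z) * ddir (b, 0) (dn n) z)
        + ddir 1 \<omega> (snd z) * snd (b, 0::real) * H (dn n z)"
      unfolding \<eta>_def by (rule ddir_eq[OF has_derivative_mult[OF 2 1]])
    moreover have "ddir (b, 0) (dn n) z = Dn b n z"
    proof -
      have "weak_ddir ?S (b, 0) (\<lambda>z. wt z - w z) (\<lambda>z. (Vt z - V z) \<bullet> b)"
        unfolding inner_diff_left by (rule weak_ddir_diff[OF wt[OF that(2)] w[OF that(2)]])
      from ddir_moll_rst[OF this cK(2) KS(2) cb[OF True that(1)]]
      show ?thesis by (simp add: dn_def Dn_def d_def D_def)
    qed
    ultimately show ?thesis using True by simp
  next
    case False
    then show ?thesis
      using ddir_outside_support[OF compact_imp_closed[OF cK(1)] \<eta>0[OF that(1)] False] by simp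
  qed
  have cont_f: "continuous_on UNIV (\<lambda>z::'a \<times> real. f (fst z))"
    by (rule continuous_on_compose2[OF f(1) continuous_on_fst[OF continuous_on_id]]) simp
  have cont_f\<omega>: "continuous_on UNIV (\<lambda>z::'a \<times> real. f (fst z) * \<omega> (snd z))"
    by (intro continuous_on_mult cont_f smooth_continuous[OF \<omega>s])
  have fm[measurable]: "(\<lambda>z::'a \<times> real. f (fst z) * \<omega> (snd z)) \<in> borel_measurable lebesgue"
    by (rule continuous_lebesgue_measurable[OF cont_f\<omega>])
  obtain M where M: "\<And>z. z \<in> K0 \<Longrightarrow> \<bar>f (fst z) * \<omega> (snd z)\<bar> \<le> M"
    using compact_imp_bounded[OF compact_continuous_image[OF continuous_on_subset[OF cont_f\<omega>, of K0] cK(1)]]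
    unfolding bounded_iff by auto
  have Hc: "isCont H x" "isCont (ddir 1 H) x" for x
    using smooth_continuous[OF H(1), of UNIV] smooth_continuous[OF smooth_ddir[OF H(1)], of UNIV]
    by (auto simp: continuous_on_eq_continuous_at)
  have Hm[measurable]: "H \<in> borel_measurable borel" "ddir 1 H \<in> borel_measurable borel"
    using smooth_continuous[OF H(1)] smooth_continuous[OF smooth_ddir[OF H(1)]] by (auto intro: borel_measurable_continuous_onI)
  have dm[measurable]: "d \<in> borel_measurable lebesgue" "dn n \<in> borel_measurable lebesgue" for n using di dni by auto
  have C0: "0 \<le> C" using H(5,6)[of 0] by linarith
  have AEd: "AE z in lebesgue. (\<lambda>n. dn n z) \<longlonglongrightarrow> d z" using r(2)[of d] by (simp add: dn_def)
  have AED: "AE z in lebesgue. (\<lambda>n. Dn b n z) \<longlonglongrightarrow> D b z" if "b \<in> Basis" for b using r(2)[of "D b"] that by (simp add: Dn_def)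
  define g0 where "g0 = rst K0 g"
  have g0i: "integrable lebesgue g0" unfolding g0_def by (rule locally_L1_rst[OF g cK(1) KS(1)])
  have g0m[measurable]: "g0 \<in> borel_measurable lebesgue" using g0i by auto
  have T1: "(\<lambda>n. LINT z|lebesgue. g0 z * ((f (fst z) * \<omega> (snd z)) * H (dn n z))) \<longlonglongrightarrow>
      (LINT z|lebesgue. g0 z * ((f (fst z) * \<omega> (snd z)) * H (d z)))"
  proof (rule integral_dominated_convergence[where w="\<lambda>z. M * \<bar>g0 z\<bar>"])
    show "AE z in lebesgue. (\<lambda>n. g0 z * ((f (fst z) * \<omega> (snd z)) * H (dn n z))) \<longlonglongrightarrow> g0 z * ((f (fst z) * \<omega> (snd z)) * H (d z))"
      using AEd by eventually_elim (intro tendsto_mult_left isCont_tendsto_compose[OF Hc(1)])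
    show "AE z in lebesgue. norm (g0 z * ((f (fst z) * \<omega> (snd z)) * H (dn n z))) \<le> M * \<bar>g0 z\<bar>"
      (is "AE z in _. ?B z") for n
    proof (rule AE_I2)
      fix z show "?B z"
      proof (cases "z \<in> K0")
        case True
        have M0: "0 \<le> M" using M[OF True] by linarith
        have "\<bar>g0 z\<bar> * (\<bar>f (fst z) * \<omega> (snd z)\<bar> * \<bar>H (dn n z)\<bar>) \<le> \<bar>g0 z\<bar> * (M * 1)"
          using M[OF True] H(3,4)[of "dn n z"] M0 by (intro mult_left_mono mult_mono) auto
        then show ?thesis by (simp add: abs_mult mult_ac)
      qed (simp add: g0_def)
    qed
  qed (use g0i in simp_all)
  define q where "q = p / (p - 1)"
  have q: "1 < q" "1 / p + 1 / q = 1" "(p - 1) * q = p" using p by (auto simp: q_def field_simps)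
  \<comment> \<open>The coefficient of the gradient in the diffusion term. It lies in
    \<open>L^q\<close> with \<open>q\<close> dual to \<open>p\<close>, because the flux grows like
    the power \<open>p - 1\<close>.\<close>
  define A where "A b z = (rst K0 (\<lambda>z. (flux p (Vt z) - flux p (V z)) \<bullet> b) z) * (f (fst z) * \<omega> (snd z))" for b z
  have Am: "A b \<in> borel_measurable lebesgue" for b
  proof -
    note [measurable] = mV[OF cK(1) KS(1)]
    have "A b = (\<lambda>z. ((flux p (indicat_real K0 z *\<^sub>R Vt z) - flux p (indicat_real K0 z *\<^sub>R V z)) \<bullet> b) * (f (fst z) * \<omega> (snd z)))"
      by (auto simp: A_def fun_eq_iff indicator_def)
    then show ?thesis by simp
  qed
  have Aq: "integrable lebesgue (\<lambda>z. \<bar>A b z\<bar> powr q)" if b: "b \<in> Basis" for b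
  proof (rule Bochner_Integration.integrable_bound)
    show "integrable lebesgue (\<lambda>z. \<bar>M\<bar> powr q * (2 powr q * (rst K0 (\<lambda>z. norm (Vt z) powr p) z + rst K0 (\<lambda>z. norm (V z) powr p) z)))"
      using np[OF cK(1) KS(1)] by simp
    show "(\<lambda>z. \<bar>A b z\<bar> powr q) \<in> borel_measurable lebesgue" using Am[of b] by measurable
    show "AE z in lebesgue. norm (\<bar>A b z\<bar> powr q) \<le> norm (\<bar>M\<bar> powr q * (2 powr q * (rst K0 (\<lambda>z. norm (Vt z) powr p) z + rst K0 (\<lambda>z. norm (V z) powr p) z)))"
      (is "AE z in _. ?B z")
    proof (rule AE_I2)
      fix z show "?B z"
      proof (cases "z \<in> K0")
        case True
        have "\<bar>(flux p (Vt z) - flux p (V z)) \<bullet> b\<bar> \<le> norm (flux p (Vt z) - flux p (V z))" by (rule Basis_le_norm[OF b])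
        also have "\<dots> \<le> norm (Vt z) powr (p - 1) + norm (V z) powr (p - 1)"
          using norm_triangle_ineq4[of "flux p (Vt z)" "flux p (V z)"] by (simp add: norm_flux)
        finally have "\<bar>A b z\<bar> \<le> (norm (Vt z) powr (p - 1) + norm (V z) powr (p - 1)) * \<bar>M\<bar>"
          using M[OF True] True unfolding A_def abs_mult[of _ "f (fst z) * \<omega> (snd z)"] by (intro mult_mono) auto
        then have "\<bar>A b z\<bar> powr q \<le> ((norm (Vt z) powr (p - 1) + norm (V z) powr (p - 1)) * \<bar>M\<bar>) powr q"
          using q(1) by (intro powr_mono2) auto
        also have "\<dots> = \<bar>M\<bar> powr q * (norm (Vt z) powr (p - 1) + norm (V z) powr (p - 1)) powr q"
          by (simp add: powr_mult mult.commute)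
        also have "\<dots> \<le> \<bar>M\<bar> powr q * (2 powr q * ((norm (Vt z) powr (p - 1)) powr q + (norm (V z) powr (p - 1)) powr q))"
          using q(1) by (intro mult_left_mono powr_add_le) auto
        finally show ?thesis using True by (simp add: powr_powr q(3))
      qed (simp add: A_def)
    qed
  qed
  have bd: "\<bar>A b z * (ddir 1 H x * y)\<bar> \<le> C * (\<bar>A b z\<bar> * \<bar>y\<bar>)" for b x y z
  proof -
    have "ddir 1 H x * (\<bar>A b z\<bar> * \<bar>y\<bar>) \<le> C * (\<bar>A b z\<bar> * \<bar>y\<bar>)" by (intro mult_right_mono H(6)) simp
    then show ?thesis using H(5)[of x] by (simp add: abs_mult mult_ac)
  qed
  have AD_le: "\<bar>A b z * (ddir 1 H (d z) * D b z)\<bar> \<le> C * (\<bar>A b z\<bar> powr q / q) + (C / p) * \<bar>P b z\<bar>" for b z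
  proof -
    have "\<bar>D b z\<bar> * \<bar>A b z\<bar> \<le> \<bar>D b z\<bar> powr p / p + \<bar>A b z\<bar> powr q / q"
      by (rule Youngs_inequality) (use p q in auto)
    from mult_left_mono[OF this C0] bd[of b z "d z" "D b z"]
    show ?thesis by (simp add: algebra_simps P_def)
  qed
  \<comment> \<open>Young's inequality under the mollifier gives the dominators; they converge in
    \<open>L^1\<close> because \<open>P b\<close>, the \<open>p\<close>-th power of the gradient
    difference, is integrable.\<close>
  have T2: "(\<lambda>n. LINT z|lebesgue. A b z * (ddir 1 H (dn n z) * Dn b n z)) \<longlonglongrightarrow> (LINT z|lebesgue. A b z * (ddir 1 H (d z) * D b z))"
    if b: "b \<in> Basis" for b
  proof (rule integral_convergence_L1_dominator[where g="\<lambda>z. C * (\<bar>A b z\<bar> powr q / q) + (C / p) * \<bar>P b z\<bar>"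
        and G="\<lambda>n z. C * (\<bar>A b z\<bar> powr q / q) + (C / p) * \<bar>moll (r n) (P b) z\<bar>"])
    note [measurable] = Am[of b]
    have [measurable]: "D b \<in> borel_measurable lebesgue" "Dn b n \<in> borel_measurable lebesgue" for n
      using Di[OF b] Dni[OF b] by auto
    show "(\<lambda>z. A b z * (ddir 1 H (d z) * D b z)) \<in> borel_measurable lebesgue"
      "(\<lambda>z. A b z * (ddir 1 H (dn n z) * Dn b n z)) \<in> borel_measurable lebesgue" for n by measurable
    show "integrable lebesgue (\<lambda>z. C * (\<bar>A b z\<bar> powr q / q) + (C / p) * \<bar>P b z\<bar>)"
      "integrable lebesgue (\<lambda>z. C * (\<bar>A b z\<bar> powr q / q) + (C / p) * \<bar>moll (r n) (P b) z\<bar>)" for n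
      using Aq[OF b] Pi[OF b] integrable_moll[OF Pi[OF b], of "r n"] by simp_all
    show "(\<lambda>n. LINT z|lebesgue. \<bar>(C * (\<bar>A b z\<bar> powr q / q) + (C / p) * \<bar>moll (r n) (P b) z\<bar>) -
        (C * (\<bar>A b z\<bar> powr q / q) + (C / p) * \<bar>P b z\<bar>)\<bar>) \<longlonglongrightarrow> 0"
      by (rule moll_dominator_L1[OF Pi[OF b] r(1)])
    show "AE z in lebesgue. (\<lambda>n. A b z * (ddir 1 H (dn n z) * Dn b n z)) \<longlonglongrightarrow> A b z * (ddir 1 H (d z) * D b z)"
      using AEd AED[OF b]
      by eventually_elim (intro tendsto_mult_left tendsto_mult isCont_tendsto_compose[OF Hc(2)])
    show "AE z in lebesgue. \<bar>A b z * (ddir 1 H (dn n z) * Dn b n z)\<bar> \<le> C * (\<bar>A b z\<bar> powr q / q) + (C / p) * \<bar>moll (r n) (P b) z\<bar>"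
      (is "AE z in _. ?B z") for n
    proof (rule AE_I2)
      fix z
      have "\<bar>A b z\<bar> * \<bar>Dn b n z\<bar> \<le> \<bar>A b z\<bar> powr q / q + \<bar>moll (r n) (P b) z\<bar> / p"
        using abs_moll_le_Young[OF p q(1,2) Di[OF b], of "A b z" "r n" z] Pi[OF b]
        unfolding Dn_def P_def by simp
      from mult_left_mono[OF this C0] bd[of b z "dn n z" "Dn b n z"]
      show "?B z"
        by (simp add: algebra_simps)
    qed
    show "AE z in lebesgue. \<bar>A b z * (ddir 1 H (d z) * D b z)\<bar> \<le> C * (\<bar>A b z\<bar> powr q / q) + (C / p) * \<bar>P b z\<bar>"
      by (intro AE_I2 AD_le)
  qed
  have le: "(LINT z|lebesgue. g0 z * ((f (fst z) * \<omega> (snd z)) * H (dn n z))) +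
      c * (\<Sum>b\<in>Basis. LINT z|lebesgue. A b z * (ddir 1 H (dn n z) * Dn b n z)) \<le> 0" if n: "n \<ge> N" for n
  proof -
    have 1: "(LINT z:?S|lebesgue. g z * (f (fst z) * \<eta> n z)) = (LINT z|lebesgue. g0 z * ((f (fst z) * \<omega> (snd z)) * H (dn n z)))"
    proof -
      have "(LINT z:?S|lebesgue. g z * (f (fst z) * \<eta> n z)) = (LINT z|lebesgue. rst K0 g z * (f (fst z) * \<eta> n z))"
        by (rule set_integral_rst[OF KS(1)]) (simp add: \<eta>0[OF n])
      then show ?thesis by (simp add: g0_def \<eta>_def mult_ac)
    qed
    have 2: "(LINT z:?S|lebesgue. ((flux p (Vt z) - flux p (V z)) \<bullet> b) * (f (fst z) * ddir (b, 0) (\<eta> n) z)) =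
        (LINT z|lebesgue. A b z * (ddir 1 H (dn n z) * Dn b n z))" if b: "b \<in> Basis" for b
    proof -
      have "(LINT z:?S|lebesgue. ((flux p (Vt z) - flux p (V z)) \<bullet> b) * (f (fst z) * ddir (b, 0) (\<eta> n) z)) =
        (LINT z|lebesgue. rst K0 (\<lambda>z. (flux p (Vt z) - flux p (V z)) \<bullet> b) z * (f (fst z) * ddir (b, 0) (\<eta> n) z))"
        by (rule set_integral_rst[OF KS(1)]) (simp add: D\<eta>[OF n b])
      also have "\<dots> = (LINT z|lebesgue. A b z * (ddir 1 H (dn n z) * Dn b n z))"
        unfolding D\<eta>[OF n b] A_def by (intro Bochner_Integration.integral_cong) (auto simp: indicator_def)
      finally show ?thesis .
    qed
    show ?thesis using ineq[OF \<eta>t[OF n] \<eta>nn] unfolding 1 using 2 by simp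
  qed
  have lim: "(\<lambda>n. (LINT z|lebesgue. g0 z * ((f (fst z) * \<omega> (snd z)) * H (dn n z))) +
      c * (\<Sum>b\<in>Basis. LINT z|lebesgue. A b z * (ddir 1 H (dn n z) * Dn b n z))) \<longlonglongrightarrow>
      (LINT z|lebesgue. g0 z * ((f (fst z) * \<omega> (snd z)) * H (d z))) +
      c * (\<Sum>b\<in>Basis. LINT z|lebesgue. A b z * (ddir 1 H (d z) * D b z))"
    by (intro tendsto_add T1 tendsto_mult_left tendsto_sum T2)
  have tot: "(LINT z|lebesgue. g0 z * ((f (fst z) * \<omega> (snd z)) * H (d z))) +
      c * (\<Sum>b\<in>Basis. LINT z|lebesgue. A b z * (ddir 1 H (d z) * D b z)) \<le> 0"
    by (rule LIMSEQ_le_const2[OF lim]) (use le in blast)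
  have ADi: "integrable lebesgue (\<lambda>z. A b z * (ddir 1 H (d z) * D b z))" if b: "b \<in> Basis" for b
  proof (rule Bochner_Integration.integrable_bound)
    note [measurable] = Am[of b]
    have [measurable]: "D b \<in> borel_measurable lebesgue" using Di[OF b] by auto
    show "(\<lambda>z. A b z * (ddir 1 H (d z) * D b z)) \<in> borel_measurable lebesgue" by measurable
    show "integrable lebesgue (\<lambda>z. C * (\<bar>A b z\<bar> powr q / q) + (C / p) * \<bar>P b z\<bar>)"
      using Aq[OF b] Pi[OF b] by simp
    show "AE z in lebesgue. norm (A b z * (ddir 1 H (d z) * D b z)) \<le> norm (C * (\<bar>A b z\<bar> powr q / q) + (C / p) * \<bar>P b z\<bar>)"
      unfolding real_norm_def by (intro AE_I2 order_trans[OF AD_le abs_ge_self])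
  qed
  have "(\<Sum>b\<in>Basis. LINT z|lebesgue. A b z * (ddir 1 H (d z) * D b z)) =
      (LINT z|lebesgue. (\<Sum>b\<in>Basis. A b z * (ddir 1 H (d z) * D b z)))"
    by (rule Bochner_Integration.integral_sum[symmetric]) (rule ADi)
  also have "\<dots> \<ge> 0"
  proof (rule Bochner_Integration.integral_nonneg)
    fix z
    show "0 \<le> (\<Sum>b\<in>Basis. A b z * (ddir 1 H (d z) * D b z))"
    proof (cases "z \<in> K0")
      case True
      then have "z \<in> K1" using K01 by blast
      define F where "F = flux p (Vt z) - flux p (V z)"
      define G where "G = Vt z - V z"
      define k where "k = f (fst z) * \<omega> (snd z)"
      have AD: "A b z = (F \<bullet> b) * k" "D b z = G \<bullet> b" for b
        using True \<open>z \<in> K1\<close> by (simp_all only: A_def D_def F_def G_def k_def indicator_simps mult_1_left)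
      \<comment> \<open>Summing over the basis reassembles the inner product of the flux difference
        with the gradient difference.\<close>
      have "(\<Sum>b\<in>Basis. A b z * (ddir 1 H (d z) * D b z)) =
        k * ddir 1 H (d z) * (\<Sum>b\<in>Basis. (F \<bullet> b) * (G \<bullet> b))"
        unfolding AD sum_distrib_left by (intro sum.cong refl) (simp only: mult_ac)
      also have "\<dots> = k * ddir 1 H (d z) * (F \<bullet> G)"
        by (subst euclidean_inner[of F G]) (rule refl)
      also have "\<dots> \<ge> 0" unfolding k_def F_def G_def by (intro mult_nonneg_nonneg f(2) \<omega>(2) H(5) flux_monotone[OF p])
      finally show ?thesis .
    qed (simp add: A_def)
  qed
  finally have "0 \<le> c * (\<Sum>b\<in>Basis. LINT z|lebesgue. A b z * (ddir 1 H (d z) * D b z))"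
    using c by simp
  then have "(LINT z|lebesgue. g0 z * ((f (fst z) * \<omega> (snd z)) * H (d z))) \<le> 0"
    using tot by linarith
  moreover have "(LINT z:?S|lebesgue. g z * (f (fst z) * (\<omega> (snd z) * H (wt z - w z)))) =
      (LINT z|lebesgue. g0 z * ((f (fst z) * \<omega> (snd z)) * H (d z)))"
    unfolding set_lebesgue_integral_def
  proof (rule Bochner_Integration.integral_cong)
    fix z
    have "z \<in> K0 \<or> snd z \<notin> {a0..b0} \<or> snd z \<in> {a0..b0} \<and> R + 1 < norm (fst z)"
      by (auto simp: K0_def mem_Times_iff not_le)
    then consider "z \<in> K0" | "snd z \<notin> {a0..b0}" | "snd z \<in> {a0..b0}" "R + 1 < norm (fst z)"
      by blast
    then show "indicator ?S z *\<^sub>R (g z * (f (fst z) * (\<omega> (snd z) * H (wt z - w z)))) = g0 z * ((f (fst z) * \<omega> (snd z)) * H (d z))"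
    proof cases
      case 1
      then show ?thesis using K01 KS by (auto simp: g0_def d_def indicator_def)
    next
      case 2
      then show ?thesis by (simp add: \<omega>(3))
    next
      case 3
      have "wt (fst z, snd z) = 0" using 3 \<omega>(4) by (intro supp) auto
      then have "H (wt z - w z) = 0" using wpos[of z] by (intro H(2)) simp
      moreover have "z \<notin> K0" using 3 by (auto simp: K0_def)
      ultimately show ?thesis by (simp add: g0_def)
    qed
  qed simp
  ultimately show ?thesis by simp
qed

section \<open>Null sets, time slices and Fubini\<close>

lemma AE_lborel_slices:
  fixes A :: "('a::euclidean_space \<times> real) set"
  assumes "A \<in> sets borel"
  shows "(AE z in lborel. z \<notin> A) \<longleftrightarrow> (AE t in lborel. AE x in lborel. (x, t) \<notin> A)"
proof -
  let ?M = "(lborel :: 'a measure) \<Otimes>\<^sub>M (lborel :: real measure)"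
  have "{z \<in> space ?M. (fst z, snd z) \<notin> A} = - A" by (auto simp: space_pair_measure)
  moreover have "- A \<in> sets ?M" unfolding lborel_prod sets_lborel using assms by (rule borel_comp)
  ultimately have m: "{z \<in> space ?M. (fst z, snd z) \<notin> A} \<in> sets ?M" by simp
  have "(AE x in lborel. AE t in lborel. (x, t) \<notin> A) \<longleftrightarrow> (AE z in lborel. z \<notin> A)"
    using lborel_pair.AE_pair_iff[OF m] unfolding lborel_prod prod.collapse .
  then show ?thesis using lborel_pair.AE_commute[OF m] by blast
qed

lemma AE_lebesgue_slices:
  fixes P :: "'a::euclidean_space \<times> real \<Rightarrow> bool"
  assumes "AE z in lebesgue. P z"
  shows "AE t in lborel. AE x in lebesgue. P (x, t)"
proof -
  have "AE z in (lborel :: ('a \<times> real) measure). P z" using assms by (simp add: AE_completion_iff)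
  then obtain N where N: "{z. \<not> P z} \<subseteq> N" "emeasure lborel N = 0" "N \<in> sets (lborel :: ('a \<times> real) measure)"
    by (auto elim: AE_E)
  then have "AE z in lborel. z \<notin> N" by (intro AE_not_in) (simp add: null_sets_def)
  then have "AE t in lborel. AE x in lborel. (x, t) \<notin> N" using AE_lborel_slices[of N] N(3) by simp
  then show ?thesis
  proof eventually_elim
    case (elim t)
    then have "AE x in lborel. P (x, t)" by eventually_elim (use N(1) in blast)
    then show ?case by (rule AE_completion)
  qed
qed

text \<open>Passing from slices back to space-time is valid for measurable sets; callers supply a
  closed set or a set defined by a Borel representative.\<close>

lemma AE_lebesgue_from_slices:
  fixes A :: "('a::euclidean_space \<times> real) set"
  assumes A: "A \<in> sets borel" and ae: "AE t in lborel. AE x in lebesgue. (x, t) \<notin> A"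
  shows "AE z in lebesgue. z \<notin> A"
  using ae unfolding AE_completion_iff AE_lborel_slices[OF A, symmetric] .

text \<open>A Borel representative agrees with \<open>k\<close> on almost every slice, and this is
  enough to identify the inner integrals.\<close>

lemma Fubini_lebesgue:
  fixes k :: "'a::euclidean_space \<times> real \<Rightarrow> real"
  assumes k: "integrable lebesgue k" and y: "y \<in> borel_measurable borel"
    and ky: "\<And>t. (LINT x|lebesgue. k (x, t)) = y t"
    and km: "\<And>t. (\<lambda>x. k (x, t)) \<in> borel_measurable lebesgue"
  shows "(LINT z|lebesgue. k z) = (LINT t|lborel. y t)"
proof -
  obtain k' where k'[measurable]: "k' \<in> borel_measurable borel" and ae: "AE z in lebesgue. k z = k' z"
    using borel_representative k by blast
  have k'l: "k' \<in> borel_measurable lebesgue" by (simp add: measurable_completion)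
  have k'i: "integrable lebesgue k'" using integrable_cong_AE[OF _ k'l ae] k by auto
  then have k'p: "integrable ((lborel :: 'a measure) \<Otimes>\<^sub>M (lborel :: real measure)) k'"
    by (simp add: integrable_completion lborel_prod)
  then have k'p': "integrable ((lborel :: 'a measure) \<Otimes>\<^sub>M (lborel :: real measure)) (case_prod (\<lambda>x t. k' (x, t)))" by simp
  have "(LINT z|lebesgue. k z) = (LINT z|lebesgue. k' z)" by (rule integral_cong_AE[OF _ k'l ae]) (use k in auto)
  also have "\<dots> = (LINT z|((lborel :: 'a measure) \<Otimes>\<^sub>M (lborel :: real measure)). k' z)"
    by (simp add: integral_completion lborel_prod)
  also have "\<dots> = (LINT t|lborel. LINT x|lborel. k' (x, t))"
    using lborel_pair.integral_snd[OF k'p'] by simp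
  also have "\<dots> = (LINT t|lborel. y t)"
  proof (rule integral_cong_AE)
    show "(\<lambda>t. LINT x|lborel. k' (x, t)) \<in> borel_measurable lborel"
      using lborel_pair.integrable_snd[OF k'p'] by auto
    show "AE t in lborel. (LINT x|lborel. k' (x, t)) = y t"
      using AE_lebesgue_slices[OF ae]
    proof (rule AE_mp, intro AE_I2 impI)
      fix t :: real assume a: "AE x in lebesgue. k (x, t) = k' (x, t)"
      have b: "(\<lambda>x. k' (x, t)) \<in> borel_measurable borel" by measurable
      have "(LINT x|lborel. k' (x, t)) = (LINT x|lebesgue. k' (x, t))" using b by (simp add: integral_completion)
      also have "\<dots> = (LINT x|lebesgue. k (x, t))"
        by (rule integral_cong_AE) (use a b km in \<open>auto simp: measurable_completion\<close>)
      finally show "(LINT x|lborel. k' (x, t)) = y t" by (simp add: ky)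
    qed
  qed (use y in simp)
  finally show ?thesis .
qed

text \<open>The solution class gives nonnegativity on each time slice, whereas the comparison needs
  it almost everywhere in space-time; joint measurability bridges the two.\<close>

lemma AE_nonneg_spacetime:
  fixes U :: "'a::euclidean_space \<times> real \<Rightarrow> real"
  assumes m: "U \<in> borel_measurable (lebesgue_on spacetime)"
    and nn: "\<And>t. 0 \<le> t \<Longrightarrow> AE x in lebesgue. 0 \<le> U (x, t)"
  shows "AE z in lebesgue. z \<in> spacetime \<longrightarrow> 0 \<le> U z"
proof -
  let ?S = "spacetime :: ('a \<times> real) set"
  have "?S \<in> sets lebesgue"
    by (intro sets_completionI_sets) (simp add: borel_open open_spacetime)
  then have "(\<lambda>z. indicator ?S z *\<^sub>R U z) \<in> borel_measurable lebesgue"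
    using m by (subst (asm) borel_measurable_restrict_space_iff) auto
  then have "rst ?S U \<in> borel_measurable lebesgue" by simp
  then obtain U' where U'[measurable]: "U' \<in> borel_measurable borel" and ae: "AE z in lebesgue. rst ?S U z = U' z"
    by (rule borel_representative) (rule that)
  have "AE z in lebesgue. z \<notin> {z. U' z < 0}"
  proof (rule AE_lebesgue_from_slices)
    show "{z. U' z < 0} \<in> sets borel" by measurable
    show "AE t in lborel. AE x in lebesgue. (x, t) \<notin> {z. U' z < 0}"
      using AE_lebesgue_slices[OF ae]
    proof eventually_elim
      case a: (elim t)
      have "AE x in lebesgue. 0 \<le> rst ?S U (x, t)"
      proof (cases "0 < t")
        case True
        then show ?thesis using nn[of t] by (auto simp: indicator_def spacetime_def)
      qed (simp add: spacetime_def)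
      with a show "AE x in lebesgue. (x, t) \<notin> {z. U' z < 0}" by eventually_elim auto
    qed
  qed
  with ae show ?thesis by eventually_elim (auto simp: indicator_def not_less)
qed

text \<open>Since \<open>w\<close> equals its positive part, \<open>v\<close> and its restriction to
  \<open>w > 0\<close> are weak derivatives of the same function, and uniqueness identifies
  them.\<close>

lemma weak_ddir_zero_set:
  fixes w v :: "'b::euclidean_space \<Rightarrow> real"
  assumes S: "open S" and w: "weak_ddir S e w v" and nn: "\<And>z. 0 \<le> w z"
  shows "AE z in lebesgue. z \<in> S \<longrightarrow> w z = 0 \<longrightarrow> v z = 0"
proof -
  have "(\<lambda>z. max 0 (w z)) = w" using nn by (auto simp: max_def intro: order_antisym)
  then have "weak_ddir S e w (\<lambda>z. if w z > 0 then v z else 0)"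
    using weak_ddir_positive_part[OF S w] by simp
  from weak_ddir_unique[OF S w this] show ?thesis by eventually_elim auto
qed

text \<open>The flux has size \<open>|V|^(p-1)\<close>, which is at most
  \<open>1 + |V|^p\<close>.\<close>

lemma locally_L1_flux:
  fixes V :: "'b::euclidean_space \<Rightarrow> 'a::euclidean_space"
  assumes p: "1 < p" and V: "\<And>b. b \<in> Basis \<Longrightarrow> locally_L1 S (\<lambda>z. V z \<bullet> b)"
    and L: "locally_L1 S (\<lambda>z. norm (V z) powr p)" and b: "b \<in> Basis"
  shows "locally_L1 S (\<lambda>z. flux p (V z) \<bullet> b)"
proof (rule locally_L1_I)
  fix K assume K: "compact K" "K \<subseteq> S"
  have e: "rst K (\<lambda>z. flux p (V z) \<bullet> b) = (\<lambda>z. flux p (indicat_real K z *\<^sub>R V z) \<bullet> b)"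
    by (auto simp: indicator_def)
  note [measurable] = rst_vector_measurable[OF V K]
  have m: "(\<lambda>z. flux p (indicat_real K z *\<^sub>R V z) \<bullet> b) \<in> borel_measurable lebesgue" by measurable
  have iK: "integrable lebesgue (indicat_real K)" using lmeasurable_compact[OF K(1)] by (simp add: lmeasurable_iff_integrable)
  show "integrable lebesgue (rst K (\<lambda>z. flux p (V z) \<bullet> b))"
  proof (rule Bochner_Integration.integrable_bound)
    show "integrable lebesgue (\<lambda>z. indicat_real K z + rst K (\<lambda>z. norm (V z) powr p) z)"
      using iK locally_L1_rst[OF L K] by simp
    show "AE z in lebesgue. norm (rst K (\<lambda>z. flux p (V z) \<bullet> b) z) \<le> norm (indicat_real K z + rst K (\<lambda>z. norm (V z) powr p) z)"
      (is "AE z in _. ?B z")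
    proof (rule AE_I2)
      fix z
      have "\<bar>flux p (V z) \<bullet> b\<bar> \<le> norm (V z) powr (p - 1)" using Basis_le_norm[OF b, of "flux p (V z)"] by (simp add: norm_flux)
      also have "\<dots> \<le> 1 + norm (V z) powr p"
      proof (cases "norm (V z) \<le> 1")
        case True
        then have "norm (V z) powr (p - 1) \<le> 1" using p by (intro powr_le1) auto
        then show ?thesis using powr_ge_zero[of "norm (V z)" p] by linarith
      next
        case False
        then have "norm (V z) powr (p - 1) \<le> norm (V z) powr p" by (intro powr_mono) auto
        then show ?thesis by simp
      qed
      finally show "?B z"
        by (auto simp: indicator_def)
    qed
  qed (use m in \<open>simp add: e\<close>)
qed

text \<open>The powers of \<open>u\<close> cancel, because \<open>(1 - \<sigma>) (p - 1) = 1 - m\<close>.\<close>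

lemma equation_flux_eq:
  fixes V :: "'a::euclidean_space"
  assumes p: "1 < p" and k: "p + m - 3 > 0"
  defines "\<sigma> \<equiv> sigma p m"
  shows "(u powr (m - 1) * norm ((u powr (1 - \<sigma>) / \<sigma>) *\<^sub>R V) powr (p - 2)) *\<^sub>R ((u powr (1 - \<sigma>) / \<sigma>) *\<^sub>R V) =
    (if u = 0 then 0 else (1 / \<sigma>) powr (p - 1) *\<^sub>R flux p V)"
proof (cases "u = 0")
  case False
  have \<sigma>: "\<sigma> > 0" using p k by (simp add: \<sigma>_def sigma_def)
  have e: "(1 - \<sigma>) * (p - 1) = 1 - m" using p by (simp add: \<sigma>_def sigma_def field_simps)
  define c where "c = u powr (1 - \<sigma>) / \<sigma>"
  have c: "c > 0" using \<sigma> False by (simp add: c_def)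
  have "c powr (p - 2) * c = c powr (p - 2) * c powr 1" using c by simp
  also have "\<dots> = c powr (p - 1)" by (simp only: powr_add[symmetric]) simp
  also have "\<dots> = (u powr (1 - \<sigma>)) powr (p - 1) * (1 / \<sigma>) powr (p - 1)"
    unfolding c_def using \<sigma> by (simp add: powr_divide powr_one_eq_one)
  also have "(u powr (1 - \<sigma>)) powr (p - 1) = u powr (1 - m)" by (simp add: powr_powr e)
  finally have c1: "c powr (p - 2) * c = u powr (1 - m) * (1 / \<sigma>) powr (p - 1)" .
  have u1: "u powr (m - 1) * u powr (1 - m) = 1"
    using False by (simp only: powr_add[symmetric]) simp
  have "u powr (m - 1) * norm (c *\<^sub>R V) powr (p - 2) * c = u powr (m - 1) * (c powr (p - 2) * c) * norm V powr (p - 2)"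
    using c by (simp add: powr_mult)
  also have "\<dots> = (1 / \<sigma>) powr (p - 1) * norm V powr (p - 2)"
    unfolding c1 using u1 by (simp add: mult.assoc[symmetric])
  finally show ?thesis using False by (simp add: c_def flux_def)
qed simp

section \<open>The energy integral in terms of a weak time derivative\<close>

lemma solution_class_facts:
  fixes u :: "'a::euclidean_space \<Rightarrow> real \<Rightarrow> real"
  assumes sc: "solution_class p m f u V"
  shows "b \<in> Basis \<Longrightarrow> weak_ddir spacetime (b, 0) (\<lambda>z. u (fst z) (snd z) powr sigma p m) (\<lambda>z. V z \<bullet> b)"
    and "locally_L1 spacetime (\<lambda>z. norm (V z) powr p)"
    and "AE z in lebesgue. z \<in> spacetime \<longrightarrow> 0 \<le> u (fst z) (snd z)"
proof -
  have eq: "(\<lambda>(x, t). u x t powr sigma p m) = (\<lambda>z. u (fst z) (snd z) powr sigma p m)" by auto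
  have W: "weak_grad_x (\<lambda>z. u (fst z) (snd z) powr sigma p m) V" using sc by (simp add: solution_class_def eq)
  then show "b \<in> Basis \<Longrightarrow> weak_ddir spacetime (b, 0) (\<lambda>z. u (fst z) (snd z) powr sigma p m) (\<lambda>z. V z \<bullet> b)"
    using weak_grad_x_iff[of "\<lambda>z. u (fst z) (snd z) powr sigma p m" V] by (auto simp: weak_grad_x_def)
  show "locally_L1 spacetime (\<lambda>z. norm (V z) powr p)"
    using sc unfolding solution_class_def locally_Lp_def locally_L1_def by blast
  show "AE z in lebesgue. z \<in> spacetime \<longrightarrow> 0 \<le> u (fst z) (snd z)"
  proof (rule AE_nonneg_spacetime)
    show "(\<lambda>z. u (fst z) (snd z)) \<in> borel_measurable (lebesgue_on spacetime)"
      using sc by (simp add: solution_class_def case_prod_unfold)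
    show "AE x in lebesgue. 0 \<le> u (fst (x, t)) (snd (x, t))" if "0 \<le> t" for t
      using sc that by (simp add: solution_class_def)
  qed
qed

text \<open>The time derivative is moved from the test function onto \<open>u\<close>, and the
  gradient convention of \<open>energy_integral\<close> is replaced by the flux of \<open>V\<close>
  alone. The result is linear in \<open>v\<close> and in the flux, so that two such identities can
  be subtracted.\<close>

lemma energy_integral_eq:
  fixes u :: "'a::euclidean_space \<Rightarrow> real \<Rightarrow> real"
  assumes p: "1 < p" and k: "p + m - 3 > 0" and f: "continuous_on UNIV f"
    and sc: "solution_class p m f u V" and v: "weak_deriv_t (\<lambda>(x, t). u x t) v"
    and \<eta>: "test_function spacetime \<eta>"
  shows "energy_integral p m f u (grad_of_power p m u V) \<eta> =
    (LINT z:spacetime|lebesgue. v z * (f (fst z) * \<eta> z)) +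
    (1 / sigma p m) powr (p - 1) *
      (\<Sum>b\<in>Basis. LINT z:spacetime|lebesgue. (flux p (V z) \<bullet> b) * (f (fst z) * ddir (b, 0) \<eta> z))"
proof -
  let ?S = "spacetime :: ('a \<times> real) set"
  define U where "U z = u (fst z) (snd z)" for z
  define c where "c = (1 / sigma p m) powr (p - 1)"
  have sg: "sigma p m > 0" using p k by (simp add: sigma_def)
  obtain K where K: "compact K" "K \<subseteq> ?S" "\<And>z. z \<notin> K \<Longrightarrow> \<eta> z = 0" and \<eta>s: "smooth \<eta>"
    using \<eta> unfolding test_function_def by blast
  have D\<eta>0: "ddir e \<eta> z = 0" if "z \<notin> K" for z e
    by (rule ddir_outside_support[OF compact_imp_closed[OF K(1)] K(3) that])
  have cf: "continuous_on UNIV (\<lambda>z::'a \<times> real. f (fst z))"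
    by (rule continuous_on_compose2[OF f continuous_on_fst[OF continuous_on_id]]) simp
  have cD: "continuous_on UNIV (\<lambda>z. f (fst z) * ddir e \<eta> z)" for e
    by (intro continuous_on_mult cf smooth_continuous[OF smooth_ddir[OF \<eta>s]])
  have D0: "f (fst z) * ddir e \<eta> z = 0" if "z \<notin> K" for e z using D\<eta>0[OF that] by simp
  have wd: "weak_ddir ?S (0, 1) U v"
    using v unfolding weak_deriv_t_iff U_def by (simp add: case_prod_unfold)
  then have lU: "locally_L1 ?S U" by (simp add: weak_ddir_def)
  note wg = solution_class_facts(1)[OF sc]
  have lV: "locally_L1 ?S (\<lambda>z. V z \<bullet> b)" if "b \<in> Basis" for b using wg[OF that] by (simp add: weak_ddir_def)
  have lF: "locally_L1 ?S (\<lambda>z. flux p (V z) \<bullet> b)" if "b \<in> Basis" for b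
    by (rule locally_L1_flux[OF p lV solution_class_facts(2)[OF sc] that])
  \<comment> \<open>Where \<open>u = 0\<close> the convention makes the flux zero, while
    \<open>flux p (V z)\<close> need not vanish at a given point. Almost everywhere it does, because
    \<open>V\<close> vanishes on the zero set of \<open>u^\<sigma>\<close>.\<close>
  have "AE z in lebesgue. z \<in> ?S \<longrightarrow> U z powr sigma p m = 0 \<longrightarrow> V z \<bullet> b = 0" if "b \<in> Basis" for b
    using weak_ddir_zero_set[OF open_spacetime wg[OF that]] by (simp add: U_def)
  then have "AE z in lebesgue. \<forall>b\<in>Basis. z \<in> ?S \<longrightarrow> U z powr sigma p m = 0 \<longrightarrow> V z \<bullet> b = 0"
    by (subst AE_ball_countable) (auto intro: countable_finite)
  then have V0: "AE z in lebesgue. z \<in> ?S \<longrightarrow> U z = 0 \<longrightarrow> V z = 0"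
    by eventually_elim (use sg in \<open>auto simp: euclidean_all_zero_iff\<close>)
  define T where "T b z = rst K (\<lambda>z. flux p (V z) \<bullet> b) z * (f (fst z) * ddir (b, 0) \<eta> z)" for b z
  have Ti: "integrable lebesgue (T b)" if "b \<in> Basis" for b
    unfolding T_def by (rule continuous_rst_integrable[OF lF[OF that] K(1,2) cD D0])
  have Ui: "integrable lebesgue (\<lambda>z. rst K U z * (f (fst z) * ddir (0, 1) \<eta> z))"
    by (rule continuous_rst_integrable[OF lU K(1,2) cD D0])
  define X where "X z = indicator ?S z *\<^sub>R (case z of (x, t) \<Rightarrow>
          (- u x t * deriv_t \<eta> z
           + (u x t powr (m - 1) * norm (grad_of_power p m u V z) powr (p - 2)) *\<^sub>R grad_of_power p m u V z \<bullet> grad_x \<eta> z) * f x)" for z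
  define Y where "Y z = - (rst K U z * (f (fst z) * ddir (0, 1) \<eta> z)) + c * (\<Sum>b\<in>Basis. T b z)" for z
  have Yi: "integrable lebesgue Y" unfolding Y_def using Ui Ti by simp
  have XY: "AE z in lebesgue. X z = Y z"
    using V0
  proof eventually_elim
    case (elim z)
    obtain x t where z: "z = (x, t)" by (cases z)
    show "X z = Y z"
    proof (cases "z \<in> K")
      case True
      then have zS: "z \<in> ?S" using K by blast
      have "(u x t powr (m - 1) * norm (grad_of_power p m u V z) powr (p - 2)) *\<^sub>R grad_of_power p m u V z = c *\<^sub>R flux p (V z)"
      proof (cases "u x t = 0")
        case True
        then have "V z = 0" using elim zS by (simp add: U_def z)
        then show ?thesis by (simp add: grad_of_power_def z)
      next
        case False
        then show ?thesis
          using equation_flux_eq[OF p k, of "u x t" "V z"] by (simp add: grad_of_power_def z c_def)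
      qed
      note F = this
      have "X z = (- U z * ddir (0, 1) \<eta> z + ((u x t powr (m - 1) * norm (grad_of_power p m u V z) powr (p - 2)) *\<^sub>R
          grad_of_power p m u V z) \<bullet> grad_x \<eta> z) * f x"
        using zS by (simp add: X_def z U_def deriv_t_def)
      also have "\<dots> = (- U z * ddir (0, 1) \<eta> z + c * (flux p (V z) \<bullet> grad_x \<eta> z)) * f x"
        unfolding F inner_scaleR_left ..
      also have "flux p (V z) \<bullet> grad_x \<eta> z = (\<Sum>b\<in>Basis. (flux p (V z) \<bullet> b) * ddir (b, 0) \<eta> z)"
        by (subst euclidean_inner) (simp add: grad_x_inner)
      finally show ?thesis using True
        by (simp add: Y_def T_def z algebra_simps sum_distrib_left sum_distrib_right)
    next
      case False
      have "grad_x \<eta> z = 0" unfolding grad_x_def using D\<eta>0[OF False] by simp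
      then show ?thesis using False D\<eta>0[OF False]
        by (simp add: X_def Y_def T_def z deriv_t_def)
    qed
  qed
  \<comment> \<open>Measurability of the original integrand is inherited from \<open>Y\<close>
    through equality almost everywhere.\<close>
  have Xm: "X \<in> borel_measurable lebesgue"
    by (rule lebesgue_measurable_AE_cong[OF _ XY]) (use Yi in auto)
  have "energy_integral p m f u (grad_of_power p m u V) \<eta> = (LINT z|lebesgue. X z)"
    unfolding energy_integral_def set_lebesgue_integral_def X_def ..
  also have "\<dots> = (LINT z|lebesgue. Y z)" by (rule integral_cong_AE[OF Xm _ XY]) (use Yi in auto)
  also have "\<dots> = - (LINT z|lebesgue. rst K U z * (f (fst z) * ddir (0, 1) \<eta> z)) + c * (\<Sum>b\<in>Basis. LINT z|lebesgue. T b z)"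
    unfolding Y_def using Ui Ti by simp
  also have "(LINT z|lebesgue. rst K U z * (f (fst z) * ddir (0, 1) \<eta> z)) = (LINT z:?S|lebesgue. U z * (f (fst z) * ddir (0, 1) \<eta> z))"
    by (rule set_integral_rst[OF K(2) D0, symmetric])
  also have "\<dots> = - (LINT z:?S|lebesgue. v z * (f (fst z) * \<eta> z))"
    by (rule weak_ddir_time_weight[OF wd f \<eta>])
  also have "(\<Sum>b\<in>Basis. LINT z|lebesgue. T b z) =
      (\<Sum>b\<in>Basis. LINT z:?S|lebesgue. (flux p (V z) \<bullet> b) * (f (fst z) * ddir (b, 0) \<eta> z))"
    unfolding T_def by (intro sum.cong refl set_integral_rst[OF K(2) D0, symmetric])
  finally show ?thesis by (simp add: c_def)
qed

text \<open>If \<open>Y T\<close> exceeded \<open>Y a\<close>, a smooth plateau that rises just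
  after \<open>a\<close> and falls just before \<open>T\<close> would give a negative value in the
  inequality: the rise weighs values of \<open>Y\<close> near \<open>Y a\<close>, the fall those
  near \<open>Y T\<close>.\<close>

lemma nonincreasing_of_weak_inequality:
  fixes Y :: "real \<Rightarrow> real"
  assumes Y: "continuous_on UNIV Y"
    and weak: "\<And>\<omega> a b. smooth \<omega> \<Longrightarrow> (\<And>t. 0 \<le> \<omega> t) \<Longrightarrow> (\<And>t. t \<notin> {a..b} \<Longrightarrow> \<omega> t = 0) \<Longrightarrow> 0 < a \<Longrightarrow> b \<le> T \<Longrightarrow>
      0 \<le> (LINT t|lborel. ddir 1 \<omega> t * Y t)"
    and a: "0 < a" "a < T"
  shows "Y T \<le> Y a"
proof (rule ccontr)
  assume "\<not> Y T \<le> Y a"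
  \<comment> \<open>Two levels at the thirds of the gap separate the values of \<open>Y\<close> near
    \<open>a\<close> from those near \<open>T\<close>.\<close>
  define c1 where "c1 = Y a + (Y T - Y a) / 3"
  define c2 where "c2 = Y a + 2 * (Y T - Y a) / 3"
  have c: "Y a < c1" "c1 < c2" "c2 < Y T" using \<open>\<not> Y T \<le> Y a\<close> by (auto simp: c1_def c2_def field_simps)
  have ic: "isCont Y x" for x using Y by (simp add: continuous_on_eq_continuous_at)
  have "\<forall>\<^sub>F t in nhds a. Y t < c1"
    using order_tendstoD(2)[OF _ c(1)] ic[of a] unfolding isCont_def tendsto_at_iff_tendsto_nhds by blast
  then obtain d1 where d1: "d1 > 0" "\<And>t. dist t a < d1 \<Longrightarrow> Y t < c1" unfolding eventually_nhds_metric by blast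
  have "\<forall>\<^sub>F t in nhds T. c2 < Y t"
    using order_tendstoD(1)[OF _ c(3)] ic[of T] unfolding isCont_def tendsto_at_iff_tendsto_nhds by blast
  then obtain d2 where d2: "d2 > 0" "\<And>t. dist t T < d2 \<Longrightarrow> c2 < Y t" unfolding eventually_nhds_metric by blast
  define \<delta> where "\<delta> = min (min d1 d2) (T - a) / 3"
  have \<delta>: "0 < \<delta>" "\<delta> < d1" "\<delta> < d2" "a + \<delta> < T - \<delta>" using d1 d2 a by (auto simp: \<delta>_def min_def field_simps)
  have Y1: "Y t < c1" if "a \<le> t" "t \<le> a + \<delta>" for t using d1(2)[of t] that \<delta> by (simp add: dist_real_def)
  have Y2: "c2 < Y t" if "T - \<delta> \<le> t" "t \<le> T" for t using d2(2)[of t] that \<delta> by (simp add: dist_real_def)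
  obtain S C where "smooth_step S C" using exists_smooth_step by blast
  note S = smooth_stepD[OF this]
  define B where "B s t = S (- s / \<delta> + (1 / \<delta>) * t)" for s t
  define D where "D s t = (1 / \<delta>) * ddir 1 S ((t - s) / \<delta>)" for s t
  have Bs: "smooth (B s)" for s unfolding B_def by (rule smooth_affine(1)[OF S(1)])
  have DB: "ddir 1 (B s) t = D s t" for s t
    unfolding B_def D_def smooth_affine(2)[OF S(1)] by (simp add: diff_divide_distrib)
  have Bv: "B s t = S ((t - s) / \<delta>)" for s t by (simp add: B_def diff_divide_distrib)
  have D0: "0 \<le> D s t" for s t using \<delta>(1) S(7) by (simp add: D_def)
  have Dout: "D s t = 0" if "t \<notin> {s..s + \<delta>}" for s t
  proof -
    have "(t - s) / \<delta> \<le> 0 \<or> 1 \<le> (t - s) / \<delta>" using that \<delta>(1) by (auto simp: divide_le_0_iff le_divide_eq)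
    then show ?thesis using S(9) by (simp add: D_def)
  qed
  have Dc: "continuous_on UNIV (D s)" for s
    using smooth_continuous[OF smooth_ddir[OF Bs[of s]], of _ 1] unfolding DB .
  have "has_bochner_integral lborel (\<lambda>t. D s t * indicator {s..s + \<delta>} t) (B s (s + \<delta>) - B s s)" for s
    by (rule has_bochner_integral_FTC_Icc_nonneg)
      (use \<delta>(1) D0 Dc[of s] smooth_real_deriv[OF Bs[of s]] in
        \<open>auto simp: DB continuous_on_eq_continuous_at intro: borel_measurable_continuous_onI\<close>)
  moreover have "(\<lambda>t. D s t * indicator {s..s + \<delta>} t) = D s" for s using Dout by (auto simp: fun_eq_iff indicator_def)
  ultimately have "has_bochner_integral lborel (D s) 1" for s using \<delta>(1) S(2,3) by (simp add: Bv)
  then have I: "integrable lborel (D s)" "(LINT t|lborel. D s t) = 1" for s by (auto simp: has_bochner_integral_iff)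
  define \<omega> where "\<omega> t = B a t - B (T - \<delta>) t" for t
  have \<omega>s: "smooth \<omega>" unfolding \<omega>_def by (rule smooth_diff[OF Bs Bs])
  have \<omega>nn: "0 \<le> \<omega> t" for t
    unfolding \<omega>_def Bv using monoD[OF S(4), of "(t - (T - \<delta>)) / \<delta>" "(t - a) / \<delta>"] \<delta> by (simp add: divide_right_mono)
  have \<omega>0: "\<omega> t = 0" if "t \<notin> {a..T}" for t
  proof (cases "t < a")
    case True
    then show ?thesis using \<delta> by (simp add: \<omega>_def Bv S(2) divide_le_0_iff)
  next
    case False
    then show ?thesis using that \<delta> by (simp add: \<omega>_def Bv S(3) le_divide_eq)
  qed
  have D\<omega>: "ddir 1 \<omega> t = D a t - D (T - \<delta>) t" for t
    unfolding \<omega>_def DB[symmetric]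
    by (rule ddir_eq[OF has_derivative_diff[OF has_derivative_ddir[OF smooth_differentiable[OF Bs]]
            has_derivative_ddir[OF smooth_differentiable[OF Bs]]]])
  have pos: "0 \<le> (LINT t|lborel. ddir 1 \<omega> t * Y t)" by (rule weak[OF \<omega>s \<omega>nn \<omega>0 a(1)]) auto
  have key: "ddir 1 \<omega> t * Y t \<le> D a t * c1 - D (T - \<delta>) t * c2" for t
  proof -
    have "D a t * Y t \<le> D a t * c1"
      using Dout[of t a] Y1[of t] D0[of a t] by (cases "t \<in> {a..a + \<delta>}") (auto intro: mult_left_mono)
    moreover have "D (T - \<delta>) t * c2 \<le> D (T - \<delta>) t * Y t"
      using Dout[of t "T - \<delta>"] Y2[of t] D0[of "T - \<delta>" t] by (cases "t \<in> {T - \<delta>..T}") (auto intro: mult_left_mono)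
    ultimately show ?thesis by (simp add: D\<omega> left_diff_distrib)
  qed
  have cm: "continuous_on UNIV (\<lambda>t. ddir 1 \<omega> t * Y t)" unfolding D\<omega> by (intro continuous_intros Dc Y)
  have "integrable lebesgue (\<lambda>t. ddir 1 \<omega> t * Y t)"
    by (rule compact_support_integrable[OF cm, of "{a..T}"]) (use Dout \<delta> in \<open>auto simp: D\<omega>\<close>)
  then have i\<omega>: "integrable lborel (\<lambda>t. ddir 1 \<omega> t * Y t)"
    using borel_measurable_continuous_onI[OF cm] by (simp add: integrable_completion)
  have "(LINT t|lborel. ddir 1 \<omega> t * Y t) \<le> (LINT t|lborel. D a t * c1 - D (T - \<delta>) t * c2)"
    by (intro integral_mono i\<omega> key) (use I in simp)
  also have "\<dots> = c1 - c2" using I by simp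
  finally show False using pos c by simp
qed

lemma density_integrable_iff:
  fixes f h :: "'a::euclidean_space \<Rightarrow> real"
  assumes f: "continuous_on UNIV f" "\<And>x. 0 \<le> f x" and h: "h \<in> borel_measurable lebesgue"
  shows "integrable (weighted f) h \<longleftrightarrow> integrable lebesgue (\<lambda>x. f x * h x)"
    and "(LINT x|weighted f. h x) = (LINT x|lebesgue. f x * h x)"
proof -
  have [measurable]: "f \<in> borel_measurable lebesgue" by (rule continuous_lebesgue_measurable[OF f(1)])
  show "integrable (weighted f) h \<longleftrightarrow> integrable lebesgue (\<lambda>x. f x * h x)"
    unfolding weighted_def using integrable_density[OF h, of f] f(2) by simp
  show "(LINT x|weighted f. h x) = (LINT x|lebesgue. f x * h x)"
    unfolding weighted_def using integral_density[OF h, of f] f(2) by simp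
qed

lemma weighted_measurable:
  "h \<in> borel_measurable (weighted f) \<longleftrightarrow> h \<in> borel_measurable lebesgue"
  unfolding weighted_def by simp

text \<open>The weighted mass \<open>Y(t)\<close> of the positive part of \<open>ut - u\<close> is
  nonincreasing and starts at zero. The compact spatial support of \<open>ut\<close> confines this
  positive part to a fixed ball, so a cutoff \<open>\<kappa>\<close> equal to 1 there loses
  nothing.\<close>

theorem comparison_principle:
  fixes u ut :: "'a::euclidean_space \<Rightarrow> real \<Rightarrow> real"
  assumes p: "1 < p" and k: "p + m - 3 > 0"
    and f: "continuous_on UNIV f" and fpos: "\<And>x. 0 < f x"
    and u: "strong_solution p m f u"
    and ut: "weak_subsolution p m f ut" and vt: "weak_deriv_t (\<lambda>(x, t). ut x t) vt"
    and supp: "\<And>T. \<exists>R\<ge>0. \<forall>x t. 0 < t \<longrightarrow> t \<le> T \<longrightarrow> R \<le> norm x \<longrightarrow> ut x t = 0"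
    and init: "AE x in lebesgue. ut x 0 \<le> u x 0" and T: "0 < T"
  shows "AE x in lebesgue. ut x T \<le> u x T"
proof -
  let ?S = "spacetime :: ('a \<times> real) set"
  obtain V where V: "solution_class p m f u V" "\<And>\<eta>. test_function ?S \<eta> \<Longrightarrow>
      energy_integral p m f u (grad_of_power p m u V) \<eta> = 0"
    using u unfolding strong_solution_def weak_solution_def by blast
  obtain v where v: "weak_deriv_t (\<lambda>(x, t). u x t) v"
    using u unfolding strong_solution_def by blast
  obtain Vt where Vt: "solution_class p m f ut Vt" "\<And>\<eta>. test_function ?S \<eta> \<Longrightarrow> (\<And>z. 0 \<le> \<eta> z) \<Longrightarrow>
      energy_integral p m f ut (grad_of_power p m ut Vt) \<eta> \<le> 0"
    using ut unfolding weak_subsolution_def by blast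
  define \<sigma> where "\<sigma> = sigma p m"
  have \<sigma>: "\<sigma> > 0" using p k by (simp add: \<sigma>_def sigma_def)
  define c where "c = (1 / \<sigma>) powr (p - 1)"
  have c: "0 < c" using \<sigma> by (simp add: c_def)
  define U where "U z = u (fst z) (snd z)" for z
  define Ut where "Ut z = ut (fst z) (snd z)" for z
  define w where "w z = U z powr \<sigma>" for z
  define wt where "wt z = Ut z powr \<sigma>" for z
  define g where "g z = vt z - v z" for z
  have wgV: "weak_ddir ?S (b, 0) w (\<lambda>z. V z \<bullet> b)" if "b \<in> Basis" for b
    unfolding w_def U_def \<sigma>_def by (rule solution_class_facts(1)[OF V(1) that])
  have wgVt: "weak_ddir ?S (b, 0) wt (\<lambda>z. Vt z \<bullet> b)" if "b \<in> Basis" for b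
    unfolding wt_def Ut_def \<sigma>_def by (rule solution_class_facts(1)[OF Vt(1) that])
  note wg = wgV wgVt
  have lV: "locally_L1 ?S (\<lambda>z. V z \<bullet> b)" "locally_L1 ?S (\<lambda>z. Vt z \<bullet> b)" if "b \<in> Basis" for b
    using wgV[OF that] wgVt[OF that] by (auto simp: weak_ddir_def)
  note Lp = solution_class_facts(2)[OF V(1)] solution_class_facts(2)[OF Vt(1)]
  have lF1: "locally_L1 ?S (\<lambda>z. flux p (V z) \<bullet> b)" if "b \<in> Basis" for b
    by (rule locally_L1_flux[OF p lV(1) Lp(1) that])
  have lF2: "locally_L1 ?S (\<lambda>z. flux p (Vt z) \<bullet> b)" if "b \<in> Basis" for b
    by (rule locally_L1_flux[OF p lV(2) Lp(2) that])
  have td: "weak_ddir ?S (0, 1) U v" "weak_ddir ?S (0, 1) Ut vt"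
    using v vt unfolding weak_deriv_t_iff U_def Ut_def by (simp_all add: case_prod_unfold)
  have lv: "locally_L1 ?S v" "locally_L1 ?S vt" using td by (auto simp: weak_ddir_def)
  have lg: "locally_L1 ?S g" unfolding g_def by (rule locally_L1_diff[OF lv(2,1)])
  have cf: "continuous_on UNIV (\<lambda>z::'a \<times> real. f (fst z))"
    by (rule continuous_on_compose2[OF f continuous_on_fst[OF continuous_on_id]]) simp
  have f0: "0 \<le> f x" for x using fpos[of x] by simp
  \<comment> \<open>Both energies are rewritten with time derivatives, so that their difference has
    the shape required by the cutoff lemma.\<close>
  have ineq: "(LINT z:?S|lebesgue. g z * (f (fst z) * \<eta> z)) +
      c * (\<Sum>b\<in>Basis. LINT z:?S|lebesgue. ((flux p (Vt z) - flux p (V z)) \<bullet> b) * (f (fst z) * ddir (b, 0) \<eta> z)) \<le> 0"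
    if \<eta>: "test_function ?S \<eta>" and nn: "\<And>z. 0 \<le> \<eta> z" for \<eta>
  proof -
    obtain K where K: "compact K" "K \<subseteq> ?S" "\<And>z. z \<notin> K \<Longrightarrow> \<eta> z = 0" and \<eta>s: "smooth \<eta>"
      using \<eta> unfolding test_function_def by blast
    have c1: "continuous_on UNIV (\<lambda>z. f (fst z) * \<eta> z)" "continuous_on UNIV (\<lambda>z. f (fst z) * ddir e \<eta> z)" for e
      by (intro continuous_on_mult cf smooth_continuous[OF \<eta>s] smooth_continuous[OF smooth_ddir[OF \<eta>s]])+
    have z1: "f (fst z) * \<eta> z = 0" "f (fst z) * ddir e \<eta> z = 0" if "z \<notin> K" for z e
      using K(3)[OF that] ddir_outside_support[OF compact_imp_closed[OF K(1)] K(3) that] by simp_all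
    have 1: "(LINT z:?S|lebesgue. g z * (f (fst z) * \<eta> z)) =
        (LINT z:?S|lebesgue. vt z * (f (fst z) * \<eta> z)) - (LINT z:?S|lebesgue. v z * (f (fst z) * \<eta> z))"
      unfolding g_def by (rule set_integral_diff_continuous[OF lv(2,1) K(1,2) c1(1) z1(1)])
    have 2: "(LINT z:?S|lebesgue. ((flux p (Vt z) - flux p (V z)) \<bullet> b) * (f (fst z) * ddir (b, 0) \<eta> z)) =
        (LINT z:?S|lebesgue. (flux p (Vt z) \<bullet> b) * (f (fst z) * ddir (b, 0) \<eta> z)) -
        (LINT z:?S|lebesgue. (flux p (V z) \<bullet> b) * (f (fst z) * ddir (b, 0) \<eta> z))" if b: "b \<in> Basis" for b
      unfolding inner_diff_left by (rule set_integral_diff_continuous[OF lF2[OF b] lF1[OF b] K(1,2) c1(2) z1(2)])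
    have "(LINT z:?S|lebesgue. g z * (f (fst z) * \<eta> z)) +
      c * (\<Sum>b\<in>Basis. LINT z:?S|lebesgue. ((flux p (Vt z) - flux p (V z)) \<bullet> b) * (f (fst z) * ddir (b, 0) \<eta> z)) =
      energy_integral p m f ut (grad_of_power p m ut Vt) \<eta> - energy_integral p m f u (grad_of_power p m u V) \<eta>"
      unfolding energy_integral_eq[OF p k f V(1) v \<eta>] energy_integral_eq[OF p k f Vt(1) vt \<eta>] 1
        c_def \<sigma>_def
      using 2 by (simp add: sum_subtractf right_diff_distrib)
    then show ?thesis using V(2)[OF \<eta>] Vt(2)[OF \<eta> nn] by simp
  qed
  obtain R where R: "0 \<le> R" "\<And>x t. 0 < t \<Longrightarrow> t \<le> T + 1 \<Longrightarrow> R \<le> norm x \<Longrightarrow> ut x t = 0"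
    using supp[of "T + 1"] by blast
  have wt0: "wt (x, t) = 0" if "0 < t" "t \<le> T + 1" "R \<le> norm x" for x t
    using R(2)[OF that] by (simp add: wt_def Ut_def)
  have w0: "0 \<le> w z" for z by (simp add: w_def)
  have U0: "AE z in lebesgue. z \<in> ?S \<longrightarrow> 0 \<le> U z" and Ut0: "AE z in lebesgue. z \<in> ?S \<longrightarrow> 0 \<le> Ut z"
    using solution_class_facts(3)[OF V(1)] solution_class_facts(3)[OF Vt(1)] by (auto simp: U_def Ut_def)
  obtain S C where "smooth_step S C" using exists_smooth_step by blast
  note S = smooth_stepD[OF this]
  \<comment> \<open>Steps of width \<open>1/(n+1)\<close>; in the limit they become the indicator of
    the set where \<open>wt > w\<close>.\<close>
  define H where "H n x = S (0 + real (Suc n) * x)" for n x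
  have Hs: "smooth (H n)" for n unfolding H_def by (rule smooth_affine(1)[OF S(1)])
  have DH: "ddir 1 (H n) x = real (Suc n) * ddir 1 S (0 + real (Suc n) * x)" for n x
    unfolding H_def by (rule smooth_affine(2)[OF S(1)])
  have Hlim: "(\<lambda>n. H n x) \<longlonglongrightarrow> (if x > 0 then 1 else 0)" for x
    using step_tendsto[of S 1 x, OF S(2,3)] by (simp add: H_def)
  define \<kappa> where "\<kappa> x = S ((R + 2)\<^sup>2 - x \<bullet> x)" for x :: 'a
  have \<kappa>s: "smooth \<kappa>" unfolding \<kappa>_def by (rule smooth_compose[OF S(1) smooth_diff[OF smooth_const smooth_inner_self]])
  have \<kappa>01: "0 \<le> \<kappa> x" "\<kappa> x \<le> 1" for x by (simp_all add: \<kappa>_def S(5,6))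
  have \<kappa>1: "\<kappa> x = 1" if "norm x \<le> R" for x
  proof -
    have "x \<bullet> x \<le> R\<^sup>2" using that by (simp add: power2_norm_eq_inner[symmetric] power_mono)
    then show ?thesis unfolding \<kappa>_def using R(1) by (intro S(3)) (simp add: power2_eq_square algebra_simps)
  qed
  have \<kappa>0: "\<kappa> x = 0" if "x \<notin> cball 0 (R + 2)" for x
  proof -
    have "(R + 2)\<^sup>2 \<le> (norm x)\<^sup>2" using that R(1) by (intro power_mono) auto
    then show ?thesis unfolding \<kappa>_def by (intro S(2)) (simp add: power2_norm_eq_inner)
  qed
  define P where "P z = max 0 (Ut z - U z)" for z
  have Pd: "weak_ddir ?S (0, 1) P (\<lambda>z. if Ut z - U z > 0 then g z else 0)"
    unfolding P_def g_def by (rule weak_ddir_positive_part[OF open_spacetime weak_ddir_diff[OF td(2,1)]])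
  have lP: "locally_L1 ?S P" using Pd by (simp add: weak_ddir_def)
  \<comment> \<open>For each \<open>n\<close> the cutoff lemma bounds the time term. As
    \<open>n\<close> grows, this term becomes the time derivative of the positive part
    \<open>P\<close> tested with \<open>\<omega>(t) \<kappa>(x)\<close>, and that derivative is then
    moved onto \<open>\<omega>\<close>.\<close>
  have energy: "0 \<le> (LINT z:?S|lebesgue. P z * (f (fst z) * (\<kappa> (fst z) * ddir 1 \<omega> (snd z))))"
    if \<omega>: "smooth \<omega>" "\<And>t. 0 \<le> \<omega> t" "\<And>t. t \<notin> {a..b} \<Longrightarrow> \<omega> t = 0" "0 < a" "b \<le> T" for \<omega> a b
  proof -
    define K where "K = (cball 0 (R + 2) :: 'a set) \<times> {a..b}"
    have K: "compact K" "K \<subseteq> ?S" using \<omega>(4) by (auto simp: K_def spacetime_def intro: compact_Times)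
    have \<omega>s: "smooth (\<lambda>z::'a \<times> real. \<omega> (snd z))"
      using smooth_compose_linear[OF bounded_linear_snd \<omega>(1), of 0] by simp
    have \<kappa>s': "smooth (\<lambda>z::'a \<times> real. \<kappa> (fst z))"
      using smooth_compose_linear[OF bounded_linear_fst \<kappa>s, of 0] by simp
    have cf\<omega>: "continuous_on UNIV (\<lambda>z::'a \<times> real. f (fst z) * \<omega> (snd z))"
      by (intro continuous_on_mult cf smooth_continuous[OF \<omega>s])
    have le: "(LINT z:?S|lebesgue. g z * (f (fst z) * (\<omega> (snd z) * H n (wt z - w z)))) \<le> 0" for n
    proof -
      have h1: "wt (x, t) = 0" if "0 < t" "t \<le> b + 1" "R \<le> norm x" for x t
        using that \<omega>(5) by (intro wt0) auto
      have h2: "H n x = 0" if "x \<le> 0" for x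
        unfolding H_def using that by (intro S(2)) (simp add: mult_le_0_iff del: of_nat_Suc)
      have h3: "0 \<le> H n x" for x by (simp add: H_def S(5,6))
      have h4: "H n x \<le> 1" for x by (simp add: H_def S(5,6))
      have h5: "0 \<le> ddir 1 (H n) x" for x unfolding DH by (intro mult_nonneg_nonneg S(7)) simp
      have h6: "ddir 1 (H n) x \<le> real (Suc n) * C" for x unfolding DH by (intro mult_left_mono S(8)) simp
      show ?thesis
        by (rule comparison_smooth_cutoff[OF p f f0 c wgVt wgV Lp(2) Lp(1) lg ineq w0 R(1) h1 \<omega>(1-4) Hs h2 h3 h4 h5 h6])
    qed
    define g0 where "g0 = rst K g"
    have g0i: "integrable lebesgue g0" unfolding g0_def by (rule locally_L1_rst[OF lg K])
    have wm: "rst K w \<in> borel_measurable lebesgue" "rst K wt \<in> borel_measurable lebesgue"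
    proof -
      have "(SOME b. b \<in> (Basis :: 'a set)) \<in> Basis" by (rule someI_ex) (use nonempty_Basis in blast)
      then have "locally_L1 ?S w" "locally_L1 ?S wt" using wg by (auto simp: weak_ddir_def)
      then show "rst K w \<in> borel_measurable lebesgue" "rst K wt \<in> borel_measurable lebesgue"
        using locally_L1_rst[OF _ K] by auto
    qed
    have [measurable]: "g0 \<in> borel_measurable lebesgue" using g0i by auto
    have [measurable]: "(\<lambda>z::'a \<times> real. f (fst z) * \<omega> (snd z)) \<in> borel_measurable lebesgue"
      by (rule continuous_lebesgue_measurable[OF cf\<omega>])
    define d where "d z = rst K wt z - rst K w z" for z
    have [measurable]: "d \<in> borel_measurable lebesgue" unfolding d_def using wm by measurable
    have [measurable]: "H n \<in> borel_measurable borel" for n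
      by (rule borel_measurable_continuous_onI[OF smooth_continuous[OF Hs]])
    obtain M where M: "\<And>z. z \<in> K \<Longrightarrow> \<bar>f (fst z) * \<omega> (snd z)\<bar> \<le> M"
      using compact_imp_bounded[OF compact_continuous_image[OF continuous_on_subset[OF cf\<omega>, of K] K(1)]]
      unfolding bounded_iff by auto
    have eqK: "(LINT z:?S|lebesgue. g z * (f (fst z) * (\<omega> (snd z) * \<phi> (wt z - w z)))) =
        (LINT z|lebesgue. g0 z * ((f (fst z) * \<omega> (snd z)) * \<phi> (d z)))" if \<phi>: "\<And>x. x \<le> 0 \<Longrightarrow> \<phi> x = 0" for \<phi>
      unfolding set_lebesgue_integral_def
    proof (rule Bochner_Integration.integral_cong)
      fix z
      have "z \<in> K \<or> snd z \<notin> {a..b} \<or> snd z \<in> {a..b} \<and> R + 2 < norm (fst z)"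
        by (auto simp: K_def mem_Times_iff not_le)
      then consider "z \<in> K" | "snd z \<notin> {a..b}" | "snd z \<in> {a..b}" "R + 2 < norm (fst z)" by blast
      then show "indicator ?S z *\<^sub>R (g z * (f (fst z) * (\<omega> (snd z) * \<phi> (wt z - w z)))) = g0 z * ((f (fst z) * \<omega> (snd z)) * \<phi> (d z))"
      proof cases
        case 1
        then have "z \<in> ?S" using K by blast
        then show ?thesis using 1 by (simp add: g0_def d_def)
      next
        case 2
        then show ?thesis by (simp add: \<omega>(3))
      next
        case 3
        have "wt (fst z, snd z) = 0" using 3 \<omega>(4,5) by (intro wt0) auto
        then have "\<phi> (wt z - w z) = 0" using w0[of z] by (intro \<phi>) simp
        moreover have "z \<notin> K" using 3 by (auto simp: K_def)
        ultimately show ?thesis by (simp add: g0_def)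
      qed
    qed simp
    have "(\<lambda>n. LINT z|lebesgue. g0 z * ((f (fst z) * \<omega> (snd z)) * H n (d z))) \<longlonglongrightarrow>
        (LINT z|lebesgue. g0 z * ((f (fst z) * \<omega> (snd z)) * (if d z > 0 then 1 else 0)))"
    proof (rule integral_dominated_convergence[where w="\<lambda>z. M * \<bar>g0 z\<bar>"])
      show "AE z in lebesgue. (\<lambda>n. g0 z * ((f (fst z) * \<omega> (snd z)) * H n (d z))) \<longlonglongrightarrow>
          g0 z * ((f (fst z) * \<omega> (snd z)) * (if d z > 0 then 1 else 0))"
        by (intro AE_I2 tendsto_mult_left Hlim)
      show "AE z in lebesgue. norm (g0 z * ((f (fst z) * \<omega> (snd z)) * H n (d z))) \<le> M * \<bar>g0 z\<bar>"
        (is "AE z in _. ?B z") for n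
      proof (rule AE_I2)
        fix z show "?B z"
        proof (cases "z \<in> K")
          case True
          have M0: "0 \<le> M" using M[OF True] by linarith
          have "\<bar>H n (d z)\<bar> \<le> 1" using S(5,6) by (simp add: H_def)
          then have "\<bar>g0 z\<bar> * (\<bar>f (fst z) * \<omega> (snd z)\<bar> * \<bar>H n (d z)\<bar>) \<le> \<bar>g0 z\<bar> * (M * 1)"
            using M[OF True] M0 by (intro mult_left_mono mult_mono) auto
          then show ?thesis by (simp add: abs_mult mult_ac)
        qed (simp add: g0_def)
      qed
    qed (use g0i in simp_all)
    moreover have "(LINT z|lebesgue. g0 z * ((f (fst z) * \<omega> (snd z)) * H n (d z))) \<le> 0" for n
    proof -
      have "H n x = 0" if "x \<le> 0" for x
        unfolding H_def using that by (intro S(2)) (simp add: mult_le_0_iff del: of_nat_Suc)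
      then show ?thesis using le[of n] eqK[of "H n"] by simp
    qed
    ultimately have lim0: "(LINT z|lebesgue. g0 z * ((f (fst z) * \<omega> (snd z)) * (if d z > 0 then 1 else 0))) \<le> 0"
      by (intro LIMSEQ_le_const2) auto
    define \<zeta> where "\<zeta> z = \<omega> (snd z) * \<kappa> (fst z)" for z :: "'a \<times> real"
    have \<zeta>0: "\<zeta> z = 0" if "z \<notin> K" for z
      using that \<omega>(3)[of "snd z"] \<kappa>0[of "fst z"] by (auto simp: \<zeta>_def K_def mem_Times_iff)
    have \<zeta>t: "test_function ?S \<zeta>"
      by (rule test_functionI[OF _ K \<zeta>0]) (unfold \<zeta>_def, rule smooth_mult[OF \<omega>s \<kappa>s'])
    have D\<zeta>: "ddir (0, 1) \<zeta> z = \<kappa> (fst z) * ddir 1 \<omega> (snd z)" for z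
    proof -
      have 1: "((\<lambda>z. \<omega> (snd z)) has_derivative (\<lambda>u. ddir 1 \<omega> (snd z) * snd u)) (at z)"
        using has_derivative_compose[OF has_derivative_snd[OF has_derivative_ident]
            smooth_real_deriv[OF \<omega>(1), unfolded has_field_derivative_def]] .
      have gd: "(\<kappa> has_derivative (\<lambda>v. ddir v \<kappa> (fst z))) (at (fst z))"
        by (rule has_derivative_ddir[OF smooth_differentiable[OF \<kappa>s]])
      have 2: "((\<lambda>z::'a \<times> real. \<kappa> (fst z)) has_derivative (\<lambda>u. ddir (fst u) \<kappa> (fst z))) (at z)"
        by (rule has_derivative_compose[OF has_derivative_fst[OF has_derivative_ident] gd])
      have "ddir (0, 1) \<zeta> z = \<omega> (snd z) * ddir (fst (0::'a, 1::real)) \<kappa> (fst z) + (ddir 1 \<omega> (snd z) * snd (0::'a, 1::real)) * \<kappa> (fst z)"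
        unfolding \<zeta>_def by (rule ddir_eq[OF has_derivative_mult[OF 1 2]])
      moreover have "ddir (0::'a) \<kappa> (fst z) = 0" using linear_0[OF has_derivative_linear[OF gd]] .
      ultimately show ?thesis by simp
    qed
    have "(LINT z:?S|lebesgue. P z * (f (fst z) * ddir (0, 1) \<zeta> z)) =
        - (LINT z:?S|lebesgue. (if Ut z - U z > 0 then g z else 0) * (f (fst z) * \<zeta> z))"
      by (rule weak_ddir_time_weight[OF Pd f \<zeta>t])
    also have "(LINT z:?S|lebesgue. (if Ut z - U z > 0 then g z else 0) * (f (fst z) * \<zeta> z)) =
        (LINT z|lebesgue. rst K (\<lambda>z. if Ut z - U z > 0 then g z else 0) z * (f (fst z) * \<zeta> z))"
      by (rule set_integral_rst[OF K(2)]) (simp add: \<zeta>0)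
    also have "\<dots> = (LINT z|lebesgue. g0 z * ((f (fst z) * \<omega> (snd z)) * (if d z > 0 then 1 else 0)))"
    proof (rule integral_cong_AE)
      have "continuous_on UNIV (\<lambda>z. f (fst z) * \<zeta> z)"
        by (intro continuous_on_mult cf smooth_continuous) (use \<zeta>t in \<open>simp add: test_function_def\<close>)
      moreover have "locally_L1 ?S (\<lambda>z. if Ut z - U z > 0 then g z else 0)" using Pd by (simp add: weak_ddir_def)
      ultimately show "(\<lambda>z. rst K (\<lambda>z. if Ut z - U z > 0 then g z else 0) z * (f (fst z) * \<zeta> z)) \<in> borel_measurable lebesgue"
        using continuous_rst_integrable[OF _ K, of "\<lambda>z. if Ut z - U z > 0 then g z else 0" "\<lambda>z. f (fst z) * \<zeta> z"] \<zeta>0 by auto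
      show "(\<lambda>z. g0 z * ((f (fst z) * \<omega> (snd z)) * (if d z > 0 then 1 else 0))) \<in> borel_measurable lebesgue"
        by measurable
      show "AE z in lebesgue. rst K (\<lambda>z. if Ut z - U z > 0 then g z else 0) z * (f (fst z) * \<zeta> z) =
          g0 z * ((f (fst z) * \<omega> (snd z)) * (if d z > 0 then 1 else 0))"
        using U0 Ut0
      proof eventually_elim
        case (elim z)
        show ?case
        proof (cases "z \<in> K")
          case True
          then have zS: "z \<in> ?S" using K by blast
          have nn: "0 \<le> U z" "0 \<le> Ut z" using elim zS by auto
          \<comment> \<open>The cutoff compares the powers; monotonicity of
            \<open>s \<mapsto> s powr \<sigma>\<close> on nonnegative numbers transfers the sign to
            \<open>ut - u\<close> itself.\<close>
          have iff: "(Ut z - U z > 0) = (d z > 0)"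
          proof
            assume "Ut z - U z > 0"
            then have "U z powr \<sigma> < Ut z powr \<sigma>" using nn \<sigma> by (intro powr_less_mono2) auto
            then show "d z > 0" using True by (simp add: d_def w_def wt_def)
          next
            assume "d z > 0"
            then have "\<not> Ut z powr \<sigma> \<le> U z powr \<sigma>" using True by (simp add: d_def w_def wt_def)
            then have "\<not> Ut z \<le> U z" using powr_mono2[of \<sigma> "Ut z" "U z"] nn \<sigma> by auto
            then show "Ut z - U z > 0" by simp
          qed
          show ?thesis
          proof (cases "d z > 0")
            case dz: True
            have "norm (fst z) \<le> R"
            proof (rule ccontr)
              assume "\<not> norm (fst z) \<le> R"
              then have "ut (fst z) (snd z) = 0" using zS True \<omega>(4,5)
                by (intro R(2)) (auto simp: K_def mem_Times_iff)
              then show False using iff dz nn by (simp add: Ut_def)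
            qed
            then have "\<kappa> (fst z) = 1" by (rule \<kappa>1)
            then show ?thesis using dz iff True by (simp add: g0_def \<zeta>_def mult_ac)
          next
            case False
            then show ?thesis using iff by simp
          qed
        qed (simp add: g0_def)
      qed
    qed
    finally show ?thesis using lim0 unfolding D\<zeta> by simp
  qed
  have um: "(\<lambda>x. u x t) \<in> borel_measurable lebesgue" "(\<lambda>x. ut x t) \<in> borel_measurable lebesgue" if "0 \<le> t" for t
  proof -
    have "integrable (weighted f) (\<lambda>x. u x t)" "integrable (weighted f) (\<lambda>x. ut x t)"
      using V(1) Vt(1) that by (auto simp: solution_class_def continuous_in_L1_def)
    then show "(\<lambda>x. u x t) \<in> borel_measurable lebesgue" "(\<lambda>x. ut x t) \<in> borel_measurable lebesgue"
      using weighted_measurable by (auto dest: borel_measurable_integrable)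
  qed
  have ui: "integrable (weighted f) (\<lambda>x. u x t)" "integrable (weighted f) (\<lambda>x. ut x t)" if "0 \<le> t" for t
    using V(1) Vt(1) that by (auto simp: solution_class_def continuous_in_L1_def)
  define q where "q t x = \<kappa> x * max 0 (ut x t - u x t)" for t x
  have \<kappa>m[measurable]: "\<kappa> \<in> borel_measurable lebesgue" by (rule continuous_lebesgue_measurable[OF smooth_continuous[OF \<kappa>s]])
  have qm: "q t \<in> borel_measurable lebesgue" if "0 \<le> t" for t
  proof -
    note [measurable] = um[OF that]
    show ?thesis unfolding q_def by measurable
  qed
  have qi: "integrable (weighted f) (q t)" if "0 \<le> t" for t
  proof (rule Bochner_Integration.integrable_bound)
    show "integrable (weighted f) (\<lambda>x. \<bar>ut x t\<bar> + \<bar>u x t\<bar>)" using ui[OF that] by simp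
    show "q t \<in> borel_measurable (weighted f)" using qm[OF that] weighted_measurable by blast
    show "AE x in weighted f. norm (q t x) \<le> norm (\<bar>ut x t\<bar> + \<bar>u x t\<bar>)"
      (is "AE x in _. ?B x")
    proof (rule AE_I2)
      fix x
      have "\<kappa> x * max 0 (ut x t - u x t) \<le> 1 * (\<bar>ut x t\<bar> + \<bar>u x t\<bar>)"
        using \<kappa>01[of x] by (intro mult_mono) auto
      then show "?B x"
        using \<kappa>01[of x] by (simp add: q_def abs_mult)
    qed
  qed
  define Y where "Y t = (LINT x|weighted f. q t x)" for t
  have Ycont: "continuous_on {0..} Y"
    unfolding continuous_on_def
  proof
    fix s :: real assume "s \<in> {0..}"
    then have s: "0 \<le> s" by simp
    define A where "A t = (LINT x|weighted f. \<bar>ut x t - ut x s\<bar>) + (LINT x|weighted f. \<bar>u x t - u x s\<bar>)" for t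
    have A: "(A \<longlongrightarrow> 0) (at s within {0..})"
      unfolding A_def
    proof (rule tendsto_add_zero)
      show "((\<lambda>t. LINT x|weighted f. \<bar>ut x t - ut x s\<bar>) \<longlongrightarrow> 0) (at s within {0..})"
        using Vt(1) s unfolding solution_class_def continuous_in_L1_def by blast
      show "((\<lambda>t. LINT x|weighted f. \<bar>u x t - u x s\<bar>) \<longlongrightarrow> 0) (at s within {0..})"
        using V(1) s unfolding solution_class_def continuous_in_L1_def by blast
    qed
    have "norm (Y t - Y s) \<le> A t" if t: "0 \<le> t" for t
    proof -
      have "norm (Y t - Y s) = \<bar>LINT x|weighted f. q t x - q s x\<bar>"
        unfolding Y_def using qi[OF t] qi[OF s] by simp
      also have "\<dots> \<le> (LINT x|weighted f. \<bar>q t x - q s x\<bar>)" by (rule integral_abs_bound)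
      also have "\<dots> \<le> (LINT x|weighted f. \<bar>ut x t - ut x s\<bar> + \<bar>u x t - u x s\<bar>)"
      proof (rule integral_mono)
        show "integrable (weighted f) (\<lambda>x. \<bar>q t x - q s x\<bar>)" using qi[OF t] qi[OF s] by simp
        show "integrable (weighted f) (\<lambda>x. \<bar>ut x t - ut x s\<bar> + \<bar>u x t - u x s\<bar>)" using ui[OF t] ui[OF s] by simp
        fix x
        have "\<bar>q t x - q s x\<bar> = \<kappa> x * \<bar>max 0 (ut x t - u x t) - max 0 (ut x s - u x s)\<bar>"
          using \<kappa>01[of x] by (simp add: q_def abs_mult flip: right_diff_distrib)
        also have "\<dots> \<le> 1 * (\<bar>ut x t - ut x s\<bar> + \<bar>u x t - u x s\<bar>)"
          using \<kappa>01[of x] by (intro mult_mono) auto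
        finally show "\<bar>q t x - q s x\<bar> \<le> \<bar>ut x t - ut x s\<bar> + \<bar>u x t - u x s\<bar>" by simp
      qed
      also have "\<dots> = A t" unfolding A_def using ui[OF t] ui[OF s] by (intro Bochner_Integration.integral_add) auto
      finally show ?thesis .
    qed
    then have "((\<lambda>t. Y t - Y s) \<longlongrightarrow> 0) (at s within {0..})"
      by (intro Lim_null_comparison[OF _ A]) (auto simp: eventually_at_filter)
    then show "(Y \<longlongrightarrow> Y s) (at s within {0..})" by (simp add: LIM_zero_iff)
  qed
  \<comment> \<open>Extended constantly to negative times so as to be continuous on the whole line;
    the test functions see positive times only.\<close>
  define Y1 where "Y1 t = Y (max 0 t)" for t
  have Y1c: "continuous_on UNIV Y1"
    unfolding Y1_def by (rule continuous_on_compose2[OF Ycont]) (auto intro!: continuous_intros)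
  have Y0: "Y 0 = 0"
  proof -
    have "AE x in lebesgue. f x * q 0 x = 0"
      using init by eventually_elim (simp add: q_def)
    then have "(LINT x|lebesgue. f x * q 0 x) = 0" by (rule integral_eq_zero_AE)
    then show ?thesis unfolding Y_def density_integrable_iff(2)[OF f f0 qm[OF order_refl]] .
  qed
  have Ynn: "0 \<le> Y t" for t
    unfolding Y_def q_def using \<kappa>01 by (intro Bochner_Integration.integral_nonneg mult_nonneg_nonneg) auto
  have weak: "0 \<le> (LINT t|lborel. ddir 1 \<omega> t * Y1 t)"
    if \<omega>: "smooth \<omega>" "\<And>t. 0 \<le> \<omega> t" "\<And>t. t \<notin> {a..b} \<Longrightarrow> \<omega> t = 0" "0 < a" "b \<le> T" for \<omega> a b
  proof -
    have D\<omega>0: "ddir 1 \<omega> t = 0" if "t \<notin> {a..b}" for t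
      by (rule ddir_outside_support[OF _ \<omega>(3) that]) auto
    define K where "K = (cball 0 (R + 2) :: 'a set) \<times> {a..b}"
    have K: "compact K" "K \<subseteq> ?S" using \<omega>(4) by (auto simp: K_def spacetime_def intro: compact_Times)
    define \<phi> where "\<phi> z = f (fst z) * (\<kappa> (fst z) * ddir 1 \<omega> (snd z))" for z :: "'a \<times> real"
    have \<phi>c: "continuous_on UNIV \<phi>"
    proof -
      have "smooth (\<lambda>z::'a \<times> real. \<kappa> (fst z))" "smooth (\<lambda>z::'a \<times> real. ddir 1 \<omega> (snd z))"
        using smooth_compose_linear[OF bounded_linear_fst \<kappa>s, of 0]
          smooth_compose_linear[OF bounded_linear_snd smooth_ddir[OF \<omega>(1), of 1], of 0] by simp_all
      then show ?thesis unfolding \<phi>_def by (intro continuous_on_mult cf smooth_continuous)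
    qed
    have \<phi>0: "\<phi> z = 0" if "z \<notin> K" for z
      using that D\<omega>0[of "snd z"] \<kappa>0[of "fst z"] by (auto simp: \<phi>_def K_def mem_Times_iff)
    have e: "(LINT z:?S|lebesgue. P z * (f (fst z) * (\<kappa> (fst z) * ddir 1 \<omega> (snd z)))) = (LINT z|lebesgue. rst K P z * \<phi> z)"
      unfolding \<phi>_def[symmetric] by (rule set_integral_rst[OF K(2) \<phi>0])
    \<comment> \<open>Where the test function is active, \<open>t\<close> is positive and
      \<open>max 0 t = t\<close>; elsewhere both sides vanish.\<close>
    have slice: "rst K P (x, t) * \<phi> (x, t) = ddir 1 \<omega> t * (f x * q (max 0 t) x)" for x t
    proof (cases "(x, t) \<in> K")
      case True
      then have "max 0 t = t" using \<omega>(4) by (auto simp: K_def)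
      then show ?thesis using True by (simp add: P_def Ut_def U_def q_def \<phi>_def)
    next
      case False
      then have "ddir 1 \<omega> t = 0 \<or> \<kappa> x = 0" using D\<omega>0[of t] \<kappa>0[of x] by (auto simp: K_def)
      then show ?thesis using False by (auto simp: q_def)
    qed
    have "(LINT z|lebesgue. rst K P z * \<phi> z) = (LINT t|lborel. ddir 1 \<omega> t * Y1 t)"
    proof (rule Fubini_lebesgue)
      show "integrable lebesgue (\<lambda>z. rst K P z * \<phi> z)" by (rule continuous_rst_integrable[OF lP K \<phi>c \<phi>0])
      show "(\<lambda>t. ddir 1 \<omega> t * Y1 t) \<in> borel_measurable borel"
        by (intro borel_measurable_continuous_onI continuous_on_mult Y1c smooth_continuous[OF smooth_ddir[OF \<omega>(1)]])
      fix t
      have fm: "(\<lambda>x. f x * q (max 0 t) x) \<in> borel_measurable lebesgue"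
        using continuous_lebesgue_measurable[OF f] qm[of "max 0 t"] by simp
      show "(LINT x|lebesgue. rst K P (x, t) * \<phi> (x, t)) = ddir 1 \<omega> t * Y1 t"
        unfolding slice Y1_def Y_def density_integrable_iff(2)[OF f f0 qm[OF max.cobounded1]] by simp
      show "(\<lambda>x. rst K P (x, t) * \<phi> (x, t)) \<in> borel_measurable lebesgue"
        unfolding slice using fm by simp
    qed
    then show ?thesis using energy[OF \<omega>] unfolding e by simp
  qed
  have dec: "Y T \<le> Y a" if "0 < a" "a < T" for a
  proof -
    have "Y1 T \<le> Y1 a"
    proof (rule nonincreasing_of_weak_inequality[OF Y1c _ that])
      fix \<omega> :: "real \<Rightarrow> real" and a b :: real
      assume a1: "smooth \<omega>" and a2: "\<And>t. 0 \<le> \<omega> t" and a3: "\<And>t. t \<notin> {a..b} \<Longrightarrow> \<omega> t = 0" and a4: "0 < a" "b \<le> T"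
      show "0 \<le> (LINT t|lborel. ddir 1 \<omega> t * Y1 t)" by (rule weak[OF a1 a2 a3 a4])
    qed
    then show ?thesis using that T by (simp add: Y1_def)
  qed
  \<comment> \<open>Continuity in \<open>L^1\<close> down to \<open>t = 0\<close> lets
    \<open>a\<close> tend to zero, where the initial ordering gives \<open>Y 0 = 0\<close>.\<close>
  have "Y T \<le> Y 0"
  proof (rule tendsto_lowerbound)
    have "(Y \<longlongrightarrow> Y 0) (at 0 within {0..})" using Ycont by (simp add: continuous_on_def)
    then show "(Y \<longlongrightarrow> Y 0) (at_right 0)" by (rule tendsto_within_subset) auto
    show "\<forall>\<^sub>F a in at_right 0. Y T \<le> Y a"
      unfolding eventually_at_right_field using T dec by blast
  qed simp
  then have "Y T = 0" using Y0 Ynn[of T] by simp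
  then have i0: "(LINT x|lebesgue. f x * q T x) = 0"
    unfolding Y_def using density_integrable_iff(2)[OF f f0 qm[of T]] T by simp
  have "integrable lebesgue (\<lambda>x. f x * q T x)"
    using qi[of T] density_integrable_iff(1)[OF f f0 qm[of T]] T by simp
  moreover have "0 \<le> f x * q T x" for x
    unfolding q_def using f0 \<kappa>01 by simp
  ultimately have "AE x in lebesgue. f x * q T x = 0"
    using i0 integral_nonneg_eq_0_iff_AE[of lebesgue "\<lambda>x. f x * q T x"] by simp
  moreover have "AE x in lebesgue. 0 \<le> u x T" using V(1) T by (simp add: solution_class_def)
  ultimately show ?thesis
  proof eventually_elim
    case (elim x)
    show ?case
    proof (cases "norm x \<le> R")
      case True
      then have "max 0 (ut x T - u x T) = 0" using elim(1) fpos[of x] \<kappa>1[OF True] by (simp add: q_def)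
      then show ?thesis by simp
    next
      case False
      then have "ut x T = 0" using T by (intro R(2)) auto
      then show ?thesis using elim(2) by simp
    qed
  qed
qed

section \<open>Functions that are differentiable along lines\<close>

text \<open>Classical derivatives along one direction outside an exceptional set \<open>X\<close>,
  bounded on compact sets. If moreover every line in direction \<open>e\<close> meets
  \<open>X\<close> in finitely many points and \<open>X\<close> is null, then \<open>d\<close> is
  the weak derivative of \<open>h\<close>; the explicit barrier is treated in this way.\<close>

definition line_diff ::
    "('a::euclidean_space \<times> real) set \<Rightarrow> 'a \<times> real \<Rightarrow> ('a \<times> real \<Rightarrow> real) \<Rightarrow> ('a \<times> real \<Rightarrow> real) \<Rightarrow> bool" where
  "line_diff X e h d \<longleftrightarrow> continuous_on spacetime h \<and>
     (\<forall>K. compact K \<and> K \<subseteq> spacetime \<longrightarrow> (\<exists>B. \<forall>y\<in>K - X. \<bar>d y\<bar> \<le> B)) \<and>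
     (\<forall>y\<in>spacetime - X. ((\<lambda>s. h (y + s *\<^sub>R e)) has_real_derivative d y) (at 0))"

lemma compact_bounded_real:
  fixes h :: "'b::topological_space \<Rightarrow> real"
  assumes "continuous_on S h" "compact K" "K \<subseteq> S"
  obtains B where "0 \<le> B" "\<And>y. y \<in> K \<Longrightarrow> \<bar>h y\<bar> \<le> B"
proof -
  have "bounded (h ` K)"
    by (intro compact_imp_bounded compact_continuous_image continuous_on_subset[OF assms(1,3)] assms(2))
  then obtain B where B: "\<And>y. y \<in> K \<Longrightarrow> \<bar>h y\<bar> \<le> B" unfolding bounded_iff by auto
  show ?thesis by (rule that[of "max 0 B"]) (use B in \<open>auto simp: le_max_iff_disj\<close>)
qed

lemma line_diff_bound:
  assumes "line_diff X e h d" "compact K" "K \<subseteq> spacetime"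
  obtains B where "0 \<le> B" "\<And>y. y \<in> K - X \<Longrightarrow> \<bar>d y\<bar> \<le> B"
proof -
  obtain B where B: "\<forall>y\<in>K - X. \<bar>d y\<bar> \<le> B" using assms unfolding line_diff_def by blast
  show ?thesis by (rule that[of "max 0 B"]) (use B in \<open>auto simp: le_max_iff_disj\<close>)
qed

lemma line_diff_mult:
  assumes "line_diff X e h d" "line_diff X e h' d'"
  shows "line_diff X e (\<lambda>y. h y * h' y) (\<lambda>y. h y * d' y + d y * h' y)"
  unfolding line_diff_def
proof (intro conjI allI impI ballI)
  have c: "continuous_on spacetime h" "continuous_on spacetime h'" using assms by (auto simp: line_diff_def)
  then show "continuous_on spacetime (\<lambda>y. h y * h' y)" by (rule continuous_on_mult)
  fix K :: "('a \<times> real) set" assume K: "compact K \<and> K \<subseteq> spacetime"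
  obtain B1 where B1: "0 \<le> B1" "\<And>y. y \<in> K \<Longrightarrow> \<bar>h y\<bar> \<le> B1" using compact_bounded_real[OF c(1)] K by blast
  obtain B2 where B2: "0 \<le> B2" "\<And>y. y \<in> K \<Longrightarrow> \<bar>h' y\<bar> \<le> B2" using compact_bounded_real[OF c(2)] K by blast
  obtain B3 where B3: "0 \<le> B3" "\<And>y. y \<in> K - X \<Longrightarrow> \<bar>d y\<bar> \<le> B3"
    using line_diff_bound[OF assms(1)] K by blast
  obtain B4 where B4: "0 \<le> B4" "\<And>y. y \<in> K - X \<Longrightarrow> \<bar>d' y\<bar> \<le> B4"
    using line_diff_bound[OF assms(2)] K by blast
  have "\<bar>h y * d' y + d y * h' y\<bar> \<le> B1 * B4 + B3 * B2" if y: "y \<in> K - X" for y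
  proof -
    have "\<bar>h y * d' y\<bar> \<le> B1 * B4" by (rule abs_mult_mono) (use B1(2) B4 y in auto)
    moreover have "\<bar>d y * h' y\<bar> \<le> B3 * B2" by (rule abs_mult_mono) (use B2(2) B3 y in auto)
    ultimately show ?thesis by linarith
  qed
  then show "\<exists>B. \<forall>y\<in>K - X. \<bar>h y * d' y + d y * h' y\<bar> \<le> B" by blast
next
  fix y assume "y \<in> spacetime - X"
  then have "((\<lambda>s. h (y + s *\<^sub>R e)) has_real_derivative d y) (at 0)" "((\<lambda>s. h' (y + s *\<^sub>R e)) has_real_derivative d' y) (at 0)"
    using assms by (auto simp: line_diff_def)
  from DERIV_mult[OF this]
  show "((\<lambda>s. h (y + s *\<^sub>R e) * h' (y + s *\<^sub>R e)) has_real_derivative h y * d' y + d y * h' y) (at 0)"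
    by (rule DERIV_cong) simp
qed

lemma line_diff_compose:
  fixes P P' :: "real \<Rightarrow> real"
  assumes h: "line_diff X e h d" and P: "\<And>x. (P has_real_derivative P' x) (at x)" and P': "continuous_on UNIV P'"
  shows "line_diff X e (\<lambda>y. P (h y)) (\<lambda>y. P' (h y) * d y)"
  unfolding line_diff_def
proof (intro conjI allI impI ballI)
  have c: "continuous_on spacetime h" using h by (auto simp: line_diff_def)
  have cP: "continuous_on UNIV P" using P by (intro DERIV_continuous_on[of _ _ P']) auto
  show "continuous_on spacetime (\<lambda>y. P (h y))" by (rule continuous_on_compose2[OF cP c]) simp
  have cP'h: "continuous_on spacetime (\<lambda>y. P' (h y))" by (rule continuous_on_compose2[OF P' c]) simp
  fix K :: "('a \<times> real) set" assume K: "compact K \<and> K \<subseteq> spacetime"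
  obtain B1 where B1: "0 \<le> B1" "\<And>y. y \<in> K \<Longrightarrow> \<bar>P' (h y)\<bar> \<le> B1" using compact_bounded_real[OF cP'h] K by blast
  obtain B3 where B3: "0 \<le> B3" "\<And>y. y \<in> K - X \<Longrightarrow> \<bar>d y\<bar> \<le> B3"
    using line_diff_bound[OF h] K by blast
  have "\<bar>P' (h y) * d y\<bar> \<le> B1 * B3" if y: "y \<in> K - X" for y
    by (rule abs_mult_mono) (use B1(2) B3 y in auto)
  then show "\<exists>B. \<forall>y\<in>K - X. \<bar>P' (h y) * d y\<bar> \<le> B" by blast
next
  fix y assume "y \<in> spacetime - X"
  then have 1: "((\<lambda>s. h (y + s *\<^sub>R e)) has_real_derivative d y) (at 0)" using h by (auto simp: line_diff_def)
  have "(P has_real_derivative P' (h y)) (at (h (y + 0 *\<^sub>R e)))" using P by simp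
  from DERIV_chain2[OF this 1]
  show "((\<lambda>s. P (h (y + s *\<^sub>R e))) has_real_derivative P' (h y) * d y) (at 0)" .
qed

lemma line_diff_cmult: "line_diff X e h d \<Longrightarrow> line_diff X e (\<lambda>y. c * h y) (\<lambda>y. c * d y)"
  using line_diff_compose[of X e h d "\<lambda>x. c * x" "\<lambda>_. c"] by (auto intro!: derivative_eq_intros)

lemma line_diff_const_along:
  assumes "continuous_on spacetime h" and "\<And>y s. h (y + s *\<^sub>R e) = h y"
  shows "line_diff X e h (\<lambda>_. 0)"
  unfolding line_diff_def using assms by auto

text \<open>The fundamental theorem of calculus on a segment tolerates finitely many points without
  derivative, provided that the function is continuous there.\<close>

lemma line_lipschitz:
  fixes h d :: "'b::euclidean_space \<Rightarrow> real"
  assumes h: "continuous_on UNIV h"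
    and der: "\<And>y. y \<notin> X \<Longrightarrow> ((\<lambda>s. h (y + s *\<^sub>R e)) has_real_derivative d y) (at 0)"
    and B: "\<And>y. y \<notin> X \<Longrightarrow> \<bar>d y\<bar> \<le> B" "0 \<le> B" and X: "\<And>z. finite {s. z + s *\<^sub>R e \<in> X}"
  shows "\<bar>h (z + s *\<^sub>R e) - h z\<bar> \<le> B * \<bar>s\<bar>"
proof -
  have pos: "\<bar>h (z + s *\<^sub>R e) - h z\<bar> \<le> B * s" if s: "0 \<le> s" for z s
  proof -
    define F where "F = {s. z + s *\<^sub>R e \<in> X}"
    define d' where "d' s = (if z + s *\<^sub>R e \<in> X then 0 else d (z + s *\<^sub>R e))" for s
    have "(d' has_integral (h (z + s *\<^sub>R e) - h (z + 0 *\<^sub>R e))) {0..s}"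
    proof (rule fundamental_theorem_of_calculus_interior_strong[of F])
      show "finite F" unfolding F_def by (rule X)
      show "continuous_on {0..s} (\<lambda>s. h (z + s *\<^sub>R e))"
        by (rule continuous_on_compose2[OF h]) (auto intro!: continuous_intros)
      fix x assume x: "x \<in> {0<..<s} - F"
      then have nX: "z + x *\<^sub>R e \<notin> X" by (auto simp: F_def)
      have "((\<lambda>t. h (z + x *\<^sub>R e + t *\<^sub>R e)) has_real_derivative d (z + x *\<^sub>R e)) (at (x + - x))"
        using der[OF nX] by simp
      then have "((\<lambda>t. h (z + x *\<^sub>R e + (t + - x) *\<^sub>R e)) has_real_derivative d (z + x *\<^sub>R e)) (at x)"
        by (subst (asm) DERIV_shift)
      moreover have "(\<lambda>t. h (z + x *\<^sub>R e + (t + - x) *\<^sub>R e)) = (\<lambda>t. h (z + t *\<^sub>R e))"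
        by (auto simp: algebra_simps)
      ultimately show "((\<lambda>s. h (z + s *\<^sub>R e)) has_vector_derivative d' x) (at x)"
        using nX by (simp add: d'_def has_real_derivative_iff_has_vector_derivative)
    qed (use s in auto)
    then have "(d' has_integral (h (z + s *\<^sub>R e) - h z)) (cbox 0 s)" by simp
    from has_integral_bound[OF B(2) this]
    have "norm (h (z + s *\<^sub>R e) - h z) \<le> B * measure lborel (cbox 0 s)"
      using B by (simp add: d'_def)
    then show ?thesis using s by simp
  qed
  show ?thesis
  proof (cases "0 \<le> s")
    case True
    then show ?thesis using pos[of s z] by simp
  next
    case False
    then have "\<bar>h (z + s *\<^sub>R e + (- s) *\<^sub>R e) - h (z + s *\<^sub>R e)\<bar> \<le> B * (- s)" by (intro pos) simp
    then show ?thesis using False by (simp add: algebra_simps abs_minus_commute)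
  qed
qed

lemma line_diff_continuous: "line_diff X e h d \<Longrightarrow> continuous_on spacetime h"
  by (simp add: line_diff_def)

lemma continuous_locally_L1:
  fixes h :: "'a::euclidean_space \<times> real \<Rightarrow> real"
  assumes c: "continuous_on spacetime h"
  shows "locally_L1 spacetime h"
proof (rule locally_L1_I)
  fix K :: "('a \<times> real) set" assume K: "compact K" "K \<subseteq> spacetime"
  have "integrable lborel (\<lambda>z. indicator K z *\<^sub>R h z)"
    using K by (intro borel_integrable_compact continuous_on_subset[OF c]) auto
  then have "integrable lborel (rst K h)" by simp
  then show "integrable lebesgue (rst K h)"
    by (subst integrable_completion) (auto dest: borel_measurable_integrable)
qed

text \<open>The product with a test function is compactly supported and Lipschitz along
  \<open>e\<close>, so its derivative integrates to zero; the product rule makes this the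
  integration by parts formula.\<close>

theorem line_diff_weak_ddir:
  fixes h d :: "'a::euclidean_space \<times> real \<Rightarrow> real"
  assumes hd: "line_diff X e h d" and X0: "AE z in lebesgue. z \<notin> X" and Xf: "\<And>z. finite {s. z + s *\<^sub>R e \<in> X}"
  shows "weak_ddir spacetime e h d"
proof -
  let ?S = "spacetime :: ('a \<times> real) set"
  have c: "continuous_on ?S h" using hd by (simp add: line_diff_def)
  have Sb: "?S \<in> sets borel" by (rule borel_open[OF open_spacetime])
  \<comment> \<open>Extension by zero makes \<open>h\<close> Borel on the whole space;
    \<open>d\<close> is then measurable as an almost everywhere limit of difference quotients of
    \<open>h0\<close>.\<close>
  define h0 where "h0 z = (if z \<in> ?S then h z else 0)" for z
  have h0m: "h0 \<in> borel_measurable borel"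
    unfolding h0_def by (rule borel_measurable_continuous_on_if[OF Sb c continuous_on_const])
  have lh: "locally_L1 ?S h" by (rule continuous_locally_L1[OF c])
  have rdm: "rst K d \<in> borel_measurable lebesgue" if K: "compact K" "K \<subseteq> ?S" for K
  proof -
    define q where "q n z = indicator K z * ((h0 (z + (1 / real (Suc n)) *\<^sub>R e) - h0 z) * real (Suc n))" for n z
    have Kb: "K \<in> sets borel" using compact_imp_closed[OF K(1)] by (rule borel_closed)
    have qm: "q n \<in> borel_measurable borel" for n
      unfolding q_def using h0m Kb by measurable
    have "(\<lambda>z. lim (\<lambda>n. q n z)) \<in> borel_measurable borel" by (rule borel_measurable_lim_metric[OF qm])
    then have lm: "(\<lambda>z. lim (\<lambda>n. q n z)) \<in> borel_measurable lebesgue" by (simp add: measurable_completion)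
    have "AE z in lebesgue. rst K d z = lim (\<lambda>n. q n z)"
      using X0
    proof eventually_elim
      case (elim z)
      show ?case
      proof (cases "z \<in> K")
        case True
        then have zS: "z \<in> ?S" using K by blast
        have der: "((\<lambda>s. h (z + s *\<^sub>R e)) has_real_derivative d z) (at 0)" using hd elim zS by (simp add: line_diff_def)
        have fl: "filterlim (\<lambda>n. 1 / real (Suc n)) (at 0) sequentially"
          unfolding filterlim_at using LIMSEQ_inverse_real_of_nat by (simp add: inverse_eq_divide)
        have "((\<lambda>s. (h (z + s *\<^sub>R e) - h z) / s) \<longlongrightarrow> d z) (at 0)"
          using der unfolding has_field_derivative_iff by simp
        from filterlim_compose[OF this fl]
        have l: "(\<lambda>n. (h (z + (1 / real (Suc n)) *\<^sub>R e) - h z) / (1 / real (Suc n))) \<longlonglongrightarrow> d z" .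
        have "((\<lambda>s. z + s *\<^sub>R e) \<longlongrightarrow> z + 0 *\<^sub>R e) (at 0)" by (intro tendsto_intros)
        then have "((\<lambda>s. z + s *\<^sub>R e) \<longlongrightarrow> z) (at 0)" by simp
        from topological_tendstoD[OF this open_spacetime zS]
        have "\<forall>\<^sub>F n in sequentially. z + (1 / real (Suc n)) *\<^sub>R e \<in> ?S"
          using fl by (rule eventually_compose_filterlim)
        then have "\<forall>\<^sub>F n in sequentially. (h (z + (1 / real (Suc n)) *\<^sub>R e) - h z) / (1 / real (Suc n)) = q n z"
          by eventually_elim (use True zS in \<open>simp add: q_def h0_def\<close>)
        from Lim_transform_eventually[OF l this] show ?thesis using True by (simp add: limI)
      next
        case False
        then show ?thesis by (simp add: q_def)
      qed
    qed
    from lebesgue_measurable_AE_cong[OF lm this] show ?thesis .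
  qed
  have ld: "locally_L1 ?S d"
  proof (rule locally_L1_I)
    fix K assume K: "compact K" "K \<subseteq> ?S"
    obtain B where B: "0 \<le> B" "\<And>y. y \<in> K - X \<Longrightarrow> \<bar>d y\<bar> \<le> B"
      using line_diff_bound[OF hd K] by blast
    show "integrable lebesgue (rst K d)"
    proof (rule Bochner_Integration.integrable_bound)
      show "integrable lebesgue (\<lambda>z. B * indicat_real K z)"
        using lmeasurable_compact[OF K(1)] by (simp add: lmeasurable_iff_integrable)
      show "AE z in lebesgue. norm (rst K d z) \<le> norm (B * indicat_real K z)"
        using X0 by eventually_elim (use B in \<open>auto simp: indicator_def\<close>)
    qed (rule rdm[OF K])
  qed
  have "(LINT z:?S|lebesgue. h z * ddir e \<eta> z) = - (LINT z:?S|lebesgue. d z * \<eta> z)" if \<eta>: "test_function ?S \<eta>" for \<eta>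
  proof -
    obtain K where K: "compact K" "K \<subseteq> ?S" "\<And>z. z \<notin> K \<Longrightarrow> \<eta> z = 0" and \<eta>s: "smooth \<eta>"
      using \<eta> unfolding test_function_def by blast
    have D\<eta>0: "ddir e \<eta> z = 0" if "z \<notin> K" for z
      by (rule ddir_outside_support[OF compact_imp_closed[OF K(1)] K(3) that])
    define H where "H z = h0 z * \<eta> z" for z
    define D where "D z = rst K h z * ddir e \<eta> z + rst K d z * \<eta> z" for z
    have Kc: "open (- K)" using compact_imp_closed[OF K(1)] by (simp add: open_Compl)
    have Hc: "continuous_on UNIV H"
    proof -
      have "continuous_on ?S (\<lambda>z. h z * \<eta> z)" by (intro continuous_on_mult c smooth_continuous[OF \<eta>s])
      then have 1: "continuous_on ?S H" by (rule continuous_on_eq) (simp add: H_def h0_def)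
      have 2: "continuous_on (- K) H"
        by (rule continuous_on_eq[OF continuous_on_const[of _ 0]]) (use K(3) in \<open>simp add: H_def\<close>)
      have "continuous_on (?S \<union> - K) H" by (rule continuous_on_open_Un[OF open_spacetime Kc 1 2])
      moreover have "?S \<union> - K = UNIV" using K(2) by blast
      ultimately show ?thesis by simp
    qed
    have H0: "H z = 0" if "z \<notin> K" for z using K(3)[OF that] by (simp add: H_def)
    have ev_open: "\<forall>\<^sub>F s in nhds 0. z + s *\<^sub>R e \<in> U" if "open U" "z \<in> U" for U z
    proof -
      have "((\<lambda>s. z + s *\<^sub>R e) \<longlongrightarrow> z + 0 *\<^sub>R e) (nhds (0::real))"
        by (intro tendsto_intros filterlim_ident)
      then show ?thesis using topological_tendstoD[OF _ that(1), of "\<lambda>s. z + s *\<^sub>R e" "z + 0 *\<^sub>R e" "nhds 0"] that(2) by simp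
    qed
    have der: "((\<lambda>s. H (z + s *\<^sub>R e)) has_real_derivative D z) (at 0)" if "z \<notin> X" for z
    proof (cases "z \<in> ?S")
      case True
      have "((\<lambda>s. h (z + s *\<^sub>R e)) has_real_derivative d z) (at 0)" using hd that True by (simp add: line_diff_def)
      from DERIV_mult[OF this line_has_derivative[OF smooth_differentiable[OF \<eta>s]]]
      have 1: "((\<lambda>s. h (z + s *\<^sub>R e) * \<eta> (z + s *\<^sub>R e)) has_real_derivative h z * ddir e \<eta> z + d z * \<eta> z) (at 0)"
        by (rule DERIV_cong) simp
      have "h z * ddir e \<eta> z + d z * \<eta> z = D z"
        using K(3)[of z] D\<eta>0[of z] by (cases "z \<in> K") (auto simp: D_def)
      moreover have "((\<lambda>s. H (z + s *\<^sub>R e)) has_real_derivative h z * ddir e \<eta> z + d z * \<eta> z) (at 0)"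
      proof (subst DERIV_cong_ev[OF refl _ refl])
        show "\<forall>\<^sub>F s in nhds 0. H (z + s *\<^sub>R e) = h (z + s *\<^sub>R e) * \<eta> (z + s *\<^sub>R e)"
          using ev_open[OF open_spacetime True] by eventually_elim (simp add: H_def h0_def)
      qed (rule 1)
      ultimately show ?thesis by simp
    next
      case False
      then have zK: "z \<in> - K" using K(2) by blast
      have "((\<lambda>s. H (z + s *\<^sub>R e)) has_real_derivative 0) (at 0)"
      proof (subst DERIV_cong_ev[OF refl _ refl])
        show "\<forall>\<^sub>F s in nhds 0. H (z + s *\<^sub>R e) = 0"
          using ev_open[OF Kc zK] by eventually_elim (simp add: H0)
      qed simp
      moreover have "D z = 0" using zK by (simp add: D_def)
      ultimately show ?thesis by simp
    qed
    obtain B1 where B1: "0 \<le> B1" "\<And>y. y \<in> K \<Longrightarrow> \<bar>h y\<bar> \<le> B1" using compact_bounded_real[OF c K(1,2)] by blast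
    obtain B2 where B2: "0 \<le> B2" "\<And>y. y \<in> K - X \<Longrightarrow> \<bar>d y\<bar> \<le> B2"
      using line_diff_bound[OF hd K(1,2)] by blast
    obtain B3 where B3: "0 \<le> B3" "\<And>z. \<bar>\<eta> z\<bar> \<le> B3" by (rule test_function_bounded[OF \<eta>]) (rule that)
    obtain B4 where B4: "0 \<le> B4" "\<And>z. \<bar>ddir e \<eta> z\<bar> \<le> B4" by (rule test_function_bounded[OF test_function_ddir[OF \<eta>]]) (rule that)
    define B where "B = B1 * B4 + B2 * B3"
    have B0: "0 \<le> B" using B1(1) B2(1) B3(1) B4(1) by (simp add: B_def)
    have DB: "\<bar>D z\<bar> \<le> B" if "z \<notin> X" for z
    proof (cases "z \<in> K")
      case True
      have "\<bar>h z * ddir e \<eta> z\<bar> \<le> B1 * B4" by (rule abs_mult_mono) (use B1 B4 True in auto)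
      moreover have "\<bar>d z * \<eta> z\<bar> \<le> B2 * B3" by (rule abs_mult_mono) (use B2 B3 True that in auto)
      ultimately show ?thesis using True unfolding D_def B_def by simp
    qed (simp add: D_def B0)
    have lip: "\<bar>H (z + s *\<^sub>R e) - H z\<bar> \<le> B * \<bar>s\<bar>" for z s
      by (rule line_lipschitz[OF Hc der DB B0 Xf])
    have i1: "integrable lebesgue (\<lambda>z. rst K h z * ddir e \<eta> z)"
      by (rule continuous_rst_integrable[OF lh K(1,2) smooth_continuous[OF smooth_ddir[OF \<eta>s]] D\<eta>0])
    have i2: "integrable lebesgue (\<lambda>z. rst K d z * \<eta> z)"
      by (rule continuous_rst_integrable[OF ld K(1,2) smooth_continuous[OF \<eta>s] K(3)])
    have aed: "AE z in lebesgue. ((\<lambda>s. H (z + s *\<^sub>R e)) has_real_derivative D z) (at 0)"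
      using X0 by eventually_elim (rule der)
    have Dm: "D \<in> borel_measurable lebesgue" unfolding D_def using i1 i2 by (intro borel_measurable_add) auto
    have "(LINT z|lebesgue. D z) = 0"
      by (rule integral_line_derivative_eq_0(2)[OF Hc K(1) H0 lip aed Dm])
    then have "(LINT z|lebesgue. rst K h z * ddir e \<eta> z) + (LINT z|lebesgue. rst K d z * \<eta> z) = 0"
      unfolding D_def using i1 i2 by simp
    moreover have "(LINT z:?S|lebesgue. h z * ddir e \<eta> z) = (LINT z|lebesgue. rst K h z * ddir e \<eta> z)"
      by (rule set_integral_rst[OF K(2) D\<eta>0])
    moreover have "(LINT z:?S|lebesgue. d z * \<eta> z) = (LINT z|lebesgue. rst K d z * \<eta> z)"
      by (rule set_integral_rst[OF K(2,3)])
    ultimately show ?thesis by simp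
  qed
  with lh ld show ?thesis by (simp add: weak_ddir_def)
qed

subsection \<open>Radial functions\<close>

text \<open>The norm is not differentiable at the origin, and the profile is glued from two formulas
  at radius \<open>r0\<close>.\<close>

definition radial_exc :: "real \<Rightarrow> ('a::euclidean_space \<times> real) set" where
  "radial_exc r0 = {z. fst z = 0 \<or> norm (fst z) = r0}"

lemma AE_radial_exc: "AE z in lebesgue. z \<notin> radial_exc r0"
proof (rule AE_lebesgue_from_slices)
  show "(radial_exc r0 :: ('a \<times> real) set) \<in> sets borel"
    unfolding radial_exc_def by (intro borel_closed) (auto intro!: closed_Collect_disj closed_Collect_eq continuous_intros)
  have "negligible (insert 0 (sphere 0 r0) :: 'a set)" by (simp add: negligible_sphere negligible_insert)
  then have "insert 0 (sphere 0 r0) \<in> null_sets (lebesgue :: 'a measure)" by (simp add: negligible_iff_null_sets)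
  then have "AE x in (lebesgue :: 'a measure). x \<notin> insert 0 (sphere 0 r0)" by (rule AE_not_in)
  then have "AE x in (lebesgue :: 'a measure). (x, t) \<notin> radial_exc r0" for t
    by eventually_elim (auto simp: radial_exc_def)
  then show "AE t in lborel. AE x in (lebesgue :: 'a measure). (x, t) \<notin> radial_exc r0" by simp
qed

text \<open>Along the line the squared norm is a quadratic polynomial in \<open>s\<close> with
  leading coefficient 1, so each of the two radii is attained at most twice.\<close>

lemma finite_radial_exc:
  assumes b: "b \<in> Basis"
  shows "finite {s. z + s *\<^sub>R (b, 0::real) \<in> radial_exc r0}"
proof (rule finite_subset)
  define c where "c \<rho> = \<rho> - norm (fst z) ^ 2 + (fst z \<bullet> b)\<^sup>2" for \<rho> :: real
  show "{s. z + s *\<^sub>R (b, 0::real) \<in> radial_exc r0} \<subseteq>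
      {- (fst z \<bullet> b) + sqrt (c 0), - (fst z \<bullet> b) - sqrt (c 0), - (fst z \<bullet> b) + sqrt (c (r0\<^sup>2)), - (fst z \<bullet> b) - sqrt (c (r0\<^sup>2))}"
  proof
    fix s assume "s \<in> {s. z + s *\<^sub>R (b, 0::real) \<in> radial_exc r0}"
    then have "norm (fst z + s *\<^sub>R b) ^ 2 = 0 \<or> norm (fst z + s *\<^sub>R b) ^ 2 = r0\<^sup>2"
      by (auto simp: radial_exc_def)
    then obtain \<rho> where \<rho>: "\<rho> = 0 \<or> \<rho> = r0\<^sup>2" "norm (fst z + s *\<^sub>R b) ^ 2 = \<rho>" by blast
    have "norm (fst z + s *\<^sub>R b) ^ 2 = norm (fst z) ^ 2 + 2 * s * (fst z \<bullet> b) + s\<^sup>2"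
      unfolding power2_norm_eq_inner using b
      by (simp add: inner_add_left inner_add_right inner_commute power2_eq_square algebra_simps)
    then have sq: "(s + fst z \<bullet> b)\<^sup>2 = c \<rho>" using \<rho>(2) by (simp add: c_def power2_eq_square algebra_simps)
    then have "sqrt (c \<rho>) = \<bar>s + fst z \<bullet> b\<bar>" by (metis real_sqrt_abs)
    then have "s = - (fst z \<bullet> b) + sqrt (c \<rho>) \<or> s = - (fst z \<bullet> b) - sqrt (c \<rho>)" by linarith
    then show "s \<in> {- (fst z \<bullet> b) + sqrt (c 0), - (fst z \<bullet> b) - sqrt (c 0), - (fst z \<bullet> b) + sqrt (c (r0\<^sup>2)), - (fst z \<bullet> b) - sqrt (c (r0\<^sup>2))}"
      using \<rho>(1) by auto
  qed
qed simp

lemma norm_line_derivative: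
  fixes x b :: "'a::euclidean_space"
  assumes "x \<noteq> 0"
  shows "((\<lambda>s. norm (x + s *\<^sub>R b)) has_real_derivative (x \<bullet> b) / norm x) (at 0)"
proof -
  have 1: "((\<lambda>s. x + s *\<^sub>R b) has_derivative (\<lambda>s. s *\<^sub>R b)) (at (0::real))" by (auto intro!: derivative_eq_intros)
  have 2: "(norm has_derivative (\<lambda>v. v \<bullet> sgn x)) (at (x + 0 *\<^sub>R b))" using has_derivative_norm[OF assms] by (simp add: inner_commute)
  from has_derivative_compose[OF 1 2] have "((\<lambda>s. norm (x + s *\<^sub>R b)) has_derivative (\<lambda>s. s *\<^sub>R b \<bullet> sgn x)) (at 0)" .
  moreover have "(\<lambda>s. s *\<^sub>R b \<bullet> sgn x) = (*) ((x \<bullet> b) / norm x)"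
    by (auto simp: sgn_div_norm inner_commute divide_inverse)
  ultimately show ?thesis by (simp add: has_field_derivative_def)
qed

lemma radial_line_derivative:
  fixes y :: "'a::euclidean_space \<times> real"
  assumes y: "y \<notin> radial_exc r0" and \<rho>: "\<And>r. 0 < r \<Longrightarrow> r \<noteq> r0 \<Longrightarrow> (\<rho> has_real_derivative \<rho>' r) (at r)"
  shows "((\<lambda>s. \<rho> (norm (fst (y + s *\<^sub>R (b, 0))))) has_real_derivative \<rho>' (norm (fst y)) * ((fst y \<bullet> b) / norm (fst y))) (at 0)"
proof -
  have n: "fst y \<noteq> 0" "norm (fst y) \<noteq> r0" using y by (auto simp: radial_exc_def)
  have "(\<rho> has_real_derivative \<rho>' (norm (fst y))) (at (norm (fst y + 0 *\<^sub>R b)))" using \<rho>[of "norm (fst y)"] n by simp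
  from DERIV_chain2[OF this norm_line_derivative[OF n(1)]] show ?thesis by simp
qed

lemma continuous_norm_fst:
  assumes "continuous_on {0..} \<rho>"
  shows "continuous_on S (\<lambda>z::'a::real_normed_vector \<times> real. \<rho> (norm (fst z)))"
  by (rule continuous_on_compose2[OF assms]) (auto intro!: continuous_intros)

lemma compact_norm_bound:
  assumes "compact (K :: ('a::euclidean_space \<times> real) set)"
  obtains R where "0 < R" "\<And>y. y \<in> K \<Longrightarrow> norm (fst y) \<le> R"
proof -
  have "bounded (fst ` K)" by (intro compact_imp_bounded compact_continuous_image continuous_intros assms)
  then obtain R where R: "\<And>y. y \<in> K \<Longrightarrow> norm (fst y) \<le> R" unfolding bounded_iff by auto
  show ?thesis by (rule that[of "max 1 R"]) (use R in \<open>auto simp: le_max_iff_disj\<close>)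
qed

lemma line_diff_radial:
  assumes b: "b \<in> Basis" and c: "continuous_on {0..} \<rho>"
    and \<rho>: "\<And>r. 0 < r \<Longrightarrow> r \<noteq> r0 \<Longrightarrow> (\<rho> has_real_derivative \<rho>' r) (at r)"
    and bd: "\<And>R. 0 < R \<Longrightarrow> \<exists>B. \<forall>r. 0 < r \<and> r \<le> R \<longrightarrow> \<bar>\<rho>' r\<bar> \<le> B"
  shows "line_diff (radial_exc r0) (b, 0) (\<lambda>z. \<rho> (norm (fst z)))
    (\<lambda>z. \<rho>' (norm (fst z)) * ((fst z \<bullet> b) / norm (fst z)))"
  unfolding line_diff_def
proof (intro conjI allI impI ballI)
  show "continuous_on spacetime (\<lambda>z::'a \<times> real. \<rho> (norm (fst z)))" by (rule continuous_norm_fst[OF c])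
  fix K :: "('a \<times> real) set" assume K: "compact K \<and> K \<subseteq> spacetime"
  obtain R where R: "0 < R" "\<And>y. y \<in> K \<Longrightarrow> norm (fst y) \<le> R" using compact_norm_bound[of K] K by blast
  obtain B where B: "\<forall>r. 0 < r \<and> r \<le> R \<longrightarrow> \<bar>\<rho>' r\<bar> \<le> B" using bd[OF R(1)] by blast
  have "\<bar>\<rho>' (norm (fst y)) * ((fst y \<bullet> b) / norm (fst y))\<bar> \<le> \<bar>B\<bar> * 1" if y: "y \<in> K - radial_exc r0" for y
    unfolding abs_mult
  proof (rule mult_mono)
    have n: "fst y \<noteq> 0" using y by (auto simp: radial_exc_def)
    then have "\<bar>\<rho>' (norm (fst y))\<bar> \<le> B" using B[rule_format, of "norm (fst y)"] R(2)[of y] y by simp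
    then show "\<bar>\<rho>' (norm (fst y))\<bar> \<le> \<bar>B\<bar>" by linarith
    show "\<bar>(fst y \<bullet> b) / norm (fst y)\<bar> \<le> 1" using Basis_le_norm[OF b, of "fst y"] n by (simp add: divide_le_eq)
  qed auto
  then show "\<exists>B. \<forall>y\<in>K - radial_exc r0. \<bar>\<rho>' (norm (fst y)) * ((fst y \<bullet> b) / norm (fst y))\<bar> \<le> B" by blast
next
  fix y :: "'a \<times> real" assume "y \<in> spacetime - radial_exc r0"
  then show "((\<lambda>s. \<rho> (norm (fst (y + s *\<^sub>R (b, 0))))) has_real_derivative \<rho>' (norm (fst y)) * ((fst y \<bullet> b) / norm (fst y))) (at 0)"
    by (intro radial_line_derivative[of _ r0] \<rho>) auto
qed

text \<open>It is enough that \<open>r \<rho>'(r)\<close> stays bounded, since the derivative of the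
  radial factor is multiplied by \<open>x_b^2 / |x|\<close>. This matters because
  \<open>deriv g\<close> may blow up at the origin when \<open>\<alpha>1 < 1\<close>.\<close>

lemma line_diff_radial_coordinate:
  assumes b: "b \<in> Basis" and c: "continuous_on {0..} \<rho>"
    and \<rho>: "\<And>r. 0 < r \<Longrightarrow> r \<noteq> r0 \<Longrightarrow> (\<rho> has_real_derivative \<rho>' r) (at r)"
    and bd: "\<And>R. 0 < R \<Longrightarrow> \<exists>B. \<forall>r. 0 < r \<and> r \<le> R \<longrightarrow> \<bar>r * \<rho>' r\<bar> \<le> B"
  shows "line_diff (radial_exc r0) (b, 0) (\<lambda>z. \<rho> (norm (fst z)) * (fst z \<bullet> b))
    (\<lambda>z. \<rho> (norm (fst z)) + \<rho>' (norm (fst z)) * ((fst z \<bullet> b)\<^sup>2 / norm (fst z)))"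
  unfolding line_diff_def
proof (intro conjI allI impI ballI)
  have c': "continuous_on spacetime (\<lambda>z::'a \<times> real. \<rho> (norm (fst z)))" by (rule continuous_norm_fst[OF c])
  then show "continuous_on spacetime (\<lambda>z::'a \<times> real. \<rho> (norm (fst z)) * (fst z \<bullet> b))" by (intro continuous_intros)
  fix K :: "('a \<times> real) set" assume K: "compact K \<and> K \<subseteq> spacetime"
  obtain R where R: "0 < R" "\<And>y. y \<in> K \<Longrightarrow> norm (fst y) \<le> R" using compact_norm_bound[of K] K by blast
  obtain B where B: "\<forall>r. 0 < r \<and> r \<le> R \<longrightarrow> \<bar>r * \<rho>' r\<bar> \<le> B" using bd[OF R(1)] by blast
  obtain B1 where B1: "0 \<le> B1" "\<And>y. y \<in> K \<Longrightarrow> \<bar>\<rho> (norm (fst y))\<bar> \<le> B1" using compact_bounded_real[OF c'] K by blast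
  have "\<bar>\<rho> (norm (fst y)) + \<rho>' (norm (fst y)) * ((fst y \<bullet> b)\<^sup>2 / norm (fst y))\<bar> \<le> B1 + \<bar>B\<bar>" if y: "y \<in> K - radial_exc r0" for y
  proof -
    have n: "fst y \<noteq> 0" using y by (auto simp: radial_exc_def)
    define q where "q = (fst y \<bullet> b) / norm (fst y)"
    have "\<bar>q\<bar> \<le> 1" using Basis_le_norm[OF b, of "fst y"] n by (simp add: q_def divide_le_eq)
    then have q2: "q\<^sup>2 \<le> 1" by (simp add: abs_square_le_1)
    have "\<bar>norm (fst y) * \<rho>' (norm (fst y))\<bar> \<le> B" using B[rule_format, of "norm (fst y)"] R(2)[of y] y n by simp
    then have "\<bar>norm (fst y) * \<rho>' (norm (fst y))\<bar> \<le> \<bar>B\<bar>" by linarith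
    then have "\<bar>norm (fst y) * \<rho>' (norm (fst y))\<bar> * q\<^sup>2 \<le> \<bar>B\<bar> * 1" using q2 by (intro mult_mono) auto
    moreover have "\<rho>' (norm (fst y)) * ((fst y \<bullet> b)\<^sup>2 / norm (fst y)) = norm (fst y) * \<rho>' (norm (fst y)) * q\<^sup>2"
      using n by (simp add: q_def power2_eq_square)
    ultimately have "\<bar>\<rho>' (norm (fst y)) * ((fst y \<bullet> b)\<^sup>2 / norm (fst y))\<bar> \<le> \<bar>B\<bar>" by (simp add: abs_mult)
    moreover have "\<bar>\<rho> (norm (fst y))\<bar> \<le> B1" using B1(2)[of y] y by blast
    ultimately show ?thesis by linarith
  qed
  then show "\<exists>B. \<forall>y\<in>K - radial_exc r0. \<bar>\<rho> (norm (fst y)) + \<rho>' (norm (fst y)) * ((fst y \<bullet> b)\<^sup>2 / norm (fst y))\<bar> \<le> B" by blast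
next
  fix y :: "'a \<times> real" assume "y \<in> spacetime - radial_exc r0"
  then have y: "y \<notin> radial_exc r0" by simp
  have 2: "((\<lambda>s. fst (y + s *\<^sub>R (b, 0::real)) \<bullet> b) has_real_derivative 1) (at 0)"
  proof -
    have "(\<lambda>s. fst (y + s *\<^sub>R (b, 0::real)) \<bullet> b) = (\<lambda>s. fst y \<bullet> b + s)" using b by (simp add: inner_add_left)
    then show ?thesis by (auto intro!: derivative_eq_intros)
  qed
  have 1: "((\<lambda>s. \<rho> (norm (fst (y + s *\<^sub>R (b, 0))))) has_real_derivative \<rho>' (norm (fst y)) * ((fst y \<bullet> b) / norm (fst y))) (at 0)"
    by (rule radial_line_derivative[OF y \<rho>])
  have y0: "y + 0 *\<^sub>R (b, 0::real) = y" by (simp add: zero_prod_def[symmetric])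
  from DERIV_mult[OF 1 2]
  show "((\<lambda>s. \<rho> (norm (fst (y + s *\<^sub>R (b, 0)))) * (fst (y + s *\<^sub>R (b, 0)) \<bullet> b)) has_real_derivative
      \<rho> (norm (fst y)) + \<rho>' (norm (fst y)) * ((fst y \<bullet> b)\<^sup>2 / norm (fst y))) (at 0)"
    unfolding y0 by (rule DERIV_cong) (simp add: power2_eq_square)
qed

lemma line_diff_time:
  assumes "\<And>t. 0 < t \<Longrightarrow> (h has_real_derivative h' t) (at t)" and h': "continuous_on {0<..} h'"
  shows "line_diff X (0, 1) (\<lambda>z::'a::euclidean_space \<times> real. h (snd z)) (\<lambda>z. h' (snd z))"
  unfolding line_diff_def
proof (intro conjI allI impI ballI)
  have "continuous_on {0<..} h" using assms(1) by (intro DERIV_continuous_on[of _ _ h']) (auto intro: has_field_derivative_at_within)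
  then show "continuous_on spacetime (\<lambda>z::'a \<times> real. h (snd z))"
    by (rule continuous_on_compose2) (auto simp: spacetime_def intro!: continuous_intros)
  have c: "continuous_on spacetime (\<lambda>z::'a \<times> real. h' (snd z))"
    by (rule continuous_on_compose2[OF h']) (auto simp: spacetime_def intro!: continuous_intros)
  fix K :: "('a \<times> real) set" assume K: "compact K \<and> K \<subseteq> spacetime"
  obtain B1 where "0 \<le> B1" "\<And>y. y \<in> K \<Longrightarrow> \<bar>h' (snd y)\<bar> \<le> B1" using compact_bounded_real[OF c] K by blast
  then show "\<exists>B. \<forall>y\<in>K - X. \<bar>h' (snd y)\<bar> \<le> B" by blast
next
  fix y :: "'a \<times> real" assume "y \<in> spacetime - X"
  then have "(h has_real_derivative h' (snd y)) (at (snd y + 0))" using assms(1)[of "snd y"] by (auto simp: spacetime_def)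
  moreover have "((\<lambda>s. snd y + s) has_real_derivative 1) (at 0)" by (auto intro!: derivative_eq_intros)
  ultimately have "((\<lambda>s. h (snd y + s)) has_real_derivative h' (snd y) * 1) (at 0)" by (rule DERIV_chain2)
  then show "((\<lambda>s. h (snd (y + s *\<^sub>R (0, 1)))) has_real_derivative h' (snd y)) (at 0)" by simp
qed

lemma line_diff_add:
  assumes "line_diff X e h d" "line_diff X e h' d'"
  shows "line_diff X e (\<lambda>y. h y + h' y) (\<lambda>y. d y + d' y)"
  unfolding line_diff_def
proof (intro conjI allI impI ballI)
  show "continuous_on spacetime (\<lambda>y. h y + h' y)" using assms by (intro continuous_on_add) (auto simp: line_diff_def)
  fix K :: "('a \<times> real) set" assume K: "compact K \<and> K \<subseteq> spacetime"
  obtain B3 where B3: "0 \<le> B3" "\<And>y. y \<in> K - X \<Longrightarrow> \<bar>d y\<bar> \<le> B3"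
    using line_diff_bound[OF assms(1)] K by blast
  obtain B4 where B4: "0 \<le> B4" "\<And>y. y \<in> K - X \<Longrightarrow> \<bar>d' y\<bar> \<le> B4"
    using line_diff_bound[OF assms(2)] K by blast
  have "\<bar>d y + d' y\<bar> \<le> B3 + B4" if "y \<in> K - X" for y using B3(2)[OF that] B4(2)[OF that] by linarith
  then show "\<exists>B. \<forall>y\<in>K - X. \<bar>d y + d' y\<bar> \<le> B" by blast
next
  fix y assume "y \<in> spacetime - X"
  then show "((\<lambda>s. h (y + s *\<^sub>R e) + h' (y + s *\<^sub>R e)) has_real_derivative d y + d' y) (at 0)"
    using assms by (intro DERIV_add) (auto simp: line_diff_def)
qed

section \<open>The radial profile of the barrier\<close>

lemma DERIV_eventually_cong:
  fixes f h :: "real \<Rightarrow> real"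
  assumes "(f has_real_derivative D) (at x)" "\<forall>\<^sub>F y in nhds x. h y = f y"
  shows "(h has_real_derivative D) (at x)"
proof -
  have "(h has_real_derivative D) (at x) \<longleftrightarrow> (f has_real_derivative D) (at x)"
    by (intro DERIV_cong_ev refl assms(2))
  then show ?thesis using assms(1) by simp
qed

locale growth =
  fixes g :: "real \<Rightarrow> real" and \<alpha>1 \<alpha>2 p :: real
  assumes g_cont: "continuous_on {0..} g"
    and g_diff: "\<And>s. s > 0 \<Longrightarrow> g differentiable (at s)"
    and dg_cont: "continuous_on {0<..} (deriv g)"
    and g_0: "g 0 = 0" and g_pos: "\<And>s. s > 0 \<Longrightarrow> g s > 0"
    and a1: "0 < \<alpha>1" and a12: "\<alpha>1 \<le> \<alpha>2" and a2p: "\<alpha>2 < p"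
    and g_lower: "\<And>s. s > 0 \<Longrightarrow> \<alpha>1 * (g s / s) \<le> deriv g s"
    and g_upper: "\<And>s. s > 0 \<Longrightarrow> deriv g s \<le> \<alpha>2 * (g s / s)"
    and p1: "1 < p"
begin

section \<open>The primitive of g(s)/s and its inverse\<close>

abbreviation G :: "real \<Rightarrow> real" where "G \<equiv> G_fun g"
abbreviation Ginv :: "real \<Rightarrow> real" where "Ginv \<equiv> half_line_inverse (G_fun g)"

lemma a2: "0 < \<alpha>2" using a1 a12 by simp
lemma p0: "0 < p" using p1 by simp

lemma g_deriv: "s > 0 \<Longrightarrow> (g has_real_derivative deriv g s) (at s)"
  using g_diff by (simp add: DERIV_deriv_iff_real_differentiable)

lemma g_nonneg: "0 \<le> s \<Longrightarrow> 0 \<le> g s"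
  using g_pos[of s] g_0 by (cases "s = 0") auto

lemma dg_pos: "s > 0 \<Longrightarrow> deriv g s > 0"
proof -
  assume s: "s > 0"
  have "0 < \<alpha>1 * (g s / s)" using g_pos[OF s] a1 s by simp
  then show "deriv g s > 0" using g_lower[OF s] by linarith
qed

lemma g_strict_mono:
  assumes "0 \<le> s" "s < t"
  shows "g s < g t"
proof (cases "s = 0")
  case True
  then show ?thesis using g_pos[of t] g_0 assms by simp
next
  case False
  show ?thesis
  proof (rule DERIV_pos_imp_increasing[OF assms(2)])
    fix x assume "s \<le> x" "x \<le> t"
    then have "0 < x" using assms(1) False by simp
    then show "\<exists>y. (g has_real_derivative y) (at x) \<and> 0 < y" using g_deriv[of x] dg_pos[of x] by blast
  qed
qed

lemma g_mono: "0 \<le> s \<Longrightarrow> s \<le> t \<Longrightarrow> g s \<le> g t"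
  using g_strict_mono[of s t] by (cases "s = t") auto

text \<open>The lower growth condition says that \<open>ln (g s) - \<alpha>1 ln s\<close> has
  nonnegative derivative.\<close>

lemma g_scale:
  assumes "0 < s" "s \<le> t"
  shows "(t / s) powr \<alpha>1 * g s \<le> g t"
proof -
  have "ln (g s) - \<alpha>1 * ln s \<le> ln (g t) - \<alpha>1 * ln t"
  proof (rule DERIV_nonneg_imp_nondecreasing[OF assms(2)])
    fix x assume "s \<le> x" "x \<le> t"
    then have x: "x > 0" using assms by simp
    have "((\<lambda>x. ln (g x) - \<alpha>1 * ln x) has_real_derivative (1 / g x) * deriv g x - \<alpha>1 * (1 / x)) (at x)"
      using x g_pos[OF x] by (intro DERIV_diff DERIV_cmult DERIV_chain2[OF DERIV_ln_divide g_deriv] DERIV_ln_divide) auto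
    moreover have "0 \<le> (1 / g x) * deriv g x - \<alpha>1 * (1 / x)"
      using g_lower[OF x] g_pos[OF x] x by (simp add: field_simps)
    ultimately show "\<exists>y. ((\<lambda>x. ln (g x) - \<alpha>1 * ln x) has_real_derivative y) (at x) \<and> 0 \<le> y" by blast
  qed
  moreover have "ln ((t / s) powr \<alpha>1 * g s) = \<alpha>1 * (ln t - ln s) + ln (g s)"
    using assms g_pos[of s] by (simp add: ln_mult ln_powr ln_div)
  ultimately have "ln ((t / s) powr \<alpha>1 * g s) \<le> ln (g t)" by (simp add: algebra_simps)
  then show ?thesis using assms g_pos[of s] g_pos[of t] by (subst (asm) ln_le_cancel_iff) auto
qed

lemma integrand_integrable: "(\<lambda>s. g s / s) integrable_on {0..r}"
proof (cases "0 < r")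
  case True
  \<comment> \<open>\<open>g_scale\<close> between \<open>s\<close> and \<open>r\<close> gives
    \<open>g s \<le> C s^\<alpha>1\<close>, so the integrand is dominated by
    \<open>C s^(\<alpha>1 - 1)\<close>, which is integrable at 0.\<close>
  define C where "C = g r * r powr (- \<alpha>1)"
  have C: "0 \<le> C" using g_nonneg[of r] True by (simp add: C_def)
  have gi: "(\<lambda>s. C * s powr (\<alpha>1 - 1)) integrable_on {0..r}"
    using integrable_cmul[OF integrable_on_powr_from_0[of "\<alpha>1 - 1" r], of C] a1 True by simp
  show ?thesis
  proof (rule measurable_bounded_by_integrable_imp_integrable[OF _ gi])
    have "g \<in> borel_measurable (lebesgue_on {0..r})"
      by (intro continuous_imp_measurable_on_sets_lebesgue continuous_on_subset[OF g_cont]) auto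
    moreover have "(\<lambda>s. s) \<in> borel_measurable (lebesgue_on {0..r})"
      by (intro continuous_imp_measurable_on_sets_lebesgue continuous_on_id) auto
    ultimately show "(\<lambda>s. g s / s) \<in> borel_measurable (lebesgue_on {0..r})" by (rule borel_measurable_divide)
    fix s assume s: "s \<in> {0..r}"
    show "norm (g s / s) \<le> C * s powr (\<alpha>1 - 1)"
    proof (cases "s = 0")
      case True then show ?thesis by simp
    next
      case False
      then have s0: "0 < s" using s by simp
      have "(r / s) powr \<alpha>1 * g s \<le> g r" using g_scale[of s r] s s0 by simp
      then have "g s \<le> C * s powr \<alpha>1"
        using s0 True by (simp add: C_def powr_divide powr_minus field_simps)
      then have "g s / s \<le> C * s powr \<alpha>1 / s" using s0 by (intro divide_right_mono) auto
      also have "\<dots> = C * s powr (\<alpha>1 - 1)" using s0 by (simp add: powr_diff)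
      finally show ?thesis using s0 g_pos[OF s0] by simp
    qed
  qed auto
next
  case False
  then have "{0..r} = {} \<or> {0..r} = {0}" by auto
  then show ?thesis using integrable_on_empty integrable_on_refl[of _ "0::real"] by (auto simp: cbox_interval)
qed

lemma G_0: "G 0 = 0" by (simp add: G_fun_def)

lemma G_deriv:
  assumes r: "0 < r"
  shows "(G has_real_derivative g r / r) (at r)"
proof -
  let ?h = "\<lambda>s. g s / s"
  \<comment> \<open>Starting the integral at \<open>r / 2\<close> avoids the endpoint 0, where the
    integrand may be unbounded.\<close>
  have hc: "continuous_on {r / 2..2 * r} ?h"
    using r by (intro continuous_on_divide continuous_on_subset[OF g_cont] continuous_on_id) auto
  have "((\<lambda>x. integral {r / 2..x} ?h) has_real_derivative ?h r) (at r within {r / 2..2 * r})"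
    by (rule integral_has_real_derivative[OF hc]) (use r in auto)
  then have 1: "((\<lambda>x. integral {r / 2..x} ?h) has_real_derivative ?h r) (at r)"
    using r by (simp add: at_within_Icc_at)
  have "((\<lambda>x. G (r / 2) + integral {r / 2..x} ?h) has_real_derivative ?h r) (at r)"
    using DERIV_add[OF DERIV_const 1] by simp
  moreover have "\<forall>\<^sub>F x in nhds r. G x = G (r / 2) + integral {r / 2..x} ?h"
  proof -
    have "\<forall>\<^sub>F x in nhds r. x \<in> {r / 2<..}" using r by (intro eventually_nhds_in_open) auto
    then show ?thesis
    proof eventually_elim
      case (elim x)
      have "integral {0..r / 2} ?h + integral {r / 2..x} ?h = integral {0..x} ?h"
        using elim r integrand_integrable by (intro Henstock_Kurzweil_Integration.integral_combine) auto
      then show ?case by (simp add: G_fun_def)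
    qed
  qed
  ultimately show ?thesis by (rule DERIV_eventually_cong)
qed

text \<open>Both inequalities are the growth condition integrated from 0 to \<open>r\<close>;
  \<open>d\<close> is given the value 0 at the origin, where \<open>g\<close> need not be
  differentiable.\<close>

lemma G_lower: "0 \<le> r \<Longrightarrow> \<alpha>1 * G r \<le> g r"
  and G_upper: "0 \<le> r \<Longrightarrow> g r \<le> \<alpha>2 * G r"
proof -
  assume r: "0 \<le> r"
  define d where "d s = (if s = 0 then 0 else deriv g s)" for s
  have d: "(d has_integral (g r - g 0)) {0..r}"
  proof (rule fundamental_theorem_of_calculus_interior_strong[of "{0}"])
    show "continuous_on {0..r} g" by (rule continuous_on_subset[OF g_cont]) auto
  qed (use r g_deriv in \<open>auto simp: d_def has_real_derivative_iff_has_vector_derivative\<close>)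
  have G: "((\<lambda>s. g s / s) has_integral G r) {0..r}"
    unfolding G_fun_def by (rule integrable_integral[OF integrand_integrable])
  have "\<alpha>1 * G r \<le> g r - g 0"
    by (rule has_integral_le[OF has_integral_mult_right[OF G] d]) (use g_lower in \<open>auto simp: d_def\<close>)
  then show "\<alpha>1 * G r \<le> g r" by (simp add: g_0)
  have "g r - g 0 \<le> \<alpha>2 * G r"
    by (rule has_integral_le[OF d has_integral_mult_right[OF G]]) (use g_upper in \<open>auto simp: d_def\<close>)
  then show "g r \<le> \<alpha>2 * G r" by (simp add: g_0)
qed

lemma G_pos: "0 < r \<Longrightarrow> 0 < G r"
proof -
  assume r: "0 < r"
  have "0 < \<alpha>2 * G r" using G_upper[of r] g_pos[OF r] r by linarith
  then show "0 < G r" using a2 by (simp add: zero_less_mult_iff)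
qed

lemma G_nonneg: "0 \<le> r \<Longrightarrow> 0 \<le> G r"
  using G_pos[of r] G_0 by (cases "r = 0") auto

lemma G_strict_mono:
  assumes "0 \<le> r" "r < t"
  shows "G r < G t"
proof (cases "r = 0")
  case True
  then show ?thesis using G_pos[of t] G_0 assms by simp
next
  case False
  show ?thesis
  proof (rule DERIV_pos_imp_increasing[OF assms(2)])
    fix x assume "r \<le> x" "x \<le> t"
    then have x: "0 < x" using assms(1) False by simp
    then have "0 < g x / x" using g_pos[OF x] by simp
    then show "\<exists>y. (G has_real_derivative y) (at x) \<and> 0 < y" using G_deriv[OF x] by blast
  qed
qed

lemma G_mono: "0 \<le> r \<Longrightarrow> r \<le> t \<Longrightarrow> G r \<le> G t"
  using G_strict_mono[of r t] by (cases "r = t") auto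

lemma G_isCont: "0 < r \<Longrightarrow> isCont G r"
  using G_deriv DERIV_isCont by blast

lemma G_cont: "continuous_on {0..} G"
  unfolding continuous_on_eq_continuous_within
proof
  fix r :: real assume "r \<in> {0..}"
  show "continuous (at r within {0..}) G"
  proof (cases "r = 0")
    case False
    then show ?thesis using G_isCont[of r] \<open>r \<in> {0..}\<close> by (simp add: continuous_at_imp_continuous_at_within)
  next
    case True
    have "(g \<longlongrightarrow> g 0) (at 0 within {0..})" using g_cont by (simp add: continuous_on_def)
    then have l: "((\<lambda>x. g x / \<alpha>1) \<longlongrightarrow> 0) (at 0 within {0..})"
      using tendsto_divide[OF _ tendsto_const[of \<alpha>1], of g 0] a1 by (simp add: g_0)
    have "(G \<longlongrightarrow> 0) (at 0 within {0..})"
    proof (rule Lim_null_comparison[OF _ l])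
      show "\<forall>\<^sub>F x in at 0 within {0..}. norm (G x) \<le> g x / \<alpha>1"
        unfolding eventually_at_filter
      proof (rule always_eventually, intro allI impI)
        fix x :: real assume "x \<noteq> 0" "x \<in> {0..}"
        then show "norm (G x) \<le> g x / \<alpha>1"
          using G_lower[of x] G_nonneg[of x] a1 by (simp add: pos_le_divide_eq mult.commute)
      qed
    qed
    then show ?thesis using True by (simp add: continuous_within G_0)
  qed
qed

lemma G_unbounded: "\<exists>r\<ge>0. y \<le> G r"
proof -
  \<comment> \<open>Chosen so that \<open>r^\<alpha>1 g(1)\<close> is at least
    \<open>\<alpha>2 |y|\<close>; the power growth of \<open>g\<close> and
    \<open>g \<le> \<alpha>2 G\<close> then finish.\<close>
  define r where "r = max 1 ((\<bar>y\<bar> * \<alpha>2 / g 1) powr (1 / \<alpha>1))"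
  have r1: "1 \<le> r" by (simp add: r_def)
  have "\<bar>y\<bar> * \<alpha>2 / g 1 = ((\<bar>y\<bar> * \<alpha>2 / g 1) powr (1 / \<alpha>1)) powr \<alpha>1"
    using a1 a2 g_pos[of 1] by (simp add: powr_powr)
  also have "\<dots> \<le> r powr \<alpha>1" using a1 by (intro powr_mono2) (auto simp: r_def)
  finally have "\<bar>y\<bar> * \<alpha>2 \<le> r powr \<alpha>1 * g 1" using g_pos[of 1] by (simp add: divide_le_eq)
  also have "\<dots> \<le> g r" using g_scale[of 1 r] r1 by simp
  also have "\<dots> \<le> \<alpha>2 * G r" using G_upper[of r] r1 by simp
  finally have "\<bar>y\<bar> \<le> G r" using a2 by (simp add: mult.commute)
  then show ?thesis using r1 by (intro exI[of _ r]) auto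
qed

lemma G_image: "0 \<le> \<tau> \<Longrightarrow> \<tau> \<in> G ` {0..}"
proof -
  assume \<tau>: "0 \<le> \<tau>"
  obtain r where r: "0 \<le> r" "\<tau> \<le> G r" using G_unbounded by blast
  have "\<exists>x\<ge>0. x \<le> r \<and> G x = \<tau>"
    by (rule IVT') (use r \<tau> G_0 in \<open>auto intro: continuous_on_subset[OF G_cont]\<close>)
  then show "\<tau> \<in> G ` {0..}" by auto
qed

lemma G_inj: "inj_on G {0..}"
proof (rule inj_onI)
  fix x y assume "x \<in> {0..}" "y \<in> {0..}" "G x = G y"
  then show "x = y" using G_strict_mono[of x y] G_strict_mono[of y x] by (cases x y rule: linorder_cases) auto
qed

lemma G_Ginv: "0 \<le> \<tau> \<Longrightarrow> G (Ginv \<tau>) = \<tau>"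
  unfolding half_line_inverse_def by (rule f_inv_into_f[OF G_image])

lemma Ginv_nonneg: "0 \<le> \<tau> \<Longrightarrow> 0 \<le> Ginv \<tau>"
  unfolding half_line_inverse_def using inv_into_into[OF G_image, of \<tau>] by simp

lemma Ginv_G: "0 \<le> r \<Longrightarrow> Ginv (G r) = r"
  unfolding half_line_inverse_def using inv_into_f_f[OF G_inj] by simp

lemma Ginv_pos: "0 < \<tau> \<Longrightarrow> 0 < Ginv \<tau>"
  using G_Ginv[of \<tau>] Ginv_nonneg[of \<tau>] G_0 by (cases "Ginv \<tau> = 0") auto

lemma less_Ginv_iff: "0 \<le> r \<Longrightarrow> 0 \<le> \<tau> \<Longrightarrow> r < Ginv \<tau> \<longleftrightarrow> G r < \<tau>"
  using G_strict_mono[of r "Ginv \<tau>"] G_mono[of "Ginv \<tau>" r] G_Ginv[of \<tau>] Ginv_nonneg[of \<tau>] by fastforce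

lemma Ginv_isCont:
  assumes \<tau>: "0 < \<tau>"
  shows "isCont Ginv \<tau>"
proof -
  let ?s = "Ginv \<tau>"
  have s: "0 < ?s" by (rule Ginv_pos[OF \<tau>])
  have "isCont Ginv (G ?s)"
    by (rule isCont_inverse_function2[of "?s / 2" ?s "2 * ?s"]) (use s Ginv_G G_isCont in auto)
  then show ?thesis using \<tau> by (simp add: G_Ginv)
qed

lemma Ginv_deriv:
  assumes \<tau>: "0 < \<tau>"
  shows "(Ginv has_real_derivative Ginv \<tau> / g (Ginv \<tau>)) (at \<tau>)"
proof -
  have s: "0 < Ginv \<tau>" by (rule Ginv_pos[OF \<tau>])
  have "(Ginv has_real_derivative inverse (g (Ginv \<tau>) / Ginv \<tau>)) (at \<tau>)"
  proof (rule DERIV_inverse_function[where f = G and a = 0 and b = "\<tau> + 1"])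
    show "(G has_real_derivative g (Ginv \<tau>) / Ginv \<tau>) (at (Ginv \<tau>))" by (rule G_deriv[OF s])
  qed (use s \<tau> g_pos[OF s] G_Ginv Ginv_isCont in auto)
  then show ?thesis by simp
qed

text \<open>Since \<open>r G'(r) = g r\<close>, this is \<open>nu0\<close>. It is also the
  logarithmic slope of the profile, \<open>p nu(r) = r J'(r) / J(r)\<close>, and the assumption
  \<open>\<alpha>2 < p\<close> keeps it away from zero.\<close>

definition nu :: "real \<Rightarrow> real" where "nu r = 1 - g r / (p * G r)"

lemma nu_lower: "0 < r \<Longrightarrow> 1 - \<alpha>2 / p \<le> nu r"
proof -
  assume r: "0 < r"
  have "g r / G r \<le> \<alpha>2" using G_upper[of r] G_pos[OF r] r by (simp add: divide_le_eq)
  then have "g r / G r / p \<le> \<alpha>2 / p" using p0 by (intro divide_right_mono) auto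
  then show "1 - \<alpha>2 / p \<le> nu r" by (simp add: nu_def mult.commute)
qed

lemma nu_upper: "0 < r \<Longrightarrow> nu r \<le> 1"
  using g_pos[of r] G_pos[of r] p0 by (simp add: nu_def)

lemma nu_pos: "0 < r \<Longrightarrow> 0 < nu r"
proof -
  assume "0 < r"
  have "\<alpha>2 / p < 1" using a2p p0 by simp
  then show "0 < nu r" using nu_lower[OF \<open>0 < r\<close>] by simp
qed

lemma nu0_eq: "0 < r \<Longrightarrow> nu0 p g r = nu r"
  using DERIV_imp_deriv[OF G_deriv, of r] by (simp add: nu0_def nu_def)

definition \<psi>J :: "real \<Rightarrow> real" where "\<psi>J r = J_fun p g r powr (1 / (p - 1))"

lemma powr_root_exp:
  assumes "0 < r" "0 < c"
  shows "(r powr p / c) powr (1 / (p - 1)) = exp ((p * ln r - ln c) / (p - 1))"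
  using assms by (simp add: powr_def ln_div ln_powr exp_diff[symmetric] flip: exp_diff)

lemma \<psi>J_exp: "0 < r \<Longrightarrow> \<psi>J r = exp ((p * ln r - ln (G r)) / (p - 1))"
  unfolding \<psi>J_def J_fun_def using powr_root_exp G_pos by blast

lemma \<psi>J_pos: "0 < r \<Longrightarrow> 0 < \<psi>J r"
  by (simp add: \<psi>J_exp)

lemma \<psi>J_deriv:
  assumes r: "0 < r"
  shows "(\<psi>J has_real_derivative p / (p - 1) * \<psi>J r * nu r / r) (at r)"
proof -
  have "((\<lambda>r. exp ((p * ln r - ln (G r)) / (p - 1))) has_real_derivative
      exp ((p * ln r - ln (G r)) / (p - 1)) * ((p * (1 / r) - (1 / G r) * (g r / r)) / (p - 1))) (at r)"
    using r G_pos[OF r]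
    by (intro DERIV_chain2[OF DERIV_exp] DERIV_cdivide DERIV_diff DERIV_cmult DERIV_ln_divide
        DERIV_chain2[OF DERIV_ln_divide G_deriv])
  moreover have "\<forall>\<^sub>F x in nhds r. \<psi>J x = exp ((p * ln x - ln (G x)) / (p - 1))"
    using eventually_nhds_in_open[of "{0<..}" r] r by (auto elim!: eventually_mono simp: \<psi>J_exp)
  ultimately have "(\<psi>J has_real_derivative
      exp ((p * ln r - ln (G r)) / (p - 1)) * ((p * (1 / r) - (1 / G r) * (g r / r)) / (p - 1))) (at r)"
    by (rule DERIV_eventually_cong)
  moreover have "exp ((p * ln r - ln (G r)) / (p - 1)) * ((p * (1 / r) - (1 / G r) * (g r / r)) / (p - 1)) =
      p / (p - 1) * \<psi>J r * nu r / r"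
    using r G_pos[OF r] p0 p1 by (simp add: \<psi>J_exp nu_def field_simps)
  ultimately show ?thesis by simp
qed

lemma \<psi>J_strict_mono: "0 < r \<Longrightarrow> r < t \<Longrightarrow> \<psi>J r < \<psi>J t"
proof -
  assume a: "0 < r" "r < t"
  show "\<psi>J r < \<psi>J t"
  proof (rule DERIV_pos_imp_increasing[OF a(2)])
    fix x assume "r \<le> x" "x \<le> t"
    then have x: "0 < x" using a by simp
    have "0 < p / (p - 1) * \<psi>J x * nu x / x" using p0 p1 \<psi>J_pos[OF x] nu_pos[OF x] x by simp
    then show "\<exists>y. (\<psi>J has_real_derivative y) (at x) \<and> 0 < y" using \<psi>J_deriv[OF x] by blast
  qed
qed

lemma \<psi>J_mono: "0 < r \<Longrightarrow> r \<le> t \<Longrightarrow> \<psi>J r \<le> \<psi>J t"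
  using \<psi>J_strict_mono[of r t] by (cases "r = t") auto

lemma \<psi>J_cont: "continuous_on {0<..} \<psi>J"
  using \<psi>J_deriv by (intro DERIV_continuous_on) (auto intro: has_field_derivative_at_within)

definition \<phi> :: "real \<Rightarrow> real" where "\<phi> \<tau> = E_fun p g \<tau> powr (1 / (p - 1))"
definition d\<phi> :: "real \<Rightarrow> real" where "d\<phi> \<tau> = p / (p - 1) * \<phi> \<tau> * nu (Ginv \<tau>) / g (Ginv \<tau>)"

lemma \<phi>_eq: "\<phi> \<tau> = \<psi>J (Ginv \<tau>)"
  by (simp add: \<phi>_def \<psi>J_def E_fun_def)

lemma \<phi>_pos: "0 < \<tau> \<Longrightarrow> 0 < \<phi> \<tau>"
  by (simp add: \<phi>_eq \<psi>J_pos Ginv_pos)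

lemma \<phi>_deriv:
  assumes \<tau>: "0 < \<tau>"
  shows "(\<phi> has_real_derivative d\<phi> \<tau>) (at \<tau>)"
proof -
  have s: "0 < Ginv \<tau>" by (rule Ginv_pos[OF \<tau>])
  have "((\<lambda>\<tau>. \<psi>J (Ginv \<tau>)) has_real_derivative p / (p - 1) * \<psi>J (Ginv \<tau>) * nu (Ginv \<tau>) / Ginv \<tau> * (Ginv \<tau> / g (Ginv \<tau>))) (at \<tau>)"
    by (rule DERIV_chain2[OF \<psi>J_deriv[OF s] Ginv_deriv[OF \<tau>]])
  then show ?thesis using s by (simp add: \<phi>_eq[abs_def] d\<phi>_def)
qed

lemma d\<phi>_nonneg: "0 < \<tau> \<Longrightarrow> 0 \<le> d\<phi> \<tau>"
  using p1 \<phi>_pos[of \<tau>] nu_pos[OF Ginv_pos, of \<tau>] g_pos[OF Ginv_pos, of \<tau>] by (simp add: d\<phi>_def)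

text \<open>The inverse of \<open>G\<close> has derivative \<open>Ginv / g(Ginv)\<close>, and
  \<open>g (Ginv \<tau>)\<close> is at least \<open>\<alpha>1 \<tau>\<close>; together with
  \<open>nu \<le> 1\<close> this gives at most power growth in \<open>\<tau>\<close>.\<close>

lemma d\<phi>_le:
  assumes \<tau>: "0 < \<tau>"
  shows "d\<phi> \<tau> \<le> p / ((p - 1) * \<alpha>1) * (\<phi> \<tau> / \<tau>)"
proof -
  have s: "0 < Ginv \<tau>" by (rule Ginv_pos[OF \<tau>])
  have "\<alpha>1 * \<tau> \<le> g (Ginv \<tau>)" using G_lower[of "Ginv \<tau>"] s \<tau> by (simp add: G_Ginv)
  moreover have "p / (p - 1) * \<phi> \<tau> * nu (Ginv \<tau>) \<le> p / (p - 1) * \<phi> \<tau> * 1"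
    using p1 \<phi>_pos[OF \<tau>] nu_upper[OF s] by (intro mult_left_mono) auto
  ultimately have "d\<phi> \<tau> \<le> (p / (p - 1) * \<phi> \<tau>) / (\<alpha>1 * \<tau>)"
    unfolding d\<phi>_def using p1 \<phi>_pos[OF \<tau>] \<tau> a1 by (intro frac_le) auto
  also have "\<dots> = p / ((p - 1) * \<alpha>1) * (\<phi> \<tau> / \<tau>)" by simp
  finally show ?thesis .
qed

lemma \<phi>_mono: "0 < \<tau> \<Longrightarrow> \<tau> \<le> \<tau>' \<Longrightarrow> \<phi> \<tau> \<le> \<phi> \<tau>'"
proof -
  assume \<tau>: "0 < \<tau>" "\<tau> \<le> \<tau>'"
  show "\<phi> \<tau> \<le> \<phi> \<tau>'"
  proof (rule DERIV_nonneg_imp_nondecreasing[OF \<tau>(2)])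
    fix x assume "\<tau> \<le> x"
    then have "0 < x" using \<tau> by simp
    then show "\<exists>y. (\<phi> has_real_derivative y) (at x) \<and> 0 \<le> y" using \<phi>_deriv d\<phi>_nonneg by blast
  qed
qed

lemma d\<phi>_cont: "continuous_on {0<..} d\<phi>"
proof -
  have c1: "continuous_on {0<..} Ginv"
  proof (rule continuous_at_imp_continuous_on, rule ballI)
    fix x :: real assume "x \<in> {0<..}"
    then show "isCont Ginv x" by (intro Ginv_isCont) simp
  qed
  have c2: "continuous_on {0<..} (\<lambda>\<tau>. g (Ginv \<tau>))"
  proof (rule continuous_on_compose2[OF g_cont c1], rule subsetI)
    fix y assume "y \<in> Ginv ` {0<..}"
    then obtain x where "y = Ginv x" "0 < x" by blast
    then show "y \<in> {0..}" using Ginv_nonneg[of x] by simp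
  qed
  have c3: "continuous_on {0<..} \<phi>"
  proof (rule DERIV_continuous_on)
    show "(\<phi> has_real_derivative d\<phi> x) (at x within {0<..})" if "x \<in> {0<..}" for x
      using \<phi>_deriv[of x] that by (auto intro: has_field_derivative_at_within)
  qed
  \<comment> \<open>\<open>G (Ginv \<tau>) = \<tau>\<close> turns \<open>nu (Ginv \<tau>)\<close>
    into an expression that is visibly continuous.\<close>
  have c4: "continuous_on {0<..} (\<lambda>\<tau>. 1 - g (Ginv \<tau>) / (p * \<tau>))"
  proof (rule continuous_on_diff[OF continuous_on_const continuous_on_divide[OF c2]])
    show "continuous_on {0<..} (\<lambda>\<tau>. p * \<tau>)" by (rule continuous_on_mult[OF continuous_on_const continuous_on_id])
  qed (use p0 in auto)
  have "continuous_on {0<..} (\<lambda>\<tau>. p / (p - 1) * \<phi> \<tau> * (1 - g (Ginv \<tau>) / (p * \<tau>)) / g (Ginv \<tau>))"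
  proof (rule continuous_on_divide[OF _ c2])
    show "continuous_on {0<..} (\<lambda>\<tau>. p / (p - 1) * \<phi> \<tau> * (1 - g (Ginv \<tau>) / (p * \<tau>)))"
      by (rule continuous_on_mult[OF continuous_on_mult[OF continuous_on_const c3] c4])
    show "\<forall>x\<in>{0<..}. g (Ginv x) \<noteq> 0"
    proof
      fix x :: real assume "x \<in> {0<..}"
      then show "g (Ginv x) \<noteq> 0" using g_pos[OF Ginv_pos[of x]] by simp
    qed
  qed
  then show ?thesis
  proof (rule continuous_on_eq)
    show "p / (p - 1) * \<phi> x * (1 - g (Ginv x) / (p * x)) / g (Ginv x) = d\<phi> x" if "x \<in> {0<..}" for x
      using that by (simp add: d\<phi>_def nu_def G_Ginv)
  qed
qed

definition \<psi> :: "real \<Rightarrow> real \<Rightarrow> real" where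
  "\<psi> r0 r = (if r0 \<le> r then \<psi>J r else I_fun p g r0 r)"
definition d\<psi> :: "real \<Rightarrow> real \<Rightarrow> real" where
  "d\<psi> r0 r = (if r0 \<le> r then p / (p - 1) * \<psi>J r * nu r / r
     else nu r0 * (p / (p - 1) * (r powr p / G r0) powr (1 / (p - 1)) / r))"
definition \<Lambda> :: "real \<Rightarrow> real" where
  "\<Lambda> r = (p / (p - 1)) powr (p - 1) * nu r powr (p - 1) / G r"
text \<open>\<open>\<Lambda>\<close> is the ratio of \<open>\<psi>'^(p-1)\<close> to
  \<open>r\<close> for the outer profile. The inner profile \<open>I\<close> is a constant plus a
  multiple of \<open>r^(p/(p-1))\<close>, for which this ratio does not depend on \<open>r\<close>,
  and the choice of \<open>nu0\<close> makes it equal to \<open>\<Lambda> r0\<close>. Hence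
  \<open>max r r0\<close>, and with it the continuity of the flux across \<open>r0\<close>.\<close>

definition \<Lambda>c :: "real \<Rightarrow> real \<Rightarrow> real" where
  "\<Lambda>c r0 r = \<Lambda> (max r r0)"

lemma I_fun_eq:
  "0 < r0 \<Longrightarrow> I_fun p g r0 r = nu r0 * (r powr p / G r0) powr (1 / (p - 1)) + (1 - nu r0) * \<psi>J r0"
  by (simp add: I_fun_def nu0_eq \<psi>J_def)

lemma I_fun_cont:
  assumes "0 < r0"
  shows "continuous_on {0..} (I_fun p g r0)"
proof -
  have "continuous_on {0..} (\<lambda>r. nu r0 * (r powr p / G r0) powr (1 / (p - 1)) + (1 - nu r0) * \<psi>J r0)"
    using p0 p1 G_pos[OF assms] by (intro continuous_intros continuous_on_powr') auto
  then show ?thesis by (rule continuous_on_eq) (simp add: I_fun_eq[OF assms])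
qed

lemma I_fun_at: "0 < r0 \<Longrightarrow> I_fun p g r0 r0 = \<psi>J r0"
  by (simp add: I_fun_eq \<psi>J_def J_fun_def algebra_simps)

lemma I_fun_le: "0 < r0 \<Longrightarrow> 0 \<le> r \<Longrightarrow> r \<le> r0 \<Longrightarrow> I_fun p g r0 r \<le> \<psi>J r0"
proof -
  assume a: "0 < r0" "0 \<le> r" "r \<le> r0"
  have "(r powr p / G r0) powr (1 / (p - 1)) \<le> \<psi>J r0"
    unfolding \<psi>J_def J_fun_def using a p0 p1 G_pos[of r0] by (intro powr_mono2 divide_right_mono powr_mono2) auto
  then have "nu r0 * (r powr p / G r0) powr (1 / (p - 1)) \<le> nu r0 * \<psi>J r0"
    using nu_pos[OF a(1)] by (intro mult_left_mono) auto
  then show "I_fun p g r0 r \<le> \<psi>J r0" using a by (simp add: I_fun_eq algebra_simps)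
qed

lemma I_fun_nonneg: "0 < r0 \<Longrightarrow> 0 \<le> I_fun p g r0 r"
  using nu_pos[of r0] nu_upper[of r0] \<psi>J_pos[of r0] by (simp add: I_fun_eq)

lemma \<psi>_nonneg: "0 < r0 \<Longrightarrow> 0 \<le> \<psi> r0 r"
  using I_fun_nonneg \<psi>J_pos[of r] by (auto simp: \<psi>_def less_imp_le)

lemma \<psi>_cont:
  assumes r0: "0 < r0"
  shows "continuous_on {0..} (\<psi> r0)"
proof -
  have "continuous_on ({r0..} \<union> {0..r0}) (\<lambda>r. if r0 \<le> r then \<psi>J r else I_fun p g r0 r)"
  proof (rule continuous_on_cases)
    show "continuous_on {r0..} \<psi>J" by (rule continuous_on_subset[OF \<psi>J_cont]) (use r0 in auto)
    show "continuous_on {0..r0} (I_fun p g r0)" by (rule continuous_on_subset[OF I_fun_cont[OF r0]]) auto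
    show "\<forall>r. r \<in> {r0..} \<and> \<not> r0 \<le> r \<or> r \<in> {0..r0} \<and> r0 \<le> r \<longrightarrow> \<psi>J r = I_fun p g r0 r"
      using I_fun_at[OF r0] by auto
  qed auto
  moreover have "{r0..} \<union> {0..r0} = {0..}" using r0 by auto
  ultimately show ?thesis by (simp add: \<psi>_def[abs_def])
qed

lemma I_fun_deriv:
  assumes "0 < r0" "0 < r"
  shows "(I_fun p g r0 has_real_derivative nu r0 * (p / (p - 1) * (r powr p / G r0) powr (1 / (p - 1)) / r)) (at r)"
proof -
  let ?c = "G r0"
  have c: "0 < ?c" by (rule G_pos[OF assms(1)])
  have "((\<lambda>r. nu r0 * exp ((p * ln r - ln ?c) / (p - 1)) + (1 - nu r0) * \<psi>J r0) has_real_derivative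
      nu r0 * (exp ((p * ln r - ln ?c) / (p - 1)) * ((p * (1 / r) - 0) / (p - 1))) + 0) (at r)"
    using assms by (intro DERIV_add DERIV_const DERIV_cmult DERIV_chain2[OF DERIV_exp] DERIV_cdivide DERIV_diff DERIV_ln_divide)
  moreover have "\<forall>\<^sub>F x in nhds r. I_fun p g r0 x = nu r0 * exp ((p * ln x - ln ?c) / (p - 1)) + (1 - nu r0) * \<psi>J r0"
  proof (rule eventually_mono)
    show "\<forall>\<^sub>F x in nhds r. x \<in> {0<..}" by (rule eventually_nhds_in_open) (use assms in auto)
    show "I_fun p g r0 x = nu r0 * exp ((p * ln x - ln ?c) / (p - 1)) + (1 - nu r0) * \<psi>J r0" if "x \<in> {0<..}" for x
      using that powr_root_exp[of x ?c] c by (simp add: I_fun_eq[OF assms(1)])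
  qed
  ultimately have "(I_fun p g r0 has_real_derivative
      nu r0 * (exp ((p * ln r - ln ?c) / (p - 1)) * ((p * (1 / r) - 0) / (p - 1))) + 0) (at r)"
    by (rule DERIV_eventually_cong)
  then show ?thesis using assms c by (simp add: powr_root_exp mult_ac)
qed

lemma \<psi>_deriv:
  assumes r0: "0 < r0" and r: "0 < r" "r \<noteq> r0"
  shows "(\<psi> r0 has_real_derivative d\<psi> r0 r) (at r)"
proof (cases "r0 < r")
  case True
  have "\<forall>\<^sub>F x in nhds r. \<psi> r0 x = \<psi>J x"
    using eventually_nhds_in_open[of "{r0<..}" r] True by (auto elim!: eventually_mono simp: \<psi>_def)
  from DERIV_eventually_cong[OF \<psi>J_deriv[OF r(1)] this] show ?thesis using True by (simp add: d\<psi>_def)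
next
  case False
  then have lt: "r < r0" using r by simp
  have "\<forall>\<^sub>F x in nhds r. \<psi> r0 x = I_fun p g r0 x"
    using eventually_nhds_in_open[of "{..<r0}" r] lt by (auto elim!: eventually_mono simp: \<psi>_def)
  from DERIV_eventually_cong[OF I_fun_deriv[OF r0 r(1)] this] show ?thesis using lt by (simp add: d\<psi>_def)
qed

lemma d\<psi>_nonneg: "0 < r0 \<Longrightarrow> 0 < r \<Longrightarrow> 0 \<le> d\<psi> r0 r"
  using p1 \<psi>J_pos[of r] nu_pos[of r] nu_pos[of r0] by (simp add: d\<psi>_def)

text \<open>The identity \<open>\<psi>'\<^sup>p\<^sup>-\<^sup>1 = r \<Lambda>(r)\<close> makes the flux of the barrier a Lipschitz radial multiple of \<open>x\<close>.\<close>

lemma d\<psi>_powr: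
  assumes r0: "0 < r0" and r: "0 < r"
  shows "d\<psi> r0 r powr (p - 1) = \<Lambda>c r0 r * r"
proof -
  \<comment> \<open>One computation serves both branches: \<open>c\<close> is \<open>G r\<close>
    outside and \<open>G r0\<close> inside, and \<open>n\<close> is the corresponding value of
    \<open>nu\<close>.\<close>
  have key: "(n * (p / (p - 1) * (r powr p / c) powr (1 / (p - 1)) / r)) powr (p - 1) =
      (p / (p - 1)) powr (p - 1) * n powr (p - 1) / c * r" if "0 < n" "0 < c" for n c
  proof -
    have "(n * (p / (p - 1) * (r powr p / c) powr (1 / (p - 1)) / r)) powr (p - 1) =
        n powr (p - 1) * ((p / (p - 1)) powr (p - 1) * ((r powr p / c) powr (1 / (p - 1))) powr (p - 1) / r powr (p - 1))"
      using that r p1 by (simp add: powr_mult powr_divide)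
    also have "((r powr p / c) powr (1 / (p - 1))) powr (p - 1) = r powr p / c"
      using that r p1 by (simp add: powr_powr)
    also have "n powr (p - 1) * ((p / (p - 1)) powr (p - 1) * (r powr p / c) / r powr (p - 1)) =
        (p / (p - 1)) powr (p - 1) * n powr (p - 1) / c * (r powr p / r powr (p - 1))"
      by simp
    also have "r powr p / r powr (p - 1) = r" using r by (simp flip: powr_diff)
    finally show ?thesis .
  qed
  show ?thesis
  proof (cases "r0 \<le> r")
    case True
    then have "d\<psi> r0 r = nu r * (p / (p - 1) * (r powr p / G r) powr (1 / (p - 1)) / r)"
      by (simp add: d\<psi>_def \<psi>J_def J_fun_def mult_ac)
    then show ?thesis using key[OF nu_pos[OF r] G_pos[OF r]] True by (simp add: \<Lambda>c_def \<Lambda>_def)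
  next
    case False
    then show ?thesis using key[OF nu_pos[OF r0] G_pos[OF r0]] by (simp add: \<Lambda>c_def \<Lambda>_def d\<psi>_def)
  qed
qed

lemma d\<psi>_eq: "0 < r0 \<Longrightarrow> 0 < r \<Longrightarrow> (\<Lambda>c r0 r * r) powr (1 / (p - 1)) = d\<psi> r0 r"
  by (subst d\<psi>_powr[symmetric]) (use d\<psi>_nonneg[of r0 r] p1 in \<open>simp_all add: powr_powr\<close>)

section \<open>Bounds for the divergence of the barrier flux\<close>

definition dnu :: "real \<Rightarrow> real" where
  "dnu r = - ((deriv g r * G r - g r * (g r / r)) / (G r * G r)) / p"

lemma nu_deriv: "0 < r \<Longrightarrow> (nu has_real_derivative dnu r) (at r)"
proof -
  assume r: "0 < r"
  have "((\<lambda>r. 1 - (g r / G r) / p) has_real_derivative 0 - ((deriv g r * G r - g r * (g r / r)) / (G r * G r)) / p) (at r)"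
    using G_pos[OF r] by (intro DERIV_diff DERIV_const DERIV_cdivide DERIV_divide g_deriv[OF r] G_deriv[OF r]) simp
  then show "(nu has_real_derivative dnu r) (at r)" unfolding nu_def[abs_def] dnu_def by (simp add: mult.commute)
qed

lemma g_over_G: "0 < r \<Longrightarrow> g r / G r \<le> \<alpha>2" "0 < r \<Longrightarrow> 0 \<le> g r / G r"
  using G_upper[of r] G_pos[of r] g_pos[of r] by (simp_all add: divide_le_eq less_imp_le)

lemma r_dg_le: "0 < r \<Longrightarrow> r * deriv g r \<le> \<alpha>2 * g r"
  using g_upper[of r] by (simp add: field_simps)

text \<open>The quantity \<open>r nu'\<close> is scale invariant: up to the factor
  \<open>-1/p\<close> it is the difference of \<open>r g' / G\<close> and \<open>(g / G)^2\<close>,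
  both of which lie between 0 and the square of \<open>\<alpha>2\<close>.\<close>

lemma dnu_bound:
  assumes r: "0 < r"
  shows "\<bar>r * dnu r\<bar> \<le> 2 * \<alpha>2\<^sup>2 / p"
proof -
  have G: "0 < G r" by (rule G_pos[OF r])
  define A where "A = r * deriv g r / G r"
  define B where "B = (g r / G r)\<^sup>2"
  have e: "r * dnu r = - (A - B) / p"
    using r G p0 by (simp add: dnu_def A_def B_def field_simps power2_eq_square)
  have A0: "0 \<le> A" using r G dg_pos[OF r] by (simp add: A_def)
  have A1: "A \<le> \<alpha>2\<^sup>2"
  proof -
    have "A \<le> \<alpha>2 * (g r / G r)" using r_dg_le[OF r] G by (simp add: A_def divide_right_mono)
    also have "\<dots> \<le> \<alpha>2 * \<alpha>2" using g_over_G[OF r] a2 by (intro mult_left_mono) auto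
    finally show ?thesis by (simp add: power2_eq_square)
  qed
  have B: "B \<le> \<alpha>2\<^sup>2" "0 \<le> B" unfolding B_def using g_over_G[OF r] by (auto intro: power_mono)
  have "\<bar>- (A - B)\<bar> \<le> 2 * \<alpha>2\<^sup>2" using A0 A1 B by linarith
  then show ?thesis unfolding e using p0 by (simp only: abs_divide abs_of_pos divide_right_mono less_imp_le)
qed

lemma \<Lambda>_pos: "0 < r \<Longrightarrow> 0 < \<Lambda> r"
  using p1 nu_pos[of r] G_pos[of r] by (simp add: \<Lambda>_def)

definition d\<Lambda> :: "real \<Rightarrow> real" where
  "d\<Lambda> r = \<Lambda> r * ((p - 1) * dnu r / nu r - g r / r / G r)"

lemma \<Lambda>_deriv:
  assumes r: "0 < r"
  shows "(\<Lambda> has_real_derivative d\<Lambda> r) (at r)"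
proof -
  let ?c = "(p / (p - 1)) powr (p - 1)"
  have n: "0 < nu r" and G: "0 < G r" using nu_pos[OF r] G_pos[OF r] .
  have d: "((\<lambda>r. ?c * nu r powr (p - 1) / G r) has_real_derivative
      ((?c * ((p - 1) * nu r powr (p - 1 - of_nat 1) * dnu r)) * G r - (?c * nu r powr (p - 1)) * (g r / r)) / (G r * G r)) (at r)"
    using G by (intro DERIV_divide DERIV_cmult DERIV_fun_powr nu_deriv[OF r] G_deriv[OF r] n) simp
  have e: "nu r powr (p - 1 - of_nat 1) = nu r powr (p - 1) / nu r" using n by (simp add: powr_diff power2_eq_square)
  have "((?c * ((p - 1) * nu r powr (p - 1 - of_nat 1) * dnu r)) * G r - (?c * nu r powr (p - 1)) * (g r / r)) / (G r * G r) = d\<Lambda> r"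
    unfolding e d\<Lambda>_def \<Lambda>_def using n G r by (simp add: diff_divide_distrib right_diff_distrib mult_ac)
  then show ?thesis using d unfolding \<Lambda>_def[abs_def] by simp
qed

text \<open>A bound for the logarithmic derivative
  \<open>r \<Lambda>' / \<Lambda> = (p-1) r nu' / nu - g / G\<close>, with \<open>nu\<close>
  replaced by its lower bound \<open>1 - \<alpha>2 / p\<close>.\<close>

definition BL :: real where "BL = (p - 1) * (2 * \<alpha>2\<^sup>2 / p) / (1 - \<alpha>2 / p) + \<alpha>2"

lemma d\<Lambda>_bound:
  assumes r: "0 < r"
  shows "\<bar>r * d\<Lambda> r\<bar> \<le> BL * \<Lambda> r"
proof -
  have n: "0 < nu r" by (rule nu_pos[OF r])
  have m: "0 < 1 - \<alpha>2 / p" using a2p p0 by simp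
  have "r * d\<Lambda> r = \<Lambda> r * ((p - 1) * (r * dnu r) / nu r - g r / G r)"
    using r by (simp add: d\<Lambda>_def algebra_simps)
  moreover have "\<bar>(p - 1) * (r * dnu r) / nu r - g r / G r\<bar> \<le> BL"
  proof -
    have "\<bar>(p - 1) * (r * dnu r) / nu r\<bar> = (p - 1) * \<bar>r * dnu r\<bar> / nu r"
      using p1 n by (simp add: abs_mult)
    also have "\<dots> \<le> (p - 1) * (2 * \<alpha>2\<^sup>2 / p) / (1 - \<alpha>2 / p)"
      using p1 m nu_lower[OF r] dnu_bound[OF r] by (intro frac_le mult_left_mono) auto
    finally show ?thesis unfolding BL_def using g_over_G[OF r] by linarith
  qed
  ultimately show ?thesis using \<Lambda>_pos[OF r] by (simp add: abs_mult mult_right_mono mult.commute)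
qed

lemma \<Lambda>_le: "0 < r \<Longrightarrow> \<Lambda> r \<le> (p / (p - 1)) powr (p - 1) / G r"
proof -
  assume r: "0 < r"
  have "nu r powr (p - 1) \<le> 1" using nu_pos[OF r] nu_upper[OF r] p1 by (intro powr_le1) auto
  then have "(p / (p - 1)) powr (p - 1) * nu r powr (p - 1) \<le> (p / (p - 1)) powr (p - 1) * 1" by (intro mult_left_mono) auto
  then show "\<Lambda> r \<le> (p / (p - 1)) powr (p - 1) / G r" unfolding \<Lambda>_def using G_pos[OF r] by (simp add: divide_right_mono)
qed

definition d\<Lambda>c :: "real \<Rightarrow> real \<Rightarrow> real" where
  "d\<Lambda>c r0 r = (if r0 < r then d\<Lambda> r else 0)"

lemma \<Lambda>c_cont: "0 < r0 \<Longrightarrow> continuous_on {0..} (\<Lambda>c r0)"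
proof -
  assume r0: "0 < r0"
  have "continuous_on {0<..} \<Lambda>"
    using \<Lambda>_deriv by (intro DERIV_continuous_on) (auto intro: has_field_derivative_at_within)
  then show "continuous_on {0..} (\<Lambda>c r0)" unfolding \<Lambda>c_def[abs_def]
    by (rule continuous_on_compose2) (use r0 in \<open>auto intro!: continuous_intros\<close>)
qed

lemma \<Lambda>c_deriv:
  assumes r0: "0 < r0" and r: "0 < r" "r \<noteq> r0"
  shows "(\<Lambda>c r0 has_real_derivative d\<Lambda>c r0 r) (at r)"
proof (cases "r0 < r")
  case True
  have "\<forall>\<^sub>F x in nhds r. \<Lambda>c r0 x = \<Lambda> x"
    using eventually_nhds_in_open[of "{r0<..}" r] True by (auto elim!: eventually_mono simp: \<Lambda>c_def)
  from DERIV_eventually_cong[OF \<Lambda>_deriv[OF r(1)] this] show ?thesis using True by (simp add: d\<Lambda>c_def)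
next
  case False
  then have lt: "r < r0" using r by simp
  have "\<forall>\<^sub>F x in nhds r. \<Lambda>c r0 x = \<Lambda> r0"
    using eventually_nhds_in_open[of "{..<r0}" r] lt by (auto elim!: eventually_mono simp: \<Lambda>c_def)
  from DERIV_eventually_cong[OF DERIV_const this] show ?thesis using lt by (simp add: d\<Lambda>c_def)
qed

lemma BL_nonneg: "0 \<le> BL"
proof -
  have "0 < 1 - \<alpha>2 / p" using a2p p0 by simp
  then show ?thesis unfolding BL_def using p1 a2 p0 by simp
qed

lemma \<Lambda>c_le: "0 < r0 \<Longrightarrow> \<Lambda>c r0 r \<le> (p / (p - 1)) powr (p - 1) / G r0"
proof -
  assume r0: "0 < r0"
  have m: "0 < max r r0" using r0 by simp
  have "\<Lambda>c r0 r \<le> (p / (p - 1)) powr (p - 1) / G (max r r0)" unfolding \<Lambda>c_def by (rule \<Lambda>_le[OF m])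
  also have "\<dots> \<le> (p / (p - 1)) powr (p - 1) / G r0" using r0 G_pos[OF r0] G_mono[of r0 "max r r0"] by (intro frac_le) auto
  finally show "\<Lambda>c r0 r \<le> (p / (p - 1)) powr (p - 1) / G r0" .
qed

lemma \<Lambda>c_pos: "0 < r0 \<Longrightarrow> 0 < \<Lambda>c r0 r"
  unfolding \<Lambda>c_def by (rule \<Lambda>_pos) simp

lemma d\<psi>_bounded:
  assumes r0: "0 < r0" and R: "0 < R"
  shows "\<exists>B. \<forall>r. 0 < r \<and> r \<le> R \<longrightarrow> \<bar>- d\<psi> r0 r\<bar> \<le> B"
proof (intro exI allI impI)
  fix r assume r: "0 < r \<and> r \<le> R"
  have "(\<Lambda>c r0 r * r) powr (1 / (p - 1)) \<le> ((p / (p - 1)) powr (p - 1) / G r0 * R) powr (1 / (p - 1))"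
    using r \<Lambda>c_pos[OF r0, of r] \<Lambda>c_le[OF r0, of r] p1 by (intro powr_mono2 mult_mono) auto
  then show "\<bar>- d\<psi> r0 r\<bar> \<le> ((p / (p - 1)) powr (p - 1) / G r0 * R) powr (1 / (p - 1))"
    using r d\<psi>_eq[OF r0, of r] d\<psi>_nonneg[OF r0, of r] by simp
qed

lemma d\<Lambda>c_bound:
  assumes r0: "0 < r0" and r: "0 < r"
  shows "\<bar>r * d\<Lambda>c r0 r\<bar> \<le> BL * ((p / (p - 1)) powr (p - 1) / G r0)"
proof (cases "r0 < r")
  case True
  have "\<bar>r * d\<Lambda>c r0 r\<bar> \<le> BL * \<Lambda>c r0 r" using d\<Lambda>_bound[OF r] True by (simp add: d\<Lambda>c_def \<Lambda>c_def)
  also have "\<dots> \<le> BL * ((p / (p - 1)) powr (p - 1) / G r0)" by (intro mult_left_mono \<Lambda>c_le r0 BL_nonneg)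
  finally show ?thesis .
next
  case False
  then show ?thesis using BL_nonneg G_pos[OF r0] by (simp add: d\<Lambda>c_def)
qed

text \<open>The decay of \<open>\<Lambda>\<close> like \<open>1/G\<close> offsets
  \<open>r g' \<le> \<alpha>2 g\<close> and \<open>g \<le> \<alpha>2 G\<close>. This is where the
  upper growth condition tames the drift produced by the exponential weight.\<close>

lemma \<Lambda>c_dg_bound:
  assumes r0: "0 < r0" and r: "0 < r"
  shows "\<Lambda>c r0 r * (r * deriv g r) \<le> (p / (p - 1)) powr (p - 1) * \<alpha>2\<^sup>2"
proof -
  let ?c = "(p / (p - 1)) powr (p - 1)"
  have m: "0 < max r r0" using r0 by simp
  have "r * deriv g r \<le> \<alpha>2\<^sup>2 * G r"
  proof -
    have "\<alpha>2 * g r \<le> \<alpha>2 * (\<alpha>2 * G r)" using G_upper[of r] r a2 by (intro mult_left_mono) auto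
    then show ?thesis using r_dg_le[OF r] by (simp add: power2_eq_square mult.assoc)
  qed
  also have "\<dots> \<le> \<alpha>2\<^sup>2 * G (max r r0)" using r by (intro mult_left_mono G_mono) auto
  finally have 1: "r * deriv g r \<le> \<alpha>2\<^sup>2 * G (max r r0)" .
  have "\<Lambda>c r0 r * (r * deriv g r) \<le> (?c / G (max r r0)) * (\<alpha>2\<^sup>2 * G (max r r0))"
    unfolding \<Lambda>c_def by (rule mult_mono[OF \<Lambda>_le[OF m] 1]) (use dg_pos[OF r] r G_pos[OF m] in auto)
  then show ?thesis using G_pos[OF m] by simp
qed

text \<open>Meant as a bound for \<open>div (\<Lambda>c f x) / f\<close>, which for the weight
  \<open>f = exp g\<close> equals \<open>r \<Lambda>c' + \<Lambda>c r g' + N \<Lambda>c\<close>;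
  \<open>N\<close> stands for the dimension.\<close>

definition Dconst :: "real \<Rightarrow> real \<Rightarrow> real" where
  "Dconst N r0 = (p / (p - 1)) powr (p - 1) * ((BL + N) / G r0 + \<alpha>2\<^sup>2)"

lemma divergence_bound:
  assumes r0: "0 < r0" and r: "0 < r" and N: "0 \<le> N"
  shows "r * d\<Lambda>c r0 r + \<Lambda>c r0 r * (r * deriv g r) + N * \<Lambda>c r0 r \<le> Dconst N r0"
proof -
  let ?c = "(p / (p - 1)) powr (p - 1)"
  have "N * \<Lambda>c r0 r \<le> N * (?c / G r0)" by (intro mult_left_mono \<Lambda>c_le r0 N)
  moreover have "Dconst N r0 = BL * (?c / G r0) + ?c * \<alpha>2\<^sup>2 + N * (?c / G r0)"
    by (simp add: Dconst_def algebra_simps add_divide_distrib)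
  ultimately show ?thesis using d\<Lambda>c_bound[OF r0 r] \<Lambda>c_dg_bound[OF r0 r] by linarith
qed

text \<open>The right side is \<open>\<psi>'^p\<close>, the contribution of diffusion when the
  derivative falls on the power of the gap. At the free boundary \<open>\<psi> = \<phi>\<close> and
  \<open>G r = \<tau>\<close>, so the lower bound has the order \<open>\<phi> / \<tau>\<close>, the
  same as the upper bound for \<open>\<phi>'\<close>.\<close>

lemma near_boundary_lower:
  assumes r0: "0 < r0" and r: "r0 \<le> r"
  shows "(p / (p - 1)) powr (p - 1) * (p / (p - 1)) * (1 - \<alpha>2 / p) powr p * (\<psi>J r / G r) \<le> d\<psi> r0 r * (\<Lambda>c r0 r * r)"
proof -
  let ?c = "(p / (p - 1)) powr (p - 1)"
  have rp: "0 < r" using r0 r by simp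
  have n: "0 < nu r" by (rule nu_pos[OF rp])
  have m: "0 < 1 - \<alpha>2 / p" using a2p p0 by simp
  have "(1 - \<alpha>2 / p) powr p \<le> nu r powr p" using m nu_lower[OF rp] p0 by (intro powr_mono2) auto
  moreover have "nu r powr p = nu r powr (p - 1) * nu r" using n by (simp add: powr_diff)
  ultimately have "?c * (p / (p - 1)) * (\<psi>J r / G r) * (1 - \<alpha>2 / p) powr p \<le> ?c * (p / (p - 1)) * (\<psi>J r / G r) * (nu r powr (p - 1) * nu r)"
    using p1 \<psi>J_pos[OF rp] G_pos[OF rp] by (intro mult_left_mono) auto
  also have "\<dots> = d\<psi> r0 r * (\<Lambda>c r0 r * r)"
    using r rp by (simp add: d\<psi>_def \<Lambda>c_def \<Lambda>_def)
  finally show ?thesis by (simp add: mult_ac)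
qed

end

section \<open>Limits of weak derivatives\<close>

text \<open>A product of a step in the squared norm and a step in time. Compactness gives a positive
  lower bound \<open>\<delta>\<close> for the times in \<open>K\<close>, and the time step switches
  on between \<open>\<delta> / 2\<close> and \<open>\<delta>\<close>.\<close>

lemma spacetime_cutoff:
  fixes K :: "('a::euclidean_space \<times> real) set"
  assumes K: "compact K" "K \<subseteq> spacetime"
  obtains \<eta> where "test_function spacetime \<eta>" "\<And>z. 0 \<le> \<eta> z" "\<And>z. z \<in> K \<Longrightarrow> \<eta> z = 1"
proof -
  obtain S C where "smooth_step S C" using exists_smooth_step by blast
  note S = smooth_stepD[OF this]
  obtain \<delta> where \<delta>: "\<delta> > 0" "(\<Union>z\<in>K. cball z \<delta>) \<subseteq> spacetime"
    by (rule compact_subset_open_imp_cball_epsilon_subset[OF K(1) open_spacetime K(2)]) (rule that)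
  have a: "\<delta> \<le> snd z" if z: "z \<in> K" for z
  proof (rule ccontr)
    assume n: "\<not> \<delta> \<le> snd z"
    have "dist z (z + (0, - snd z)) = \<bar>snd z\<bar>" by (simp add: dist_norm norm_Pair)
    moreover have "0 < snd z" using z K(2) by (auto simp: spacetime_def)
    ultimately have "z + (0, - snd z) \<in> cball z \<delta>" using n by simp
    then have "z + (0, - snd z) \<in> spacetime" using \<delta>(2) z by blast
    then have "0 < snd (z + (0, - snd z))" unfolding spacetime_def by (metis greaterThan_iff mem_Times_iff)
    then show False by simp
  qed
  obtain R where R: "\<And>z. z \<in> K \<Longrightarrow> norm z \<le> R" using compact_imp_bounded[OF K(1)] unfolding bounded_iff by blast
  define \<eta> :: "'a \<times> real \<Rightarrow> real" where "\<eta> z = S ((R\<^sup>2 + 1) - z \<bullet> z) * S ((2 / \<delta>) * snd z - 1)" for z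
  have s1: "smooth (\<lambda>z::'a \<times> real. S ((R\<^sup>2 + 1) - z \<bullet> z))"
    by (rule smooth_compose[OF S(1) smooth_diff[OF smooth_const smooth_inner_self]])
  have bl: "bounded_linear (\<lambda>z::'a \<times> real. (2 / \<delta>) * snd z)" by (intro bounded_linear_intros)
  have s2: "smooth (\<lambda>z::'a \<times> real. S ((2 / \<delta>) * snd z - 1))"
    by (rule smooth_compose[OF S(1) smooth_diff[OF smooth_linear[OF bl] smooth_const]])
  have sm: "smooth \<eta>" unfolding \<eta>_def by (rule smooth_mult[OF s1 s2])
  define K' where "K' = cball (0::'a \<times> real) (sqrt (R\<^sup>2 + 1)) \<inter> {z. \<delta> / 2 \<le> snd z}"
  have "closed {z::'a \<times> real. \<delta> / 2 \<le> snd z}" by (intro closed_Collect_le continuous_intros)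
  then have K': "compact K'" unfolding K'_def by (intro compact_Int_closed compact_cball)
  have K'S: "K' \<subseteq> spacetime" using \<delta>(1) by (auto simp: K'_def spacetime_def)
  show ?thesis
  proof (rule that)
    show "test_function spacetime \<eta>"
    proof (rule test_functionI[OF sm K' K'S])
      fix z :: "'a \<times> real" assume "z \<notin> K'"
      then consider "sqrt (R\<^sup>2 + 1) < norm z" | "snd z < \<delta> / 2" by (auto simp: K'_def)
      then show "\<eta> z = 0"
      proof cases
        case 1
        then have "(sqrt (R\<^sup>2 + 1))\<^sup>2 < (norm z)\<^sup>2" by (intro power_strict_mono) auto
        then show ?thesis using S(2) by (simp add: \<eta>_def power2_norm_eq_inner)
      next
        case 2
        then have "(2 / \<delta>) * snd z - 1 \<le> 0" using \<delta>(1) by (simp add: field_simps)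
        then show ?thesis using S(2) by (simp add: \<eta>_def)
      qed
    qed
    show "0 \<le> \<eta> z" for z using S(5) by (simp add: \<eta>_def)
    fix z assume z: "z \<in> K"
    have "z \<bullet> z \<le> R\<^sup>2" using R[OF z] by (simp add: power2_norm_eq_inner[symmetric] power_mono)
    moreover have "1 \<le> (2 / \<delta>) * snd z - 1" using a[OF z] \<delta>(1) by (simp add: field_simps)
    ultimately show "\<eta> z = 1" using S(3) by (simp add: \<eta>_def)
  qed
qed

lemma rst_integral_abs_le:
  fixes h W \<kappa> :: "'b::euclidean_space \<Rightarrow> real"
  assumes "integrable lebesgue (\<lambda>z. rst K h z * \<kappa> z)" "integrable lebesgue (\<lambda>z. rst K W z * \<bar>\<kappa> z\<bar>)"
    and "\<And>z. z \<in> K \<Longrightarrow> \<bar>h z\<bar> \<le> W z"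
  shows "\<bar>LINT z|lebesgue. rst K h z * \<kappa> z\<bar> \<le> (LINT z|lebesgue. rst K W z * \<bar>\<kappa> z\<bar>)"
proof (rule order_trans[OF integral_abs_bound integral_mono])
  show "\<bar>rst K h z * \<kappa> z\<bar> \<le> rst K W z * \<bar>\<kappa> z\<bar>" for z
    using assms(3)[of z] by (cases "z \<in> K") (auto simp: abs_mult intro: mult_right_mono)
qed (use assms in auto)

text \<open>By Fatou's lemma, a part of the derivatives with a sign is bounded in \<open>L\<^sup>1\<close> by the other terms.\<close>

lemma weak_ddir_Fatou:
  fixes B :: "'a::euclidean_space \<times> real \<Rightarrow> real"
  assumes wn: "\<And>n. weak_ddir spacetime e (wn n) (\<lambda>z. An n z + Bn n z)"
    and W: "locally_L1 spacetime W" and w: "\<And>n z. z \<in> spacetime \<Longrightarrow> \<bar>wn n z\<bar> \<le> W z"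
    and Al: "\<And>n. locally_L1 spacetime (An n)"
    and A: "locally_L1 spacetime Y" "\<And>n z. z \<in> spacetime \<Longrightarrow> \<bar>An n z\<bar> \<le> Y z"
    and B0: "\<And>n z. z \<in> spacetime \<Longrightarrow> 0 \<le> Bn n z" and B: "\<And>z. z \<in> spacetime \<Longrightarrow> (\<lambda>n. Bn n z) \<longlonglongrightarrow> B z"
  shows "locally_L1 spacetime B"
proof (rule locally_L1_I)
  let ?S = "spacetime :: ('a \<times> real) set"
  fix K :: "('a \<times> real) set" assume K: "compact K" "K \<subseteq> ?S"
  obtain \<eta> where \<eta>: "test_function ?S \<eta>" "\<And>z. 0 \<le> \<eta> z" "\<And>z. z \<in> K \<Longrightarrow> \<eta> z = 1"
    by (rule spacetime_cutoff[OF K]) (rule that)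
  obtain K' where K': "compact K'" "K' \<subseteq> ?S" "\<And>z. z \<notin> K' \<Longrightarrow> \<eta> z = 0" and \<eta>s: "smooth \<eta>"
    using \<eta>(1) unfolding test_function_def by blast
  have D\<eta>0: "ddir e \<eta> z = 0" if "z \<notin> K'" for z
    by (rule ddir_outside_support[OF compact_imp_closed[OF K'(1)] K'(3) that])
  have \<eta>c: "continuous_on UNIV \<eta>" by (rule smooth_continuous[OF \<eta>s])
  have Bl: "locally_L1 ?S (Bn n)" for n
    using locally_L1_diff[OF _ Al[of n], of "\<lambda>z. An n z + Bn n z"] wn[of n] by (simp add: weak_ddir_def)
  have i1: "integrable lebesgue (\<lambda>z. rst K' W z * \<bar>ddir e \<eta> z\<bar>)"
  proof (rule continuous_rst_integrable[OF W K'(1,2)])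
    show "continuous_on UNIV (\<lambda>z. \<bar>ddir e \<eta> z\<bar>)"
      by (rule continuous_on_rabs[OF smooth_continuous[OF smooth_ddir[OF \<eta>s]]])
  qed (simp add: D\<eta>0)
  have i2: "integrable lebesgue (\<lambda>z. rst K' Y z * \<eta> z)" by (rule continuous_rst_integrable[OF A(1) K'(1,2) \<eta>c K'(3)])
  \<comment> \<open>The identity tested with \<open>\<eta>\<close> expresses the integral of
    \<open>Bn n\<close> through the other two terms, whose bounds do not depend on
    \<open>n\<close>.\<close>
  define M where "M = (LINT z|lebesgue. rst K' W z * \<bar>ddir e \<eta> z\<bar>) + (LINT z|lebesgue. rst K' Y z * \<eta> z)"
  have iB: "integrable lebesgue (\<lambda>z. rst K' (Bn n) z * \<eta> z)" for n by (rule continuous_rst_integrable[OF Bl K'(1,2) \<eta>c K'(3)])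
  have bound: "(LINT z|lebesgue. rst K' (Bn n) z * \<eta> z) \<le> M" for n
  proof -
    have lw: "locally_L1 ?S (wn n)" using wn[of n] by (simp add: weak_ddir_def)
    have i3: "integrable lebesgue (\<lambda>z. rst K' (wn n) z * ddir e \<eta> z)"
      by (rule continuous_rst_integrable[OF lw K'(1,2) smooth_continuous[OF smooth_ddir[OF \<eta>s]] D\<eta>0])
    have i4: "integrable lebesgue (\<lambda>z. rst K' (An n) z * \<eta> z)" by (rule continuous_rst_integrable[OF Al K'(1,2) \<eta>c K'(3)])
    have "(LINT z:?S|lebesgue. wn n z * ddir e \<eta> z) = - (LINT z:?S|lebesgue. (An n z + Bn n z) * \<eta> z)"
      using wn[of n] \<eta>(1) by (simp add: weak_ddir_def)
    moreover have "(LINT z:?S|lebesgue. wn n z * ddir e \<eta> z) = (LINT z|lebesgue. rst K' (wn n) z * ddir e \<eta> z)"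
      by (rule set_integral_rst[OF K'(2) D\<eta>0])
    moreover have "(LINT z:?S|lebesgue. (An n z + Bn n z) * \<eta> z) = (LINT z|lebesgue. rst K' (\<lambda>z. An n z + Bn n z) z * \<eta> z)"
      by (rule set_integral_rst[OF K'(2,3)])
    ultimately have "(LINT z|lebesgue. rst K' (wn n) z * ddir e \<eta> z) = - (LINT z|lebesgue. rst K' (\<lambda>z. An n z + Bn n z) z * \<eta> z)"
      by simp
    also have "(LINT z|lebesgue. rst K' (\<lambda>z. An n z + Bn n z) z * \<eta> z) =
        (LINT z|lebesgue. rst K' (An n) z * \<eta> z + rst K' (Bn n) z * \<eta> z)"
      by (intro Bochner_Integration.integral_cong) (auto simp: algebra_simps)
    also have "\<dots> = (LINT z|lebesgue. rst K' (An n) z * \<eta> z) + (LINT z|lebesgue. rst K' (Bn n) z * \<eta> z)"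
      by (rule Bochner_Integration.integral_add[OF i4 iB])
    finally have e: "(LINT z|lebesgue. rst K' (Bn n) z * \<eta> z) =
        - (LINT z|lebesgue. rst K' (wn n) z * ddir e \<eta> z) - (LINT z|lebesgue. rst K' (An n) z * \<eta> z)"
      by simp
    have "\<bar>LINT z|lebesgue. rst K' (wn n) z * ddir e \<eta> z\<bar> \<le> (LINT z|lebesgue. rst K' W z * \<bar>ddir e \<eta> z\<bar>)"
      by (rule rst_integral_abs_le[OF i3 i1]) (use w K'(2) in blast)
    moreover have "\<bar>LINT z|lebesgue. rst K' (An n) z * \<eta> z\<bar> \<le> (LINT z|lebesgue. rst K' Y z * \<bar>\<eta> z\<bar>)"
      by (rule rst_integral_abs_le[OF i4]) (use i2 \<eta>(2) A(2) K'(2) in \<open>auto simp: abs_of_nonneg\<close>)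
    ultimately show ?thesis using \<eta>(2) unfolding e M_def by simp
  qed
  have Bpt: "0 \<le> rst K' (Bn n) z * \<eta> z" for n z
    using B0[of z n] K'(2) \<eta>(2)[of z] by (cases "z \<in> K'") auto
  have lim: "(\<lambda>n. rst K' (Bn n) z * \<eta> z) \<longlonglongrightarrow> rst K' B z * \<eta> z" for z
    using B[of z] K'(2) by (cases "z \<in> K'") (auto intro!: tendsto_mult)
  have mB: "(\<lambda>z. rst K' B z * \<eta> z) \<in> borel_measurable lebesgue"
    by (rule borel_measurable_LIMSEQ_real[OF lim]) (use iB in auto)
  have "(\<integral>\<^sup>+z. ennreal (rst K' B z * \<eta> z) \<partial>lebesgue) \<le> liminf (\<lambda>n. \<integral>\<^sup>+z. ennreal (rst K' (Bn n) z * \<eta> z) \<partial>lebesgue)"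
  proof -
    have "(\<integral>\<^sup>+z. liminf (\<lambda>n. ennreal (rst K' (Bn n) z * \<eta> z)) \<partial>lebesgue) \<le> liminf (\<lambda>n. \<integral>\<^sup>+z. ennreal (rst K' (Bn n) z * \<eta> z) \<partial>lebesgue)"
      by (rule nn_integral_liminf) (use iB in auto)
    moreover have "liminf (\<lambda>n. ennreal (rst K' (Bn n) z * \<eta> z)) = ennreal (rst K' B z * \<eta> z)" for z
      by (rule lim_imp_Liminf) (auto intro!: tendsto_ennrealI lim)
    ultimately show ?thesis by simp
  qed
  also have "\<dots> \<le> liminf (\<lambda>n::nat. ennreal M)"
  proof (rule Liminf_mono, rule always_eventually, rule allI)
    fix n
    have "(\<integral>\<^sup>+z. ennreal (rst K' (Bn n) z * \<eta> z) \<partial>lebesgue) = ennreal (LINT z|lebesgue. rst K' (Bn n) z * \<eta> z)"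
      by (rule nn_integral_eq_integral[OF iB]) (use Bpt in auto)
    also have "\<dots> \<le> ennreal M" using bound by (rule ennreal_leI)
    finally show "(\<integral>\<^sup>+z. ennreal (rst K' (Bn n) z * \<eta> z) \<partial>lebesgue) \<le> ennreal M" .
  qed
  also have "\<dots> = ennreal M" by (simp add: Liminf_const)
  finally have fin: "(\<integral>\<^sup>+z. ennreal (rst K' B z * \<eta> z) \<partial>lebesgue) < \<infinity>" by (rule le_less_trans) simp
  have pt: "0 \<le> rst K' B z * \<eta> z" for z by (rule LIMSEQ_le_const[OF lim]) (use Bpt in auto)
  have I: "integrable lebesgue (\<lambda>z. rst K' B z * \<eta> z)"
    by (rule integrableI_nonneg[OF mB _ fin]) (use pt in auto)
  have Km: "K \<in> sets lebesgue" using lmeasurable_compact[OF K(1)] by (rule fmeasurableD)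
  have "integrable lebesgue (\<lambda>z. indicator K z * (rst K' B z * \<eta> z))"
    by (rule bounded_mult_integrable[OF I, of _ 1]) (use Km in \<open>auto simp: indicator_def\<close>)
  moreover have "indicator K z * (rst K' B z * \<eta> z) = rst K B z" for z
  proof (cases "z \<in> K")
    case True
    then have "z \<in> K'" using \<eta>(3)[of z] K'(3)[of z] by fastforce
    then show ?thesis using True \<eta>(3) by simp
  qed simp
  ultimately show "integrable lebesgue (rst K B)" by simp
qed

section \<open>The barrier\<close>

subsection \<open>Regularised powers of the positive part\<close>

definition pospow :: "real \<Rightarrow> real \<Rightarrow> real" where "pospow a z = max 0 z powr a"

lemma pospow_nonneg [simp]: "0 \<le> pospow a z"
  by (simp add: pospow_def)

lemma pospow_pos: "0 < z \<Longrightarrow> pospow a z = z powr a"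
  by (simp add: pospow_def)

lemma pospow_neg: "z \<le> 0 \<Longrightarrow> pospow a z = 0"
  by (simp add: pospow_def)

lemma pospow_continuous_on: "0 < a \<Longrightarrow> continuous_on S h \<Longrightarrow> continuous_on S (\<lambda>x. pospow a (h x))"
  unfolding pospow_def by (intro continuous_on_powr' continuous_intros) auto

text \<open>The two one-sided formulas match at the origin because the difference quotient there is
  at most \<open>|h|^(a-1)\<close>, and \<open>a > 1\<close>.\<close>

lemma pospow_has_derivative:
  assumes a: "1 < a"
  shows "(pospow a has_real_derivative a * pospow (a - 1) z) (at z)"
proof -
  consider "0 < z" | "z < 0" | "z = 0" by linarith
  then show ?thesis
  proof cases
    case 1
    have "\<forall>\<^sub>F x in nhds z. pospow a x = x powr a"
      using eventually_nhds_in_open[of "{0<..}" z] 1 by (auto elim!: eventually_mono simp: pospow_pos)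
    from DERIV_eventually_cong[OF has_real_derivative_powr[OF 1] this] show ?thesis using 1 by (simp add: pospow_pos)
  next
    case 2
    have "\<forall>\<^sub>F x in nhds z. pospow a x = 0"
      using eventually_nhds_in_open[of "{..<0}" z] 2 by (auto elim!: eventually_mono simp: pospow_neg)
    from DERIV_eventually_cong[OF DERIV_const this] show ?thesis using 2 by (simp add: pospow_neg)
  next
    case 3
    have "continuous_on UNIV (\<lambda>h::real. \<bar>h\<bar> powr (a - 1))" using a by (intro continuous_on_powr' continuous_intros) auto
    then have "((\<lambda>h::real. \<bar>h\<bar> powr (a - 1)) \<longlongrightarrow> \<bar>0\<bar> powr (a - 1)) (at 0)"
      unfolding continuous_on_def by blast
    then have l: "((\<lambda>h::real. \<bar>h\<bar> powr (a - 1)) \<longlongrightarrow> 0) (at 0)" by simp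
    have "((\<lambda>h. (pospow a h - pospow a 0) / h) \<longlongrightarrow> 0) (at 0)"
    proof (rule Lim_null_comparison[OF _ l], rule always_eventually, rule allI)
      fix h :: real
      show "norm ((pospow a h - pospow a 0) / h) \<le> \<bar>h\<bar> powr (a - 1)"
      proof (cases "0 < h")
        case True
        then show ?thesis by (simp add: pospow_pos pospow_neg powr_diff)
      qed (simp add: pospow_neg)
    qed
    then show ?thesis using 3 by (simp add: has_field_derivative_iff pospow_neg)
  qed
qed

text \<open>The quotient \<open>z\<^sub>+\<^bsup>q+2\<^esup>/(z\<^sup>2 + d)\<close> is continuously differentiable even if \<open>q \<le> 1\<close>, increases to \<open>z\<^sub>+\<^bsup>q\<^esup>\<close> as
  \<open>d\<close> decreases to \<open>0\<close>, and its logarithmic derivative is at most \<open>(q + 2)/z\<close> for every \<open>d\<close>.\<close>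

definition regpow :: "real \<Rightarrow> real \<Rightarrow> real \<Rightarrow> real" where
  "regpow q d z = pospow (q + 2) z / (z\<^sup>2 + d)"
definition dregpow :: "real \<Rightarrow> real \<Rightarrow> real \<Rightarrow> real" where
  "dregpow q d z = ((q + 2) * pospow (q + 1) z * (z\<^sup>2 + d) - pospow (q + 2) z * (2 * z)) / ((z\<^sup>2 + d) * (z\<^sup>2 + d))"

context
  fixes q d :: real
  assumes q: "0 < q" and d: "0 < d"
begin

lemma regpow_den: "0 < z\<^sup>2 + d"
  using d by (simp add: add_nonneg_pos)

lemma regpow_has_derivative: "(regpow q d has_real_derivative dregpow q d z) (at z)"
proof -
  have "((\<lambda>z. z\<^sup>2 + d) has_real_derivative 2 * z) (at z)" by (auto intro!: derivative_eq_intros)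
  moreover have "(pospow (q + 2) has_real_derivative (q + 2) * pospow (q + 1) z) (at z)"
    using pospow_has_derivative[of "q + 2" z] q by (simp add: add.commute)
  ultimately show ?thesis unfolding regpow_def[abs_def] dregpow_def
    using regpow_den[of z] by (intro DERIV_divide) auto
qed

lemma dregpow_continuous: "continuous_on UNIV (dregpow q d)"
  unfolding dregpow_def[abs_def]
  by (intro continuous_intros pospow_continuous_on) (use regpow_den q in \<open>auto simp: less_imp_neq[symmetric]\<close>)

lemma regpow_nonneg: "0 \<le> regpow q d z"
  using regpow_den[of z] by (simp add: regpow_def)

lemma regpow_eq: "0 < z \<Longrightarrow> regpow q d z = z powr q * (z\<^sup>2 / (z\<^sup>2 + d))"
  by (simp add: regpow_def pospow_pos powr_add powr_numeral)

lemma regpow_neg: "z \<le> 0 \<Longrightarrow> regpow q d z = 0" "z \<le> 0 \<Longrightarrow> dregpow q d z = 0"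
  by (simp_all add: regpow_def dregpow_def pospow_neg)

lemma regpow_le: "regpow q d z \<le> pospow q z"
proof (cases "0 < z")
  case True
  have "z\<^sup>2 / (z\<^sup>2 + d) \<le> 1" using regpow_den[of z] d by (simp add: divide_le_eq)
  then show ?thesis using True mult_left_mono[of "z\<^sup>2 / (z\<^sup>2 + d)" 1 "z powr q"] by (simp add: regpow_eq pospow_pos)
qed (simp add: regpow_neg)

lemma dregpow_eq:
  assumes z: "0 < z"
  shows "dregpow q d z = z powr (q - 1) * (z\<^sup>2 / (z\<^sup>2 + d)) * (q + 2 * (d / (z\<^sup>2 + d)))"
proof -
  define D where "D = z\<^sup>2 + d"
  have D: "0 < D" using regpow_den[of z] by (simp add: D_def)
  define Q where "Q = z powr (q - 1)"
  have e: "pospow (q + 1) z = Q * z\<^sup>2" "pospow (q + 2) z * z = Q * z\<^sup>2 * z\<^sup>2"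
  proof -
    have "z powr (q + 1) = z powr ((q - 1) + 2)" by (simp add: add.commute)
    also have "\<dots> = Q * z\<^sup>2" using z by (simp only: powr_add) (simp add: Q_def powr_numeral)
    finally show 1: "pospow (q + 1) z = Q * z\<^sup>2" using z by (simp add: pospow_pos)
    have "z powr (q + 2) * z = z powr (q + 1) * z\<^sup>2"
      using z by (simp add: powr_add powr_numeral power2_eq_square)
    then show "pospow (q + 2) z * z = Q * z\<^sup>2 * z\<^sup>2" using z 1 by (simp add: pospow_pos)
  qed
  have "dregpow q d z = ((q + 2) * (Q * z\<^sup>2) * D - 2 * (Q * z\<^sup>2 * z\<^sup>2)) / (D * D)"
    unfolding dregpow_def D_def[symmetric] using e by (simp add: mult.left_commute)
  also have "\<dots> = Q * z\<^sup>2 * ((q + 2) * D - 2 * z\<^sup>2) / (D * D)" by (simp add: algebra_simps)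
  also have "(q + 2) * D - 2 * z\<^sup>2 = q * D + 2 * d" by (simp add: D_def algebra_simps)
  also have "Q * z\<^sup>2 * (q * D + 2 * d) / (D * D) = Q * (z\<^sup>2 / D) * (q + 2 * (d / D))"
    using D by (simp add: field_simps)
  finally show ?thesis by (simp add: D_def Q_def)
qed

lemma dregpow_nonneg: "0 \<le> dregpow q d z"
  using q d regpow_den[of z] by (cases "0 < z") (simp_all add: dregpow_eq regpow_neg)

text \<open>For \<open>z > 0\<close> the logarithmic derivative times \<open>z\<close> is
  \<open>q + 2 d / (z^2 + d)\<close>, and the fraction \<open>d / (z^2 + d)\<close> is at most
  1.\<close>

lemma dregpow_mult_le: "z * dregpow q d z \<le> (q + 2) * regpow q d z"
proof (cases "0 < z")
  case True
  have "z * z powr (q - 1) = z powr q" using True by (simp add: powr_diff)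
  then have "z * dregpow q d z = regpow q d z * (q + 2 * (d / (z\<^sup>2 + d)))"
    using True by (simp add: dregpow_eq regpow_eq mult.assoc[symmetric])
  also have "\<dots> \<le> regpow q d z * (q + 2 * 1)"
    using regpow_den[of z] regpow_nonneg[of z] by (intro mult_left_mono add_left_mono) (auto simp: divide_le_eq)
  finally show ?thesis by (simp add: mult.commute)
qed (simp add: regpow_neg)

lemma dregpow_le: "dregpow q d z \<le> (q + 2) * pospow (q - 1) z"
proof (cases "0 < z")
  case True
  have "z * dregpow q d z \<le> (q + 2) * z powr q"
    using dregpow_mult_le[of z] regpow_le[of z] q True
    by (smt (verit) mult_left_mono pospow_pos)
  also have "\<dots> = z * ((q + 2) * z powr (q - 1))" using True by (simp add: powr_diff)
  finally show ?thesis using True by (simp add: pospow_pos)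
qed (use q in \<open>simp add: regpow_neg\<close>)

end

lemma regpow_tendsto:
  assumes "0 < q"
  shows "(\<lambda>n. regpow q (1 / real (Suc n)) z) \<longlonglongrightarrow> pospow q z"
    and "(\<lambda>n. dregpow q (1 / real (Suc n)) z) \<longlonglongrightarrow> q * pospow (q - 1) z"
proof -
  have d0: "(\<lambda>n. 1 / real (Suc n)) \<longlonglongrightarrow> 0" using LIMSEQ_inverse_real_of_nat by (simp add: inverse_eq_divide)
  have "(\<lambda>n. regpow q (1 / real (Suc n)) z) \<longlonglongrightarrow> z powr q * (z\<^sup>2 / (z\<^sup>2 + 0))" if z: "0 < z"
    by (subst regpow_eq[OF assms _ z], simp) (intro tendsto_intros d0, use z in simp)
  then show "(\<lambda>n. regpow q (1 / real (Suc n)) z) \<longlonglongrightarrow> pospow q z"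
    using assms by (cases "0 < z") (simp_all add: pospow_pos pospow_neg regpow_neg)
  have "(\<lambda>n. dregpow q (1 / real (Suc n)) z) \<longlonglongrightarrow> z powr (q - 1) * (z\<^sup>2 / (z\<^sup>2 + 0)) * (q + 2 * (0 / (z\<^sup>2 + 0)))" if z: "0 < z"
    by (subst dregpow_eq[OF assms _ z], simp) (intro tendsto_intros d0, use z in simp_all)
  then show "(\<lambda>n. dregpow q (1 / real (Suc n)) z) \<longlonglongrightarrow> q * pospow (q - 1) z"
    using assms by (cases "0 < z") (simp_all add: pospow_pos pospow_neg regpow_neg mult.commute)
qed

subsection \<open>Parameters of the barrier\<close>

context growth
begin

text \<open>\<open>c1\<close> is the constant of \<open>near_boundary_lower\<close>,
  \<open>c2\<close> that of \<open>d\<phi>_le\<close>: they measure the diffusion at the free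
  boundary and the growth of \<open>\<phi>\<close>.\<close>

definition c1 :: real where "c1 = (p / (p - 1)) powr (p - 1) * (p / (p - 1)) * (1 - \<alpha>2 / p) powr p"
definition c2 :: real where "c2 = p / ((p - 1) * \<alpha>1)"

lemma c1_pos: "0 < c1" using p1 a2p by (simp add: c1_def)
lemma c2_pos: "0 < c2" using p1 a1 by (simp add: c2_def)

end

text \<open>\<open>K C^k\<close> is the coefficient of the diffusion term after division by
  \<open>C (t + t0)^(-1/k-1)\<close> and by the weight. \<open>C_small\<close> makes the divergence
  at most half of the decay \<open>1/k\<close>; \<open>\<Gamma>_small\<close> lets the diffusion
  near the free boundary dominate \<open>\<Gamma> \<phi>'\<close>; \<open>t0_large\<close> lets the
  other half of the decay dominate it inside; \<open>core\<close> confines the region near the free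
  boundary to radii at least \<open>r0\<close>.\<close>

locale barrier_params = growth +
  fixes m t0 C r0 \<Gamma> N k q K :: real
  defines k_def: "k \<equiv> p + m - 3" and q_def: "q \<equiv> (p - 1) / k" and K_def: "K \<equiv> ((p - 1) / k) powr (p - 1)"
  assumes k0: "0 < p + m - 3" and t0: "1 < t0" and C0: "0 < C" and r0: "0 < r0" and \<Gamma>0: "0 < \<Gamma>" and N0: "0 \<le> N"
    and core: "\<psi>J r0 \<le> \<phi> (\<Gamma> * ln t0) / 2"
    and C_small: "K * C powr k * Dconst N r0 \<le> 1 / (2 * k)"
    and \<Gamma>_small: "\<Gamma> * c2 \<le> K * C powr k * c1 / 2"
    and t0_large: "c2 * (4 * k * (q + 2)) \<le> ln t0"
begin

abbreviation tau :: "real \<Rightarrow> real" where "tau t \<equiv> \<Gamma> * ln (t + t0)"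
definition gap :: "'a::euclidean_space \<times> real \<Rightarrow> real" where
  "gap y = \<phi> (tau (snd y)) - \<psi> r0 (norm (fst y))"
definition tpow :: "real \<Rightarrow> 'a::euclidean_space \<times> real \<Rightarrow> real" where
  "tpow a y = (snd y + t0) powr a"
definition dgap :: "'a::euclidean_space \<times> real \<Rightarrow> real" where
  "dgap y = d\<phi> (tau (snd y)) * (\<Gamma> / (snd y + t0))"

lemma k_pos: "0 < k" using k0 by (simp add: k_def)
lemma q_pos: "0 < q" using k_pos p1 by (simp add: q_def)
lemma K_pos: "0 < K" using k_pos p1 by (simp add: K_def)

lemma tau_pos: "0 \<le> t \<Longrightarrow> 0 < tau t"
  using t0 \<Gamma>0 by (simp add: ln_gt_zero)

lemma tau_mono: "0 \<le> t \<Longrightarrow> t \<le> t' \<Longrightarrow> tau t \<le> tau t'"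
  using t0 \<Gamma>0 by (intro mult_left_mono ln_mono) auto

text \<open>Since \<open>\<tau> = \<Gamma> ln (t + t0)\<close>, the factor \<open>\<Gamma>\<close>
  cancels in the second bound, which therefore rests on \<open>t0_large\<close> alone. The factor
  \<open>4 k (q + 2)\<close> is what the inner region consumes.\<close>

lemma \<Gamma>_d\<phi>_le:
  assumes t: "0 \<le> t"
  shows "\<Gamma> * d\<phi> (tau t) \<le> \<Gamma> * c2 * (\<phi> (tau t) / tau t)"
    and "\<Gamma> * d\<phi> (tau t) * (4 * k * (q + 2)) \<le> \<phi> (tau t)"
proof -
  show 1: "\<Gamma> * d\<phi> (tau t) \<le> \<Gamma> * c2 * (\<phi> (tau t) / tau t)"
    unfolding mult.assoc c2_def by (rule mult_left_mono[OF d\<phi>_le[OF tau_pos[OF t]]]) (use \<Gamma>0 in simp)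
  have "ln t0 \<le> ln (t + t0)" using t t0 by (intro ln_mono) auto
  then have L: "c2 * (4 * k * (q + 2)) \<le> ln (t + t0)" "0 < ln (t + t0)" using t0_large t0 t by (auto intro: order_trans ln_gt_zero)
  have "\<Gamma> * d\<phi> (tau t) * (4 * k * (q + 2)) \<le> \<Gamma> * c2 * (\<phi> (tau t) / tau t) * (4 * k * (q + 2))"
    using 1 k_pos q_pos by (intro mult_right_mono) auto
  also have "\<dots> = \<phi> (tau t) / ln (t + t0) * (c2 * (4 * k * (q + 2)))" using \<Gamma>0 by simp
  also have "\<dots> \<le> \<phi> (tau t) / ln (t + t0) * ln (t + t0)"
    using \<phi>_pos[OF tau_pos[OF t]] L by (intro mult_left_mono) auto
  finally show "\<Gamma> * d\<phi> (tau t) * (4 * k * (q + 2)) \<le> \<phi> (tau t)" using L(2) by simp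
qed

lemma \<phi>_tau_deriv: "0 \<le> t \<Longrightarrow> ((\<lambda>t. \<phi> (tau t)) has_real_derivative d\<phi> (tau t) * (\<Gamma> / (t + t0))) (at t)"
proof -
  assume t: "0 \<le> t"
  have "((\<lambda>t. \<Gamma> * ln (t + t0)) has_real_derivative \<Gamma> / (t + t0)) (at t)"
    using t t0 by (auto intro!: derivative_eq_intros)
  from DERIV_chain2[OF \<phi>_deriv[OF tau_pos[OF t]] this]
  show "((\<lambda>t. \<phi> (tau t)) has_real_derivative d\<phi> (tau t) * (\<Gamma> / (t + t0))) (at t)" .
qed

lemma d\<phi>_tau_cont: "continuous_on {0<..} (\<lambda>t. d\<phi> (tau t) * (\<Gamma> / (t + t0)))"
proof -
  have "continuous_on {0<..} (\<lambda>t. d\<phi> (tau t))"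
  proof (rule continuous_on_compose2[OF d\<phi>_cont])
    show "continuous_on {0<..} tau" using t0 by (intro continuous_intros) auto
    show "tau ` {0<..} \<subseteq> {0<..}" using tau_pos by auto
  qed
  then show ?thesis using t0 by (intro continuous_intros) auto
qed

lemma gap_time: "line_diff {} (0, 1) gap dgap"
proof -
  have c: "continuous_on spacetime (\<lambda>z::'a \<times> real. - \<psi> r0 (norm (fst z)))"
    by (intro continuous_on_minus continuous_norm_fst \<psi>_cont r0)
  have "line_diff {} (0, 1) (\<lambda>z::'a \<times> real. \<phi> (tau (snd z)) + - \<psi> r0 (norm (fst z))) (\<lambda>z. d\<phi> (tau (snd z)) * (\<Gamma> / (snd z + t0)) + 0)"
    by (rule line_diff_add[OF line_diff_time[of "\<lambda>t. \<phi> (tau t)", OF \<phi>_tau_deriv[OF less_imp_le] d\<phi>_tau_cont] line_diff_const_along[OF c]]) auto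
  then show ?thesis by (simp add: gap_def[abs_def] dgap_def[abs_def])
qed

lemma gap_cont: "continuous_on spacetime gap"
  by (rule line_diff_continuous[OF gap_time])

lemma gap_space:
  assumes b: "b \<in> Basis"
  shows "line_diff (radial_exc r0) (b, 0) gap (\<lambda>y. - d\<psi> r0 (norm (fst y)) * ((fst y \<bullet> b) / norm (fst y)))"
proof -
  have c: "continuous_on spacetime (\<lambda>z::'a \<times> real. \<phi> (tau (snd z)))"
    by (rule line_diff_continuous[OF line_diff_time[of "\<lambda>t. \<phi> (tau t)" _ "{}", OF \<phi>_tau_deriv[OF less_imp_le] d\<phi>_tau_cont]])
  have r: "line_diff (radial_exc r0) (b, 0) (\<lambda>z. - \<psi> r0 (norm (fst z))) (\<lambda>y. - d\<psi> r0 (norm (fst y)) * ((fst y \<bullet> b) / norm (fst y)))"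
  proof (rule line_diff_radial[OF b])
    show "continuous_on {0..} (\<lambda>r. - \<psi> r0 r)" by (intro continuous_on_minus \<psi>_cont r0)
    show "((\<lambda>r. - \<psi> r0 r) has_real_derivative - d\<psi> r0 r) (at r)" if "0 < r" "r \<noteq> r0" for r
      by (rule DERIV_minus[OF \<psi>_deriv[OF r0 that]])
    show "\<exists>B. \<forall>r. 0 < r \<and> r \<le> R \<longrightarrow> \<bar>- d\<psi> r0 r\<bar> \<le> B" if "0 < R" for R by (rule d\<psi>_bounded[OF r0 that])
  qed
  have "line_diff (radial_exc r0) (b, 0) (\<lambda>z. \<phi> (tau (snd z)) + - \<psi> r0 (norm (fst z)))
      (\<lambda>y. 0 + - d\<psi> r0 (norm (fst y)) * ((fst y \<bullet> b) / norm (fst y)))"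
    by (rule line_diff_add[OF line_diff_const_along[OF c] r]) auto
  then show ?thesis by (simp add: gap_def[abs_def])
qed

lemma tpow_time: "line_diff {} (0, 1) (tpow a) (\<lambda>y. a * tpow (a - 1) y)"
proof -
  have "((\<lambda>t. (t + t0) powr a) has_real_derivative a * (t + t0) powr (a - 1)) (at t)" if "0 < t" for t
    using that t0 by (auto intro!: derivative_eq_intros)
  moreover have "continuous_on {0<..} (\<lambda>t. a * (t + t0) powr (a - 1))"
    using t0 by (intro continuous_intros) auto
  ultimately show ?thesis unfolding tpow_def[abs_def]
    by (rule line_diff_time[of "\<lambda>t. (t + t0) powr a"])
qed

lemma tpow_cont: "continuous_on spacetime (tpow a)"
  by (rule line_diff_continuous[OF tpow_time])

lemma tpow_space: "line_diff X (b, 0) (tpow a) (\<lambda>_. 0)"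
  by (rule line_diff_const_along[OF tpow_cont]) (simp add: tpow_def)

lemma barrier_eq:
  "barrier p m g t0 C r0 \<Gamma> x t = C * tpow (- (1 / k)) (x, t) * pospow q (gap (x, t))"
  by (simp add: barrier_def Let_def tpow_def gap_def pospow_def \<phi>_def \<psi>_def \<psi>J_def k_def q_def powr_minus divide_inverse)

text \<open>The differential inequality behind the subsolution property. Where \<open>\<psi> \<le> \<phi> / 2\<close> the growth of
  \<open>\<phi>\<close> is absorbed by the decay factor in time, since \<open>t\<^sub>0\<close> is large; near the free boundary
  it is absorbed by the diffusion term, since \<open>\<Gamma>\<close> is small.\<close>

lemma barrier_inequality:
  fixes P dP r t :: real
  assumes t: "0 \<le> t" and r: "0 < r"
  defines "z \<equiv> \<phi> (tau t) - \<psi> r0 r"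
  assumes P: "0 \<le> P" "0 \<le> dP" "z * dP \<le> (q + 2) * P" "z \<le> 0 \<Longrightarrow> dP = 0"
    and D: "D \<le> Dconst N r0"
  shows "- P / k + dP * (\<Gamma> * d\<phi> (tau t)) + K * C powr k * (P * D - dP * (d\<psi> r0 r * (\<Lambda>c r0 r * r))) \<le> 0"
proof -
  define M where "M = K * C powr k"
  have M: "0 < M" using K_pos C0 by (simp add: M_def)
  define F where "F = \<phi> (tau t)"
  have F: "0 < F" unfolding F_def by (rule \<phi>_pos[OF tau_pos[OF t]])
  define Y where "Y = d\<psi> r0 r * (\<Lambda>c r0 r * r)"
  have Y: "0 \<le> Y" using d\<psi>_nonneg[OF r0 r] \<Lambda>c_pos[OF r0, of r] r by (simp add: Y_def)
  \<comment> \<open>Half of the decay \<open>P / k\<close> pays for the divergence; the remaining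
    \<open>P / (2 k)\<close> and the diffusion term have to pay for the growth of
    \<open>\<phi>\<close>.\<close>
  have "M * (P * D) \<le> P * (M * Dconst N r0)" using M P(1) D by (simp add: mult_left_mono mult.left_commute)
  also have "\<dots> \<le> P * (1 / (2 * k))" using C_small P(1) unfolding M_def by (rule mult_left_mono)
  finally have 1: "M * (P * D) \<le> P / (2 * k)" by simp
  have 2: "dP * (\<Gamma> * d\<phi> (tau t)) - M * (dP * Y) \<le> P / (2 * k)"
  proof (cases "\<psi> r0 r \<le> F / 2")
    case True
    then have z: "F \<le> 2 * z" by (simp add: z_def F_def)
    \<comment> \<open>Here \<open>z\<close> is at least \<open>F / 2\<close>, so the bound on the
      logarithmic derivative gives \<open>dP \<le> 2 (q + 2) P / F\<close>.\<close>
    have "dP * (\<Gamma> * d\<phi> (tau t)) * (4 * k * (q + 2)) \<le> dP * F"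
      using \<Gamma>_d\<phi>_le(2)[OF t] P(2) unfolding F_def by (simp add: mult.assoc mult_left_mono)
    also have "\<dots> \<le> dP * (2 * z)" using z P(2) by (rule mult_left_mono)
    also have "\<dots> = 2 * (z * dP)" by simp
    also have "\<dots> \<le> 2 * ((q + 2) * P)" using P(3) by (intro mult_left_mono) auto
    finally have "dP * (\<Gamma> * d\<phi> (tau t)) * (2 * k) * (2 * (q + 2)) \<le> P * (2 * (q + 2))" by (simp add: algebra_simps)
    then have "dP * (\<Gamma> * d\<phi> (tau t)) * (2 * k) \<le> P" by (rule mult_right_le_imp_le) (use q_pos in simp)
    then have "dP * (\<Gamma> * d\<phi> (tau t)) \<le> P / (2 * k)" using k_pos by (simp add: pos_le_divide_eq)
    moreover have "0 \<le> M * (dP * Y)" using M P(2) Y by simp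
    ultimately show ?thesis by linarith
  next
    case far: False
    show ?thesis
    proof (cases "z \<le> 0")
      case True
      then show ?thesis using P(1,4) k_pos by simp
    next
      case False
      have core': "\<psi>J r0 \<le> F / 2"
      proof -
        have "\<phi> (\<Gamma> * ln t0) \<le> F" unfolding F_def using \<phi>_mono[OF tau_pos[of 0] tau_mono[of 0 t]] t by simp
        then show ?thesis using core by linarith
      qed
      \<comment> \<open>\<open>core\<close> rules out the inner profile, so the explicit lower bound
        for the diffusion is available.\<close>
      have rr: "r0 \<le> r"
      proof (rule ccontr)
        assume "\<not> r0 \<le> r"
        then have "\<psi> r0 r \<le> \<psi>J r0" using I_fun_le[OF r0, of r] r by (simp add: \<psi>_def)
        then show False using far core' by linarith
      qed
      then have \<psi>: "\<psi> r0 r = \<psi>J r" by (simp add: \<psi>_def)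
      have "r < Ginv (tau t)"
      proof (rule ccontr)
        assume "\<not> r < Ginv (tau t)"
        then have "\<psi>J (Ginv (tau t)) \<le> \<psi>J r" using Ginv_pos[OF tau_pos[OF t]] by (intro \<psi>J_mono) auto
        then show False using False \<psi> by (simp add: z_def \<phi>_eq)
      qed
      then have Gr: "G r < tau t" using less_Ginv_iff[of r "tau t"] r tau_pos[OF t] by simp
      \<comment> \<open>Inside the support \<open>G r < tau t\<close>, and in this case
        \<open>\<psi>\<close> exceeds half of \<open>\<phi>\<close>; both facts push the quotient
        up.\<close>
      have "F / 2 / tau t \<le> \<psi>J r / G r" using far F Gr G_pos[OF r] by (intro frac_le) (auto simp: \<psi>)
      then have "c1 * (F / 2 / tau t) \<le> c1 * (\<psi>J r / G r)" using c1_pos by (intro mult_left_mono) auto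
      also have "\<dots> \<le> Y" unfolding c1_def Y_def by (rule near_boundary_lower[OF r0 rr])
      finally have 3: "c1 * (F / 2 / tau t) \<le> Y" .
      have "\<Gamma> * d\<phi> (tau t) \<le> \<Gamma> * c2 * (F / tau t)" unfolding F_def by (rule \<Gamma>_d\<phi>_le(1)[OF t])
      also have "\<dots> \<le> M * c1 / 2 * (F / tau t)"
        using \<Gamma>_small F tau_pos[OF t] unfolding M_def by (intro mult_right_mono) auto
      also have "\<dots> = M * (c1 * (F / 2 / tau t))" by simp
      also have "\<dots> \<le> M * Y" using 3 M by (intro mult_left_mono) auto
      finally have "dP * (\<Gamma> * d\<phi> (tau t)) \<le> dP * (M * Y)" using P(2) by (rule mult_left_mono)
      moreover have "0 \<le> P / (2 * k)" using P(1) k_pos by simp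
      moreover have "dP * (M * Y) = M * (dP * Y)" by simp
      ultimately show ?thesis by linarith
    qed
  qed
  have "- P / k + P / (2 * k) + P / (2 * k) = 0" using k_pos by (simp add: field_simps)
  then show ?thesis using 1 2 unfolding M_def[symmetric] Y_def[symmetric] by (simp only: right_diff_distrib)
qed

subsection \<open>The time derivative of the barrier\<close>

text \<open>For \<open>q < 1\<close> the factor \<open>pospow (q - 1)\<close> is unbounded at the
  free boundary. Where the gap is nonpositive, the convention \<open>0 powr a = 0\<close> makes both
  terms vanish.\<close>

definition dbarrier :: "'a::euclidean_space \<times> real \<Rightarrow> real" where
  "dbarrier y = - (C / k) * tpow (- (1 / k) - 1) y * pospow q (gap y) +
     C * tpow (- (1 / k)) y * (q * pospow (q - 1) (gap y) * dgap y)"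

definition ureg :: "nat \<Rightarrow> 'a::euclidean_space \<times> real \<Rightarrow> real" where
  "ureg n y = C * tpow (- (1 / k)) y * regpow q (1 / real (Suc n)) (gap y)"
definition dureg :: "nat \<Rightarrow> 'a::euclidean_space \<times> real \<Rightarrow> real" where
  "dureg n y = - (C / k) * tpow (- (1 / k) - 1) y * regpow q (1 / real (Suc n)) (gap y) +
     C * tpow (- (1 / k)) y * (dregpow q (1 / real (Suc n)) (gap y) * dgap y)"

lemma regpow_gap:
  assumes "line_diff X e (gap :: 'a::euclidean_space \<times> real \<Rightarrow> real) D"
  shows "line_diff X e (\<lambda>y. regpow q (1 / real (Suc n)) (gap y)) (\<lambda>y. dregpow q (1 / real (Suc n)) (gap y) * D y)"
  by (rule line_diff_compose[OF assms regpow_has_derivative dregpow_continuous]) (use q_pos in auto)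

lemma weak_ddir_ureg: "weak_ddir spacetime (0, 1) (ureg n :: 'a::euclidean_space \<times> real \<Rightarrow> real) (dureg n)"
proof -
  have "line_diff {} (0, 1) (ureg n :: 'a \<times> real \<Rightarrow> real) (\<lambda>y. C * tpow (- (1 / k)) y * (dregpow q (1 / real (Suc n)) (gap y) * dgap y) +
      C * (- (1 / k) * tpow (- (1 / k) - 1) y) * regpow q (1 / real (Suc n)) (gap y))"
    unfolding ureg_def[abs_def] by (rule line_diff_mult[OF line_diff_cmult[OF tpow_time] regpow_gap[OF gap_time]])
  moreover have "(\<lambda>y. C * tpow (- (1 / k)) y * (dregpow q (1 / real (Suc n)) (gap y) * dgap y) +
      C * (- (1 / k) * tpow (- (1 / k) - 1) y) * regpow q (1 / real (Suc n)) (gap y)) = (dureg n :: 'a \<times> real \<Rightarrow> real)"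
    by (auto simp: dureg_def)
  ultimately show ?thesis by (intro line_diff_weak_ddir[where X = "{}"]) auto
qed

lemma tpow_nonneg [simp]: "0 \<le> tpow a y"
  by (simp add: tpow_def)

lemma dgap_nonneg: "y \<in> spacetime \<Longrightarrow> 0 \<le> dgap y"
  using d\<phi>_nonneg[OF tau_pos, of "snd y"] \<Gamma>0 t0 by (auto simp: dgap_def spacetime_def)

lemma ureg_bound: "\<bar>ureg n y\<bar> \<le> C * tpow (- (1 / k)) y * pospow q (gap y)"
  using regpow_le[of q "1 / real (Suc n)" "gap y"] regpow_nonneg[of q "1 / real (Suc n)" "gap y"] q_pos C0
  by (auto simp: ureg_def abs_mult intro!: mult_left_mono)

lemma ureg_tendsto: "(\<lambda>n. ureg n y) \<longlonglongrightarrow> C * tpow (- (1 / k)) y * pospow q (gap y)"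
  unfolding ureg_def by (intro tendsto_mult tendsto_const regpow_tendsto q_pos)

lemma gap_pospow_cont: "0 < a \<Longrightarrow> continuous_on spacetime (\<lambda>y. pospow a (gap y))"
  by (intro pospow_continuous_on gap_cont)

lemma barrier_cont: "continuous_on spacetime (\<lambda>y. C * tpow (- (1 / k)) y * pospow q (gap y))"
  by (intro continuous_intros gap_pospow_cont tpow_cont q_pos)

text \<open>The two parts of the derivative behave differently. The one from the decay factor has a
  continuous bound. The one from the gap is nonnegative, so Fatou's lemma makes its limit
  \<open>YB\<close> locally integrable, after which \<open>dregpow_le\<close> turns a multiple of
  that limit into a dominator for the whole sequence.\<close>

lemma dureg_limit:
  obtains Y :: "'a::euclidean_space \<times> real \<Rightarrow> real" where "locally_L1 spacetime Y" "\<And>n y. y \<in> spacetime \<Longrightarrow> \<bar>dureg n y\<bar> \<le> Y y"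
    "\<And>y::'a \<times> real. (\<lambda>n. dureg n y) \<longlonglongrightarrow> dbarrier y"
proof -
  define A :: "nat \<Rightarrow> 'a \<times> real \<Rightarrow> real" where
    "A n y = - (C / k) * tpow (- (1 / k) - 1) y * regpow q (1 / real (Suc n)) (gap y)" for n y
  define B :: "nat \<Rightarrow> 'a \<times> real \<Rightarrow> real" where
    "B n y = C * tpow (- (1 / k)) y * (dregpow q (1 / real (Suc n)) (gap y) * dgap y)" for n y
  define YA :: "'a \<times> real \<Rightarrow> real" where "YA y = (C / k) * tpow (- (1 / k) - 1) y * pospow q (gap y)" for y
  define YB :: "'a \<times> real \<Rightarrow> real" where "YB y = C * tpow (- (1 / k)) y * (q * pospow (q - 1) (gap y) * dgap y)" for y
  have cYA: "continuous_on spacetime YA" unfolding YA_def by (intro continuous_intros gap_pospow_cont tpow_cont q_pos)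
  have e: "dureg n = (\<lambda>y. A n y + B n y)" for n by (auto simp: dureg_def A_def B_def)
  have dn: "(0::real) < 1 / real (Suc n)" for n by simp
  have AY: "\<bar>A n y\<bar> \<le> YA y" for n y
    using regpow_le[OF q_pos dn[of n], of "gap y"] regpow_nonneg[OF q_pos dn[of n], of "gap y"] C0 k_pos
    by (auto simp: A_def YA_def abs_mult intro!: divide_right_mono mult_left_mono)
  have cA: "continuous_on spacetime (A n)" for n
  proof -
    have "continuous_on spacetime (\<lambda>y::'a \<times> real. regpow q (1 / real (Suc n)) (gap y))"
      by (rule line_diff_continuous[OF regpow_gap[OF gap_time]])
    then show ?thesis unfolding A_def by (intro continuous_intros tpow_cont)
  qed
  have B0: "0 \<le> B n y" if "y \<in> spacetime" for n y
    using dregpow_nonneg[OF q_pos dn[of n], of "gap y"] dgap_nonneg[OF that] C0 by (simp add: B_def)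
  have BY: "(\<lambda>n. B n y) \<longlonglongrightarrow> YB y" for y
    unfolding B_def YB_def by (intro tendsto_mult tendsto_const regpow_tendsto q_pos)
  have lYB: "locally_L1 spacetime YB"
  proof (rule weak_ddir_Fatou)
    show "weak_ddir spacetime (0, 1) (ureg n :: 'a \<times> real \<Rightarrow> real) (\<lambda>z. A n z + B n z)" for n
      unfolding e[symmetric] by (rule weak_ddir_ureg)
    show "locally_L1 spacetime (\<lambda>y::'a \<times> real. C * tpow (- (1 / k)) y * pospow q (gap y))" by (rule continuous_locally_L1[OF barrier_cont])
    show "locally_L1 spacetime (A n)" for n by (rule continuous_locally_L1[OF cA])
    show "locally_L1 spacetime YA" by (rule continuous_locally_L1[OF cYA])
  qed (use ureg_bound AY B0 BY in auto)
  \<comment> \<open>A sum written as a difference, to fit \<open>locally_L1_diff\<close>. The factor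
    \<open>(q + 2) / q\<close> compares the bound \<open>(q + 2) z^(q-1)\<close> with the limit
    \<open>q z^(q-1)\<close>.\<close>
  define Y where "Y y = YA y - (- ((q + 2) / q)) * YB y" for y
  have BYle: "\<bar>B n y\<bar> \<le> (q + 2) / q * YB y" if y: "y \<in> spacetime" for n y
  proof -
    have "dregpow q (1 / real (Suc n)) (gap y) * dgap y \<le> (q + 2) * pospow (q - 1) (gap y) * dgap y"
      by (rule mult_right_mono[OF dregpow_le[OF q_pos dn] dgap_nonneg[OF y]])
    then have "B n y \<le> C * tpow (- (1 / k)) y * ((q + 2) * pospow (q - 1) (gap y) * dgap y)"
      unfolding B_def using C0 by (intro mult_left_mono) auto
    also have "\<dots> = (q + 2) / q * YB y" using q_pos by (simp add: YB_def)
    finally show ?thesis using B0[OF y] by simp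
  qed
  have lY: "locally_L1 spacetime Y"
  proof -
    have "rst K' (\<lambda>y. (- ((q + 2) / q)) * YB y) = (\<lambda>z. (- ((q + 2) / q)) * rst K' YB z)" for K' by auto
    then have "locally_L1 spacetime (\<lambda>y. (- ((q + 2) / q)) * YB y)"
      using locally_L1_rst[OF lYB] by (intro locally_L1_I) simp
    then show ?thesis unfolding Y_def by (rule locally_L1_diff[OF continuous_locally_L1[OF cYA]])
  qed
  show ?thesis
  proof (rule that[OF lY])
    fix n and y :: "'a \<times> real" assume y: "y \<in> spacetime"
    show "\<bar>dureg n y\<bar> \<le> Y y" using AY[of n y] BYle[OF y, of n] unfolding e Y_def by linarith
  next
    fix y :: "'a \<times> real"
    show "(\<lambda>n. dureg n y) \<longlonglongrightarrow> dbarrier y"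
      unfolding dureg_def dbarrier_def by (intro tendsto_add tendsto_mult tendsto_const regpow_tendsto q_pos)
  qed
qed

lemma weak_deriv_t_barrier:
  "weak_deriv_t (\<lambda>(x, t). barrier p m g t0 C r0 \<Gamma> x t) (dbarrier :: 'a::euclidean_space \<times> real \<Rightarrow> real)"
proof -
  obtain Y :: "'a \<times> real \<Rightarrow> real" where Y: "locally_L1 spacetime Y" "\<And>n y. y \<in> spacetime \<Longrightarrow> \<bar>dureg n y\<bar> \<le> Y y"
    "\<And>y::'a \<times> real. (\<lambda>n. dureg n y) \<longlonglongrightarrow> dbarrier y"
    by (rule dureg_limit) (rule that)
  have "weak_ddir spacetime (0, 1) (\<lambda>y::'a \<times> real. C * tpow (- (1 / k)) y * pospow q (gap y)) dbarrier"
  proof (rule weak_ddir_limit)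
    show "weak_ddir spacetime (0, 1) (ureg n :: 'a \<times> real \<Rightarrow> real) (dureg n)" for n by (rule weak_ddir_ureg)
    show "locally_L1 spacetime (\<lambda>y::'a \<times> real. C * tpow (- (1 / k)) y * pospow q (gap y))"
      by (rule continuous_locally_L1[OF barrier_cont])
    show "locally_L1 spacetime Y" by (rule Y(1))
  qed (auto intro!: ureg_bound ureg_tendsto Y(2,3))
  moreover have "(\<lambda>y::'a \<times> real. C * tpow (- (1 / k)) y * pospow q (gap y)) = (\<lambda>(x, t). barrier p m g t0 C r0 \<Gamma> x t)"
    by (auto simp: barrier_eq)
  ultimately show ?thesis by (simp add: weak_deriv_t_iff)
qed

end

context barrier_params
begin

subsection \<open>The barrier belongs to the solution class\<close>

definition bar :: "'a::euclidean_space \<times> real \<Rightarrow> real" where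
  "bar y = C * tpow (- (1 / k)) y * pospow q (gap y)"

lemma barrier_eq_bar: "barrier p m g t0 C r0 \<Gamma> x t = bar (x, t)"
  by (simp add: barrier_eq bar_def)

lemma bar_cont: "continuous_on spacetime bar"
  unfolding bar_def[abs_def] by (rule barrier_cont)

definition bar_max :: real where "bar_max = C * (t0 powr (- (1 / k)) * \<phi> (\<Gamma> * ln t0) powr q)"

lemma bar_nonneg: "0 \<le> bar y"
  using C0 by (simp add: bar_def)

text \<open>The function \<open>E(\<tau>) / (t + t\<^sub>0)\<close> is nonincreasing in time, hence the barrier is bounded.\<close>

lemma bar_le_max:
  assumes t: "0 \<le> snd y"
  shows "bar y \<le> bar_max"
proof -
  have fr: "- (1 / k) * (1 / T) + q * (1 / F * (d * (\<Gamma> / T))) = (\<Gamma> * d * (k * q) - F) / (k * T * F)"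
    if "0 < T" "0 < F" for T F d
    using that k_pos by (simp add: field_simps)
  \<comment> \<open>The logarithm of the decay factor times \<open>\<phi>^q\<close>; its derivative
    is nonpositive because \<open>\<Gamma> \<phi>' k q\<close> is at most
    \<open>\<phi>\<close>.\<close>
  define h where "h t = - (1 / k) * ln (t + t0) + q * ln (\<phi> (tau t))" for t
  have "h (snd y) \<le> h 0"
  proof (rule DERIV_nonpos_imp_nonincreasing[OF t])
    fix t assume "0 \<le> t" "t \<le> snd y"
    then have t: "0 \<le> t" by simp
    have F: "0 < \<phi> (tau t)" by (rule \<phi>_pos[OF tau_pos[OF t]])
    have T: "0 < t + t0" using t t0 by simp
    have "((\<lambda>t. ln (t + t0)) has_real_derivative 1 / (t + t0)) (at t)"
      using T by (auto intro!: derivative_eq_intros)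
    then have d: "(h has_real_derivative - (1 / k) * (1 / (t + t0)) + q * (1 / \<phi> (tau t) * (d\<phi> (tau t) * (\<Gamma> / (t + t0))))) (at t)"
      unfolding h_def using F
      by (intro DERIV_add DERIV_cmult DERIV_chain2[OF DERIV_ln_divide \<phi>_tau_deriv[OF t]])
    have "\<Gamma> * d\<phi> (tau t) * (k * q) \<le> \<Gamma> * d\<phi> (tau t) * (4 * k * (q + 2))"
      using \<Gamma>0 d\<phi>_nonneg[OF tau_pos[OF t]] k_pos q_pos by (intro mult_left_mono) (auto simp: algebra_simps)
    then have "\<Gamma> * d\<phi> (tau t) * (k * q) \<le> \<phi> (tau t)" using \<Gamma>_d\<phi>_le(2)[OF t] by linarith
    then have "- (1 / k) * (1 / (t + t0)) + q * (1 / \<phi> (tau t) * (d\<phi> (tau t) * (\<Gamma> / (t + t0)))) \<le> 0"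
      unfolding fr[OF T F] by (intro divide_nonpos_pos mult_pos_pos k_pos T F) simp
    with d show "\<exists>y. (h has_real_derivative y) (at t) \<and> y \<le> 0" by blast
  qed
  then have "exp (h (snd y)) \<le> exp (h 0)" by simp
  moreover have "exp (h s) = (s + t0) powr (- (1 / k)) * \<phi> (tau s) powr q" if "0 \<le> s" for s
    using t0 that \<phi>_pos[OF tau_pos[OF that]] unfolding h_def exp_add by (simp add: powr_def)
  ultimately have 1: "(snd y + t0) powr (- (1 / k)) * \<phi> (tau (snd y)) powr q \<le> t0 powr (- (1 / k)) * \<phi> (\<Gamma> * ln t0) powr q"
    using t by simp
  have "pospow q (gap y) \<le> \<phi> (tau (snd y)) powr q"
    unfolding pospow_def gap_def using \<psi>_nonneg[OF r0, of "norm (fst y)"] \<phi>_pos[OF tau_pos[OF t]] q_pos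
    by (intro powr_mono2) auto
  then have "(snd y + t0) powr (- (1 / k)) * pospow q (gap y) \<le> t0 powr (- (1 / k)) * \<phi> (\<Gamma> * ln t0) powr q"
    using 1 by (meson mult_left_mono order_trans powr_ge_zero)
  then show ?thesis using C0 by (simp add: bar_def bar_max_def tpow_def mult.assoc)
qed

text \<open>At radius \<open>Ginv (tau T)\<close> the outer profile reaches
  \<open>\<phi> (tau T)\<close>, the largest value of \<open>\<phi>\<close> up to time
  \<open>T\<close>.\<close>

lemma gap_nonpos:
  assumes "0 \<le> t" "t \<le> T" "max r0 (Ginv (tau T)) \<le> norm x"
  shows "gap (x, t) \<le> 0"
proof -
  have "\<phi> (tau t) \<le> \<phi> (tau T)" by (rule \<phi>_mono[OF tau_pos tau_mono]) (use assms in auto)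
  also have "\<dots> \<le> \<psi>J (norm x)" unfolding \<phi>_eq
    using assms by (intro \<psi>J_mono Ginv_pos tau_pos) auto
  also have "\<dots> = \<psi> r0 (norm x)" using assms by (simp add: \<psi>_def)
  finally show ?thesis by (simp add: gap_def)
qed

lemma bar_eq_0: "0 \<le> t \<Longrightarrow> t \<le> T \<Longrightarrow> max r0 (Ginv (tau T)) \<le> norm x \<Longrightarrow> bar (x, t) = 0"
  using gap_nonpos[of t T x] by (simp add: bar_def pospow_neg)

lemma bar_slice_cont: "continuous_on UNIV (\<lambda>x. bar (x, t))"
proof -
  have "continuous_on UNIV (\<lambda>x::'a. \<psi> r0 (norm x))"
    by (rule continuous_on_compose2[OF \<psi>_cont[OF r0]]) (auto intro!: continuous_intros)
  then have "continuous_on UNIV (\<lambda>x::'a. gap (x, t))"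
    unfolding gap_def fst_conv snd_conv by (intro continuous_on_diff continuous_on_const)
  then show ?thesis unfolding bar_def tpow_def snd_conv
    by (intro continuous_on_mult continuous_on_const pospow_continuous_on q_pos)
qed

lemma bar_time_isCont:
  assumes t: "0 \<le> t"
  shows "isCont (\<lambda>t. bar (x, t)) t"
proof -
  have "isCont (\<lambda>t. \<phi> (tau t)) t" using \<phi>_tau_deriv[OF t] by (rule DERIV_isCont)
  then have g: "isCont (\<lambda>t. gap (x, t)) t" unfolding gap_def by simp
  have "isCont (pospow q) (gap (x, t))"
    using pospow_continuous_on[OF q_pos continuous_on_id, of UNIV] by (simp add: continuous_on_eq_continuous_at)
  with g have "isCont (\<lambda>t. pospow q (gap (x, t))) t" by (rule isCont_o2)
  moreover have "isCont (\<lambda>t. tpow (- (1 / k)) (x, t)) t" unfolding tpow_def using t t0 by (intro continuous_intros) auto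
  ultimately show ?thesis unfolding bar_def by (intro continuous_intros)
qed

abbreviation (input) wt :: "'a::euclidean_space \<Rightarrow> real" where "wt x \<equiv> exp (g (norm x))"

lemma g_norm_cont: "continuous_on S (\<lambda>x::'a::euclidean_space. g (norm x))"
  by (rule continuous_on_compose2[OF g_cont]) (auto intro!: continuous_intros)

text \<open>On a bounded time range the barrier is bounded and supported in one ball, so pointwise
  continuity in time passes to the weighted norm by dominated convergence. Time 0 is included, since
  \<open>t0 > 1\<close> keeps \<open>ln (t + t0)\<close> positive.\<close>

lemma continuous_in_L1_bar: "continuous_in_L1 wt (\<lambda>x t. bar (x, t))"
  unfolding continuous_in_L1_def
proof (intro conjI allI impI)
  have wc: "continuous_on UNIV (\<lambda>x::'a. wt x)" by (intro continuous_intros g_norm_cont)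
  have bm: "(\<lambda>x::'a. bar (x, t)) \<in> borel_measurable lebesgue" for t by (rule continuous_lebesgue_measurable[OF bar_slice_cont])
  note D = density_integrable_iff[OF wc]
  show "integrable (weighted wt) (\<lambda>x::'a. bar (x, t))" if t: "0 \<le> t" for t
  proof (subst D(1)[OF _ bm])
    show "integrable lebesgue (\<lambda>x::'a. wt x * bar (x, t))"
      by (rule compact_support_integrable[of _ "cball 0 (max r0 (Ginv (tau t)))"])
        (auto intro!: continuous_on_mult wc bar_slice_cont bar_eq_0[OF t order_refl])
  qed simp
  fix s :: real assume s: "0 \<le> s"
  show "((\<lambda>t. LINT x|weighted wt. \<bar>bar (x::'a, t) - bar (x, s)\<bar>) \<longlongrightarrow> 0) (at s within {0..})"
    unfolding tendsto_at_iff_sequentially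
  proof (intro allI impI)
    fix X :: "nat \<Rightarrow> real" assume X: "\<forall>i. X i \<in> {0..} - {s}" "X \<longlonglongrightarrow> s"
    then have X0: "0 \<le> X n" for n by auto
    obtain T where T: "\<And>n. X n \<le> T" using convergent_imp_Bseq[OF convergentI[OF X(2)]] unfolding Bseq_def
      by (metis abs_le_D1 real_norm_def)
    have sT: "s \<le> T" by (rule LIMSEQ_le_const2[OF X(2)]) (use T in auto)
    define R where "R = max r0 (Ginv (tau T))"
    have R0: "0 \<le> R" using r0 by (simp add: R_def)
    have bound: "\<bar>bar (x, t)\<bar> \<le> bar_max * indicator (cball 0 R) x" if "0 \<le> t" "t \<le> T" for x :: 'a and t
    proof (cases "norm x \<le> R")
      case True
      then show ?thesis using bar_le_max[of "(x, t)"] bar_nonneg[of "(x, t)"] that(1) by simp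
    next
      case False
      then have "max r0 (Ginv (tau T)) \<le> norm x" unfolding R_def by linarith
      then show ?thesis using bar_eq_0[OF that, of x] bar_le_max[of "(x, t)"] False that by simp
    qed
    have m: "(\<lambda>x::'a. \<bar>bar (x, X n) - bar (x, s)\<bar>) \<in> borel_measurable lebesgue" for n
      by (intro borel_measurable_abs borel_measurable_diff bm)
    have "(\<lambda>n. LINT x|lebesgue. wt x * \<bar>bar (x::'a, X n) - bar (x, s)\<bar>) \<longlonglongrightarrow> (LINT x|(lebesgue :: 'a measure). 0)"
    proof (rule integral_dominated_convergence)
      show "integrable lebesgue (\<lambda>x::'a. exp (g R) * (2 * bar_max) * indicat_real (cball 0 R) x)"
        using lmeasurable_cball[of "0::'a" R] by (simp add: lmeasurable_iff_integrable)
      show "(\<lambda>x::'a. wt x * \<bar>bar (x, X n) - bar (x, s)\<bar>) \<in> borel_measurable lebesgue" for n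
        by (rule borel_measurable_times[OF continuous_lebesgue_measurable[OF wc] m])
      show "AE x in lebesgue. (\<lambda>n. wt x * \<bar>bar (x::'a, X n) - bar (x, s)\<bar>) \<longlonglongrightarrow> 0"
      proof (rule AE_I2)
        fix x :: 'a
        have "(\<lambda>n. bar (x, X n)) \<longlonglongrightarrow> bar (x, s)" by (rule isCont_tendsto_compose[OF bar_time_isCont[OF s] X(2)])
        then have "(\<lambda>n. wt x * \<bar>bar (x, X n) - bar (x, s)\<bar>) \<longlonglongrightarrow> wt x * \<bar>bar (x, s) - bar (x, s)\<bar>"
          by (intro tendsto_mult tendsto_const tendsto_rabs tendsto_diff)
        then show "(\<lambda>n. wt x * \<bar>bar (x, X n) - bar (x, s)\<bar>) \<longlonglongrightarrow> 0" by simp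
      qed
      fix n
      show "AE x in lebesgue. norm (wt x * \<bar>bar (x::'a, X n) - bar (x, s)\<bar>) \<le> exp (g R) * (2 * bar_max) * indicat_real (cball 0 R) x"
      proof (rule AE_I2)
        fix x :: 'a
        have b: "\<bar>bar (x, X n) - bar (x, s)\<bar> \<le> 2 * bar_max * indicator (cball 0 R) x"
          using bound[OF X0 T, of x n] bound[OF s sT, of x] by linarith
        show "norm (wt x * \<bar>bar (x, X n) - bar (x, s)\<bar>) \<le> exp (g R) * (2 * bar_max) * indicat_real (cball 0 R) x"
        proof (cases "x \<in> cball 0 R")
          case True
          then have "wt x \<le> exp (g R)" using g_mono[of "norm x" R] by simp
          then have "wt x * \<bar>bar (x, X n) - bar (x, s)\<bar> \<le> exp (g R) * (2 * bar_max)"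
            using b True by (intro mult_mono) auto
          then show ?thesis using True by (simp add: abs_mult)
        next
          case False
          then show ?thesis using b by simp
        qed
      qed
    qed simp
    then have "(\<lambda>n. LINT x|weighted wt. \<bar>bar (x::'a, X n) - bar (x, s)\<bar>) \<longlonglongrightarrow> 0"
      by (subst D(2)[OF _ m]) simp_all
    then show "((\<lambda>t. LINT x|weighted wt. \<bar>bar (x::'a, t) - bar (x, s)\<bar>) \<circ> X) \<longlonglongrightarrow> 0" by (simp add: comp_def)
  qed
qed

abbreviation (input) \<sigma> :: real where "\<sigma> \<equiv> sigma p m"

lemma \<sigma>_eq: "\<sigma> * (p - 1) = k + 1" "q * \<sigma> = (k + 1) / k"
  using p1 k_pos by (simp_all add: sigma_def q_def k_def)

lemma \<sigma>_pos: "0 < \<sigma>"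
  using p1 k0 by (simp add: sigma_def)

lemma bar_powr_\<sigma>: "bar y powr \<sigma> = C powr \<sigma> * tpow (- (\<sigma> / k)) y * pospow ((k + 1) / k) (gap y)"
  using C0 by (simp add: bar_def powr_mult pospow_def powr_powr tpow_def \<sigma>_eq(2)[symmetric])

text \<open>The modulus of the gradient of \<open>bar^\<sigma>\<close>, written with
  \<open>(\<Lambda>c r0 r * r) powr (1 / (p - 1))\<close> in place of \<open>\<psi>'\<close>: the
  two agree for \<open>r > 0\<close>, and the former is continuous at the origin and across
  \<open>r0\<close>.\<close>

definition Hgrad :: "'a::euclidean_space \<times> real \<Rightarrow> real" where
  "Hgrad y = C powr \<sigma> * tpow (- (\<sigma> / k)) y * ((k + 1) / k * pospow (1 / k) (gap y)) *
     (\<Lambda>c r0 (norm (fst y)) * norm (fst y)) powr (1 / (p - 1))"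
definition Vgrad :: "'a::euclidean_space \<times> real \<Rightarrow> 'a" where
  "Vgrad y = - Hgrad y *\<^sub>R sgn (fst y)"

lemma Hgrad_cont: "continuous_on spacetime Hgrad"
proof -
  have "continuous_on spacetime (\<lambda>y::'a \<times> real. \<Lambda>c r0 (norm (fst y)))" by (rule continuous_norm_fst[OF \<Lambda>c_cont[OF r0]])
  then have c: "continuous_on spacetime (\<lambda>y::'a \<times> real. \<Lambda>c r0 (norm (fst y)) * norm (fst y))"
    by (intro continuous_intros)
  have nn: "0 \<le> \<Lambda>c r0 (norm (fst y)) * norm (fst y)" for y :: "'a \<times> real"
    using \<Lambda>c_pos[OF r0, of "norm (fst y)"] by simp
  have "continuous_on spacetime (\<lambda>y::'a \<times> real. (\<Lambda>c r0 (norm (fst y)) * norm (fst y)) powr (1 / (p - 1)))"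
    by (rule continuous_on_powr'[OF c continuous_on_const]) (use nn p1 in simp)
  moreover have "continuous_on spacetime (\<lambda>y::'a \<times> real. pospow (1 / k) (gap y))" by (rule gap_pospow_cont) (use k_pos in simp)
  ultimately show ?thesis unfolding Hgrad_def[abs_def]
    by (intro continuous_on_mult continuous_on_const tpow_cont)
qed

lemma Hgrad_nonneg: "0 \<le> Hgrad y"
  using k_pos by (simp add: Hgrad_def)

lemma Hgrad_0: "fst y = 0 \<Longrightarrow> Hgrad y = 0"
  by (simp add: Hgrad_def)

lemma norm_Vgrad: "norm (Vgrad y) = Hgrad y"
  using Hgrad_nonneg[of y] Hgrad_0[of y] by (cases "fst y = 0") (simp_all add: Vgrad_def norm_sgn)

text \<open>The exponent \<open>(k + 1) / k\<close> of the gap in \<open>bar^\<sigma>\<close>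
  exceeds 1, so the power is differentiated directly, off the exceptional radii, even when
  \<open>q < 1\<close>.\<close>

lemma weak_ddir_bar:
  fixes b :: "'a::euclidean_space"
  assumes b: "b \<in> Basis"
  shows "weak_ddir spacetime (b, 0) (\<lambda>y. bar y powr \<sigma>) (\<lambda>y. Vgrad y \<bullet> b)"
proof -
  have e: "(k + 1) / k - 1 = 1 / k" using k_pos by (simp add: field_simps)
  have cont: "continuous_on UNIV (\<lambda>z. (k + 1) / k * pospow (1 / k) z)"
    using k_pos by (intro continuous_intros pospow_continuous_on) auto
  have der: "(pospow ((k + 1) / k) has_real_derivative (k + 1) / k * pospow (1 / k) z) (at z)" for z
    using pospow_has_derivative[of "(k + 1) / k" z] k_pos by (simp add: e)
  have ld: "line_diff (radial_exc r0) (b, 0) (\<lambda>y. C powr \<sigma> * tpow (- (\<sigma> / k)) y * pospow ((k + 1) / k) (gap y))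
     (\<lambda>y. C powr \<sigma> * tpow (- (\<sigma> / k)) y * ((k + 1) / k * pospow (1 / k) (gap y) * (- d\<psi> r0 (norm (fst y)) * ((fst y \<bullet> b) / norm (fst y))))
        + C powr \<sigma> * 0 * pospow ((k + 1) / k) (gap y))" (is "line_diff _ _ _ ?d")
    by (rule line_diff_mult[OF line_diff_cmult[OF tpow_space] line_diff_compose[OF gap_space[OF b] der cont]])
  have "weak_ddir spacetime (b, 0) (\<lambda>y. C powr \<sigma> * tpow (- (\<sigma> / k)) y * pospow ((k + 1) / k) (gap y)) ?d"
    by (rule line_diff_weak_ddir[OF ld AE_radial_exc finite_radial_exc[OF b]])
  moreover have "?d = (\<lambda>y. Vgrad y \<bullet> b)"
  proof
    fix y :: "'a \<times> real"
    show "?d y = Vgrad y \<bullet> b"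
    proof (cases "fst y = 0")
      case False
      then have "Hgrad y = C powr \<sigma> * tpow (- (\<sigma> / k)) y * ((k + 1) / k * pospow (1 / k) (gap y)) * d\<psi> r0 (norm (fst y))"
        by (simp add: Hgrad_def d\<psi>_eq[OF r0])
      then show ?thesis by (simp add: Vgrad_def sgn_div_norm divide_inverse mult_ac)
    qed (simp add: Vgrad_def)
  qed
  ultimately show ?thesis by (simp add: bar_powr_\<sigma>)
qed

lemma solution_class_bar: "solution_class p m wt (\<lambda>x t. bar (x, t)) Vgrad"
  unfolding solution_class_def
proof (intro conjI allI impI)
  let ?S = "spacetime :: ('a \<times> real) set"
  have Sm: "?S \<in> sets lebesgue"
    by (intro sets_completionI_sets) (simp add: borel_open open_spacetime)
  have e: "(\<lambda>(x, t). bar (x, t) powr \<sigma>) = (\<lambda>y::'a \<times> real. bar y powr \<sigma>)" by auto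
  show "AE x in (lebesgue :: 'a measure). 0 \<le> bar (x, t)" for t using bar_nonneg by (intro AE_I2)
  show "continuous_in_L1 wt (\<lambda>x t. bar (x :: 'a, t))" by (rule continuous_in_L1_bar)
  have "bar \<in> borel_measurable (lebesgue_on ?S)"
    by (rule continuous_imp_measurable_on_sets_lebesgue[OF bar_cont Sm])
  then show "(\<lambda>(x, t). bar (x :: 'a, t)) \<in> borel_measurable (lebesgue_on ?S)" by (simp add: case_prod_unfold)
  show "\<exists>M. AE (x, t) in lebesgue. s < t \<longrightarrow> \<bar>bar (x :: 'a, t)\<bar> \<le> M" if s: "0 < s" for s
  proof (intro exI AE_I2)
    fix z :: "'a \<times> real"
    show "case z of (x, t) \<Rightarrow> s < t \<longrightarrow> \<bar>bar (x, t)\<bar> \<le> bar_max"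
      using bar_le_max[of z] bar_nonneg[of z] s by (cases z) auto
  qed
  have lb: "locally_L1 ?S (\<lambda>z. Vgrad z \<bullet> b)" if "b \<in> Basis" for b
    using weak_ddir_bar[OF that] by (simp add: weak_ddir_def)
  have lV: "locally_L1 ?S Vgrad"
    unfolding locally_L1_def set_integrable_def
  proof (intro allI impI)
    fix K :: "('a \<times> real) set" assume K: "compact K \<and> K \<subseteq> ?S"
    have "integrable lebesgue (\<lambda>z. \<Sum>b\<in>Basis. (rst K (\<lambda>z. Vgrad z \<bullet> b) z) *\<^sub>R b)"
      using locally_L1_rst[OF lb] K by (intro Bochner_Integration.integrable_sum integrable_scaleR_left) blast+
    moreover have "(\<Sum>b\<in>Basis. (rst K (\<lambda>z. Vgrad z \<bullet> b) z) *\<^sub>R b) = indicat_real K z *\<^sub>R Vgrad z" for z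
      by (simp flip: scaleR_scaleR scaleR_sum_right add: euclidean_representation)
    ultimately show "integrable lebesgue (\<lambda>z. indicat_real K z *\<^sub>R Vgrad z)" by simp
  qed
  have "b0 \<in> Basis \<Longrightarrow> locally_L1 ?S (\<lambda>y. bar y powr \<sigma>)" for b0 :: 'a
    using weak_ddir_bar[of b0] by (simp add: weak_ddir_def)
  then have lw: "locally_L1 ?S (\<lambda>y. bar y powr \<sigma>)" using nonempty_Basis by blast
  show "weak_grad_x (\<lambda>(x, t). bar (x :: 'a, t) powr \<sigma>) Vgrad"
    unfolding e weak_grad_x_iff[OF lw lV] using weak_ddir_bar by blast
  show "locally_Lp p ?S Vgrad"
    unfolding locally_Lp_def norm_Vgrad
  proof (intro conjI)
    have H: "Hgrad \<in> borel_measurable (lebesgue_on ?S)"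
      by (rule continuous_imp_measurable_on_sets_lebesgue[OF Hgrad_cont Sm])
    have "(\<lambda>y::'a \<times> real. inverse (norm (fst y)) *\<^sub>R fst y) \<in> borel_measurable borel"
      by (intro borel_measurable_scaleR borel_measurable_inverse borel_measurable_continuous_onI continuous_intros)
    then have "(\<lambda>y::'a \<times> real. sgn (fst y)) \<in> borel_measurable lebesgue"
      by (simp add: sgn_div_norm measurable_completion)
    then have "(\<lambda>y::'a \<times> real. sgn (fst y)) \<in> borel_measurable (lebesgue_on ?S)" by (rule measurable_restrict_space1)
    with H show "Vgrad \<in> borel_measurable (lebesgue_on ?S)"
      unfolding Vgrad_def[abs_def] by (intro borel_measurable_scaleR borel_measurable_uminus)
    have "continuous_on ?S (\<lambda>z. Hgrad z powr p)"
      using Hgrad_cont Hgrad_nonneg p0 by (intro continuous_on_powr' continuous_intros) auto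
    from continuous_locally_L1[OF this]
    show "\<forall>K. compact K \<and> K \<subseteq> ?S \<longrightarrow> set_integrable lebesgue K (\<lambda>z. Hgrad z powr p)" by (simp add: locally_L1_def)
  qed
qed

subsection \<open>The barrier is a subsolution\<close>

text \<open>The powers collapse to \<open>- K C^k / (t + t0)\<close> times the barrier times
  \<open>\<Lambda>c x\<close>: raising \<open>pospow (1/k)\<close> to the power \<open>p - 1\<close>
  returns the exponent \<open>q\<close>, and the time exponent is
  \<open>-(\<sigma>/k)(p-1) = -1/k - 1\<close>.\<close>

lemma flux_Vgrad:
  "(1 / \<sigma>) powr (p - 1) * (flux p (Vgrad y) \<bullet> b) =
    - (K * C powr (k + 1) * tpow (- (1 / k) - 1) y * pospow q (gap y) * (\<Lambda>c r0 (norm (fst y)) * (fst y \<bullet> b)))"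
proof (cases "fst y = 0")
  case True
  then show ?thesis by (simp add: Vgrad_def)
next
  case False
  define r where "r = norm (fst y)"
  have r: "0 < r" using False by (simp add: r_def)
  have "Hgrad y powr (p - 2) * Hgrad y = Hgrad y powr (p - 1)"
  proof (cases "Hgrad y = 0")
    case False
    then have "0 < Hgrad y" using Hgrad_nonneg[of y] by simp
    then have "Hgrad y powr (p - 2) * Hgrad y powr 1 = Hgrad y powr (p - 1)" by (simp only: powr_add[symmetric]) simp
    then show ?thesis using \<open>0 < Hgrad y\<close> by simp
  qed simp
  then have 1: "flux p (Vgrad y) = - (Hgrad y powr (p - 1)) *\<^sub>R sgn (fst y)"
    unfolding flux_def norm_Vgrad by (simp add: Vgrad_def)
  have gen: "(a * (b * c * d * e)) powr s = a powr s * (b powr s * c powr s * d powr s * e powr s)"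
    if "0 \<le> a" "0 \<le> b" "0 \<le> c" "0 \<le> d" "0 \<le> e" for a b c d e s :: real
    using that by (simp add: powr_mult)
  have c: "(1 / \<sigma>) * ((k + 1) / k) = (p - 1) / k" using \<sigma>_pos k_pos \<sigma>_eq(1) by (simp add: field_simps)
  have "(1 / \<sigma>) powr (p - 1) * Hgrad y powr (p - 1) = ((1 / \<sigma>) * Hgrad y) powr (p - 1)"
    using \<sigma>_pos Hgrad_nonneg[of y] by (simp only: powr_mult)
  also have "(1 / \<sigma>) * Hgrad y = ((1 / \<sigma>) * ((k + 1) / k)) * (C powr \<sigma> * tpow (- (\<sigma> / k)) y * pospow (1 / k) (gap y) * (\<Lambda>c r0 r * r) powr (1 / (p - 1)))"
    by (simp add: Hgrad_def r_def)
  also have "\<dots> powr (p - 1) = ((p - 1) / k) powr (p - 1) * ((C powr \<sigma>) powr (p - 1) * tpow (- (\<sigma> / k)) y powr (p - 1) *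
      pospow (1 / k) (gap y) powr (p - 1) * ((\<Lambda>c r0 r * r) powr (1 / (p - 1))) powr (p - 1))"
    unfolding c using p1 k_pos \<Lambda>c_pos[OF r0, of r] r by (intro gen) auto
  also have "(C powr \<sigma>) powr (p - 1) = C powr (k + 1)" by (simp add: powr_powr \<sigma>_eq(1))
  also have "tpow (- (\<sigma> / k)) y powr (p - 1) = tpow (- (1 / k) - 1) y"
  proof -
    have "- (\<sigma> / k) * (p - 1) = - ((\<sigma> * (p - 1)) / k)" by simp
    also have "\<dots> = - (1 / k) - 1" unfolding \<sigma>_eq(1) using k_pos by (simp add: field_simps)
    finally show ?thesis by (simp only: tpow_def powr_powr)
  qed
  also have "pospow (1 / k) (gap y) powr (p - 1) = pospow q (gap y)" by (simp add: pospow_def powr_powr q_def)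
  also have "((\<Lambda>c r0 r * r) powr (1 / (p - 1))) powr (p - 1) = \<Lambda>c r0 r * r"
    using p1 r \<Lambda>c_pos[OF r0, of r] by (simp add: powr_powr)
  finally have 2: "(1 / \<sigma>) powr (p - 1) * Hgrad y powr (p - 1) =
      K * (C powr (k + 1) * tpow (- (1 / k) - 1) y * pospow q (gap y) * (\<Lambda>c r0 r * r))" by (simp add: K_def)
  have "(1 / \<sigma>) powr (p - 1) * (flux p (Vgrad y) \<bullet> b) = - ((1 / \<sigma>) powr (p - 1) * Hgrad y powr (p - 1)) * ((fst y \<bullet> b) / r)"
    unfolding 1 by (simp add: sgn_div_norm r_def divide_inverse mult_ac)
  then show ?thesis unfolding 2 using r by (simp add: r_def mult_ac)
qed

text \<open>The weight is absorbed into the radial factor, so that the weighted divergence becomes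
  an ordinary one.\<close>

definition \<rho> :: "real \<Rightarrow> real" where "\<rho> r = \<Lambda>c r0 r * exp (g r)"
definition d\<rho> :: "real \<Rightarrow> real" where "d\<rho> r = exp (g r) * (d\<Lambda>c r0 r + \<Lambda>c r0 r * deriv g r)"

lemma \<rho>_cont: "continuous_on {0..} \<rho>"
  unfolding \<rho>_def[abs_def] by (intro continuous_intros \<Lambda>c_cont r0 g_cont)

lemma \<rho>_deriv:
  assumes "0 < r" "r \<noteq> r0"
  shows "(\<rho> has_real_derivative d\<rho> r) (at r)"
proof -
  have "((\<lambda>r. exp (g r)) has_real_derivative exp (g r) * deriv g r) (at r)"
    by (rule DERIV_chain2[OF DERIV_exp g_deriv[OF assms(1)]])
  from DERIV_mult[OF \<Lambda>c_deriv[OF r0 assms] this] show ?thesis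
    unfolding \<rho>_def[abs_def] by (rule DERIV_cong) (simp add: d\<rho>_def algebra_simps)
qed

lemma d\<rho>_bounded: "0 < R \<Longrightarrow> \<exists>B. \<forall>r. 0 < r \<and> r \<le> R \<longrightarrow> \<bar>r * d\<rho> r\<bar> \<le> B"
proof -
  assume R: "0 < R"
  define B where "B = BL * ((p / (p - 1)) powr (p - 1) / G r0) + (p / (p - 1)) powr (p - 1) * \<alpha>2\<^sup>2"
  have "\<bar>r * d\<rho> r\<bar> \<le> exp (g R) * B" if r: "0 < r" "r \<le> R" for r
  proof -
    have e: "r * d\<rho> r = exp (g r) * (r * d\<Lambda>c r0 r + \<Lambda>c r0 r * (r * deriv g r))" by (simp add: d\<rho>_def algebra_simps)
    have "0 \<le> \<Lambda>c r0 r * (r * deriv g r)" using \<Lambda>c_pos[OF r0, of r] dg_pos[OF r(1)] r by simp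
    then have "\<bar>r * d\<Lambda>c r0 r + \<Lambda>c r0 r * (r * deriv g r)\<bar> \<le> B"
      using d\<Lambda>c_bound[OF r0 r(1)] \<Lambda>c_dg_bound[OF r0 r(1)] unfolding B_def by linarith
    moreover have "\<bar>exp (g r)\<bar> \<le> exp (g R)" using g_mono[of r R] r by simp
    ultimately show ?thesis unfolding e by (intro abs_mult_mono)
  qed
  then show ?thesis by blast
qed

text \<open>Minus the weighted flux, with \<open>z^q\<close> replaced by the same regularised power
  as in \<open>ureg\<close>. Using one power in both places keeps \<open>barrier_inequality\<close>
  applicable.\<close>

definition Freg :: "nat \<Rightarrow> 'a::euclidean_space \<Rightarrow> 'a \<times> real \<Rightarrow> real" where
  "Freg n b y = (K * C powr (k + 1) * tpow (- (1 / k) - 1) y * regpow q (1 / real (Suc n)) (gap y)) * (\<rho> (norm (fst y)) * (fst y \<bullet> b))"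
definition dFreg :: "nat \<Rightarrow> 'a::euclidean_space \<Rightarrow> 'a \<times> real \<Rightarrow> real" where
  "dFreg n b y = K * C powr (k + 1) * tpow (- (1 / k) - 1) y * regpow q (1 / real (Suc n)) (gap y) *
      (\<rho> (norm (fst y)) + d\<rho> (norm (fst y)) * ((fst y \<bullet> b)\<^sup>2 / norm (fst y))) -
    K * C powr (k + 1) * tpow (- (1 / k) - 1) y * dregpow q (1 / real (Suc n)) (gap y) *
      d\<psi> r0 (norm (fst y)) * ((fst y \<bullet> b)\<^sup>2 / norm (fst y)) * \<rho> (norm (fst y))"

lemma weak_ddir_Freg:
  fixes b :: "'a::euclidean_space"
  assumes b: "b \<in> Basis"
  shows "weak_ddir spacetime (b, 0) (Freg n b) (dFreg n b)" and "continuous_on spacetime (Freg n b)"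
proof -
  let ?a = "K * C powr (k + 1)"
  have ld: "line_diff (radial_exc r0) (b, 0) (Freg n b)
     (\<lambda>y. ?a * tpow (- (1 / k) - 1) y * regpow q (1 / real (Suc n)) (gap y) *
        (\<rho> (norm (fst y)) + d\<rho> (norm (fst y)) * ((fst y \<bullet> b)\<^sup>2 / norm (fst y))) +
       (?a * tpow (- (1 / k) - 1) y * (dregpow q (1 / real (Suc n)) (gap y) * (- d\<psi> r0 (norm (fst y)) * ((fst y \<bullet> b) / norm (fst y))))
         + ?a * 0 * regpow q (1 / real (Suc n)) (gap y)) * (\<rho> (norm (fst y)) * (fst y \<bullet> b)))"
    (is "line_diff _ _ _ ?d")
    unfolding Freg_def[abs_def]
    by (rule line_diff_mult[OF line_diff_mult[OF line_diff_cmult[OF tpow_space] regpow_gap[OF gap_space[OF b]]]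
          line_diff_radial_coordinate[OF b \<rho>_cont \<rho>_deriv d\<rho>_bounded]])
  then show "continuous_on spacetime (Freg n b)" by (rule line_diff_continuous)
  have "?d = dFreg n b"
    by (auto simp: dFreg_def power2_eq_square algebra_simps)
  then show "weak_ddir spacetime (b, 0) (Freg n b) (dFreg n b)"
    using line_diff_weak_ddir[OF ld AE_radial_exc finite_radial_exc[OF b]] by simp
qed

text \<open>After division by \<open>C (t + t0)^(-1/k-1) exp g\<close> this is
  \<open>barrier_inequality\<close>. The dimension enters through the sum over the basis, in which
  the terms \<open>x_b^2 / r\<close> add up to \<open>r\<close>.\<close>

lemma regularised_inequality:
  fixes y :: "'a::euclidean_space \<times> real"
  assumes N: "N = real DIM('a)" and y: "y \<in> spacetime" "y \<notin> radial_exc r0"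
  shows "dureg n y * wt (fst y) + (\<Sum>b\<in>Basis. dFreg n b y) \<le> 0"
proof -
  define r where "r = norm (fst y)"
  define t where "t = snd y"
  define P where "P = regpow q (1 / real (Suc n)) (gap y)"
  define dP where "dP = dregpow q (1 / real (Suc n)) (gap y)"
  define A where "A = tpow (- (1 / k) - 1) y"
  define D where "D = r * d\<Lambda>c r0 r + \<Lambda>c r0 r * (r * deriv g r) + N * \<Lambda>c r0 r"
  have r: "0 < r" using y(2) by (auto simp: r_def radial_exc_def)
  have t: "0 < t" using y(1) by (auto simp: t_def spacetime_def)
  have dn: "(0::real) < 1 / real (Suc n)" by simp
  have gp: "gap y = \<phi> (tau t) - \<psi> r0 r" by (simp add: gap_def t_def r_def)
  have ineq: "- P / k + dP * (\<Gamma> * d\<phi> (tau t)) + K * C powr k * (P * D - dP * (d\<psi> r0 r * (\<Lambda>c r0 r * r))) \<le> 0"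
  proof (rule barrier_inequality[OF less_imp_le[OF t] r])
    show "0 \<le> P" "0 \<le> dP" unfolding P_def dP_def by (rule regpow_nonneg[OF q_pos dn] dregpow_nonneg[OF q_pos dn])+
    show "(\<phi> (tau t) - \<psi> r0 r) * dP \<le> (q + 2) * P"
      unfolding P_def dP_def gp[symmetric] by (rule dregpow_mult_le[OF q_pos dn])
    show "dP = 0" if "\<phi> (tau t) - \<psi> r0 r \<le> 0"
      unfolding dP_def using that regpow_neg(2)[OF q_pos dn] gp by simp
    show "D \<le> Dconst N r0" unfolding D_def by (rule divergence_bound[OF r0 r N0])
  qed
  have tp: "tpow (- (1 / k)) y * (\<Gamma> / (t + t0)) = A * \<Gamma>"
    using t t0 by (simp add: A_def tpow_def t_def powr_diff)
  have 1: "dureg n y = C * A * (- P / k + dP * (\<Gamma> * d\<phi> (tau t)))"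
  proof -
    have "dureg n y = - (C / k) * A * P + C * dP * d\<phi> (tau t) * (tpow (- (1 / k)) y * (\<Gamma> / (t + t0)))"
      by (simp add: dureg_def A_def P_def dP_def dgap_def t_def)
    then show ?thesis unfolding tp by (simp add: algebra_simps)
  qed
  have sq: "(\<Sum>b\<in>Basis. (fst y \<bullet> b)\<^sup>2 / r) = r"
  proof -
    have "(\<Sum>b\<in>Basis. (fst y \<bullet> b)\<^sup>2 / r) = r\<^sup>2 / r"
      unfolding sum_divide_distrib[symmetric] r_def power2_norm_eq_inner euclidean_inner[of "fst y" "fst y"] by (simp add: power2_eq_square)
    then show ?thesis using r by (simp add: power2_eq_square)
  qed
  have "(\<Sum>b\<in>Basis. dFreg n b y) = (\<Sum>b\<in>Basis. K * C powr (k + 1) * A * P * \<rho> r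
      + K * C powr (k + 1) * A * (P * d\<rho> r - dP * d\<psi> r0 r * \<rho> r) * ((fst y \<bullet> b)\<^sup>2 / r))"
    by (rule sum.cong) (simp_all add: dFreg_def A_def P_def dP_def r_def algebra_simps)
  also have "\<dots> = N * (K * C powr (k + 1) * A * P * \<rho> r) + K * C powr (k + 1) * A * (P * d\<rho> r - dP * d\<psi> r0 r * \<rho> r) * r"
    by (simp only: sum.distrib sum_distrib_left[symmetric] sq sum_constant N) (simp add: mult_ac)
  also have "\<dots> = C * A * exp (g r) * (K * C powr k * (P * D - dP * (d\<psi> r0 r * (\<Lambda>c r0 r * r))))"
    using C0 by (simp add: \<rho>_def d\<rho>_def D_def powr_add algebra_simps)
  finally have 2: "(\<Sum>b\<in>Basis. dFreg n b y) = C * A * exp (g r) * (K * C powr k * (P * D - dP * (d\<psi> r0 r * (\<Lambda>c r0 r * r))))" .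
  have "dureg n y * wt (fst y) + (\<Sum>b\<in>Basis. dFreg n b y) = C * A * exp (g r) *
      (- P / k + dP * (\<Gamma> * d\<phi> (tau t)) + K * C powr k * (P * D - dP * (d\<psi> r0 r * (\<Lambda>c r0 r * r))))"
    unfolding 1 2 r_def[symmetric] by (simp add: algebra_simps)
  also have "\<dots> \<le> 0" using ineq C0 by (intro mult_nonneg_nonpos) (auto simp: A_def)
  finally show ?thesis .
qed

text \<open>The pointwise inequality for the regularised functions is integrated against
  \<open>\<eta>\<close> and the spatial derivatives are moved onto \<open>\<eta>\<close> before
  \<open>n\<close> tends to infinity, so that the flux, and not its divergence, has to
  converge.\<close>

lemma energy_bar_nonpos:
  fixes \<eta> :: "'a::euclidean_space \<times> real \<Rightarrow> real"
  assumes N: "N = real DIM('a)" and \<eta>: "test_function spacetime \<eta>" "\<And>z. 0 \<le> \<eta> z"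
  shows "energy_integral p m wt (\<lambda>x t. bar (x, t)) (grad_of_power p m (\<lambda>x t. bar (x, t)) Vgrad) \<eta> \<le> 0"
proof -
  let ?S = "spacetime :: ('a \<times> real) set"
  define c where "c = (1 / \<sigma>) powr (p - 1)"
  have wc: "continuous_on UNIV (\<lambda>x::'a. wt x)" by (intro continuous_intros g_norm_cont)
  obtain K' where K: "compact K'" "K' \<subseteq> ?S" "\<And>z. z \<notin> K' \<Longrightarrow> \<eta> z = 0" and \<eta>s: "smooth \<eta>"
    using \<eta>(1) unfolding test_function_def by blast
  have D0: "ddir e \<eta> z = 0" if "z \<notin> K'" for z e
    by (rule ddir_outside_support[OF compact_imp_closed[OF K(1)] K(3) that])
  have \<eta>c: "continuous_on UNIV \<eta>" by (rule smooth_continuous[OF \<eta>s])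
  have kc: "continuous_on UNIV (\<lambda>z. wt (fst z) * \<eta> z)" by (intro continuous_intros continuous_on_compose2[OF wc] \<eta>c) auto
  have kz: "wt (fst z) * \<eta> z = 0" if "z \<notin> K'" for z using K(3)[OF that] by simp
  obtain Y :: "'a \<times> real \<Rightarrow> real" where Y: "locally_L1 spacetime Y" "\<And>n y. y \<in> spacetime \<Longrightarrow> \<bar>dureg n y\<bar> \<le> Y y"
    "\<And>y::'a \<times> real. (\<lambda>n. dureg n y) \<longlonglongrightarrow> dbarrier y"
    by (rule dureg_limit) (rule that)
  have ld: "locally_L1 ?S (dureg n)" for n
    using weak_ddir_ureg[of n, where 'a = 'a] by (simp add: weak_ddir_def)
  define T1 where "T1 n = (LINT z:?S|lebesgue. dureg n z * (wt (fst z) * \<eta> z))" for n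
  have T1: "T1 \<longlonglongrightarrow> (LINT z:?S|lebesgue. dbarrier z * (wt (fst z) * \<eta> z))"
    unfolding T1_def
    by (rule set_integral_limit[OF ld Y(1) _ _ kc K(1,2) kz]) (auto intro!: AE_I2 Y(2,3))
  define Fl where "Fl b y = K * C powr (k + 1) * tpow (- (1 / k) - 1) y * pospow q (gap y) * (\<rho> (norm (fst y)) * (fst y \<bullet> b))"
    for b and y :: "'a \<times> real"
  define T2 where "T2 b n = (LINT z:?S|lebesgue. Freg n b z * ddir (b, 0) \<eta> z)" for b n
  have T2: "T2 b \<longlonglongrightarrow> (LINT z:?S|lebesgue. Fl b z * ddir (b, 0) \<eta> z)" if b: "b \<in> Basis" for b
    unfolding T2_def
  proof (rule set_integral_limit[OF _ _ _ _ smooth_continuous[OF smooth_ddir[OF \<eta>s]] K(1,2) D0])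
    show "locally_L1 ?S (Freg n b)" for n by (rule continuous_locally_L1[OF weak_ddir_Freg(2)[OF b]])
    have "continuous_on ?S (Fl b)"
      unfolding Fl_def by (intro continuous_intros tpow_cont gap_pospow_cont q_pos continuous_norm_fst \<rho>_cont)
    then show "locally_L1 ?S (\<lambda>y. \<bar>Fl b y\<bar>)" by (intro continuous_locally_L1 continuous_intros)
    show "AE z in lebesgue. z \<in> ?S \<longrightarrow> \<bar>Freg n b z\<bar> \<le> \<bar>Fl b z\<bar>" for n
    proof (intro AE_I2 impI)
      fix z :: "'a \<times> real"
      have "0 \<le> regpow q (1 / real (Suc n)) (gap z)" "regpow q (1 / real (Suc n)) (gap z) \<le> pospow q (gap z)"
        using regpow_nonneg[OF q_pos, of "1 / real (Suc n)"] regpow_le[OF q_pos, of "1 / real (Suc n)"] by auto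
      then show "\<bar>Freg n b z\<bar> \<le> \<bar>Fl b z\<bar>"
        unfolding Freg_def Fl_def abs_mult using K_pos by (intro mult_right_mono mult_left_mono) auto
    qed
    show "AE z in lebesgue. z \<in> ?S \<longrightarrow> (\<lambda>n. Freg n b z) \<longlonglongrightarrow> Fl b z"
      unfolding Freg_def Fl_def by (intro AE_I2 impI tendsto_mult tendsto_const regpow_tendsto q_pos)
  qed
  have flx: "c * (LINT z:?S|lebesgue. (flux p (Vgrad z) \<bullet> b) * (wt (fst z) * ddir (b, 0) \<eta> z)) =
      - (LINT z:?S|lebesgue. Fl b z * ddir (b, 0) \<eta> z)" for b
  proof -
    have "c * (LINT z:?S|lebesgue. (flux p (Vgrad z) \<bullet> b) * (wt (fst z) * ddir (b, 0) \<eta> z)) =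
        (LINT z:?S|lebesgue. c * ((flux p (Vgrad z) \<bullet> b) * (wt (fst z) * ddir (b, 0) \<eta> z)))"
      by (rule set_integral_mult_right[symmetric])
    also have "\<dots> = (LINT z:?S|lebesgue. - (Fl b z * ddir (b, 0) \<eta> z))"
    proof (rule arg_cong[where f = "\<lambda>h. set_lebesgue_integral lebesgue ?S h"], rule ext)
      fix z :: "'a \<times> real"
      have "c * ((flux p (Vgrad z) \<bullet> b) * (wt (fst z) * ddir (b, 0) \<eta> z)) = c * (flux p (Vgrad z) \<bullet> b) * (wt (fst z) * ddir (b, 0) \<eta> z)"
        by simp
      also have "\<dots> = - (Fl b z * ddir (b, 0) \<eta> z)"
        unfolding c_def flux_Vgrad Fl_def \<rho>_def by (simp add: mult_ac)
      finally show "c * ((flux p (Vgrad z) \<bullet> b) * (wt (fst z) * ddir (b, 0) \<eta> z)) = - (Fl b z * ddir (b, 0) \<eta> z)" .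
    qed
    also have "\<dots> = - (LINT z:?S|lebesgue. Fl b z * ddir (b, 0) \<eta> z)"
      unfolding set_lebesgue_integral_def by simp
    finally show ?thesis .
  qed
  have wd: "weak_deriv_t (\<lambda>(x, t). bar (x, t)) (dbarrier :: 'a \<times> real \<Rightarrow> real)"
    using weak_deriv_t_barrier[where 'a = 'a] by (simp only: barrier_eq_bar)
  have E: "energy_integral p m wt (\<lambda>x t. bar (x, t)) (grad_of_power p m (\<lambda>x t. bar (x, t)) Vgrad) \<eta> =
      (LINT z:?S|lebesgue. dbarrier z * (wt (fst z) * \<eta> z)) + (\<Sum>b\<in>Basis. - (LINT z:?S|lebesgue. Fl b z * ddir (b, 0) \<eta> z))"
    unfolding energy_integral_eq[OF p1 k0 wc solution_class_bar wd \<eta>(1)] sum_distrib_left c_def[symmetric] flx ..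
  have "(\<lambda>n. T1 n + (\<Sum>b\<in>Basis. - T2 b n)) \<longlonglongrightarrow>
      (LINT z:?S|lebesgue. dbarrier z * (wt (fst z) * \<eta> z)) + (\<Sum>b\<in>Basis. - (LINT z:?S|lebesgue. Fl b z * ddir (b, 0) \<eta> z))"
    by (intro tendsto_add T1 tendsto_sum tendsto_minus T2)
  moreover have "T1 n + (\<Sum>b\<in>Basis. - T2 b n) \<le> 0" for n
  proof -
    have i1: "integrable lebesgue (\<lambda>z. rst K' (dureg n) z * (wt (fst z) * \<eta> z))"
      by (rule continuous_rst_integrable[OF ld K(1,2) kc kz])
    have i2: "integrable lebesgue (\<lambda>z. rst K' (dFreg n b) z * \<eta> z)" if b: "b \<in> Basis" for b
    proof (rule continuous_rst_integrable[OF _ K(1,2) \<eta>c K(3)])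
      show "locally_L1 ?S (dFreg n b)" using weak_ddir_Freg(1)[OF b, of n] by (simp add: weak_ddir_def)
    qed
    have t1: "T1 n = (LINT z|lebesgue. rst K' (dureg n) z * (wt (fst z) * \<eta> z))"
      unfolding T1_def by (rule set_integral_rst[OF K(2) kz])
    have t2: "- T2 b n = (LINT z|lebesgue. rst K' (dFreg n b) z * \<eta> z)" if b: "b \<in> Basis" for b
    proof -
      have "T2 b n = - (LINT z:?S|lebesgue. dFreg n b z * \<eta> z)"
        unfolding T2_def using weak_ddir_Freg(1)[OF b, of n] \<eta>(1) by (simp add: weak_ddir_def)
      also have "(LINT z:?S|lebesgue. dFreg n b z * \<eta> z) = (LINT z|lebesgue. rst K' (dFreg n b) z * \<eta> z)"
        by (rule set_integral_rst[OF K(2,3)])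
      finally show ?thesis by simp
    qed
    have "T1 n + (\<Sum>b\<in>Basis. - T2 b n) = (LINT z|lebesgue. rst K' (dureg n) z * (wt (fst z) * \<eta> z)) +
        (\<Sum>b\<in>Basis. LINT z|lebesgue. rst K' (dFreg n b) z * \<eta> z)" by (simp add: t1 t2)
    also have "(\<Sum>b\<in>Basis. LINT z|lebesgue. rst K' (dFreg n b) z * \<eta> z) = (LINT z|lebesgue. (\<Sum>b\<in>Basis. rst K' (dFreg n b) z * \<eta> z))"
      by (rule Bochner_Integration.integral_sum[symmetric]) (rule i2)
    also have "(LINT z|lebesgue. rst K' (dureg n) z * (wt (fst z) * \<eta> z)) + (LINT z|lebesgue. (\<Sum>b\<in>Basis. rst K' (dFreg n b) z * \<eta> z)) =
        (LINT z|lebesgue. rst K' (dureg n) z * (wt (fst z) * \<eta> z) + (\<Sum>b\<in>Basis. rst K' (dFreg n b) z * \<eta> z))"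
      by (rule Bochner_Integration.integral_add[symmetric, OF i1]) (rule Bochner_Integration.integrable_sum, rule i2)
    also have "\<dots> \<le> (LINT z|(lebesgue :: ('a \<times> real) measure). 0)"
    proof (rule integral_mono_AE)
      show "integrable lebesgue (\<lambda>z. rst K' (dureg n) z * (wt (fst z) * \<eta> z) + (\<Sum>b\<in>Basis. rst K' (dFreg n b) z * \<eta> z))"
        by (rule Bochner_Integration.integrable_add[OF i1]) (rule Bochner_Integration.integrable_sum, rule i2)
      show "AE z in lebesgue. rst K' (dureg n) z * (wt (fst z) * \<eta> z) + (\<Sum>b\<in>Basis. rst K' (dFreg n b) z * \<eta> z) \<le> 0"
        using AE_radial_exc[of r0, where 'a = 'a]
      proof eventually_elim
        case (elim z)
        show ?case
        proof (cases "z \<in> K'")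
          case True
          then have "dureg n z * wt (fst z) + (\<Sum>b\<in>Basis. dFreg n b z) \<le> 0" using regularised_inequality[OF N _ elim] K(2) by blast
          then have "(dureg n z * wt (fst z) + (\<Sum>b\<in>Basis. dFreg n b z)) * \<eta> z \<le> 0" using \<eta>(2)[of z] by (rule mult_nonpos_nonneg)
          then show ?thesis using True by (simp add: distrib_right sum_distrib_right mult.assoc)
        qed simp
      qed
    qed simp
    finally show ?thesis by simp
  qed
  ultimately show ?thesis unfolding E by (intro LIMSEQ_le_const2) auto
qed

theorem weak_subsolution_barrier:
  assumes N: "N = real DIM('a)"
  shows "weak_subsolution p m wt (barrier p m g t0 C r0 \<Gamma> :: 'a::euclidean_space \<Rightarrow> real \<Rightarrow> real)"
proof -
  have "(barrier p m g t0 C r0 \<Gamma> :: 'a \<Rightarrow> real \<Rightarrow> real) = (\<lambda>x t. bar (x, t))" by (intro ext) (rule barrier_eq_bar)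
  then show ?thesis unfolding weak_subsolution_def
    using solution_class_bar[where 'a = 'a] energy_bar_nonpos[OF N] by auto
qed

end

subsection \<open>Comparison with the barrier\<close>

context barrier_params
begin

text \<open>Initially the barrier vanishes outside the ball of radius \<open>l\<close>, because
  \<open>tau 0 = G l\<close>, and inside it is at most \<open>bar_max\<close>, which the condition
  on \<open>C\<close> puts below \<open>\<epsilon>\<close>.\<close>

lemma barrier_le_solution:
  fixes u :: "'a::euclidean_space \<Rightarrow> real \<Rightarrow> real"
  assumes N: "N = real DIM('a)" and start: "\<Gamma> * ln t0 = G l" "0 < l" "r0 \<le> l" "C * \<phi> (G l) powr q \<le> \<epsilon>"
    and u0: "AE x in lebesgue. 0 \<le> u\<^sub>0 x" "AE x in lebesgue. norm x \<le> l \<longrightarrow> \<epsilon> \<le> u\<^sub>0 x"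
    and u: "strong_solution_Cauchy p m wt u\<^sub>0 u" and t: "0 < t"
  shows "AE x in lebesgue. barrier p m g t0 C r0 \<Gamma> x t \<le> u x t"
proof (rule comparison_principle[OF p1 k0 _ _ _ weak_subsolution_barrier[OF N] weak_deriv_t_barrier _ _ t])
  show "continuous_on UNIV (\<lambda>x::'a. wt x)" by (intro continuous_intros g_norm_cont)
  show "strong_solution p m wt u" using u by (simp add: strong_solution_Cauchy_def)
  show "\<exists>R\<ge>0. \<forall>(x::'a) t. 0 < t \<longrightarrow> t \<le> T \<longrightarrow> R \<le> norm x \<longrightarrow> barrier p m g t0 C r0 \<Gamma> x t = 0" for T
    using r0 bar_eq_0[where 'a = 'a and T = T] unfolding barrier_eq_bar
    by (intro exI[of _ "max r0 (Ginv (tau T))"]) auto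
  have bm: "bar_max \<le> \<epsilon>"
  proof -
    have "t0 powr (- (1 / k)) \<le> 1" using t0 k_pos by (simp add: powr_minus inverse_le_1_iff ge_one_powr_ge_zero)
    then have "t0 powr (- (1 / k)) * \<phi> (\<Gamma> * ln t0) powr q \<le> 1 * \<phi> (\<Gamma> * ln t0) powr q" by (rule mult_right_mono) simp
    then have "bar_max \<le> C * \<phi> (\<Gamma> * ln t0) powr q" using C0 by (simp add: bar_max_def)
    then show ?thesis using start by simp
  qed
  have "AE x in lebesgue. u x 0 = u\<^sub>0 x" using u by (simp add: strong_solution_Cauchy_def)
  then show "AE x in lebesgue. barrier p m g t0 C r0 \<Gamma> x 0 \<le> u x 0"
    using u0
  proof eventually_elim
    case (elim x)
    show ?case
    proof (cases "norm x \<le> l")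
      case True
      then show ?thesis using elim bm bar_le_max[of "(x, 0)"] unfolding barrier_eq_bar by simp
    next
      case False
      then have "max r0 (Ginv (tau 0)) \<le> norm x" using start by (simp add: Ginv_G)
      then show ?thesis using elim bar_eq_0[of 0 0 x] unfolding barrier_eq_bar by simp
    qed
  qed
qed simp

text \<open>For radii at least \<open>r0\<close> the strict monotonicity of the outer profile
  decides; below \<open>r0\<close>, \<open>core\<close> keeps \<open>\<psi>\<close> under half of
  \<open>\<phi>\<close>.\<close>

lemma barrier_positive:
  assumes t: "0 \<le> t" and x: "G (norm x) < tau t"
  shows "0 < barrier p m g t0 C r0 \<Gamma> x t"
proof -
  have "\<psi> r0 (norm x) < \<phi> (tau t)"
  proof (cases "r0 \<le> norm x")
    case True
    then have "norm x < Ginv (tau t)" using less_Ginv_iff[of "norm x" "tau t"] x tau_pos[OF t] by simp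
    then have "\<psi>J (norm x) < \<phi> (tau t)" unfolding \<phi>_eq using True r0 by (intro \<psi>J_strict_mono) auto
    then show ?thesis using True by (simp add: \<psi>_def)
  next
    case False
    then have "\<psi> r0 (norm x) \<le> \<psi>J r0" using I_fun_le[OF r0, of "norm x"] by (simp add: \<psi>_def)
    moreover have "\<phi> (\<Gamma> * ln t0) \<le> \<phi> (tau t)" using \<phi>_mono[OF tau_pos[of 0] tau_mono[of 0 t]] t by simp
    moreover have "0 < \<phi> (\<Gamma> * ln t0)" using \<phi>_pos[OF tau_pos[of 0]] by simp
    ultimately show ?thesis using core by linarith
  qed
  then show ?thesis using C0 t t0 by (simp add: barrier_eq pospow_def tpow_def gap_def)
qed

end

lemma (in growth) g_half_line_inverse:
  assumes "0 \<le> y"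
  shows "g (half_line_inverse g y) = y" "0 \<le> half_line_inverse g y"
proof -
  obtain r where r: "0 \<le> r" "y / \<alpha>1 \<le> G r" using G_unbounded by blast
  then have "y \<le> g r" using G_lower[of r] a1 by (simp add: divide_le_eq mult.commute)
  then have "\<exists>x\<ge>0. x \<le> r \<and> g x = y"
    using r assms g_0 by (intro IVT') (auto intro: continuous_on_subset[OF g_cont])
  then have y: "y \<in> g ` {0..}" by auto
  show "g (half_line_inverse g y) = y" unfolding half_line_inverse_def by (rule f_inv_into_f[OF y])
  show "0 \<le> half_line_inverse g y" unfolding half_line_inverse_def using inv_into_into[OF y] by simp
qed

text \<open>If \<open>v\<close> vanished almost everywhere near a point of the ball, positivity
  would make a nonempty open set null.\<close>

lemma ball_subset_ess_support:
  fixes v :: "'a::euclidean_space \<Rightarrow> real"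
  assumes "AE x in lebesgue. x \<in> ball 0 R \<longrightarrow> 0 < v x"
  shows "ball 0 R \<subseteq> ess_support v"
proof
  fix x :: 'a assume x: "x \<in> ball 0 R"
  show "x \<in> ess_support v"
    unfolding ess_support_def
  proof (intro CollectI allI impI notI)
    fix e :: real assume e: "0 < e" and z: "AE y in lebesgue. y \<in> ball x e \<longrightarrow> v y = 0"
    have "AE y in lebesgue. y \<notin> ball x e \<inter> ball 0 R" using assms z by eventually_elim auto
    moreover have o: "open (ball x e \<inter> ball 0 R)" by auto
    ultimately have "negligible (ball x e \<inter> ball 0 R)"
      by (simp add: negligible_iff_null_sets AE_iff_null_sets sets_completionI_sets borel_open)
    moreover have "x \<in> ball x e \<inter> ball 0 R" using x e by simp
    ultimately show False using open_not_negligible[OF o] by blast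
  qed
qed

text \<open>\<open>g\<close> grows at least like the power \<open>\<alpha>1\<close>, so
  \<open>g(\<gamma> h) \<le> \<gamma>^\<alpha>1 ln t\<close> when \<open>g h = ln t\<close>. The
  condition on \<open>\<gamma>\<close> and \<open>\<alpha>1 G \<le> g\<close> then place the ball
  inside the set where \<open>G r < \<tau>\<close>.\<close>

lemma (in barrier_params) support_ball:
  fixes u :: "'a::euclidean_space \<Rightarrow> real \<Rightarrow> real"
  assumes le: "AE x in lebesgue. barrier p m g t0 C r0 \<Gamma> x t \<le> u x t"
    and \<gamma>: "0 < \<gamma>" "\<gamma> \<le> 1" "\<gamma> powr \<alpha>1 \<le> \<alpha>1 * \<Gamma>" and t: "t0 < t"
  shows "ball 0 (\<gamma> * half_line_inverse g (ln t)) \<subseteq> ess_support (\<lambda>x. u x t)"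
proof (rule ball_subset_ess_support)
  define h where "h = half_line_inverse g (ln t)"
  have y: "0 < ln t" using t t0 by simp
  have h: "g h = ln t" "0 \<le> h" using g_half_line_inverse[of "ln t"] y by (simp_all add: h_def)
  then have hp: "0 < h" using y g_0 by (cases "h = 0") auto
  have "G (norm x) < tau t" if x: "norm x < \<gamma> * h" for x :: 'a
  proof -
    have "(1 / \<gamma>) powr \<alpha>1 * g (\<gamma> * h) \<le> g h" using g_scale[of "\<gamma> * h" h] hp \<gamma> by simp
    then have "g (\<gamma> * h) \<le> \<gamma> powr \<alpha>1 * ln t" using \<gamma> by (simp add: h powr_divide divide_le_eq mult.commute)
    also have "\<dots> \<le> \<alpha>1 * \<Gamma> * ln t" using \<gamma>(3) y by (intro mult_right_mono) auto
    finally have 1: "g (\<gamma> * h) \<le> \<alpha>1 * \<Gamma> * ln t" .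
    have "\<alpha>1 * G (norm x) \<le> g (norm x)" by (rule G_lower) simp
    also have "\<dots> < g (\<gamma> * h)" using x by (intro g_strict_mono) auto
    finally have "\<alpha>1 * G (norm x) < \<alpha>1 * (\<Gamma> * ln t)" using 1 by simp
    then have "G (norm x) < \<Gamma> * ln t" using a1 by simp
    also have "\<dots> \<le> tau t" using t t0 \<Gamma>0 by (intro mult_left_mono ln_mono) auto
    finally show ?thesis .
  qed
  then have "0 < barrier p m g t0 C r0 \<Gamma> x t" if "norm x < \<gamma> * h" for x :: 'a
    using that t t0 by (intro barrier_positive) auto
  then have "0 < u x t" if "barrier p m g t0 C r0 \<Gamma> x t \<le> u x t" "x \<in> ball 0 (\<gamma> * h)" for x
    using that by (metis less_le_trans mem_ball_0)
  then show "AE x in lebesgue. x \<in> ball 0 (\<gamma> * half_line_inverse g (ln t)) \<longrightarrow> 0 < u x t"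
    using le unfolding h_def[symmetric] by (auto elim: eventually_mono)
qed

text \<open>By the lower bound on \<open>nu\<close> the profile grows at least like
  \<open>r^c\<close> with \<open>c = (p - \<alpha>2) / (p - 1)\<close>; hence shrinking
  \<open>l\<close> by the factor \<open>2^(-1/c)\<close> at least halves it.\<close>

lemma (in growth) \<psi>J_halved:
  assumes l: "0 < l"
  obtains r0 where "0 < r0" "r0 \<le> l" "\<psi>J r0 \<le> \<psi>J l / 2"
proof -
  define c where "c = p / (p - 1) * (1 - \<alpha>2 / p)"
  have c: "0 < c" using p1 a2p by (simp add: c_def)
  define r0 where "r0 = l * (1 / 2) powr (1 / c)"
  have le1: "(1 / 2 :: real) powr (1 / c) \<le> 1" using c by (intro powr_le1) auto
  have r0: "0 < r0" "r0 \<le> l" using l le1 by (simp_all add: r0_def mult_left_le)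
  have "ln (\<psi>J r0) - c * ln r0 \<le> ln (\<psi>J l) - c * ln l"
  proof (rule DERIV_nonneg_imp_nondecreasing[OF r0(2)])
    fix x assume "r0 \<le> x" "x \<le> l"
    then have x: "0 < x" using r0 by simp
    have "((\<lambda>r. ln (\<psi>J r) - c * ln r) has_real_derivative
        1 / \<psi>J x * (p / (p - 1) * \<psi>J x * nu x / x) - c * (1 / x)) (at x)"
      using x \<psi>J_pos[OF x] by (intro DERIV_diff DERIV_cmult DERIV_chain2[OF DERIV_ln_divide \<psi>J_deriv] DERIV_ln_divide) auto
    moreover have "1 / \<psi>J x * (p / (p - 1) * \<psi>J x * nu x / x) - c * (1 / x) = p / (p - 1) * (nu x - (1 - \<alpha>2 / p)) / x"
      using \<psi>J_pos[OF x] by (simp add: c_def diff_divide_distrib right_diff_distrib)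
    moreover have "0 \<le> p / (p - 1) * (nu x - (1 - \<alpha>2 / p)) / x" using nu_lower[OF x] p1 x by simp
    ultimately show "\<exists>y. ((\<lambda>r. ln (\<psi>J r) - c * ln r) has_real_derivative y) (at x) \<and> 0 \<le> y" by metis
  qed
  moreover have "c * ln r0 = c * ln l - ln 2" using l c by (simp add: r0_def ln_mult ln_powr ln_div algebra_simps)
  ultimately have "ln (\<psi>J r0) \<le> ln (\<psi>J l / 2)" using \<psi>J_pos[OF l] by (simp add: ln_div)
  then have "\<psi>J r0 \<le> \<psi>J l / 2" using \<psi>J_pos[OF l] \<psi>J_pos[OF r0(1)] by (subst (asm) ln_le_cancel_iff) auto
  with r0 show ?thesis by (rule that)
qed

text \<open>There is no circularity in the choice: once \<open>r0\<close> and \<open>C\<close> are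
  fixed, both remaining conditions are upper bounds for \<open>\<Gamma>\<close>, because under
  \<open>\<Gamma> ln t0 = G l\<close> a large \<open>ln t0\<close> means a small
  \<open>\<Gamma>\<close>. So \<open>t0\<close> is defined last.\<close>

lemma (in growth) exists_barrier_params:
  assumes k0: "0 < p + m - 3" and l: "0 < l" and \<epsilon>: "0 < \<epsilon>" and N: "0 \<le> N"
  obtains t0 C r0 \<Gamma> where "barrier_params g \<alpha>1 \<alpha>2 p m t0 C r0 \<Gamma> N" "\<Gamma> * ln t0 = G l" "r0 \<le> l"
    "C * \<phi> (G l) powr ((p - 1) / (p + m - 3)) \<le> \<epsilon>"
proof -
  define k where "k = p + m - 3"
  define q where "q = (p - 1) / k"
  define K where "K = ((p - 1) / k) powr (p - 1)"
  have k: "0 < k" using k0 by (simp add: k_def)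
  have q: "0 < q" using k p1 by (simp add: q_def)
  have K: "0 < K" using k p1 by (simp add: K_def)
  obtain r0 where r0: "0 < r0" "r0 \<le> l" "\<psi>J r0 \<le> \<psi>J l / 2" by (rule \<psi>J_halved[OF l]) (rule that)
  have Gl: "0 < G l" by (rule G_pos[OF l])
  have \<phi>l: "\<phi> (G l) = \<psi>J l" using l by (simp add: \<phi>_eq Ginv_G)
  have Fp: "0 < \<phi> (G l) powr q" using \<phi>_pos[OF Gl] by simp
  define D where "D = Dconst N r0"
  have D: "0 \<le> D" using BL_nonneg N G_pos[OF r0(1)] by (simp add: D_def Dconst_def)
  \<comment> \<open>\<open>D + 1\<close> in place of \<open>D\<close> excludes a zero denominator;
    the second bound in \<open>C\<close> brings the initial barrier below
    \<open>\<epsilon>\<close>.\<close>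
  define A where "A = (1 / (2 * k * K * (D + 1))) powr (1 / k)"
  define C where "C = min A (\<epsilon> / \<phi> (G l) powr q)"
  have A: "0 < A" using k K D by (simp add: A_def)
  have C: "0 < C" using A \<epsilon> Fp by (simp add: C_def)
  have C_small: "K * C powr k * D \<le> 1 / (2 * k)"
  proof -
    have "C powr k \<le> A powr k" using C k by (intro powr_mono2) (auto simp: C_def)
    also have "A powr k = 1 / (2 * k * K * (D + 1))" using k K D by (simp add: A_def powr_powr)
    finally have "K * C powr k * D \<le> K * (1 / (2 * k * K * (D + 1))) * D"
      using K D by (intro mult_right_mono mult_left_mono) auto
    also have "\<dots> = 1 / (2 * k) * (D / (D + 1))" using K by simp
    also have "\<dots> \<le> 1 / (2 * k) * 1" using k D by (intro mult_left_mono) auto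
    finally show ?thesis by simp
  qed
  have C\<epsilon>: "C * \<phi> (G l) powr q \<le> \<epsilon>"
  proof -
    have "C \<le> \<epsilon> / \<phi> (G l) powr q" by (simp add: C_def)
    then show ?thesis using Fp by (simp add: pos_le_divide_eq)
  qed
  define \<Gamma> where "\<Gamma> = min (K * C powr k * c1 / 2 / c2) (G l / (c2 * (4 * k * (q + 2))))"
  have X: "0 < c2 * (4 * k * (q + 2))" using c2_pos k q by simp
  have \<Gamma>: "0 < \<Gamma>" using K C c1_pos c2_pos Gl X by (simp add: \<Gamma>_def)
  have \<Gamma>_small: "\<Gamma> * c2 \<le> K * C powr k * c1 / 2"
  proof -
    have "\<Gamma> \<le> K * C powr k * c1 / 2 / c2" unfolding \<Gamma>_def by (rule min.cobounded1)
    then show ?thesis using c2_pos by (simp only: pos_le_divide_eq)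
  qed
  define t0 where "t0 = exp (G l / \<Gamma>)"
  have t0: "1 < t0" using Gl \<Gamma> by (simp add: t0_def)
  have ln: "\<Gamma> * ln t0 = G l" using \<Gamma> by (simp add: t0_def)
  have t0_large: "c2 * (4 * k * (q + 2)) \<le> ln t0"
  proof -
    have "\<Gamma> \<le> G l / (c2 * (4 * k * (q + 2)))" unfolding \<Gamma>_def by (rule min.cobounded2)
    then have "\<Gamma> * (c2 * (4 * k * (q + 2))) \<le> G l" using X by (simp only: pos_le_divide_eq)
    also have "\<dots> = \<Gamma> * ln t0" by (rule ln[symmetric])
    finally show ?thesis using \<Gamma> by (rule mult_left_le_imp_le)
  qed
  show ?thesis
  proof (rule that[OF _ ln r0(2)])
    show "barrier_params g \<alpha>1 \<alpha>2 p m t0 C r0 \<Gamma> N"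
      by unfold_locales
        (use k0 t0 C r0 \<Gamma> N \<phi>l ln C_small \<Gamma>_small t0_large in \<open>simp_all add: k_def q_def K_def D_def\<close>)
    show "C * \<phi> (G l) powr ((p - 1) / (p + m - 3)) \<le> \<epsilon>" using C\<epsilon> by (simp add: q_def k_def)
  qed
qed

theorem theorem1p4:
  fixes p m \<alpha>\<^sub>1 \<alpha>\<^sub>2 \<epsilon> l :: real and g :: "real \<Rightarrow> real"
    and f :: "'a::euclidean_space \<Rightarrow> real"
  assumes "1 < p" and "p < real DIM('a)" and "p + m - 3 > 0"
    and "continuous_on {0..} g"
    and "\<And>s. s > 0 \<Longrightarrow> g differentiable (at s)"
    and "continuous_on {0<..} (deriv g)"
    and "g 0 = 0" and "\<And>s. s > 0 \<Longrightarrow> g s > 0"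
    and "0 < \<alpha>\<^sub>1" and "\<alpha>\<^sub>1 \<le> \<alpha>\<^sub>2" and "\<alpha>\<^sub>2 < p"
    and "\<And>s. s > 0 \<Longrightarrow> \<alpha>\<^sub>1 * (g s / s) \<le> deriv g s"
    and "\<And>s. s > 0 \<Longrightarrow> deriv g s \<le> \<alpha>\<^sub>2 * (g s / s)"
    and "\<And>x. f x = exp (g (norm x))"
    and "\<epsilon> > 0" and "l > 0"
  shows "\<exists>t\<^sub>0 C r\<^sub>0 \<Gamma> \<gamma>. t\<^sub>0 > 1 \<and> C > 0 \<and> r\<^sub>0 > 0 \<and> \<Gamma> > 0 \<and> \<gamma> > 0 \<and>
    weak_subsolution p m f (barrier p m g t\<^sub>0 C r\<^sub>0 \<Gamma>) \<and>
    (\<forall>u\<^sub>0 u.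
       u\<^sub>0 \<in> borel_measurable lebesgue \<and>
       (AE x in lebesgue. 0 \<le> u\<^sub>0 x) \<and>
       (\<exists>M. AE x in lebesgue. u\<^sub>0 x \<le> M) \<and>
       compact (ess_support u\<^sub>0) \<and>
       (AE x in lebesgue. norm x \<le> l \<longrightarrow> \<epsilon> \<le> u\<^sub>0 x) \<and>
       strong_solution_Cauchy p m f u\<^sub>0 u \<longrightarrow>
       (\<forall>t>0. AE x in lebesgue. barrier p m g t\<^sub>0 C r\<^sub>0 \<Gamma> x t \<le> u x t) \<and>
       (\<forall>t>t\<^sub>0. ball 0 (\<gamma> * half_line_inverse g (ln t)) \<subseteq> ess_support (\<lambda>x. u x t)))"
proof -
  interpret growth g \<alpha>\<^sub>1 \<alpha>\<^sub>2 p
    by unfold_locales (fact assms)+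
  have f: "f = (\<lambda>x. exp (g (norm x)))" using assms(14) by (rule ext)
  obtain t0 C r0 \<Gamma> where bp: "barrier_params g \<alpha>\<^sub>1 \<alpha>\<^sub>2 p m t0 C r0 \<Gamma> (real DIM('a))" "\<Gamma> * ln t0 = G l" "r0 \<le> l"
    "C * \<phi> (G l) powr ((p - 1) / (p + m - 3)) \<le> \<epsilon>"
    by (rule exists_barrier_params[OF assms(3,16,15), of "real DIM('a)"]) (simp, rule that)
  interpret B: barrier_params g \<alpha>\<^sub>1 \<alpha>\<^sub>2 p m t0 C r0 \<Gamma> "real DIM('a)" "p + m - 3" "(p - 1) / (p + m - 3)" "((p - 1) / (p + m - 3)) powr (p - 1)"
    by (rule bp(1)) simp_all
  \<comment> \<open>The solution of
    \<open>\<gamma> powr \<alpha>\<^sub>1 = \<alpha>\<^sub>1 * \<Gamma>\<close>, capped at 1 so that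
    \<open>\<gamma> h \<le> h\<close> and \<open>g_scale\<close> applies.\<close>
  define \<gamma> where "\<gamma> = min 1 ((\<alpha>\<^sub>1 * \<Gamma>) powr (1 / \<alpha>\<^sub>1))"
  have \<gamma>: "0 < \<gamma>" "\<gamma> \<le> 1" using a1 B.\<Gamma>0 by (simp_all add: \<gamma>_def)
  have "\<gamma> powr \<alpha>\<^sub>1 \<le> ((\<alpha>\<^sub>1 * \<Gamma>) powr (1 / \<alpha>\<^sub>1)) powr \<alpha>\<^sub>1"
    using \<gamma> a1 by (intro powr_mono2) (auto simp: \<gamma>_def)
  then have \<gamma>3: "\<gamma> powr \<alpha>\<^sub>1 \<le> \<alpha>\<^sub>1 * \<Gamma>" using a1 B.\<Gamma>0 by (simp add: powr_powr)
  show ?thesis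
  proof (rule exI[of _ t0], rule exI[of _ C], rule exI[of _ r0], rule exI[of _ \<Gamma>], rule exI[of _ \<gamma>], intro conjI allI impI)
    show "weak_subsolution p m f (barrier p m g t0 C r0 \<Gamma>)"
      unfolding f by (rule B.weak_subsolution_barrier) simp
    fix u\<^sub>0 :: "'a \<Rightarrow> real" and u :: "'a \<Rightarrow> real \<Rightarrow> real"
    assume u: "u\<^sub>0 \<in> borel_measurable lebesgue \<and>
       (AE x in lebesgue. 0 \<le> u\<^sub>0 x) \<and>
       (\<exists>M. AE x in lebesgue. u\<^sub>0 x \<le> M) \<and>
       compact (ess_support u\<^sub>0) \<and>
       (AE x in lebesgue. norm x \<le> l \<longrightarrow> \<epsilon> \<le> u\<^sub>0 x) \<and>
       strong_solution_Cauchy p m f u\<^sub>0 u"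
    have u0: "AE x in lebesgue. 0 \<le> u\<^sub>0 x" "AE x in lebesgue. norm x \<le> l \<longrightarrow> \<epsilon> \<le> u\<^sub>0 x"
      and us: "strong_solution_Cauchy p m (\<lambda>x. exp (g (norm x))) u\<^sub>0 u" using u unfolding f by blast+
    have le: "AE x in lebesgue. barrier p m g t0 C r0 \<Gamma> x t \<le> u x t" if "0 < t" for t
      by (rule B.barrier_le_solution[OF refl bp(2) assms(16) bp(3,4) u0 us that])
    then show "AE x in lebesgue. barrier p m g t0 C r0 \<Gamma> x t \<le> u x t" if "0 < t" for t using that .
    show "ball 0 (\<gamma> * half_line_inverse g (ln t)) \<subseteq> ess_support (\<lambda>x. u x t)" if t: "t0 < t" for t
    proof (rule B.support_ball[OF _ \<gamma> \<gamma>3 t])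
      show "AE x in lebesgue. barrier p m g t0 C r0 \<Gamma> x t \<le> u x t" using t B.t0 by (intro le) simp
    qed
  qed (use B.t0 B.C0 B.r0 B.\<Gamma>0 \<gamma> in auto)
qed

end
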